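(* Let $\rho=\{\rho_N\}_{N\ge1}$ be an appropriate (CLT-appropriate) sequence of probability measures, $\rho_N$ a probability measure on $\mathbb{GT}_N$, with limit functions $F_\rho(x)$ and $Q_\rho(x,y)$. For $k=1,2,\dots$ let $$p_k^{(N)}=\sum_{i=1}^N(\lambda_i+N-i)^k,\qquad \lambda=(\lambda_1,\dots,\lambda_N)\ \text{distributed according to }\rho_N .$$ Then, as $N\to\infty$, the collection $\{N^{-k}(p_k^{(N)}-\mathbf E p_k^{(N)})\}_{k\ge1}$ converges in the sense of moments (i.e. all joint moments converge) to a centered Gaussian vector with covariance $$\lim_{N\to\infty}\frac{\mathrm{cov}(p_{k_1}^{(N)},p_{k_2}^{(N)})}{N^{k_1+k_2}}=\frac{1}{(2\pi \mathbf i)^2}\oint_{|z|=\epsilon}\oint_{|w|=2\epsilon}\Big(\frac1z+1+(1+z)F_\rho(1+z)\Big)^{k_1}\Big(\frac1w+1+(1+w)F_\rho(1+w)\Big)^{k_2}Q_\rho(z,w)\,dz\,dw,$$ where the contours are counter-clockwise and $\epsilon>0$ is sufficiently small.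
   Context: A signature of length $N$ is $\lambda=(\lambda_1\ge\dots\ge\lambda_N)\in\mathbb Z^N$; $\mathbb{GT}_N$ is the set of these. The Schur function is $s_\lambda(x_1,\dots,x_N)=\det[x_i^{\lambda_j+N-j}]/\prod_{i<j}(x_i-x_j)$. For a probability measure $\rho$ on $\mathbb{GT}_N$ its Schur generating function is $S_\rho(x_1,\dots,x_N)=\sum_{\lambda}\rho(\lambda)s_\lambda(x_1,\dots,x_N)/s_\lambda(1^N)$; it is always assumed that this series converges uniformly in an open neighborhood of $(1^N)=(1,\dots,1)$. A sequence of symmetric functions $\{F_N(x_1,\dots,x_N)\}_{N\ge1}$ is called appropriate if there are reals $\{c_k\}_{k\ge1}$, $\{d_{k,l}\}_{k,l\ge1}$ such that: $\log F_N$ is holomorphic in an open neighborhood of $(1^N)$; for any fixed index $i$ and $k\in\mathbb N$, $\lim_{N\to\infty}N^{-1}\partial_i^k\log F_N|_{(1^N)}=c_k$; for any fixed distinct $i,j$ and $k,l\in\mathbb N$, $\lim_{N\to\infty}\partial_i^k\partial_j^l\log F_N|_{(1^N)}=d_{k,l}$; for any fixed $s$ and fixed indices $i_1,\dots,i_s$ with at least three distinct values among them, $\lim_{N\to\infty}\partial_{i_1}\cdots\partial_{i_s}\log F_N|_{(1^N)}=0$; and the series $\sum_{k\ge1}\frac{c_k}{(k-1)!}(x-1)^{k-1}$, $\sum_{k,l\ge1}\frac{d_{k,l}}{(k-1)!(l-1)!}(x-1)^{k-1}(y-1)^{l-1}$ converge in neighborhoods of $x=1$ and $(x,y)=(1,1)$.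 A sequence of measures $\rho=\{\rho_N\}$ is appropriate if $\{S_{\rho_N}\}$ is; its limit functions are $F_\rho(x)=\sum_{k\ge1}\frac{c_k}{(k-1)!}(x-1)^{k-1}$, $G_\rho(x,y)=\sum_{k,l\ge1}\frac{d_{k,l}}{(k-1)!(l-1)!}(x-1)^{k-1}(y-1)^{l-1}$, and $Q_\rho(x,y)=G_\rho(1+x,1+y)+\frac1{(x-y)^2}$. Here $\partial_i=\partial/\partial x_i$. *)

theory Defs
  imports "HOL-Analysis.Analysis" "HOL-Probability.Probability"
begin

text \<open>A signature of length N is encoded as an int list l of length N with
  l!0 \<ge> l!1 \<ge> ... \<ge> l!(N-1)  (0-based: l!(i-1) is lambda_i).\<close>
definition GT :: "nat \<Rightarrow> int list set" where
  "GT N = {l. length l = N \<and> sorted_wrt (\<ge>) l}"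

text \<open>Points of C^N are functions nat => complex; only coordinates 0..N-1 matter.\<close>
definition one_pt :: "nat \<Rightarrow> complex" where
  "one_pt = (\<lambda>_. 1)"

definition polydisc :: "nat \<Rightarrow> real \<Rightarrow> (nat \<Rightarrow> complex) set" where
  "polydisc N r = {x. \<forall>i<N. cmod (x i - 1) < r}"

text \<open>Holomorphy in several variables (Osgood's definition): continuous and
  holomorphic in each variable separately.\<close>
definition holo_on_polydisc :: "nat \<Rightarrow> real \<Rightarrow> ((nat \<Rightarrow> complex) \<Rightarrow> complex) \<Rightarrow> bool" where
  "holo_on_polydisc N r f \<longleftrightarrow>
     continuous_on (polydisc N r) f \<and>
     (\<forall>x\<in>polydisc N r. \<forall>i<N. (\<lambda>t. f (x(i := t))) field_differentiable (at (x i)))"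

definition pd :: "nat \<Rightarrow> ((nat \<Rightarrow> complex) \<Rightarrow> complex) \<Rightarrow> ((nat \<Rightarrow> complex) \<Rightarrow> complex)" where
  "pd i f = (\<lambda>x. deriv (\<lambda>t. f (x(i := t))) (x i))"

definition pds :: "nat list \<Rightarrow> ((nat \<Rightarrow> complex) \<Rightarrow> complex) \<Rightarrow> ((nat \<Rightarrow> complex) \<Rightarrow> complex)" where
  "pds is f = foldr pd is f"

definition det_nat :: "nat \<Rightarrow> (nat \<Rightarrow> nat \<Rightarrow> complex) \<Rightarrow> complex" where
  "det_nat N M = (\<Sum>p | p permutes {..<N}. of_int (sign p) * (\<Prod>i<N. M i (p i)))"

definition distinct_pts :: "nat \<Rightarrow> (nat \<Rightarrow> complex) set" where
  "distinct_pts N = {y. \<forall>i<N. \<forall>j<N. i < j \<longrightarrow> y i \<noteq> y j}"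

text \<open>The bialternant ratio det[x_i^(lambda_j+N-j)] / prod_{i<j}(x_i-x_j) (0-based indices).\<close>
definition schur_ratio :: "nat \<Rightarrow> int list \<Rightarrow> (nat \<Rightarrow> complex) \<Rightarrow> complex" where
  "schur_ratio N l y =
     det_nat N (\<lambda>i j. y i powi (l ! j + int N - 1 - int j)) /
     (\<Prod>i<N. \<Prod>j\<in>{i<..<N}. y i - y j)"

text \<open>The Schur function: the ratio, extended by continuity to coinciding variables
  (e.g. to the point (1^N)).\<close>
definition schur :: "nat \<Rightarrow> int list \<Rightarrow> (nat \<Rightarrow> complex) \<Rightarrow> complex" where
  "schur N l x = Lim (at x within distinct_pts N) (schur_ratio N l)"

definition sgf_term :: "nat \<Rightarrow> int list pmf \<Rightarrow> int list \<Rightarrow> (nat \<Rightarrow> complex) \<Rightarrow> complex" where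
  "sgf_term N \<rho> l x = of_real (pmf \<rho> l) * schur N l x / schur N l one_pt"

definition SGF :: "nat \<Rightarrow> int list pmf \<Rightarrow> (nat \<Rightarrow> complex) \<Rightarrow> complex" where
  "SGF N \<rho> x = (\<Sum>\<^sub>\<infinity>l\<in>set_pmf \<rho>. sgf_term N \<rho> l x)"

definition SGF_unif_conv :: "nat \<Rightarrow> int list pmf \<Rightarrow> bool" where
  "SGF_unif_conv N \<rho> \<longleftrightarrow> (\<exists>r>0.
     uniform_limit (polydisc N r) (\<lambda>L x. \<Sum>l\<in>L. sgf_term N \<rho> l x) (SGF N \<rho>)
       (finite_subsets_at_top (set_pmf \<rho>)))"

text \<open>c k and d k l are only used for k, l \<ge> 1.\<close>
definition appropriate_with ::
  "(nat \<Rightarrow> (nat \<Rightarrow> complex) \<Rightarrow> complex) \<Rightarrow> (nat \<Rightarrow> real) \<Rightarrow> (nat \<Rightarrow> nat \<Rightarrow> real) \<Rightarrow> bool" where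
  "appropriate_with F c d \<longleftrightarrow>
     (\<forall>N\<ge>1. \<exists>r>0. holo_on_polydisc N r (\<lambda>x. Ln (F N x))) \<and>
     (\<forall>i k. k \<ge> 1 \<longrightarrow>
        (\<lambda>N. (pd i ^^ k) (\<lambda>x. Ln (F N x)) one_pt / of_nat N) \<longlonglongrightarrow> of_real (c k)) \<and>
     (\<forall>i j k l. i \<noteq> j \<longrightarrow> k \<ge> 1 \<longrightarrow> l \<ge> 1 \<longrightarrow>
        (\<lambda>N. (pd i ^^ k) ((pd j ^^ l) (\<lambda>x. Ln (F N x))) one_pt) \<longlonglongrightarrow> of_real (d k l)) \<and>
     (\<forall>is. card (set is) \<ge> 3 \<longrightarrow>
        (\<lambda>N. pds is (\<lambda>x. Ln (F N x)) one_pt) \<longlonglongrightarrow> 0) \<and>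
     (\<exists>r>0. \<forall>x::complex. cmod (x - 1) < r \<longrightarrow>
        summable (\<lambda>m. of_real (c (m + 1)) / fact m * (x - 1) ^ m)) \<and>
     (\<exists>r>0. \<forall>x y::complex. cmod (x - 1) < r \<and> cmod (y - 1) < r \<longrightarrow>
        (\<lambda>(m, n). of_real (d (m + 1) (n + 1)) / (fact m * fact n) * (x - 1) ^ m * (y - 1) ^ n)
          summable_on UNIV)"

definition F_lim :: "(nat \<Rightarrow> real) \<Rightarrow> complex \<Rightarrow> complex" where
  "F_lim c x = (\<Sum>m. of_real (c (m + 1)) / fact m * (x - 1) ^ m)"

definition G_lim :: "(nat \<Rightarrow> nat \<Rightarrow> real) \<Rightarrow> complex \<Rightarrow> complex \<Rightarrow> complex" where
  "G_lim d x y = (\<Sum>\<^sub>\<infinity>(m, n)\<in>UNIV.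
      of_real (d (m + 1) (n + 1)) / (fact m * fact n) * (x - 1) ^ m * (y - 1) ^ n)"

definition Q_lim :: "(nat \<Rightarrow> nat \<Rightarrow> real) \<Rightarrow> complex \<Rightarrow> complex \<Rightarrow> complex" where
  "Q_lim d x y = G_lim d (1 + x) (1 + y) + 1 / (x - y) ^ 2"

definition U_fun :: "(nat \<Rightarrow> real) \<Rightarrow> complex \<Rightarrow> complex" where
  "U_fun c z = 1 / z + 1 + (1 + z) * F_lim c (1 + z)"

text \<open>(2 pi i)^{-2} \<ointegral>_{|z|=eps} \<ointegral>_{|w|=2eps} U(z)^k1 U(w)^k2 Q(z,w) dz dw, counter-clockwise,
  written via the parametrisations z = eps e^{is}, w = 2 eps e^{it}, s,t in [0,2pi].\<close>
definition cov_integral :: "(nat \<Rightarrow> real) \<Rightarrow> (nat \<Rightarrow> nat \<Rightarrow> real) \<Rightarrow> real \<Rightarrow> nat \<Rightarrow> nat \<Rightarrow> complex" where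
  "cov_integral c d \<epsilon> k1 k2 =
     1 / (2 * of_real pi * \<i>) ^ 2 *
     integral {0..2*pi} (\<lambda>t. integral {0..2*pi} (\<lambda>s.
       (let z = of_real \<epsilon> * cis s; w = of_real (2 * \<epsilon>) * cis t in
        U_fun c z ^ k1 * U_fun c w ^ k2 * Q_lim d z w * (\<i> * z) * (\<i> * w))))"

definition p_k :: "nat \<Rightarrow> nat \<Rightarrow> int list \<Rightarrow> real" where
  "p_k N k l = (\<Sum>i<N. (real_of_int (l ! i) + real N - 1 - real i) ^ k)"

definition p_cov :: "int list pmf \<Rightarrow> nat \<Rightarrow> nat \<Rightarrow> nat \<Rightarrow> real" where
  "p_cov \<rho> N k1 k2 =
     measure_pmf.expectation \<rho> (\<lambda>l. p_k N k1 l * p_k N k2 l)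
     - measure_pmf.expectation \<rho> (p_k N k1) * measure_pmf.expectation \<rho> (p_k N k2)"

definition p_norm :: "int list pmf \<Rightarrow> nat \<Rightarrow> nat \<Rightarrow> int list \<Rightarrow> real" where
  "p_norm \<rho> N k l = (p_k N k l - measure_pmf.expectation \<rho> (p_k N k)) / real N ^ k"

text \<open>(Z_k)_{k\<ge>1} is a centred Gaussian vector with covariance C: every finite
  linear combination is centred normal with variance given by C (a point mass at 0
  if the variance vanishes).\<close>
definition gaussian_family :: "'a measure \<Rightarrow> (nat \<Rightarrow> 'a \<Rightarrow> real) \<Rightarrow> (nat \<Rightarrow> nat \<Rightarrow> real) \<Rightarrow> bool" where
  "gaussian_family M Z C \<longleftrightarrow> prob_space M \<and> (\<forall>k. Z k \<in> borel_measurable M) \<and>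
     (\<forall>n a. let Y = (\<lambda>\<omega>. \<Sum>k\<in>{1..n}. a k * Z k \<omega>);
                 v = (\<Sum>k\<in>{1..n}. \<Sum>j\<in>{1..n}. a k * a j * C k j) in
        v \<ge> 0 \<and>
        (v > 0 \<longrightarrow> distributed M lborel Y (\<lambda>x. ennreal (normal_density 0 (sqrt v) x))) \<and>
        (v = 0 \<longrightarrow> (AE \<omega> in M. Y \<omega> = 0)))"

end

theory Submission
  imports Defs "HOL-Complex_Analysis.Complex_Analysis" "Jordan_Normal_Form.Determinant" "HOL-Library.Disjoint_Sets"
begin

text \<open>Applying the difference operators that are diagonal on Schur functions repeatedly to the
 Schur generating function at (1,...,1) gives an exact formula: mixed moments of the power
 sums are multiple contour integrals in which the variables of different power sums interact
 only through the cross terms 1 + chi(T) with T a set of at least two indices. Only a finite jet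
 of the logarithm of the generating function matters, and by symmetry that jet is a polynomial
 in power sums whose coefficients are indexed by set partitions. After centring, inclusion-exclusion
 leaves the families of sets T that cover all indices; chi(T) has order N to the power -|T|, and only
 perfect matchings contribute at the leading order N to the power -|A|. This is Wick's rule with the
 covariance of the pairs, which a Cholesky factorisation realises by independent normal variables.\<close>

text \<open>The operators have poles where two variables coincide, hence at (1,...,1) itself. They
  are therefore applied at the pairwise distinct points 1 + h*j, and averaging over a circle of
  complex h returns the value at h = 0. Each power sum brings two circle variables: an auxiliary t,
  whose exponential is the dilation parameter q and whose k-th Taylor coefficient turns the
  eigenvalue into p_k / k!, and a variable v that replaces the residue sum of the operator. For
  fixed N the radius of t shrinks together with h, so that truncating the logarithm of the
  generating function costs O(h^(K+1-s)) with s the total degree; the main term is independent of h,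
  which makes the formula exact once K >= s. Only then is t put on the circle of radius 1/N, the
  scale on which all factors have limits. The truncation order K is fixed before N tends to
  infinity, so the covariance first appears with polynomials in place of the limit series; since the
  moments do not depend on K, letting K grow gives the contour integral of the statement.\<close>

section \<open>Determinants of powers in Newton form\<close>

lemma det_nat_eq_det: "det_nat N M = Determinant.det (Matrix.mat N N (%(i, j). M i j))"
 unfolding det_nat_def Determinant.det_def
 by (auto simp: lessThan_atLeast0 permutes_in_image intro!: sum.cong prod.cong)

lemma det_nat_mult:
 "det_nat N (%i j. \<Sum>k<N. A i k * B k j) = det_nat N A * det_nat N B"
proof -
 have "Matrix.mat N N (%(i, j). \<Sum>k<N. A i k * B k j)
   = Matrix.mat N N (%(i, j). A i j) * Matrix.mat N N (%(i, j). B i j)"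
  by (rule eq_matI) (auto simp: scalar_prod_def lessThan_atLeast0 intro!: sum.cong)
 then show ?thesis
  unfolding det_nat_eq_det by (simp add: Determinant.det_mult[of _ N])
qed

lemma det_nat_cong:
 "(\<And>i j. i < N ==> j < N ==> A i j = B i j) ==> det_nat N A = det_nat N B"
 unfolding det_nat_def using permutes_in_image
 by (intro sum.cong arg_cong2[where f = "(*)"] prod.cong refl) fastforce

lemma det_nat_scale_rows: "det_nat N (%i j. a i * B i j) = (\<Prod>i<N. a i) * det_nat N B"
 unfolding det_nat_def by (simp add: prod.distrib sum_distrib_left mult_ac)

lemma det_nat_scale_cols: "det_nat N (%i j. B i j * a j) = det_nat N B * (\<Prod>j<N. a j)"
 unfolding det_nat_def
 unfolding prod.distrib sum_distrib_right
proof (intro sum.cong refl)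
 fix p assume "p \<in> {p. p permutes {..<N}}"
 then have "(\<Prod>i<N. a (p i)) = (\<Prod>i<N. a i)"
  by (intro prod.permute[symmetric, of p, unfolded o_def]) auto
 then show "of_int (sign p) * ((\<Prod>i<N. B i (p i)) * (\<Prod>i<N. a (p i))) =
    of_int (sign p) * (\<Prod>i<N. B i (p i)) * (\<Prod>i<N. a i)" by simp
qed

lemma det_nat_transpose: "det_nat N (%i j. A j i) = det_nat N A"
proof -
 have "Matrix.mat N N (%(i, j). A j i) = transpose_mat (Matrix.mat N N (%(i, j). A i j))"
  by (rule eq_matI) auto
 then show ?thesis unfolding det_nat_eq_det by (simp add: Determinant.det_transpose[of _ N])
qed

lemma det_nat_permute_rows:
 assumes "p permutes {..<N}"
 shows "det_nat N (%i j. A (p i) j) = of_int (sign p) * det_nat N A"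
proof -
 have "Matrix.mat N N (%(i, j). A (p i) j)
  = Matrix.mat N N (%(i, j). Matrix.mat N N (%(i, j). A i j) $$ (p i, j))"
  using assms by (intro eq_matI) (auto simp: permutes_in_image[OF assms, unfolded lessThan_iff])
 moreover have "p permutes {0..<N}" using assms by (simp add: lessThan_atLeast0)
 ultimately show ?thesis
  unfolding det_nat_eq_det
  by (simp add: Determinant.det_permute_rows[of _ N])
qed

lemma prod_list_diag: "prod_list (diag_mat (Matrix.mat N N (%(i, j). A i j))) = (\<Prod>i<N. A i i)"
 unfolding diag_mat_def
 by (auto simp: prod.list_conv_set_nth lessThan_atLeast0 intro!: prod.cong)

lemma det_nat_lower:
 assumes "\<And>i j. i < j ==> j < N ==> A i j = 0"
 shows "det_nat N A = (\<Prod>i<N. A i i)"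
 unfolding det_nat_eq_det using assms
 by (subst Determinant.det_lower_triangular[of N]) (auto simp: prod_list_diag)

text \<open>This is the complete homogeneous symmetric polynomial h_(n-k)(x_0, ..., x_k), equally
  the divided difference of y^n at these nodes. Being a polynomial it survives coinciding nodes,
  which is what later gives the bialternant quotient a value at (1,...,1).\<close>

fun newton_coeff :: "(nat => complex) => nat => nat => complex" where
 "newton_coeff x 0 k = (if k = 0 then 1 else 0)"
| "newton_coeff x (Suc n) k =
  (if k = 0 then 0 else newton_coeff x n (k - 1)) + x k * newton_coeff x n k"

lemma newton_coeff_gt: "n < k ==> newton_coeff x n k = 0"
 by (induction n arbitrary: k) auto

lemma newton_coeff_diag: "newton_coeff x n n = 1"
 by (induction n) (auto simp: newton_coeff_gt)

lemma newton_coeff_ones: "newton_coeff (%_. 1) n k = of_nat (n choose k)"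
proof (induction n arbitrary: k)
 case (Suc n)
 then show ?case by (cases k) auto
qed (auto simp: binomial_eq_0)

lemma newton_interp: "y ^ n = (\<Sum>k\<le>n. newton_coeff x n k * (\<Prod>m<k. y - x m))"
proof (induction n)
 case (Suc n)
 let ?p = "%k. \<Prod>m<k. y - x m"
 have *: "y * ?p k = ?p (Suc k) + x k * ?p k" for k by (simp add: algebra_simps)
 have "y ^ Suc n = (\<Sum>k\<le>n. newton_coeff x n k * (y * ?p k))"
  using Suc by (simp add: sum_distrib_left mult_ac)
 also have "\<dots> = (\<Sum>k\<le>n. newton_coeff x n k * ?p (Suc k)) + (\<Sum>k\<le>n. x k * newton_coeff x n k * ?p k)"
  unfolding * by (simp only: distrib_left sum.distrib mult_ac)
 also have "(\<Sum>k\<le>n. newton_coeff x n k * ?p (Suc k))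
   = (\<Sum>k\<le>Suc n. (if k = 0 then 0 else newton_coeff x n (k - 1)) * ?p k)"
  by (subst sum.atMost_Suc_shift) simp
 also have "(\<Sum>k\<le>n. x k * newton_coeff x n k * ?p k) = (\<Sum>k\<le>Suc n. x k * newton_coeff x n k * ?p k)"
  by (simp add: newton_coeff_gt)
 also have "(\<Sum>k\<le>Suc n. (if k = 0 then 0 else newton_coeff x n (k - 1)) * ?p k)
  + (\<Sum>k\<le>Suc n. x k * newton_coeff x n k * ?p k) = (\<Sum>k\<le>Suc n. newton_coeff x (Suc n) k * ?p k)"
  by (subst sum.distrib[symmetric]) (simp add: algebra_simps del: sum.atMost_Suc)
 finally show ?case .
qed simp

text \<open>At the node x_i the basis products with k > i vanish, and the coefficients with k > n
  vanish as well. Hence the summation range can be taken independent of i and n, which is the shape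
  of a matrix product.\<close>

lemma newton_interp_node:
 assumes "i < N"
 shows "x i ^ n = (\<Sum>k<N. (\<Prod>m<k. x i - x m) * newton_coeff x n k)"
proof -
 let ?t = "%k. (\<Prod>m<k. x i - x m) * newton_coeff x n k"
 have z: "?t k = 0" if "k > i" for k using that by (auto intro: prod_zero)
 have "x i ^ n = (\<Sum>k\<le>n. ?t k)" by (subst newton_interp[of _ _ x]) (simp add: mult_ac)
 also have "\<dots> = (\<Sum>k\<in>{..n} \<inter> {..<N}. ?t k)"
  using z assms by (intro sum.mono_neutral_right) auto
 also have "\<dots> = (\<Sum>k<N. ?t k)"
  by (intro sum.mono_neutral_left) (auto simp: newton_coeff_gt not_le)
 finally show ?thesis .
qed

text \<open>Newton interpolation at the nodes factors the matrix. The left factor is lower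
  triangular, because a node product vanishes beyond the diagonal, and it carries the whole
  Vandermonde product; the right factor is polynomial in x.\<close>

lemma det_nat_powers:
 "det_nat N (%i j. x i ^ e j) =
  (\<Prod>i<N. \<Prod>m<i. x i - x m) * det_nat N (%k j. newton_coeff x (e j) k)"
proof -
 have "det_nat N (%i j. x i ^ e j)
  = det_nat N (%i j. \<Sum>k<N. (\<Prod>m<k. x i - x m) * newton_coeff x (e j) k)"
  by (intro det_nat_cong newton_interp_node)
 also have "\<dots> = det_nat N (%i k. \<Prod>m<k. x i - x m) * det_nat N (%k j. newton_coeff x (e j) k)"
  by (rule det_nat_mult)
 also have "det_nat N (%i k. \<Prod>m<k. x i - x m) = (\<Prod>i<N. \<Prod>m<i. x i - x m)"
  by (intro det_nat_lower) (auto intro: prod_zero)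
 finally show ?thesis .
qed

lemma det_newton_upper: "det_nat N (%k j. newton_coeff x j k) = 1"
 by (subst det_nat_transpose[symmetric], subst det_nat_lower)
  (auto simp: newton_coeff_gt newton_coeff_diag)

lemma det_vandermonde: "det_nat N (%i j. x i ^ j) = (\<Prod>i<N. \<Prod>m<i. x i - x m)"
 using det_nat_powers[of N x "%j. j"] by (simp add: det_newton_upper)

text \<open>Passing between monomials and the Newton basis is a unitriangular change of columns, so
  the nodes x leave no trace in the determinant.\<close>

lemma det_falling:
 "det_nat N (%j k. \<Prod>m<k. y j - x m) = (\<Prod>i<N. \<Prod>m<i. y i - y m)"
proof -
 have "(\<Prod>i<N. \<Prod>m<i. y i - y m) = det_nat N (%i j. y i ^ j)" by (simp add: det_vandermonde)
 also have "\<dots> = det_nat N (%i j. \<Sum>k<N. (\<Prod>m<k. y i - x m) * newton_coeff x j k)"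
 proof (intro det_nat_cong)
  fix i j assume "j < N"
  have "y i ^ j = (\<Sum>k\<le>j. newton_coeff x j k * (\<Prod>m<k. y i - x m))" by (rule newton_interp)
  also have "\<dots> = (\<Sum>k<N. newton_coeff x j k * (\<Prod>m<k. y i - x m))"
   using \<open>j < N\<close> by (intro sum.mono_neutral_left) (auto simp: newton_coeff_gt)
  finally show "y i ^ j = (\<Sum>k<N. (\<Prod>m<k. y i - x m) * newton_coeff x j k)" by (simp add: mult_ac)
 qed
 also have "\<dots> = det_nat N (%j k. \<Prod>m<k. y j - x m) * 1"
  by (subst det_nat_mult) (simp add: det_newton_upper)
 finally show ?thesis by simp
qed

text \<open>Multiplying column k by k! turns binomials into falling factorials, that is, Newton
  products with nodes 0, 1, 2, .... The determinant becomes the Vandermonde product of the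
  exponents, which injectivity keeps away from zero.\<close>

lemma det_binomial_nonzero:
 assumes "inj_on e {..<N}"
 shows "det_nat N (%k j. of_nat (e j choose k)) \<noteq> 0"
proof -
 have "fact k * of_nat (e j choose k) = (\<Prod>m<k. of_nat (e j) - of_nat m :: complex)" for j k
  using gbinomial_mult_fact[of k "of_nat (e j) :: complex"]
  by (simp add: binomial_gbinomial lessThan_atLeast0)
 then have "det_nat N (%j k. of_nat (e j choose k) * fact k)
  = (\<Prod>i<N. \<Prod>m<i. of_nat (e i) - of_nat (e m) :: complex)"
  using det_falling[of N "%j. of_nat (e j)" of_nat] by (simp add: mult.commute)
 moreover have "(\<Prod>i<N. \<Prod>m<i. of_nat (e i) - of_nat (e m) :: complex) \<noteq> 0"
 proof -
  have "e i \<noteq> e m" if "i < N" "m < i" for i m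
   using inj_onD[OF assms, of i m] that by auto
  then show ?thesis by simp
 qed
 ultimately have "det_nat N (%j k. of_nat (e j choose k) * fact k) \<noteq> 0" by simp
 then have "det_nat N (%j k. of_nat (e j choose k)) \<noteq> 0"
  by (subst (asm) det_nat_scale_cols) auto
 then show ?thesis by (subst det_nat_transpose)
qed

section \<open>Schur functions as continuous extensions of bialternants\<close>

definition vdm :: "nat => (nat => complex) => complex" where
 "vdm N x = (\<Prod>i<N. \<Prod>j\<in>{i<..<N}. x i - x j)"

text \<open>The sign (-1)^(N(N-1)/2) between the two orders in which the differences are taken:
  smaller index first in \<open>vdm\<close>, larger index first in the determinant formulas.\<close>

definition vdm_sign :: "nat => complex" where
 "vdm_sign N = (\<Prod>i<N. \<Prod>m<i. - 1)"

lemma vdm_sign_sq: "vdm_sign N * vdm_sign N = 1"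
 unfolding vdm_sign_def by (simp add: prod.distrib[symmetric])

lemma vdm_alt: "vdm N x = vdm_sign N * (\<Prod>i<N. \<Prod>m<i. x i - x m)"
proof -
 have "vdm N x = (\<Prod>(i,j)\<in>Sigma {..<N} (%i. {i<..<N}). x i - x j)"
  unfolding vdm_def by (subst prod.Sigma) auto
 also have "\<dots> = (\<Prod>(i,m)\<in>Sigma {..<N} (%i. {..<i}). x m - x i)"
  by (intro prod.reindex_bij_witness[of _ "%(i,j). (j,i)" "%(i,j). (j,i)"]) auto
 also have "\<dots> = (\<Prod>i<N. \<Prod>m<i. (-1) * (x i - x m))"
  by (subst prod.Sigma) auto
 finally show ?thesis unfolding vdm_sign_def by (simp only: prod.distrib)
qed

lemma vdm_nonzero: "x \<in> distinct_pts N ==> vdm N x \<noteq> 0"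
 unfolding vdm_def distinct_pts_def by auto

lemma vdm_permute: "p permutes {..<N} ==> vdm N (x \<circ> p) = of_int (sign p) * vdm N x"
 using det_nat_permute_rows[of p N "%i j. x i ^ j"]
 by (simp add: vdm_alt det_vandermonde[symmetric] o_def)

text \<open>Entries of a signature may be negative. Adding this amount makes every exponent a
  natural number, at the price of the monomial prefactor in \<open>schur_cont\<close>.\<close>

definition sig_shift :: "nat => int list => nat" where
 "sig_shift N l = (\<Sum>j<N. nat \<bar>l ! j\<bar>)"

definition sig_exp :: "nat => int list => nat => int" where
 "sig_exp N l j = l ! j + int N - 1 - int j"

text \<open>The bialternant quotient after its Vandermonde factor has been cancelled. It is
  holomorphic wherever no coordinate vanishes, on the diagonals too.\<close>

definition schur_cont :: "nat => int list => (nat => complex) => complex" where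
 "schur_cont N l x = vdm_sign N * (\<Prod>i<N. x i powi (- int (sig_shift N l))) *
  det_nat N (%k j. newton_coeff x (nat (sig_exp N l j + int (sig_shift N l))) k)"

lemma sig_exp_shift_nonneg: "j < N ==> sig_exp N l j + int (sig_shift N l) \<ge> 0"
proof -
 assume j: "j < N"
 have "nat \<bar>l ! j\<bar> \<le> sig_shift N l" unfolding sig_shift_def
  using j by (intro member_le_sum) auto
 then show ?thesis unfolding sig_exp_def using j by linarith
qed

lemma schur_ratio_eq:
 assumes nz: "\<And>i. i < N ==> x i \<noteq> 0" and d: "x \<in> distinct_pts N"
 shows "schur_ratio N l x = schur_cont N l x"
proof -
 let ?M = "sig_shift N l" let ?e = "%j. nat (sig_exp N l j + int ?M)"
 have *: "x i powi (l ! j + int N - 1 - int j) = x i powi (- int ?M) * x i ^ ?e j"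
  if "i < N" "j < N" for i j
 proof -
  have "x i ^ ?e j = x i powi (sig_exp N l j + int ?M)"
   using sig_exp_shift_nonneg[OF that(2), of l] by (simp add: power_int_def)
  then show ?thesis using nz[OF that(1)] by (simp add: power_int_add[symmetric] sig_exp_def)
 qed
 have "det_nat N (%i j. x i powi (l ! j + int N - 1 - int j))
   = (\<Prod>i<N. x i powi (- int ?M)) * det_nat N (%i j. x i ^ ?e j)"
  by (subst det_nat_scale_rows[symmetric], rule det_nat_cong) (use * in auto)
 also have "det_nat N (%i j. x i ^ ?e j) = vdm_sign N * vdm N x * det_nat N (%k j. newton_coeff x (?e j) k)"
  by (subst det_nat_powers) (simp add: vdm_alt mult.assoc[symmetric] vdm_sign_sq)
 finally show ?thesis
  unfolding schur_ratio_def schur_cont_def vdm_def[symmetric] using vdm_nonzero[OF d]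
  by (simp add: field_simps)
qed

lemma continuous_on_coord: "continuous_on S (%x :: nat => complex. x i)"
 by (rule continuous_on_subset[OF continuous_on_product_coordinates]) auto

lemma open_nonzero_coords: "open {x :: nat => complex. \<forall>i<N. x i \<noteq> 0}"
proof -
 have "{x :: nat => complex. \<forall>i<N. x i \<noteq> 0} = (\<Inter>i<N. {x. x i \<noteq> 0})" by auto
 moreover have "open {x :: nat => complex. x i \<noteq> 0}" for i
  by (intro open_Collect_neq continuous_on_coord continuous_on_const)
 ultimately show ?thesis by (simp add: open_INT)
qed

lemma continuous_newton_coeff:
 "(\<And>i. continuous_on S (%y. f y i)) ==> continuous_on S (%y. newton_coeff (f y) n k)"
proof (induction n arbitrary: k)
 case (Suc n)
 then show ?case by (cases k) (auto intro!: continuous_intros)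
qed auto

lemma holomorphic_newton_coeff:
 "(\<And>i. (%y. f y i) holomorphic_on S) ==> (%y. newton_coeff (f y) n k) holomorphic_on S"
proof (induction n arbitrary: k)
 case (Suc n)
 then show ?case by (cases k) (auto intro!: holomorphic_intros)
qed auto

lemma continuous_schur_cont:
 assumes "\<And>i. continuous_on S (%y. f y i)" "\<And>y i. y \<in> S ==> i < N ==> f y i \<noteq> 0"
 shows "continuous_on S (%y. schur_cont N l (f y))"
 unfolding schur_cont_def det_nat_def
 using assms by (intro continuous_intros continuous_newton_coeff) auto

lemma holomorphic_schur_cont:
 assumes "\<And>i. (%y. f y i) holomorphic_on S" "\<And>y i. y \<in> S ==> i < N ==> f y i \<noteq> 0"
 shows "(%y. schur_cont N l (f y)) holomorphic_on S"
 unfolding schur_cont_def det_nat_def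
 using assms by (intro holomorphic_intros holomorphic_newton_coeff) auto

lemma newton_coeff_cong:
 "(\<And>i. i \<le> k ==> x i = y i) ==> newton_coeff x n k = newton_coeff y n k"
 by (induction n arbitrary: k) auto

text \<open>\<open>schur\<close> is a limit, which is determined only if every x is a limit point of
  \<open>distinct_pts N\<close>. The perturbation uses i + 1 instead of i so that coordinate 0 moves
  too and the sequence avoids x itself.\<close>

lemma distinct_pts_approx:
 fixes x :: "nat => complex"
 defines "y \<equiv> (%n i. x i + of_real (inverse (real (Suc n))) * of_nat (Suc i))"
 shows "filterlim y (at x within distinct_pts N) sequentially"
proof -
 have conv: "(%n. y n i) \<longlonglongrightarrow> x i" for i
 proof -
  have "(%n. complex_of_real (inverse (real (Suc n)))) \<longlonglongrightarrow> of_real 0"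
   by (intro tendsto_of_real LIMSEQ_inverse_real_of_nat)
  from tendsto_add[OF tendsto_const[of "x i"] tendsto_mult_right[OF this, of "of_nat (Suc i)"]]
  show ?thesis unfolding y_def by (simp add: mult.commute)
 qed
 have lim: "y \<longlonglongrightarrow> x"
  unfolding tendsto_def eventually_sequentially
 proof (intro allI impI)
  fix S :: "(nat => complex) set" assume "open S" "x \<in> S"
  then obtain X where X: "x \<in> (\<Pi>\<^sub>E i\<in>UNIV. X i)" "\<And>i. open (X i)" "finite {i. X i \<noteq> UNIV}"
    "(\<Pi>\<^sub>E i\<in>UNIV. X i) \<subseteq> S"
   using product_topology_open_contains_basis[of "%_::nat. euclidean :: complex topology" UNIV S x]
   by (auto simp: open_fun_def)
  have "eventually (%n. \<forall>i\<in>{i. X i \<noteq> UNIV}. y n i \<in> X i) sequentially"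
   using X by (intro eventually_ball_finite ballI topological_tendstoD[OF conv]) auto
  then have "eventually (%n. y n \<in> S) sequentially"
  proof eventually_elim
   case (elim n)
   then have "y n i \<in> X i" for i by (cases "X i = UNIV") auto
   then show ?case using X(4) by auto
  qed
  then show "\<exists>M. \<forall>n\<ge>M. y n \<in> S" by (simp add: eventually_sequentially)
 qed
 have "eventually (%n. y n i \<noteq> y n j) sequentially" if "i < j" for i j
 proof -
  \<comment> \<open>A coincidence of the perturbed coordinates forces x_i - x_j = (j - i)/(n + 1).
    For x_i = x_j this contradicts i < j; otherwise the right side is eventually too small.\<close>
  have "eventually (%n. inverse (real (Suc n)) < cmod (x i - x j) / (real j + 1) \<or> x i = x j) sequentially"
  proof (cases "x i = x j")
   case False
   then have "cmod (x i - x j) / (real j + 1) > 0" by simp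
   from order_tendstoD(2)[OF LIMSEQ_inverse_real_of_nat this]
   show ?thesis by eventually_elim auto
  qed auto
  then show ?thesis
  proof eventually_elim
   case (elim n)
   show ?case
   proof
    assume "y n i = y n j"
    then have e: "x i - x j = of_real (inverse (real (Suc n))) * (of_nat j - of_nat i)"
     unfolding y_def by (simp add: algebra_simps)
    then have "cmod (x i - x j) = inverse (real (Suc n)) * (real j - real i)"
     using that by (simp add: norm_mult norm_inverse of_nat_diff[symmetric] del: of_nat_Suc of_nat_diff)

    moreover have "x i \<noteq> x j"
     using e that by (auto simp del: of_nat_Suc simp: of_nat_eq_iff)
    ultimately have "inverse (real (Suc n)) * (real j + 1) < inverse (real (Suc n)) * (real j - real i)"
     using elim by (simp add: field_simps)
    then show False by (simp add: mult_less_cancel_left)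
   qed
  qed
 qed
 then have "eventually (%n. \<forall>i\<in>{..<N}. \<forall>j\<in>{..<N}. i < j \<longrightarrow> y n i \<noteq> y n j) sequentially"
  by (intro eventually_ball_finite ballI) auto
 then have "eventually (%n. y n \<in> distinct_pts N) sequentially"
  by eventually_elim (auto simp: distinct_pts_def)
 moreover have "y n \<noteq> x" for n
 proof
  assume "y n = x"
  then have "y n 0 = x 0" by simp
  moreover have "(of_nat (Suc n) :: complex) \<noteq> 0" using of_nat_neq_0 by blast
  ultimately show False unfolding y_def by simp
 qed
 ultimately show ?thesis using lim by (auto simp: filterlim_at)
qed

lemma at_distinct_pts_nontriv: "at x within distinct_pts N \<noteq> bot"
proof
 assume "at x within distinct_pts N = bot"
 with distinct_pts_approx[of x N] show False
  unfolding filterlim_def by (auto dest!: le_bot simp: filtermap_bot_iff)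
qed

text \<open>Nonvanishing coordinates are an open condition, and under it the ratio agrees off the
  diagonals with a function that is continuous at x.\<close>

lemma schur_eq:
 assumes nz: "\<And>i. i < N ==> x i \<noteq> 0"
 shows "schur N l x = schur_cont N l x"
 unfolding schur_def
proof (rule tendsto_Lim)
 let ?S = "{x :: nat => complex. \<forall>i<N. x i \<noteq> 0}"
 have "continuous_on ?S (schur_cont N l)"
  by (rule continuous_schur_cont) (auto intro: continuous_on_coord)
 then have "isCont (schur_cont N l) x"
  using open_nonzero_coords nz by (auto simp: continuous_on_eq_continuous_at)
 then have lim: "(schur_cont N l \<longlongrightarrow> schur_cont N l x) (at x within distinct_pts N)"
  unfolding isCont_def by (rule filterlim_mono) (auto intro: at_le)
 have "eventually (%y. y \<in> ?S) (at x within distinct_pts N)"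
  using nz by (intro eventually_at_topological[THEN iffD2] exI[of _ ?S]) (auto simp: open_nonzero_coords)
 moreover have "eventually (%y. y \<in> distinct_pts N) (at x within distinct_pts N)"
  by (simp add: eventually_at_filter)
 ultimately have "eventually (%y. schur_cont N l y = schur_ratio N l y) (at x within distinct_pts N)"
  by eventually_elim (simp add: schur_ratio_eq)
 with lim show "(schur_ratio N l \<longlongrightarrow> schur_cont N l x) (at x within distinct_pts N)"
  by (rule Lim_transform_eventually)
qed (rule at_distinct_pts_nontriv)

lemma schur_ratio_permute:
 assumes p: "p permutes {..<N}"
 shows "schur_ratio N l (x \<circ> p) = schur_ratio N l x"
 unfolding schur_ratio_def vdm_def[symmetric] vdm_permute[OF p]
 using det_nat_permute_rows[OF p, of "%i j. x i powi (l ! j + int N - 1 - int j)"]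
 by (simp add: sign_def)

text \<open>Symmetry is invisible in \<open>schur_cont\<close>, where the order of the nodes
  matters. It is visible in the ratio, whose numerator and denominator change by the same sign, and
  it passes to the limit.\<close>

lemma schur_permute:
 assumes p: "p permutes {..<N}" and nz: "\<And>i. i < N ==> x i \<noteq> 0"
 shows "schur N l (x \<circ> p) = schur N l x"
proof -
 have pin: "p i < N \<longleftrightarrow> i < N" for i using permutes_in_image[OF p, of i] by simp
 let ?S = "{x :: nat => complex. \<forall>i<N. x i \<noteq> 0}"
 let ?D = "at x within distinct_pts N"
 have c: "isCont (schur_cont N l) x" "isCont (%x. schur_cont N l (x \<circ> p)) x"
 proof -
  have "continuous_on ?S (schur_cont N l)"
   by (rule continuous_schur_cont) (auto intro: continuous_on_coord)
  moreover have "continuous_on ?S (%x. schur_cont N l (x \<circ> p))"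
   by (rule continuous_schur_cont) (auto intro: continuous_on_coord simp: pin)
  ultimately show "isCont (schur_cont N l) x" "isCont (%x. schur_cont N l (x \<circ> p)) x"
   using open_nonzero_coords nz by (auto simp: continuous_on_eq_continuous_at)
 qed
 have "eventually (%y. y \<in> ?S) ?D"
  using nz by (intro eventually_at_topological[THEN iffD2] exI[of _ ?S]) (auto simp: open_nonzero_coords)
 moreover have "eventually (%y. y \<in> distinct_pts N) ?D" by (simp add: eventually_at_filter)
 ultimately have ev: "eventually (%y. schur_cont N l y = schur_cont N l (y \<circ> p)) ?D"
 proof eventually_elim
  case (elim y)
  have "y \<circ> p \<in> distinct_pts N"
   unfolding distinct_pts_def
  proof (safe)
   fix i j assume ij: "i < N" "j < N" "i < j" "(y \<circ> p) i = (y \<circ> p) j"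
   have "p i \<noteq> p j" using permutes_inj[OF p] ij(3) by (auto simp: inj_eq)
   have D: "y a \<noteq> y b" if "a < b" "b < N" for a b
    using elim(2) that by (auto simp: distinct_pts_def)
   from \<open>p i \<noteq> p j\<close> consider "p i < p j" | "p j < p i" by linarith
   then show False
   proof cases
    case 1
    with D[OF 1] ij pin show ?thesis by simp
   next
    case 2
    with D[OF 2] ij pin show ?thesis by simp
   qed
  qed
  then show ?case
   using elim pin schur_ratio_permute[OF p, of l y] by (simp add: schur_ratio_eq)
 qed
 have lim: "(schur_cont N l \<longlongrightarrow> schur_cont N l x) ?D"
   "((%y. schur_cont N l (y \<circ> p)) \<longlongrightarrow> schur_cont N l (x \<circ> p)) ?D"
  using c unfolding isCont_def by (auto intro: filterlim_mono[OF _ order_refl] at_le)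
 have "schur_cont N l x = schur_cont N l (x \<circ> p)"
  by (rule tendsto_unique[OF at_distinct_pts_nontriv Lim_transform_eventually[OF lim(1) ev] lim(2)])
 then show ?thesis using nz pin by (simp add: schur_eq)
qed

text \<open>At (1,...,1) the Newton coefficients are binomials, and weak monotonicity of the
  signature makes the exponents strictly decreasing, hence injective. This legitimises the
  normalisation in the generating function.\<close>

lemma schur_one_nonzero:
 assumes "l \<in> GT N"
 shows "schur N l one_pt \<noteq> 0"
proof -
 have l: "l ! i \<ge> l ! j" if "i < j" "j < N" for i j
  using assms that by (auto simp: GT_def sorted_wrt_iff_nth_less)
 have inj: "inj_on (%j. nat (sig_exp N l j + int (sig_shift N l))) {..<N}"
 proof (rule linorder_inj_onI')
  fix i j assume ij: "i \<in> {..<N}" "j \<in> {..<N}" "i < j"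
  then have "sig_exp N l i > sig_exp N l j" using l[of i j] by (simp add: sig_exp_def)
  then show "nat (sig_exp N l i + int (sig_shift N l)) \<noteq> nat (sig_exp N l j + int (sig_shift N l))"
   using sig_exp_shift_nonneg[of i N l] sig_exp_shift_nonneg[of j N l] ij by auto
 qed
 have "vdm_sign N \<noteq> 0" using vdm_sign_sq[of N] by auto
 then show ?thesis
  using det_binomial_nonzero[OF inj]
  by (subst schur_eq) (auto simp: one_pt_def schur_cont_def newton_coeff_ones)
qed

section \<open>The q-difference operator and its eigenvalues on Schur functions\<close>

text \<open>Macdonald's first q-difference operator with t = q, the case in which its eigenfunctions
  are the Schur functions.\<close>

definition Dq :: "nat => complex => ((nat => complex) => complex) => (nat => complex) => complex" where
 "Dq N q F x = (\<Sum>i<N. (\<Prod>j\<in>{..<N} - {i}. (q * x i - x j) / (x i - x j)) * F (x(i := q * x i)))"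

text \<open>The constant C collects the factors without coordinate i. It is common to all y that
  agree with x elsewhere, so it cancels from Vandermonde quotients.\<close>

lemma vdm_split:
 assumes "i < N"
 obtains C where "\<And>y. (\<And>j. j \<noteq> i ==> y j = x j) ==> vdm N y = C * (\<Prod>j\<in>{..<N} - {i}. y i - y j)"
proof -
 let ?P = "Sigma {..<N} (%i. {i<..<N})"
 let ?Q = "{p \<in> ?P. fst p = i \<or> snd p = i}"
 let ?s = "\<Prod>j\<in>{..<N} - {i}. (if i < j then 1 else - 1 :: complex)"
 have fin: "finite ?P" by auto
 show ?thesis
 proof (rule that[of "(\<Prod>p\<in>?P - ?Q. x (fst p) - x (snd p)) * ?s"])
  fix y assume y: "\<And>j. j \<noteq> i ==> y j = x j"
  have "vdm N y = (\<Prod>p\<in>?P. y (fst p) - y (snd p))"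
   unfolding vdm_def by (subst prod.Sigma) (auto simp: case_prod_unfold)
  also have "\<dots> = (\<Prod>p\<in>?P - ?Q. y (fst p) - y (snd p)) * (\<Prod>p\<in>?Q. y (fst p) - y (snd p))"
   by (intro prod.subset_diff fin) auto
  also have "(\<Prod>p\<in>?P - ?Q. y (fst p) - y (snd p)) = (\<Prod>p\<in>?P - ?Q. x (fst p) - x (snd p))"
   using y by (intro prod.cong) auto
  also have "(\<Prod>p\<in>?Q. y (fst p) - y (snd p))
   = (\<Prod>j\<in>{..<N} - {i}. (if i < j then 1 else - 1) * (y i - y j))"
   using assms
   by (intro prod.reindex_bij_witness[of _ "%j. if i < j then (i,j) else (j,i)"
      "%p. if fst p = i then snd p else fst p"]) auto
  finally show "vdm N y = (\<Prod>p\<in>?P - ?Q. x (fst p) - x (snd p)) * ?s * (\<Prod>j\<in>{..<N} - {i}. y i - y j)"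
   by (simp add: prod.distrib mult.assoc)
 qed
qed

lemma vdm_shift_ratio:
 assumes i: "i < N" and d: "x \<in> distinct_pts N"
 shows "vdm N (x(i := y)) / vdm N x = (\<Prod>j\<in>{..<N} - {i}. (y - x j) / (x i - x j))"
proof -
 obtain C where C: "\<And>y. (\<And>j. j \<noteq> i ==> y j = x j) ==> vdm N y = C * (\<Prod>j\<in>{..<N} - {i}. y i - y j)"
  using vdm_split[OF i] by blast
 have "vdm N x = C * (\<Prod>j\<in>{..<N} - {i}. x i - x j)" by (rule C) auto
 moreover have "vdm N (x(i := y)) = C * (\<Prod>j\<in>{..<N} - {i}. y - x j)"
  by (rule trans[OF C]) (auto intro!: prod.cong)
 ultimately show "vdm N (x(i := y)) / vdm N x = (\<Prod>j\<in>{..<N} - {i}. (y - x j) / (x i - x j))"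
  using vdm_nonzero[OF d] by (simp add: prod_dividef)
qed

text \<open>In the term of a permutation p, dilating x_i contributes q to the power e (p i). Summed
  over i this is the same number for every p, so it factors out of the determinant.\<close>

lemma det_nat_shift_rows:
 fixes q :: complex
 assumes q: "q \<noteq> 0" and nz: "\<And>i. i < N ==> x i \<noteq> 0"
 shows "(\<Sum>i<N. det_nat N (%i' j. (x(i := q * x i)) i' powi e j))
  = (\<Sum>j<N. q powi e j) * det_nat N (%i j. x i powi e j)"
proof -
 have *: "(\<Prod>i'<N. (x(i := q * x i)) i' powi e (p i')) = q powi e (p i) * (\<Prod>i'<N. x i' powi e (p i'))"
  if "i < N" for i p
 proof -
  have "(\<Prod>i'<N. (x(i := q * x i)) i' powi e (p i'))
   = (\<Prod>i'<N. (if i' = i then q powi e (p i) else 1) * x i' powi e (p i'))"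
   by (intro prod.cong) (auto simp: power_int_mult_distrib)
  then show ?thesis using that by (simp add: prod.distrib prod.delta)
 qed
 have "(\<Sum>i<N. det_nat N (%i' j. (x(i := q * x i)) i' powi e j))
  = (\<Sum>p | p permutes {..<N}. \<Sum>i<N. of_int (sign p) * (\<Prod>i'<N. (x(i := q * x i)) i' powi e (p i')))"
  unfolding det_nat_def by (rule sum.swap)
 also have "\<dots> = (\<Sum>p | p permutes {..<N}. (\<Sum>i<N. q powi e (p i)) * (of_int (sign p) * (\<Prod>i'<N. x i' powi e (p i'))))"
  unfolding sum_distrib_right by (intro sum.cong refl, subst *) auto
 also have "\<dots> = (\<Sum>p | p permutes {..<N}. (\<Sum>i<N. q powi e i) * (of_int (sign p) * (\<Prod>i'<N. x i' powi e (p i'))))"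
 proof (rule sum.cong[OF refl])
  fix p assume "p \<in> {p. p permutes {..<N}}"
  then have "(\<Sum>i<N. q powi e (p i)) = (\<Sum>i<N. q powi e i)"
   by (intro sum.permute[symmetric, of p, unfolded o_def]) auto
  then show "(\<Sum>i<N. q powi e (p i)) * (of_int (sign p) * (\<Prod>i'<N. x i' powi e (p i')))
   = (\<Sum>i<N. q powi e i) * (of_int (sign p) * (\<Prod>i'<N. x i' powi e (p i')))" by simp
 qed
 finally show ?thesis by (simp add: det_nat_def sum_distrib_left)
qed

text \<open>The coefficients of \<open>Dq\<close> are quotients of Vandermonde products; they trade
  the denominator at the shifted point for the one at x, and what remains is a sum of determinants
  with one dilated row.\<close>

lemma schur_eigen:
 assumes q: "q \<noteq> 0" and nz: "\<And>i. i < N ==> x i \<noteq> 0" and d: "x \<in> distinct_pts N"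
  and ds: "\<And>i. i < N ==> x(i := q * x i) \<in> distinct_pts N"
 shows "Dq N q (schur N l) x = (\<Sum>j<N. q powi sig_exp N l j) * schur N l x"
proof -
 let ?D = "%x. det_nat N (%i j. x i powi sig_exp N l j)"
 have s: "schur N l y = ?D y / vdm N y" if "\<And>i. i < N ==> y i \<noteq> 0" "y \<in> distinct_pts N" for y
  using schur_ratio_eq[of N y l] that
  by (simp add: schur_eq schur_ratio_def vdm_def sig_exp_def)
 have "Dq N q (schur N l) x = (\<Sum>i<N. vdm N (x(i := q * x i)) / vdm N x * (?D (x(i := q * x i)) / vdm N (x(i := q * x i))))"
  unfolding Dq_def using q nz d ds
  by (intro sum.cong refl) (subst vdm_shift_ratio, auto simp: s)
 also have "\<dots> = (\<Sum>i<N. ?D (x(i := q * x i)) / vdm N x)"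
  using vdm_nonzero[OF ds] by (intro sum.cong refl) auto
 also have "\<dots> = (\<Sum>j<N. q powi sig_exp N l j) * (?D x / vdm N x)"
  using det_nat_shift_rows[OF q nz, where e = "sig_exp N l"] by (simp add: sum_divide_distrib[symmetric])
 finally show ?thesis using nz d by (simp add: s)
qed

section \<open>Holomorphic functions on polydiscs about (1,...,1)\<close>

lemma polydisc_upd:
 "x \<in> polydisc N r ==> cmod (t - 1) < r ==> x(i := t) \<in> polydisc N r"
 by (auto simp: polydisc_def)

lemma polydisc_mono: "r' \<le> r ==> polydisc N r' \<subseteq> polydisc N r"
 by (auto simp: polydisc_def)

lemma holo_on_polydisc_mono: "holo_on_polydisc N r f ==> r' \<le> r ==> holo_on_polydisc N r' f"
 unfolding holo_on_polydisc_def
 using polydisc_mono[of r' r N] by (auto intro: continuous_on_subset)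

lemma holo_slice:
 assumes f: "holo_on_polydisc N r f" and x: "x \<in> polydisc N r" and i: "i < N"
 shows "(%t. f (x(i := t))) holomorphic_on ball 1 r"
 unfolding holomorphic_on_def
proof
 fix t :: complex assume t: "t \<in> ball 1 r"
 then have "x(i := t) \<in> polydisc N r"
  using x by (intro polydisc_upd) (auto simp: dist_norm norm_minus_commute)
 then have "(%s. f ((x(i := t))(i := s))) field_differentiable at ((x(i := t)) i)"
  using f i unfolding holo_on_polydisc_def by blast
 then show "(%t. f (x(i := t))) field_differentiable at t within ball 1 r"
  by (simp add: field_differentiable_at_within)
qed

text \<open>The kernel of Cauchy's formula for the first derivative on a circle about 1, with 1/(2
  pi i) already cancelled against the velocity of \<open>circlepath\<close>.\<close>

definition cauchy_ker :: "real => complex => real => complex" where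
 "cauchy_ker R w t = of_real R * exp (2 * of_real pi * \<i> * of_real t) / (circlepath 1 R t - w) ^ 2"

text \<open>Written as an integral over a fixed circle, a partial derivative becomes a parameter
  integral, so its continuity and its differentiability in the other variables reduce to theorems on
  such integrals.\<close>

lemma pd_integral:
 assumes f: "holo_on_polydisc N r f" and i: "i < N" and R: "0 < R" "R < r"
  and x: "x \<in> polydisc N r" "cmod (x i - 1) < R"
 shows "pd i f x = integral {0..1} (%t. f (x(i := circlepath 1 R t)) * cauchy_ker R (x i) t)"
proof -
 let ?g = "%t. f (x(i := t))"
 have h: "?g holomorphic_on ball 1 r" by (rule holo_slice[OF f x(1) i])
 have sub: "cball 1 R \<subseteq> ball 1 r" using R by auto
 have "(?g has_field_derivative (1 / (2 * of_real pi * \<i>) *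
   contour_integral (circlepath 1 R) (%u. ?g u / (u - x i)^2))) (at (x i))"
 proof (rule Cauchy_derivative_integral_circlepath)
  show "continuous_on (cball 1 R) ?g"
   using h sub by (intro holomorphic_on_imp_continuous_on) (rule holomorphic_on_subset)
  show "?g holomorphic_on ball 1 R"
   using h by (rule holomorphic_on_subset) (use R in auto)
  show "x i \<in> ball 1 R" using x(2) by (simp add: dist_norm norm_minus_commute)
 qed
 then have "pd i f x = 1 / (2 * of_real pi * \<i>) *
   contour_integral (circlepath 1 R) (%u. ?g u / (u - x i)^2)"
  unfolding pd_def by (rule DERIV_imp_deriv)
 also have "\<dots> = integral {0..1} (%t. 1 / (2 * of_real pi * \<i>) * (?g (circlepath 1 R t) / (circlepath 1 R t - x i)^2
   * (2 * pi * \<i> * R * exp(2 * of_real pi * \<i> * t))))"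
  unfolding contour_integral_integral vector_derivative_circlepath integral_mult_right by (rule refl)
 also have "\<dots> = integral {0..1} (%t. f (x(i := circlepath 1 R t)) * cauchy_ker R (x i) t)"
  by (intro integral_cong) (simp add: cauchy_ker_def mult_ac)
 finally show ?thesis .
qed

lemma circlepath_norm: "R \<ge> 0 ==> cmod (circlepath 1 R t - 1) = R"
 by (simp add: circlepath norm_mult)

lemma circlepath_neq:
 assumes "0 < R" "cmod (w - 1) < R"
 shows "circlepath 1 R t - w \<noteq> 0"
 using circlepath_norm[of R t] assms by (metis less_imp_le eq_iff_diff_eq_0 less_irrefl)

lemma continuous_cauchy_ker:
 assumes "0 < R" "\<And>y. y \<in> S ==> cmod (w y - 1) < R" "continuous_on S w" "continuous_on S t"
 shows "continuous_on S (%y. cauchy_ker R (w y) (t y))"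
 unfolding cauchy_ker_def circlepath using circlepath_neq[OF assms(1,2), unfolded circlepath]
 by (intro continuous_intros assms) auto

lemma continuous_upd:
 assumes "\<And>j. continuous_on S (%y. g y j)" "continuous_on S h"
 shows "continuous_on S (%y. (g y :: nat => complex)(i := h y))"
proof (rule continuous_on_coordinatewise_then_product)
 fix j show "continuous_on S (%y. ((g y)(i := h y)) j)"
  using assms by (cases "j = i") auto
qed

lemma continuous_circlepath: "continuous_on S t ==> continuous_on S (%y. circlepath 1 R (t y))"
 unfolding circlepath by (intro continuous_intros)

lemma continuous_pd_integrand:
 assumes f: "continuous_on (polydisc N r) f" and R: "0 < R" "R < r"
  and g: "\<And>j. continuous_on S (%y. g y j)" "\<And>y. y \<in> S ==> g y \<in> polydisc N R" and i: "i < N"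
 shows "continuous_on (S \<times> cbox 0 1) (%(y, t :: real). f ((g y)(i := circlepath 1 R t)) * cauchy_ker R (g y i) t)"
 unfolding case_prod_unfold
proof (rule continuous_on_mult)
 have gc: "continuous_on (S \<times> cbox 0 1) (%p :: _ \<times> real. g (fst p) j)" for j
  by (rule continuous_on_compose2[OF g(1) continuous_on_fst[OF continuous_on_id]]) auto
 show "continuous_on (S \<times> cbox 0 1) (%p :: _ \<times> real. f ((g (fst p))(i := circlepath 1 R (snd p))))"
 proof (rule continuous_on_compose2[OF f])
  show "continuous_on (S \<times> cbox 0 1) (%p :: _ \<times> real. (g (fst p))(i := circlepath 1 R (snd p)))"
   by (intro continuous_upd gc continuous_circlepath continuous_on_snd continuous_on_id)
  show "(%p. (g (fst p))(i := circlepath 1 R (snd p))) ` (S \<times> cbox 0 1) \<subseteq> polydisc N r"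
   using g(2) polydisc_mono[of R r N] R
   by (auto intro!: polydisc_upd simp: circlepath_norm)
 qed
 show "continuous_on (S \<times> cbox 0 1) (%p. cauchy_ker R (g (fst p) i) (snd p))"
  using g(2) i
  by (intro continuous_cauchy_ker gc R continuous_on_snd continuous_on_id)
   (auto simp: polydisc_def)
qed

lemma continuous_pd:
 assumes f: "holo_on_polydisc N r f" and i: "i < N" and R: "0 < R" "R < r"
 shows "continuous_on (polydisc N R) (pd i f)"
proof -
 have c: "continuous_on (polydisc N R)
  (%x. integral (cbox 0 1) (%t. f (x(i := circlepath 1 R t)) * cauchy_ker R (x i) t))"
  using f i unfolding holo_on_polydisc_def
  by (intro integral_continuous_on_param continuous_pd_integrand[where r = r] R continuous_on_coord) auto
 show ?thesis
  using i polydisc_mono[of R r N] R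
  by (intro continuous_on_eq[OF c] pd_integral[OF f i R, symmetric, unfolded cbox_interval[symmetric]])
   (auto simp: polydisc_def)
qed

text \<open>Differentiation under the integral sign. The outcome is again a Cauchy integral, now of
  \<open>pd j f\<close>, which \<open>pd_commute\<close> recognises as
  \<open>pd i (pd j f)\<close>.\<close>

lemma pd_var_derivative:
 assumes f: "holo_on_polydisc N r f" and ij: "i < N" "j < N" "i \<noteq> j" and R: "0 < R" "R < r"
  and x: "x \<in> polydisc N R"
 shows "((%t. pd i f (x(j := t))) has_field_derivative
  integral {0..1} (%t. pd j f (x(i := circlepath 1 R t)) * cauchy_ker R (x i) t)) (at (x j))"
proof -
 \<comment> \<open>An intermediate radius, because continuity of \<open>pd j f\<close> is available
   only on a smaller polydisc than that of f.\<close>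
 define r1 where "r1 = (R + r) / 2"
 have r1: "R < r1" "r1 < r" "0 < r1" using R by (auto simp: r1_def)
 have xb: "x j \<in> ball 1 R" using x ij by (auto simp: polydisc_def dist_norm norm_minus_commute)
 have upd: "x(j := s) \<in> polydisc N R" if "s \<in> ball 1 R" for s
  using that x by (intro polydisc_upd) (auto simp: dist_norm norm_minus_commute)
 let ?F = "%s t. f ((x(j := s))(i := circlepath 1 R t)) * cauchy_ker R ((x(j := s)) i) t"
 let ?F' = "%s t. pd j f ((x(j := s))(i := circlepath 1 R t)) * cauchy_ker R ((x(j := s)) i) t"
 have cont: "continuous_on (ball 1 R \<times> cbox 0 1) (%(s, t :: real). g ((x(j := s))(i := circlepath 1 R t)) * cauchy_ker R ((x(j := s)) i) t)"
  if "continuous_on (polydisc N r1) g" for g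
 proof (rule continuous_pd_integrand[OF that R(1) r1(1) _ _ ij(1)])
  fix k show "continuous_on (ball 1 R) (%s. (x(j := s)) k)" by (cases "k = j") auto
 qed (rule upd)
 have cf: "continuous_on (polydisc N r1) f"
  using f r1 polydisc_mono[of r1 r N] unfolding holo_on_polydisc_def by (auto intro: continuous_on_subset)
 have cF: "?F s integrable_on cbox 0 1" if "s \<in> ball 1 R" for s
 proof -
  have "continuous_on (cbox 0 1) (%t. (%(s, t). ?F s t) (s, t))"
   using that by (intro continuous_on_compose2[OF cont[OF cf]] continuous_intros) auto
  then show ?thesis by (intro integrable_continuous) auto
 qed
 have "((%s. integral (cbox 0 1) (?F s)) has_field_derivative integral (cbox 0 1) (?F' (x j))) (at (x j) within ball 1 R)"
 proof (rule leibniz_rule_field_derivative[OF _ cF cont[OF continuous_pd[OF f ij(2) r1(3,2)]] xb])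
  fix s t :: complex and t' :: real assume st: "s \<in> ball 1 R" "t' \<in> cbox 0 1"
  let ?y = "x(i := circlepath 1 R t')"
  have "x(j := s) \<in> polydisc N r" using upd[OF st(1)] R polydisc_mono[of R r N] by auto
  then have "(x(j := s))(i := circlepath 1 R t') \<in> polydisc N r"
   by (rule polydisc_upd) (use R in \<open>simp add: circlepath_norm\<close>)
  then have y: "?y(j := s) \<in> polydisc N r" using ij by (simp add: fun_upd_twist)
  then have "(%t. f ((?y(j := s))(j := t))) field_differentiable at ((?y(j := s)) j)"
   using f ij unfolding holo_on_polydisc_def by blast
  then have "((%s. f (?y(j := s))) has_field_derivative pd j f (?y(j := s))) (at s)"
   unfolding pd_def by (simp add: field_differentiable_derivI)
  then have "((%s. f (?y(j := s)) * cauchy_ker R (x i) t') has_field_derivative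
    pd j f (?y(j := s)) * cauchy_ker R (x i) t') (at s within ball 1 R)"
   by (intro DERIV_cmult_right) (rule has_field_derivative_at_within)
  then show "((%s. ?F s t') has_field_derivative ?F' s t') (at s within ball 1 R)"
   using ij by (simp add: fun_upd_twist[of i j])
 qed auto
 then have d: "((%s. integral {0..1} (?F s)) has_field_derivative integral {0..1} (?F' (x j))) (at (x j))"
  using xb by (simp add: at_within_open[OF _ open_ball])
 have ev: "eventually (%s. integral {0..1} (?F s) = pd i f (x(j := s))) (nhds (x j))"
 proof (rule eventually_nhds[THEN iffD2], intro exI conjI ballI)
  fix s :: complex assume "s \<in> ball 1 R"
  then show "integral {0..1} (?F s) = pd i f (x(j := s))"
   using upd[of s] polydisc_mono[of R r N] R ij
   by (intro pd_integral[OF f ij(1) R, symmetric]) (auto simp: polydisc_def)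
 qed (use xb in auto)
 show ?thesis
  using d DERIV_cong_ev[OF refl ev refl] ij by (simp del: fun_upd_apply)
qed

lemma pd_slice_same: "pd i f (x(i := t)) = deriv (%s. f (x(i := s))) t"
 by (simp add: pd_def)

lemma holo_pd:
 assumes f: "holo_on_polydisc N r f" and i: "i < N" and R: "R < r"
 shows "holo_on_polydisc N R (pd i f)"
proof (cases "R > 0")
 case False
 then have "polydisc N R = {}" using i by (auto simp: polydisc_def not_less intro!: exI[of _ i] intro: order_trans)
 then show ?thesis by (simp add: holo_on_polydisc_def)
next
 case True
 show ?thesis
  unfolding holo_on_polydisc_def
 proof (intro conjI ballI allI impI)
  show "continuous_on (polydisc N R) (pd i f)" by (rule continuous_pd[OF f i True R])
  fix x j assume x: "x \<in> polydisc N R" and j: "j < N"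
  show "(%t. pd i f (x(j := t))) field_differentiable at (x j)"
  proof (cases "i = j")
   case True
   have "(%t. f (x(i := t))) holomorphic_on ball 1 r"
    using x R polydisc_mono[of R r N] by (intro holo_slice[OF f _ i]) auto
   then have "deriv (%t. f (x(i := t))) holomorphic_on ball 1 r" by (intro holomorphic_deriv) auto
   then have "deriv (%t. f (x(i := t))) field_differentiable at (x i)"
    using x i R by (intro holomorphic_on_imp_differentiable_at) (force simp: polydisc_def dist_norm norm_minus_commute)+
   then show ?thesis using True by (simp add: pd_slice_same)
  next
   case False
   then show ?thesis
    using pd_var_derivative[OF f i j False \<open>R > 0\<close> R x] by (auto simp: field_differentiable_def)
  qed
 qed
qed

lemma pd_commute:
 assumes f: "holo_on_polydisc N r f" and ij: "i < N" "j < N" and x: "x \<in> polydisc N R" and R: "0 < R" "R < r"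
 shows "pd i (pd j f) x = pd j (pd i f) x"
proof (cases "i = j")
 case False
 define r1 where "r1 = (R + r) / 2"
 have r1: "R < r1" "r1 < r" using R by (auto simp: r1_def)
 have "pd i (pd j f) x = integral {0..1} (%t. pd j f (x(i := circlepath 1 R t)) * cauchy_ker R (x i) t)"
  using x ij r1 polydisc_mono[of R r1 N]
  by (intro pd_integral[OF holo_pd[OF f ij(2) r1(2)] ij(1) R(1) r1(1)]) (auto simp: polydisc_def)
 also have "\<dots> = pd j (pd i f) x"
  unfolding pd_def[of j "pd i f"]
  using pd_var_derivative[OF f ij False R x] by (intro DERIV_imp_deriv[symmetric])
 finally show ?thesis .
qed simp

lemma pds_Nil [simp]: "pds [] f = f" by (simp add: pds_def)
lemma pds_Cons [simp]: "pds (i # is) f = pd i (pds is f)" by (simp add: pds_def)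

lemma holo_pds:
 assumes f: "holo_on_polydisc N r f" and "set is \<subseteq> {..<N}" "R < r"
 shows "holo_on_polydisc N R (pds is f)"
 using assms(2,3)
proof (induction "is" arbitrary: R)
 case Nil
 then show ?case using holo_on_polydisc_mono[OF f] by auto
next
 case (Cons i "is")
 define r1 where "r1 = (R + r) / 2"
 have "R < r1" "r1 < r" using Cons.prems by (auto simp: r1_def)
 then show ?case using holo_pd[OF Cons.IH[of r1], of i R] Cons.prems by auto
qed

lemma pds_perm:
 assumes f: "holo_on_polydisc N r f" and "mset is = mset is'" "set is \<subseteq> {..<N}" "x \<in> polydisc N R" "0 < R" "R < r"
 shows "pds is f x = pds is' f x"
proof -
 \<comment> \<open>Point and radius are generalised because the equality is differentiated again in
   the induction and so must hold on a whole neighbourhood.\<close>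
 have move: "pds (i # as) f x = pds (as @ [i]) f x"
  if "set (i # as) \<subseteq> {..<N}" "x \<in> polydisc N R" "0 < R" "R < r" for i as x R
  using that
 proof (induction as arbitrary: x R)
  case (Cons a as)
  define r1 where "r1 = (R + r) / 2"
  have r1: "R < r1" "r1 < r" using Cons.prems by (auto simp: r1_def)
  have "pds (i # a # as) f x = pd a (pds (i # as) f) x"
   using Cons.prems r1 holo_pds[OF f, of as r1] by (simp add: pd_commute[of N r1 _ i a x R])
  also have "\<dots> = pd a (pds (as @ [i]) f) x"
   unfolding pd_def
  proof (rule deriv_cong_ev[OF _ refl], rule eventually_nhds[THEN iffD2], intro exI conjI ballI)
   show "x a \<in> ball 1 R" using Cons.prems by (auto simp: polydisc_def dist_norm norm_minus_commute)
   fix t :: complex assume "t \<in> ball 1 R"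
   then show "pds (i # as) f (x(a := t)) = pds (as @ [i]) f (x(a := t))"
    using Cons.prems by (intro Cons.IH[of _ R] polydisc_upd) (auto simp: dist_norm norm_minus_commute)
  qed auto
  finally show ?case by simp
 qed simp
 show ?thesis using assms(2-)
 proof (induction "is" arbitrary: is' x R)
  case (Cons a as)
  then obtain p q where pq: "is' = p @ a # q"
   by (metis list.set_intros(1) mset_eq_setD split_list)
  have sub: "set is' \<subseteq> {..<N}" using Cons.prems mset_eq_setD[OF Cons.prems(1)] by auto
  have as: "mset as = mset (p @ q)" using Cons.prems(1) pq by simp
  have cong: "pd b g x = pd b h x" if "\<And>y. y \<in> polydisc N R ==> g y = h y" "b < N" "x \<in> polydisc N R" for b g h x
   unfolding pd_def
  proof (rule deriv_cong_ev[OF _ refl], rule eventually_nhds[THEN iffD2], intro exI conjI ballI)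
   show "x b \<in> ball 1 R" using that by (auto simp: polydisc_def dist_norm norm_minus_commute)
   fix t :: complex assume "t \<in> ball 1 R"
   then show "g (x(b := t)) = h (x(b := t))"
    using that by (intro that polydisc_upd) (auto simp: dist_norm norm_minus_commute)
  qed auto
  have conga: "pds (ys @ zs) f y = pds (ys @ zs') f y"
   if "\<And>y. y \<in> polydisc N R ==> pds zs f y = pds zs' f y" "set ys \<subseteq> {..<N}" "y \<in> polydisc N R" for ys zs zs' y
   using that(2,3)
  proof (induction ys arbitrary: y)
   case (Cons b ys)
   then show ?case by simp (intro cong, auto)
  qed (use that in auto)
  have "pds (a # as) f x = pds (a # (p @ q)) f x"
   using conga[of as "p @ q" "[a]" x] Cons.IH[OF as] Cons.prems by auto
  also have "\<dots> = pds ((p @ q) @ [a]) f x"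
   using Cons.prems sub pq by (intro move[of _ _ _ R]) auto
  also have "\<dots> = pds (p @ (q @ [a])) f x" by simp
  also have "\<dots> = pds (p @ (a # q)) f x"
  proof (rule conga)
   fix y assume "y \<in> polydisc N R"
   then show "pds (q @ [a]) f y = pds (a # q) f y"
    using Cons.prems sub pq by (intro move[symmetric, of _ _ _ R]) auto
  qed (use Cons.prems sub pq in auto)
  finally show ?case using pq by simp
 qed simp
qed

section \<open>Taylor expansion in several variables\<close>

lemma FTC_linepath:
 assumes h: "g holomorphic_on ball c R" and seg: "path_image (linepath a b) \<subseteq> ball c R"
 shows "((%\<theta>. deriv g (linepath a b \<theta>) * (b - a)) has_integral (g b - g a)) {0..1}"
proof -
 have "(g has_field_derivative deriv g t) (at t within ball c R)" if "t \<in> ball c R" for t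
  by (rule has_field_derivative_at_within, rule holomorphic_derivI[OF h open_ball that])
 note contour_integral_primitive[of "ball c R" g "deriv g" "linepath a b", OF this valid_path_linepath seg]
 then show ?thesis
  unfolding has_contour_integral_linepath pathfinish_linepath pathstart_linepath .
qed

text \<open>Directional derivative: the coordinates are moved one at a time, and the
 fundamental theorem of calculus turns each move into an integral of a partial
 derivative that is continuous in the end point.\<close>

lemma line_derivative:
 assumes f: "holo_on_polydisc N r f" and R: "0 < R" "R < r"
  and u: "\<And>j. j \<ge> N ==> u j = 0" and x: "(%j. 1 + s0 * u j) \<in> polydisc N R"
 shows "((%s. f (%j. 1 + s * u j)) has_field_derivative
  (\<Sum>i<N. u i * pd i f (%j. 1 + s0 * u j))) (at s0)"
proof -
 define r1 where "r1 = (R + r) / 2"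
 have r1: "R < r1" "r1 < r" "0 < r1" using R by (auto simp: r1_def)
 define M where "M = 1 + (\<Sum>j<N. cmod (u j))"
 \<comment> \<open>M bounds every component of u, so moving s by less than this amount displaces
   each coordinate by at most r1 - R and the point stays in the polydisc of radius r1.\<close>
 define \<delta> where "\<delta> = (r1 - R) / M"
 have M: "M \<ge> 1" "\<And>j. j < N ==> cmod (u j) \<le> M"
  unfolding M_def by (auto intro!: sum_nonneg add_increasing member_le_sum)
 have \<delta>: "\<delta> > 0" using r1 M unfolding \<delta>_def by auto
 have near: "cmod (1 + s * u j - 1) < r1" if "s \<in> ball s0 \<delta>" "j < N" for s j
 proof -
  have "cmod (1 + s * u j - 1) \<le> cmod (s0 * u j) + cmod ((s - s0) * u j)"
   by (metis add_diff_cancel_left' diff_add_cancel distrib_right norm_triangle_ineq add.commute)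
  also have "cmod (s0 * u j) < R" using x that by (auto simp: polydisc_def)
  also have "cmod ((s - s0) * u j) \<le> \<delta> * M"
   unfolding norm_mult using that M \<delta> by (intro mult_mono) (auto simp: dist_norm norm_minus_commute)
  also have "\<delta> * M = r1 - R" using M by (simp add: \<delta>_def)
  finally show ?thesis by simp
 qed
 have s0: "s0 \<in> ball s0 \<delta>" using \<delta> by simp
 define Y where "Y = (%n s j. if j < n then 1 + s * u j else 1 + s0 * u j)"
 have Yp: "Y n s \<in> polydisc N r1" if "s \<in> ball s0 \<delta>" for n s
  unfolding polydisc_def Y_def using near[OF that] near[OF s0] by auto
 have step: "((%s. f (Y (Suc n) s) - f (Y n s)) has_field_derivative u n * pd n f (%j. 1 + s0 * u j)) (at s0)"
  if n: "n < N" for n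
 proof -
  define Z where "Z = (%s \<theta>. (Y n s)(n := 1 + (s0 + of_real \<theta> * (s - s0)) * u n))"
  have \<theta>b: "s0 + of_real \<theta> * (s - s0) \<in> ball s0 \<delta>" if "s \<in> ball s0 \<delta>" "\<theta> \<in> cbox 0 1" for s and \<theta> :: real
  proof -
   have "cmod (of_real \<theta> * (s - s0)) \<le> 1 * cmod (s - s0)"
    unfolding norm_mult using that by (intro mult_right_mono) auto
   then show ?thesis using that by (auto simp: dist_norm norm_minus_commute)
  qed
  have Zp: "Z s \<theta> \<in> polydisc N r1" if "s \<in> ball s0 \<delta>" "\<theta> \<in> cbox 0 1" for s \<theta>
   unfolding Z_def using Yp[OF that(1)] near[OF \<theta>b[OF that] n] by (intro polydisc_upd) auto
  define \<Psi> where "\<Psi> s = integral (cbox 0 1) (%\<theta>. pd n f (Z s \<theta>))" for s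
  have "continuous_on (ball s0 \<delta>) \<Psi>"
   unfolding \<Psi>_def
  proof (rule integral_continuous_on_param)
   show "continuous_on (ball s0 \<delta> \<times> cbox 0 1) (%(s, \<theta>). pd n f (Z s \<theta>))"
    unfolding case_prod_unfold
   proof (rule continuous_on_compose2[OF continuous_pd[OF f n r1(3,2)]])
    show "continuous_on (ball s0 \<delta> \<times> cbox 0 1) (%p. Z (fst p) (snd p))"
     unfolding Z_def
    proof (rule continuous_upd)
     fix j show "continuous_on (ball s0 \<delta> \<times> cbox 0 1) (%p :: complex \<times> real. Y n (fst p) j)"
      unfolding Y_def by (cases "j < n") (auto intro!: continuous_intros)
    qed (intro continuous_intros)
   qed (use Zp in auto)
  qed
  then have "isCont \<Psi> s0" using s0 by (auto simp: continuous_on_eq_continuous_at)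
  moreover have "\<Psi> s0 = pd n f (%j. 1 + s0 * u j)"
  proof -
   have "Z s0 \<theta> = (%j. 1 + s0 * u j)" for \<theta> by (auto simp: Z_def Y_def)
   then show ?thesis by (simp add: \<Psi>_def)
  qed
  ultimately have lim: "((%s. u n * \<Psi> s) \<longlongrightarrow> u n * pd n f (%j. 1 + s0 * u j)) (at s0)"
   by (metis isCont_def tendsto_mult_left)
  have diff: "f (Y (Suc n) s) - f (Y n s) = (s - s0) * (u n * \<Psi> s)" if s: "s \<in> ball s0 \<delta>" for s
  proof -
   let ?a = "1 + s0 * u n" and ?b = "1 + s * u n" let ?g = "%t. f ((Y n s)(n := t))"
   have h: "?g holomorphic_on ball 1 r1"
    using Yp[OF s] r1 by (intro holo_slice[OF holo_on_polydisc_mono[OF f] _ n]) auto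
   have ab: "?a \<in> ball 1 r1" "?b \<in> ball 1 r1"
    using near[OF s n] near[OF s0 n] by (auto simp: dist_norm norm_minus_commute)
   have seg: "path_image (linepath ?a ?b) \<subseteq> ball 1 r1"
    unfolding path_image_linepath by (rule closed_segment_subset[OF ab convex_ball])
   have "((%\<theta>. deriv ?g (linepath ?a ?b \<theta>) * (?b - ?a)) has_integral (?g ?b - ?g ?a)) {0..1}"
    by (rule FTC_linepath[OF h seg])
   then have "?g ?b - ?g ?a = integral {0..1} (%\<theta>. deriv ?g (linepath ?a ?b \<theta>) * (?b - ?a))"
    by (rule integral_unique[symmetric])
   also have "\<dots> = integral {0..1} (%\<theta>. deriv ?g (linepath ?a ?b \<theta>)) * ((s - s0) * u n)"
    by (subst integral_mult_left[symmetric]) (simp add: algebra_simps)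
   also have "integral {0..1} (%\<theta>. deriv ?g (linepath ?a ?b \<theta>)) = \<Psi> s"
    unfolding \<Psi>_def cbox_interval
   proof (rule integral_cong)
    fix \<theta> :: real assume "\<theta> \<in> {0..1}"
    have "linepath ?a ?b \<theta> = 1 + (s0 + of_real \<theta> * (s - s0)) * u n"
     by (simp add: linepath_def scaleR_conv_of_real algebra_simps)
    then show "deriv ?g (linepath ?a ?b \<theta>) = pd n f (Z s \<theta>)"
     by (simp add: Z_def pd_slice_same)
   qed
   also have "(Y n s)(n := ?b) = Y (Suc n) s" by (auto simp: Y_def less_Suc_eq)
   also have "(Y n s)(n := ?a) = Y n s" by (auto simp: Y_def)
   finally show ?thesis by (simp add: mult_ac)
  qed
  have Y0: "Y m s0 = (%j. 1 + s0 * u j)" for m by (auto simp: Y_def)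
  have "eventually (%s. u n * \<Psi> s = ((f (Y (Suc n) s) - f (Y n s)) - (f (Y (Suc n) s0) - f (Y n s0))) / (s - s0)) (at s0)"
   unfolding eventually_at_topological
  proof (intro exI conjI ballI impI)
   fix s assume "s \<in> ball s0 \<delta>" "s \<noteq> s0"
   then show "u n * \<Psi> s = ((f (Y (Suc n) s) - f (Y n s)) - (f (Y (Suc n) s0) - f (Y n s0))) / (s - s0)"
    unfolding diff[OF \<open>s \<in> ball s0 \<delta>\<close>] Y0 by simp
  qed (use s0 in auto)
  then show ?thesis
   unfolding has_field_derivative_iff by (rule Lim_transform_eventually[OF lim])
 qed
 have "((%s. \<Sum>n<N. f (Y (Suc n) s) - f (Y n s)) has_field_derivative
  (\<Sum>n<N. u n * pd n f (%j. 1 + s0 * u j))) (at s0)"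
  by (intro DERIV_sum step) auto
 then have "((%s. f (Y 0 s0) + (\<Sum>n<N. f (Y (Suc n) s) - f (Y n s))) has_field_derivative
  0 + (\<Sum>n<N. u n * pd n f (%j. 1 + s0 * u j))) (at s0)"
  by (intro DERIV_add DERIV_const)
 moreover have "f (Y 0 s0) + (\<Sum>n<N. f (Y (Suc n) s) - f (Y n s)) = f (%j. 1 + s * u j)" for s
 proof -
  have "Y N s = (%j. 1 + s * u j)" using u by (auto simp: Y_def)
  moreover have "Y 0 s0 = Y 0 s" by (simp add: Y_def)
  moreover have "(\<Sum>n<N. f (Y (Suc n) s) - f (Y n s)) = f (Y N s) - f (Y 0 s)"
   by (rule sum_lessThan_telescope)
  ultimately show ?thesis by simp
 qed
 ultimately show ?thesis by simp
qed

text \<open>A neighbourhood in the product topology may constrain coordinates beyond N, and f may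
  depend on them. Fixing these coordinates to 1 leaves finitely many conditions, hence one
  radius.\<close>

lemma near_one_pt:
 fixes f :: "(nat => complex) => complex"
 assumes f: "continuous_on (polydisc N r) f" and r: "0 < r" and e: "0 < e"
 shows "\<exists>d>0. \<forall>x. (\<forall>j<N. cmod (x j - 1) < d) \<longrightarrow> (\<forall>j\<ge>N. x j = 1) \<longrightarrow> cmod (f x - f one_pt) < e"
proof -
 have op: "open (polydisc N r)"
 proof -
  have "polydisc N r = (\<Inter>i<N. {x. cmod (x i - 1) < r})" by (auto simp: polydisc_def)
  moreover have "open {x :: nat => complex. cmod (x i - 1) < r}" for i
   by (intro open_Collect_less continuous_intros continuous_on_coord)
  ultimately show ?thesis by (simp add: open_INT)
 qed
 have one: "one_pt \<in> polydisc N r" using r by (simp add: polydisc_def one_pt_def)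
 have "isCont f one_pt" using f op one by (simp add: continuous_on_eq_continuous_at)
 then have "(f \<longlongrightarrow> f one_pt) (nhds one_pt)"
  by (simp add: isCont_def tendsto_at_iff_tendsto_nhds)
 then have "eventually (%x. dist (f x) (f one_pt) < e) (nhds one_pt)"
  using e by (rule tendstoD)
 then obtain U where U: "open U" "one_pt \<in> U" "\<And>x. x \<in> U ==> dist (f x) (f one_pt) < e"
  by (auto simp: eventually_nhds)
 then obtain X where X: "one_pt \<in> (\<Pi>\<^sub>E i\<in>UNIV. X i)" "\<And>i. open (X i)" "(\<Pi>\<^sub>E i\<in>UNIV. X i) \<subseteq> U"
  using product_topology_open_contains_basis[of "%_::nat. euclidean :: complex topology" UNIV U one_pt]
  by (auto simp: open_fun_def)
 have "\<exists>d>0. ball 1 d \<subseteq> X i" for i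
  using X(1) open_contains_ball[of "X i"] X(2)[of i] by (auto simp: one_pt_def PiE_iff)
 then obtain d where d: "\<And>i. d i > 0" "\<And>i. ball 1 (d i) \<subseteq> X i" by metis
 define D where "D = Min (insert 1 (d ` {..<N}))"
 have D: "D > 0" "\<And>i. i < N ==> D \<le> d i"
  unfolding D_def using d by (auto simp: Min_gr_iff)
 show ?thesis
 proof (intro exI[of _ D] conjI allI impI)
  fix x :: "nat => complex" assume x: "\<forall>j<N. cmod (x j - 1) < D" "\<forall>j\<ge>N. x j = 1"
  have "x i \<in> X i" for i
  proof (cases "i < N")
   case True
   then have "x i \<in> ball 1 (d i)" using x D(2)[OF True] by (force simp: dist_norm norm_minus_commute)
   then show ?thesis using d(2)[of i] by blast
  next
   case False
   then show ?thesis using x X(1) by (auto simp: one_pt_def PiE_iff)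
  qed
  then have "x \<in> U" using X(3) by auto
  then show "cmod (f x - f one_pt) < e" using U(3) by (auto simp: dist_norm)
 qed (use D in auto)
qed

definition idx_lists :: "nat => nat => nat list set" where
 "idx_lists N k = {is. set is \<subseteq> {..<N} \<and> length is = k}"

lemma finite_idx_lists [simp]: "finite (idx_lists N k)"
 unfolding idx_lists_def by (rule finite_lists_length_eq) auto

lemma idx_lists_0 [simp]: "idx_lists N 0 = {[]}"
 by (auto simp: idx_lists_def)

lemma sum_idx_lists_Suc:
 "(\<Sum>is\<in>idx_lists N (Suc k). g is) = (\<Sum>is\<in>idx_lists N k. \<Sum>i<N. g (i # is))"
proof -
 have "(\<Sum>is\<in>idx_lists N (Suc k). g is) = (\<Sum>(is, i)\<in>idx_lists N k \<times> {..<N}. g (i # is))"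
  by (rule sum.reindex_bij_witness[of _ "%(is, i). i # is" "%is. (tl is, hd is)"])
   (auto simp: idx_lists_def length_Suc_conv)
 then show ?thesis by (simp add: sum.cartesian_product)
qed

text \<open>The expansion is the one-variable Taylor formula for f along the segment from (1,...,1)
  to 1 + u, whose k-th derivative is the sum over index lists of length k. The constant depends on
  finitely many derivatives of order K + 1 only, hence not on u.\<close>

lemma multi_Taylor:
 assumes f: "holo_on_polydisc N r f" and r: "0 < r"
 shows "\<exists>d>0. \<exists>C. \<forall>u \<delta>. (\<forall>j\<ge>N. u j = 0) \<longrightarrow> (\<forall>j<N. cmod (u j) \<le> \<delta>) \<longrightarrow> \<delta> < d \<longrightarrow>
  cmod (f (%j. 1 + u j) - (\<Sum>k\<le>K. (\<Sum>is\<in>idx_lists N k. prod_list (map u is) * pds is f one_pt) / fact k))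
   \<le> C * \<delta> ^ Suc K"
proof -
 define R where "R = r / 2"
 have R: "0 < R" "R < r" using r by (auto simp: R_def)
 define R2 where "R2 = r * (3/4)"
 have R2: "0 < R2" "R2 < r" "R < R2" using r by (auto simp: R_def R2_def)
 have "\<exists>d>0. \<forall>x. (\<forall>j<N. cmod (x j - 1) < d) \<longrightarrow> (\<forall>j\<ge>N. x j = 1) \<longrightarrow> cmod (pds is f x - pds is f one_pt) < 1"
  if "is \<in> idx_lists N (Suc K)" for "is"
  using holo_pds[OF f, of "is" R] that R by (intro near_one_pt[of N R]) (auto simp: holo_on_polydisc_def idx_lists_def)
 then obtain d where d: "\<And>is. is \<in> idx_lists N (Suc K) ==> d is > 0"
  "\<And>is x. is \<in> idx_lists N (Suc K) ==> (\<forall>j<N. cmod (x j - 1) < d is) ==> (\<forall>j\<ge>N. x j = 1) ==> cmod (pds is f x - pds is f one_pt) < 1"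
  by metis
 define D where "D = Min (insert R (d ` idx_lists N (Suc K)))"
 have D: "D > 0" "D \<le> R" "\<And>is. is \<in> idx_lists N (Suc K) ==> D \<le> d is"
  unfolding D_def using d(1) R by (auto simp: Min_gr_iff)
 define C where "C = (\<Sum>is\<in>idx_lists N (Suc K). 1 + cmod (pds is f one_pt))"
 show ?thesis
 proof (rule exI[of _ D], rule conjI, rule D(1), rule exI[of _ C], intro allI impI)
  fix u :: "nat => complex" and \<delta> :: real
  assume u: "\<forall>j\<ge>N. u j = 0" "\<forall>j<N. cmod (u j) \<le> \<delta>" and \<delta>D: "\<delta> < D"
  define \<Phi> where "\<Phi> k s = (\<Sum>is\<in>idx_lists N k. prod_list (map u is) * pds is f (%j. 1 + s * u j))" for k s
  have X: "(%j. 1 + s * u j) \<in> polydisc N R" "\<And>j. j < N ==> cmod (s * u j) \<le> \<delta>" if "s \<in> cball 0 1" for s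
  proof -
   have b: "cmod (s * u j) \<le> \<delta>" if "j < N" for j
   proof -
    have "cmod (s * u j) \<le> 1 * cmod (u j)"
     unfolding norm_mult using \<open>s \<in> cball 0 1\<close> by (intro mult_right_mono) auto
    then show ?thesis using u(2) that by force
   qed
   then show "\<And>j. j < N ==> cmod (s * u j) \<le> \<delta>" by blast
   show "(%j. 1 + s * u j) \<in> polydisc N R"
    unfolding polydisc_def using b \<delta>D D(2) by fastforce
  qed
  have der: "(\<Phi> k has_field_derivative \<Phi> (Suc k) s) (at s within cball 0 1)" if "s \<in> cball 0 1" for k s
  proof -
   have "(\<Phi> k has_field_derivative (\<Sum>is\<in>idx_lists N k. prod_list (map u is) *
     (\<Sum>i<N. u i * pd i (pds is f) (%j. 1 + s * u j)))) (at s)"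
    unfolding \<Phi>_def
    using u(1) X(1)[OF that] R2 R holo_pds[OF f _ R2(2)]
    by (intro DERIV_sum DERIV_cmult line_derivative[of N R2 _ R]) (auto simp: idx_lists_def)
   moreover have "(\<Sum>is\<in>idx_lists N k. prod_list (map u is) *
     (\<Sum>i<N. u i * pd i (pds is f) (%j. 1 + s * u j))) = \<Phi> (Suc k) s"
    unfolding \<Phi>_def sum_idx_lists_Suc by (simp add: sum_distrib_left mult_ac)
   ultimately show ?thesis by (simp add: has_field_derivative_at_within)
  qed
  have bound: "cmod (\<Phi> (Suc K) s) \<le> C * \<delta> ^ Suc K" if "s \<in> cball 0 1" for s
  proof -
   have "cmod (\<Phi> (Suc K) s) \<le> (\<Sum>is\<in>idx_lists N (Suc K). (1 + cmod (pds is f one_pt)) * \<delta> ^ Suc K)"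
    unfolding \<Phi>_def
   proof (rule sum_norm_le)
    fix "is" assume isl: "is \<in> idx_lists N (Suc K)"
    have p: "cmod (prod_list (map u js)) \<le> \<delta> ^ length js" if "set js \<subseteq> {..<N}" for js
     using that
    proof (induction js)
     case (Cons j js)
     then have "cmod (u j) \<le> \<delta>" using u by auto
     then show ?case using Cons by (auto simp: norm_mult intro!: mult_mono order_trans[OF norm_ge_zero])
    qed auto
    have "cmod (pds is f (%j. 1 + s * u j) - pds is f one_pt) < 1"
     using X(2)[OF that] D(3)[OF isl] \<delta>D u(1) by (intro d(2)[OF isl]) fastforce+
    then have "cmod (pds is f (%j. 1 + s * u j)) \<le> 1 + cmod (pds is f one_pt)"
     by (smt (verit) norm_triangle_sub)
    then show "cmod (prod_list (map u is) * pds is f (%j. 1 + s * u j)) \<le> (1 + cmod (pds is f one_pt)) * \<delta> ^ Suc K"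
     unfolding norm_mult using p[of "is"] isl
     by (subst mult.commute) (intro mult_mono, auto simp: idx_lists_def)
   qed
   then show ?thesis by (simp add: C_def sum_distrib_right)
  qed
  have "cmod (\<Phi> 0 1 - (\<Sum>k\<le>K. \<Phi> k 0 * (1 - 0) ^ k / fact k)) \<le> C * \<delta> ^ Suc K * cmod (1 - 0) ^ Suc K / fact K"
   by (rule complex_Taylor[OF convex_cball der bound]) auto
  also have "\<dots> \<le> C * \<delta> ^ Suc K"
  proof -
   have "C * \<delta> ^ Suc K \<ge> 0" using bound[of 0] order_trans[OF norm_ge_zero] by auto
   then have "C * \<delta> ^ Suc K * 1 \<le> C * \<delta> ^ Suc K * fact K"
    by (intro mult_left_mono) (auto simp: fact_ge_1)
   then show ?thesis by (simp add: divide_le_eq)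
  qed
  finally show "cmod (f (%j. 1 + u j) - (\<Sum>k\<le>K. (\<Sum>is\<in>idx_lists N k. prod_list (map u is) * pds is f one_pt) / fact k))
   \<le> C * \<delta> ^ Suc K"
   by (simp add: \<Phi>_def one_pt_def)
 qed
qed

subsection \<open>Bounded convergence calculus\<close>

text \<open>The hypotheses of dominated convergence with a constant majorant, closed under algebra
  so that limits of long integrands can be read off factor by factor. The bound is required only
  eventually, since denominators are bounded away from zero only for large n.\<close>

definition bconv :: "'a measure => (nat => 'a => complex) => ('a => complex) => bool" where
 "bconv M f g \<longleftrightarrow> (\<forall>n. f n \<in> borel_measurable M) \<and> g \<in> borel_measurable M \<and>
  (\<exists>C. eventually (%n. \<forall>x. cmod (f n x) \<le> C) sequentially) \<and> (\<forall>x. (%n. f n x) \<longlonglongrightarrow> g x)"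

abbreviation bmeas :: "'a measure => ('a => complex) => bool" where
 "bmeas M f \<equiv> bconv M (%_. f) f"

lemma bconvI:
 assumes "\<And>n. f n \<in> borel_measurable M" "g \<in> borel_measurable M"
  "eventually (%n. \<forall>x. cmod (f n x) \<le> C) sequentially" "\<And>x. (%n. f n x) \<longlonglongrightarrow> g x"
 shows "bconv M f g"
 using assms unfolding bconv_def by blast

lemma bconvE:
 assumes "bconv M f g"
 obtains C where "C > 0" "eventually (%n. \<forall>x. cmod (f n x) \<le> C) sequentially" "\<And>x. cmod (g x) \<le> C"
proof -
 obtain C where C: "eventually (%n. \<forall>x. cmod (f n x) \<le> C) sequentially" "\<And>x. (%n. f n x) \<longlonglongrightarrow> g x"
  using assms unfolding bconv_def by blast
 have C': "eventually (%n. \<forall>x. cmod (f n x) \<le> max C 1) sequentially"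
  using C(1) by (rule eventually_mono) (auto intro: order_trans)
 have g: "cmod (g x) \<le> max C 1" for x
 proof (rule tendsto_upperbound[OF tendsto_norm[OF C(2)[of x]]])
  show "eventually (%n. cmod (f n x) \<le> max C 1) sequentially"
   using C' by (rule eventually_mono) blast
 qed simp
 show ?thesis by (rule that[OF _ C' g]) simp
qed

lemma bconv_meas: "bconv M f g ==> f n \<in> borel_measurable M" "bconv M f g ==> g \<in> borel_measurable M"
 and bconv_lim: "bconv M f g ==> (%n. f n x) \<longlonglongrightarrow> g x"
 by (simp_all add: bconv_def)

lemma bmeasI:
 "f \<in> borel_measurable M ==> (\<And>x. cmod (f x) \<le> C) ==> bmeas M f"
 by (rule bconvI[where C = C]) auto

lemma bconv_imp_bmeas: "bconv M f g ==> bmeas M g"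
 by (metis bconvE bconv_meas(2) bmeasI)

lemma bconv_const: "c \<longlonglongrightarrow> d ==> bconv M (%n _. c n) (%_. d)"
proof -
 assume c: "c \<longlonglongrightarrow> d"
 obtain K where "\<And>n. cmod (c n) \<le> K"
  using convergent_imp_Bseq[OF convergentI[OF c]] unfolding Bseq_def by blast
 then show ?thesis using c by (intro bconvI[where C = K]) auto
qed

lemma bmeas_const [simp]: "bmeas M (%_. c)" by (rule bconv_const) simp

lemma bconv_add: "bconv M f g ==> bconv M f' g' ==> bconv M (%n x. f n x + f' n x) (%x. g x + g' x)"
proof -
 assume a: "bconv M f g" "bconv M f' g'"
 obtain C C' where "eventually (%n. \<forall>x. cmod (f n x) \<le> C) sequentially"
  "eventually (%n. \<forall>x. cmod (f' n x) \<le> C') sequentially" using a by (metis bconvE)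
 then have "eventually (%n. \<forall>x. cmod (f n x + f' n x) \<le> C + C') sequentially"
  by eventually_elim (meson add_mono norm_triangle_le)
 then show ?thesis
  using bconv_meas[OF a(1)] bconv_meas[OF a(2)] bconv_lim[OF a(1)] bconv_lim[OF a(2)]
  by (intro bconvI) (auto intro: tendsto_intros)
qed

lemma bconv_mult: "bconv M f g ==> bconv M f' g' ==> bconv M (%n x. f n x * f' n x) (%x. g x * g' x)"
proof -
 assume a: "bconv M f g" "bconv M f' g'"
 obtain C C' where C: "C > 0" "eventually (%n. \<forall>x. cmod (f n x) \<le> C) sequentially"
  "eventually (%n. \<forall>x. cmod (f' n x) \<le> C') sequentially" using a by (metis bconvE)
 from C(2,3) have "eventually (%n. \<forall>x. cmod (f n x * f' n x) \<le> C * C') sequentially"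
  by eventually_elim (use C(1) in \<open>auto simp: norm_mult intro!: mult_mono\<close>)
 then show ?thesis
  using bconv_meas[OF a(1)] bconv_meas[OF a(2)] bconv_lim[OF a(1)] bconv_lim[OF a(2)]
  by (intro bconvI) (auto intro: tendsto_intros)
qed

lemma bconv_uminus: "bconv M f g ==> bconv M (%n x. - f n x) (%x. - g x)"
 using bconv_mult[of M "%_ _. -1" "%_. -1" f g] by simp

lemma bconv_diff: "bconv M f g ==> bconv M f' g' ==> bconv M (%n x. f n x - f' n x) (%x. g x - g' x)"
 using bconv_add[of M f g "%n x. - f' n x" "%x. - g' x"] bconv_uminus[of M f' g'] by simp

lemma bconv_sum:
 "(\<And>i. i \<in> I ==> bconv M (f i) (g i)) ==> bconv M (%n x. \<Sum>i\<in>I. f i n x) (%x. \<Sum>i\<in>I. g i x)"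
 by (induction I rule: infinite_finite_induct) (auto intro!: bconv_add)

lemma bconv_prod:
 "(\<And>i. i \<in> I ==> bconv M (f i) (g i)) ==> bconv M (%n x. \<Prod>i\<in>I. f i n x) (%x. \<Prod>i\<in>I. g i x)"
 by (induction I rule: infinite_finite_induct) (auto intro!: bconv_mult)

lemma bconv_power: "bconv M f g ==> bconv M (%n x. f n x ^ k) (%x. g x ^ k)"
 by (induction k) (auto intro!: bconv_mult)

lemma bconv_exp: "bconv M f g ==> bconv M (%n x. exp (f n x)) (%x. exp (g x))"
proof -
 assume a: "bconv M f g"
 obtain C where "eventually (%n. \<forall>x. cmod (f n x) \<le> C) sequentially" using a by (metis bconvE)
 then have ev: "eventually (%n. \<forall>x. cmod (exp (f n x)) \<le> exp C) sequentially"
  by eventually_elim (meson exp_le_cancel_iff norm_exp order_trans)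
 show ?thesis
  by (rule bconvI[OF _ _ ev])
   (use bconv_meas[OF a] bconv_lim[OF a] in \<open>auto intro: tendsto_intros\<close>)
qed

lemma bconv_inverse:
 assumes a: "bconv M f g" and c: "c > 0" "eventually (%n. \<forall>x. c \<le> cmod (f n x)) sequentially"
 shows "bconv M (%n x. inverse (f n x)) (%x. inverse (g x))"
proof -
 have "eventually (%n. \<forall>x. cmod (inverse (f n x)) \<le> inverse c) sequentially"
  using c(2) by eventually_elim (use c(1) in \<open>auto simp: norm_inverse intro!: le_imp_inverse_le\<close>)
 moreover have "g x \<noteq> 0" for x
 proof -
  have "c \<le> cmod (g x)"
  proof (rule tendsto_lowerbound[OF tendsto_norm[OF bconv_lim[OF a]]])
   show "eventually (%n. c \<le> cmod (f n x)) sequentially"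
    using c(2) by (rule eventually_mono) blast
  qed simp
  then show ?thesis using c(1) by auto
 qed
 ultimately show ?thesis
  using bconv_meas[OF a] bconv_lim[OF a] by (intro bconvI) (auto intro: tendsto_intros)
qed

lemma bconv_divide:
 assumes "bconv M f g" "bconv M f' g'" "c > 0" "eventually (%n. \<forall>x. c \<le> cmod (f' n x)) sequentially"
 shows "bconv M (%n x. f n x / f' n x) (%x. g x / g' x)"
 unfolding divide_inverse by (intro bconv_mult bconv_inverse[OF _ assms(3,4)] assms(1,2))

lemma bmeas_divide:
 assumes "bmeas M f" "bmeas M g" "c > 0" "\<And>x. c \<le> cmod (g x)"
 shows "bmeas M (%x. f x / g x)"
 using assms by (intro bconv_divide[where c = c]) auto

lemma bmeas_comp:
 assumes "bmeas M f" "h \<in> measurable M' M"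
 shows "bmeas M' (%x. f (h x))"
proof -
 obtain C where "\<And>x. cmod (f x) \<le> C" using assms(1) by (metis bconvE)
 then show ?thesis using assms by (intro bmeasI[where C = C]) (auto dest: bconv_meas)
qed

lemma bmeas_integrable:
 assumes "finite_measure M" "bmeas M f"
 shows "integrable M f"
proof -
 interpret finite_measure M by fact
 obtain C where "\<And>x. cmod (f x) \<le> C" using assms(2) by (metis bconvE)
 then show ?thesis using bconv_meas[OF assms(2)]
  by (intro integrable_const_bound[where B = C]) auto
qed

lemma bconv_integral:
 assumes "finite_measure M" and a: "bconv M f g"
 shows "(%n. integral\<^sup>L M (f n)) \<longlonglongrightarrow> integral\<^sup>L M g"
proof -
 interpret finite_measure M by fact
 obtain C where "eventually (%n. \<forall>x. cmod (f n x) \<le> C) sequentially"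
  using a unfolding bconv_def by blast
 then obtain n0 where C: "\<And>n x. n \<ge> n0 ==> cmod (f n x) \<le> C"
  unfolding eventually_sequentially by blast
 have "(%n. integral\<^sup>L M (f (n + n0))) \<longlonglongrightarrow> integral\<^sup>L M g"
 proof (rule integral_dominated_convergence[where w = "%_. C"])
  show "AE x in M. (%n. f (n + n0) x) \<longlonglongrightarrow> g x"
   by (intro AE_I2 LIMSEQ_ignore_initial_segment bconv_lim[OF a])
 qed (use C bconv_meas[OF a] in auto)
 then show ?thesis by (rule LIMSEQ_offset)
qed

text \<open>The second-order remainder of the exponential, multiplied by A, is at most C^2 * e^C / A
  when |f| <= C and A >= 1.\<close>

lemma bconv_expm1:
 assumes a: "bconv M f g" and A: "filterlim A at_top sequentially"
 shows "bconv M (%n x. of_real (A n) * (exp (f n x / of_real (A n)) - 1)) g"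
proof -
 obtain C where C: "C > 0" "eventually (%n. \<forall>x. cmod (f n x) \<le> C) sequentially" using a by (metis bconvE)
 have A1: "eventually (%n. A n \<ge> 1) sequentially" using A by (auto simp: filterlim_at_top)
 have bd: "cmod (exp z - 1 - z) \<le> cmod z ^ 2 * exp (cmod z)" for z :: complex
 proof -
  have "cmod (exp z - (\<Sum>i\<le>1. z ^ i / fact i)) \<le> exp \<bar>Re z\<bar> * cmod z ^ Suc 1 / fact 1"
   by (rule Taylor_exp)
  also have "\<dots> = cmod z ^ 2 * exp \<bar>Re z\<bar>" by (simp add: numeral_2_eq_2)
  also have "\<dots> \<le> cmod z ^ 2 * exp (cmod z)"
   by (intro mult_left_mono) (simp_all add: abs_Re_le_cmod)
  finally show ?thesis by (simp add: algebra_simps)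
 qed
 have bd1: "cmod (of_real (A n) * (exp (f n x / of_real (A n)) - 1) - f n x) \<le> C ^ 2 * exp C / A n"
  if "\<forall>x. cmod (f n x) \<le> C" "A n \<ge> 1" for n x
 proof -
  let ?z = "f n x / of_real (A n)"
  have z: "cmod ?z \<le> C / A n" "C / A n \<le> C"
   using that C(1) by (auto simp: norm_divide divide_right_mono divide_le_eq mult_le_cancel_left1)
  have "of_real (A n) * (exp ?z - 1) - f n x = of_real (A n) * (exp ?z - 1 - ?z)"
   using that by (auto simp: field_simps)
  then have "cmod (of_real (A n) * (exp ?z - 1) - f n x) = A n * cmod (exp ?z - 1 - ?z)"
   using that by (simp add: norm_mult)
  also have "\<dots> \<le> A n * ((C / A n) ^ 2 * exp C)"
   using that z by (intro mult_left_mono order_trans[OF bd] mult_mono power_mono) (auto intro: order_trans)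
  also have "\<dots> = C ^ 2 * exp C / A n" using that by (simp add: power2_eq_square)
  finally show ?thesis .
 qed
 show ?thesis
 proof (rule bconvI)
  show "eventually (%n. \<forall>x. cmod (of_real (A n) * (exp (f n x / of_real (A n)) - 1)) \<le> C ^ 2 * exp C + C) sequentially"
   using C(2) A1
  proof eventually_elim
   case (elim n)
   show ?case
   proof
    fix x
    let ?E = "of_real (A n) * (exp (f n x / of_real (A n)) - 1)"
    have "cmod ?E \<le> cmod (?E - f n x) + cmod (f n x)" by (metis diff_add_cancel norm_triangle_ineq)
    also have "\<dots> \<le> C ^ 2 * exp C / A n + C" using bd1[OF elim] elim(1) by (intro add_mono) auto
    also have "\<dots> \<le> C ^ 2 * exp C + C"
    proof -
     have "C ^ 2 * exp C / A n \<le> C ^ 2 * exp C / 1" using elim(2) by (intro divide_left_mono) auto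
     then show ?thesis by simp
    qed
    finally show "cmod ?E \<le> C ^ 2 * exp C + C" .
   qed
  qed
  fix x
  have "(%n. of_real (A n) * (exp (f n x / of_real (A n)) - 1) - f n x) \<longlonglongrightarrow> 0"
  proof (rule Lim_null_comparison)
   show "eventually (%n. norm (of_real (A n) * (exp (f n x / of_real (A n)) - 1) - f n x) \<le> C ^ 2 * exp C / A n) sequentially"
    using C(2) A1 by eventually_elim (rule bd1)
   show "(%n. C ^ 2 * exp C / A n) \<longlonglongrightarrow> 0"
    by (rule tendsto_divide_0[OF tendsto_const]) (rule filterlim_at_top_imp_at_infinity[OF A])
  qed
  from tendsto_add[OF this bconv_lim[OF a, of x]]
  show "(%n. of_real (A n) * (exp (f n x / of_real (A n)) - 1)) \<longlonglongrightarrow> g x" by simp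
 qed (use bconv_meas[OF a] in auto)
qed

text \<open>The bound is (1 + C/n)^n <= e^C. Convergence goes through n * Ln(1 + f/n), which differs
  from f by at most 2 * C^2 / n.\<close>

lemma bconv_power_exp:
 assumes a: "bconv M f g"
 shows "bconv M (%n x. (1 + f n x / of_nat n) ^ n) (%x. exp (g x))"
proof -
 obtain C where C: "C > 0" "eventually (%n. \<forall>x. cmod (f n x) \<le> C) sequentially" using a by (metis bconvE)
 show ?thesis
 proof (rule bconvI)
  show "eventually (%n. \<forall>x. cmod ((1 + f n x / of_nat n) ^ n) \<le> exp C) sequentially"
   using C(2) eventually_gt_at_top[of 0]
  proof eventually_elim
   case (elim n)
   show ?case
   proof
    fix x
    have "cmod (1 + f n x / of_nat n) \<le> 1 + cmod (f n x / of_nat n)"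
     using norm_triangle_ineq[of 1 "f n x / of_nat n"] by simp
    also have "\<dots> \<le> 1 + C / real n"
     using elim by (simp add: norm_divide divide_right_mono)
    also have "\<dots> \<le> exp (C / real n)" by (rule exp_ge_add_one_self)
    finally have "cmod (1 + f n x / of_nat n) ^ n \<le> exp (C / real n) ^ n" by (intro power_mono) auto
    also have "\<dots> = exp C" using elim by (simp add: exp_of_nat_mult[symmetric])
    finally show "cmod ((1 + f n x / of_nat n) ^ n) \<le> exp C" by (simp add: norm_power)
   qed
  qed
  fix x
  let ?z = "%n. f n x / of_nat n"
  have small: "eventually (%n. cmod (?z n) \<le> C / real n \<and> C / real n \<le> 1 / 2 \<and> n > 0) sequentially"
  proof -
   have "eventually (%n. n > 0 \<and> 2 * C \<le> real n) sequentially"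
    using eventually_conj[OF eventually_gt_at_top[of 0] eventually_ge_at_top[of "nat \<lceil>2 * C\<rceil>"]]
    by (rule eventually_mono) linarith
   with C(2) show ?thesis
   proof eventually_elim
    case (elim n)
    have "cmod (?z n) \<le> C / real n"
     using elim by (auto simp: norm_divide divide_right_mono)
    moreover have "C / real n \<le> 1 / 2" using elim by (simp add: divide_simps)
    ultimately show ?case using elim(2) by blast
   qed
  qed
  have "(%n. of_nat n * Ln (1 + ?z n) - f n x) \<longlonglongrightarrow> 0"
  proof (rule Lim_null_comparison)
   show "eventually (%n. norm (of_nat n * Ln (1 + ?z n) - f n x) \<le> 2 * C ^ 2 / real n) sequentially"
    using small
   proof eventually_elim
    case (elim n)
    then have z: "cmod (?z n) \<le> 1/2" by linarith
    have "of_nat n * Ln (1 + ?z n) - f n x = of_nat n * (Ln (1 + ?z n) - ?z n)"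
     using elim by (simp add: field_simps)
    then have "norm (of_nat n * Ln (1 + ?z n) - f n x) = real n * cmod (Ln (1 + ?z n) - ?z n)"
     by (simp add: norm_mult)
    also have "\<dots> \<le> real n * (cmod (?z n) ^ 2 / (1 - cmod (?z n)))"
     using z by (intro mult_left_mono Ln_approx_linear) auto
    also have "\<dots> \<le> real n * ((C / real n) ^ 2 / (1 / 2))"
     using z conjunct1[OF elim] norm_ge_zero[of "?z n"] by (intro mult_left_mono frac_le power_mono zero_le_power2) linarith+
    also have "\<dots> = 2 * C ^ 2 / real n" using elim by (simp add: power2_eq_square)
    finally show ?case .
   qed
   show "(%n. 2 * C ^ 2 / real n) \<longlonglongrightarrow> 0"
    by (rule tendsto_divide_0[OF tendsto_const]) (rule filterlim_at_top_imp_at_infinity[OF filterlim_real_sequentially])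
  qed
  from tendsto_exp[OF tendsto_add[OF this bconv_lim[OF a, of x]]]
  have "(%n. exp (of_nat n * Ln (1 + ?z n))) \<longlonglongrightarrow> exp (g x)" by simp
  moreover have "eventually (%n. exp (of_nat n * Ln (1 + ?z n)) = (1 + ?z n) ^ n) sequentially"
   using small
  proof eventually_elim
   case (elim n)
   then have "cmod (?z n) \<le> 1/2" by linarith
   then have "?z n \<noteq> - 1"
    by (intro notI) simp
   then have "1 + ?z n \<noteq> 0" by (simp add: add_eq_0_iff)
   then show ?case by (simp add: exp_of_nat_mult)
  qed
  ultimately show "(%n. (1 + ?z n) ^ n) \<longlonglongrightarrow> exp (g x)" by (rule Lim_transform_eventually)
 qed (use bconv_meas[OF a] in auto)
qed

subsection \<open>Averages over circles\<close>

definition U01 :: "real measure" where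
 "U01 = density lborel (%x. ennreal (indicator {0..1} x))"

text \<open>Together with the uniform law \<open>U01\<close> this turns contour integrals into
  expectations: (1/(2 pi i)) times the integral of g(z) dz is the average of g(z) * z.\<close>

definition cir :: "real => real => complex" where
 "cir r \<theta> = of_real r * exp (2 * of_real pi * \<i> * of_real \<theta>)"

lemma sets_U01 [measurable_cong, simp]: "sets U01 = sets borel"
 by (simp add: U01_def)

lemma space_U01 [simp]: "space U01 = UNIV"
 by (simp add: U01_def)

lemma prob_U01: "prob_space U01"
 by (rule prob_spaceI) (simp add: U01_def emeasure_density ennreal_indicator)

lemma norm_cir [simp]: "cmod (cir r \<theta>) = \<bar>r\<bar>"
 by (simp add: cir_def norm_mult)

lemma cir_nonzero: "0 < r ==> cir r \<theta> \<noteq> 0"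
 by (simp add: cir_def)

lemma measurable_cir [measurable]: "cir r \<in> borel_measurable borel"
 unfolding cir_def by measurable

lemma integral_U01:
 fixes f :: "real => complex"
 assumes "continuous_on {0..1} f" "f \<in> borel_measurable borel"
 shows "integral\<^sup>L U01 f = integral {0..1} f"
proof -
 have "integral\<^sup>L U01 f = (LINT x:{0..1}|lborel. f x)"
  unfolding U01_def set_lebesgue_integral_def using assms by (subst integral_density) auto
 also have "\<dots> = integral {0..1} f"
  by (rule set_borel_integral_eq_integral(2), unfold set_integrable_def, rule borel_integrable_compact)
   (use assms in auto)
 finally show ?thesis .
qed

lemma cir_circlepath: "cir r \<theta> = circlepath 0 r \<theta>"
 by (simp add: cir_def circlepath)

lemma cir_avg_contour:
 assumes c: "(g has_contour_integral I) (circlepath 0 r)" and r: "r > 0" and g: "continuous_on (sphere 0 r) g"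
 shows "integral\<^sup>L U01 (%\<theta>. g (cir r \<theta>) * cir r \<theta>) = I / (2 * of_real pi * \<i>)"
proof -
 have cc: "continuous_on UNIV (%\<theta>. g (cir r \<theta>) * cir r \<theta>)"
  by (intro continuous_on_mult continuous_on_compose2[OF g])
   (use r in \<open>auto simp: cir_def norm_mult intro!: continuous_intros\<close>)
 then have "integral\<^sup>L U01 (%\<theta>. g (cir r \<theta>) * cir r \<theta>) = integral {0..1} (%\<theta>. g (cir r \<theta>) * cir r \<theta>)"
  by (intro integral_U01 borel_measurable_continuous_onI) (auto intro: continuous_on_subset)
 also have "\<dots> = I / (2 * of_real pi * \<i>)"
 proof (rule integral_unique)
  have "((%x. g (circlepath 0 r x) * (2 * pi * \<i> * r * exp (2 * of_real pi * \<i> * x))) has_integral I) {0..1}"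
   using c by (simp add: has_contour_integral vector_derivative_circlepath)
  then have "((%x. g (circlepath 0 r x) * (2 * pi * \<i> * r * exp (2 * of_real pi * \<i> * x)) / (2 * of_real pi * \<i>)) has_integral I / (2 * of_real pi * \<i>)) {0..1}"
   by (rule has_integral_divide)
  then show "((%\<theta>. g (cir r \<theta>) * cir r \<theta>) has_integral I / (2 * of_real pi * \<i>)) {0..1}"
   by (rule has_integral_eq[rotated]) (simp add: cir_circlepath circlepath mult_ac)
 qed
 finally show ?thesis .
qed

lemma cir_avg_cauchy:
 assumes f: "f holomorphic_on ball 0 R" and r: "0 < r" "r < R" and w: "cmod w < r"
 shows "integral\<^sup>L U01 (%\<theta>. f (cir r \<theta>) * cir r \<theta> / (cir r \<theta> - w)) = f w"
proof -
 have f': "f holomorphic_on cball 0 r" using f by (rule holomorphic_on_subset) (use r in auto)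
 have "integral\<^sup>L U01 (%\<theta>. f (cir r \<theta>) / (cir r \<theta> - w) * cir r \<theta>) = 2 * of_real pi * \<i> * f w / (2 * of_real pi * \<i>)"
 proof (rule cir_avg_contour)
  show "((%u. f u / (u - w)) has_contour_integral 2 * of_real pi * \<i> * f w) (circlepath 0 r)"
   using f' w by (intro Cauchy_integral_circlepath_simple) auto
  show "continuous_on (sphere 0 r) (%u. f u / (u - w))"
   using w by (intro continuous_intros holomorphic_on_imp_continuous_on holomorphic_on_subset[OF f']) auto
 qed (use r in auto)
 then show ?thesis by simp
qed

lemma cir_avg_mean:
 assumes f: "f holomorphic_on ball 0 R" and r: "0 < r" "r < R"
 shows "integral\<^sup>L U01 (%\<theta>. f (cir r \<theta>)) = f 0"
proof -
 have "cir r \<theta> \<noteq> 0" for \<theta> by (rule cir_nonzero[OF r(1)])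
 then show ?thesis using cir_avg_cauchy[OF f r, of 0] r by simp
qed

lemma cir_avg_deriv:
 assumes f: "f holomorphic_on ball 0 R" and r: "0 < r" "r < R"
 shows "integral\<^sup>L U01 (%\<theta>. f (cir r \<theta>) / cir r \<theta> ^ k) = (deriv ^^ k) f 0 / fact k"
proof -
 have f': "f holomorphic_on cball 0 r" using f by (rule holomorphic_on_subset) (use r in auto)
 have nz: "cir r \<theta> \<noteq> 0" for \<theta> by (rule cir_nonzero[OF r(1)])
 have "integral\<^sup>L U01 (%\<theta>. f (cir r \<theta>) / cir r \<theta> ^ Suc k * cir r \<theta>)
   = 2 * pi * \<i> / fact k * (deriv ^^ k) f 0 / (2 * of_real pi * \<i>)"
 proof (rule cir_avg_contour)
  show "((%u. f u / u ^ Suc k) has_contour_integral 2 * pi * \<i> / fact k * (deriv ^^ k) f 0) (circlepath 0 r)"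
   using Cauchy_has_contour_integral_higher_derivative_circlepath[of 0 r f 0 k] r
    holomorphic_on_imp_continuous_on[OF f'] holomorphic_on_subset[OF f' ball_subset_cball] by simp
  show "continuous_on (sphere 0 r) (%u. f u / u ^ Suc k)"
   using r by (intro continuous_intros holomorphic_on_imp_continuous_on holomorphic_on_subset[OF f']) auto
 qed (use r in auto)
 then show ?thesis using nz by simp
qed

lemma partial_fractions:
 fixes u :: "nat => complex"
 assumes "finite J" "J \<noteq> {}" "inj_on u J" "\<And>j. j \<in> J ==> z \<noteq> u j"
 shows "1 / (\<Prod>j\<in>J. z - u j) = (\<Sum>i\<in>J. 1 / ((z - u i) * (\<Prod>j\<in>J - {i}. u i - u j)))"
 using assms
proof (induction J arbitrary: z rule: finite_ne_induct)
 case (insert k J)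
 have inj: "inj_on u J" and nk: "\<And>i. i \<in> J ==> u i \<noteq> u k" "\<And>i. i \<in> J ==> u k \<noteq> u i"
  using insert by (auto simp: inj_on_def)
 define p where "p i = (\<Prod>j\<in>J - {i}. u i - u j)" for i
 have p0: "p i \<noteq> 0" if "i \<in> J" for i
  unfolding p_def using insert.hyps(1) inj that by (auto simp: inj_on_def)
 have pk: "(\<Prod>j\<in>insert k J - {i}. u i - u j) = (u i - u k) * p i" if "i \<in> J" for i
 proof -
  have "insert k J - {i} = insert k (J - {i})" using that insert by auto
  then show ?thesis using insert unfolding p_def by simp
 qed
 have kk: "insert k J - {k} = J" using insert by auto
 have "1 / (\<Prod>j\<in>insert k J. z - u j) = 1 / (z - u k) * (1 / (\<Prod>j\<in>J. z - u j))"
  using insert.hyps by simp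
 also have "1 / (\<Prod>j\<in>J. z - u j) = (\<Sum>i\<in>J. 1 / ((z - u i) * p i))"
  unfolding p_def using insert inj by (intro insert.IH) auto
 also have "1 / (z - u k) * \<dots> = (\<Sum>i\<in>J. 1 / ((z - u i) * ((u i - u k) * p i)) + 1 / (z - u k) * (1 / ((u k - u i) * p i)))"
  unfolding sum_distrib_left
 proof (rule sum.cong[OF refl])
  fix i assume i: "i \<in> J"
  have "z - u k \<noteq> 0" "z - u i \<noteq> 0" "u i - u k \<noteq> 0" "u k - u i \<noteq> 0" "p i \<noteq> 0"
   using insert.prems i nk[OF i] p0[OF i] by auto
  then show "1 / (z - u k) * (1 / ((z - u i) * p i)) =
   1 / ((z - u i) * ((u i - u k) * p i)) + 1 / (z - u k) * (1 / ((u k - u i) * p i))"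
   by (simp add: divide_simps) (simp add: algebra_simps)
 qed
 also have "\<dots> = (\<Sum>i\<in>J. 1 / ((z - u i) * ((u i - u k) * p i))) + 1 / (z - u k) * (\<Sum>i\<in>J. 1 / ((u k - u i) * p i))"
  by (simp add: sum.distrib sum_distrib_left)
 also have "(\<Sum>i\<in>J. 1 / ((u k - u i) * p i)) = 1 / (\<Prod>j\<in>J. u k - u j)"
  unfolding p_def using insert inj nk by (intro insert.IH[symmetric]) auto
 also have "(\<Sum>i\<in>J. 1 / ((z - u i) * ((u i - u k) * p i))) + 1 / (z - u k) * (1 / (\<Prod>j\<in>J. u k - u j))
  = (\<Sum>i\<in>insert k J. 1 / ((z - u i) * (\<Prod>j\<in>insert k J - {i}. u i - u j)))"
  using insert pk kk by simp
 finally show ?case .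
qed simp

text \<open>The right side is the kind of sum produced by \<open>Dq\<close>, with a pole at each
  coincidence of the u_i; on the left the u_i enter only through factors that do not vanish on the
  circle. Partial fractions reduce it to Cauchy's formula.\<close>

lemma cir_avg_residues:
 fixes u :: "nat => complex"
 assumes f: "f holomorphic_on ball 0 R" and r: "0 < r" "r < R" and N: "N > 0"
  and u: "\<And>i. i < N ==> cmod (u i) < r" "inj_on u {..<N}"
 shows "integral\<^sup>L U01 (%\<theta>. f (cir r \<theta>) * cir r \<theta> / (\<Prod>j<N. cir r \<theta> - u j))
   = (\<Sum>i<N. f (u i) / (\<Prod>j\<in>{..<N} - {i}. u i - u j))"
proof -
 have ne: "cir r \<theta> \<noteq> u j" if "j < N" for \<theta> j
 proof
  assume e: "cir r \<theta> = u j"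
  have "cmod (u j) = \<bar>r\<bar>" unfolding e[symmetric] by (rule norm_cir)
  then show False using u(1)[OF that] r by simp
 qed
 have f': "f holomorphic_on cball 0 r" using f by (rule holomorphic_on_subset) (use r in auto)
 have int: "integrable U01 (%\<theta>. f (cir r \<theta>) * cir r \<theta> / (cir r \<theta> - u i))" if i: "i < N" for i
 proof -
  have c: "continuous_on UNIV (%\<theta>. f (cir r \<theta>) * cir r \<theta> / (cir r \<theta> - u i))"
   using ne[OF i] r
   by (intro continuous_intros continuous_on_compose2[OF holomorphic_on_imp_continuous_on[OF f']])
    (auto simp: cir_def norm_mult intro!: continuous_intros)
  have "set_integrable lborel {0..1} (%\<theta>. f (cir r \<theta>) * cir r \<theta> / (cir r \<theta> - u i))"
   unfolding set_integrable_def
   by (rule borel_integrable_compact) (use c in \<open>auto intro: continuous_on_subset\<close>)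
  then show ?thesis
   unfolding U01_def set_integrable_def
   by (subst integrable_density) (auto intro!: borel_measurable_continuous_onI[OF c])
 qed
 have "integral\<^sup>L U01 (%\<theta>. f (cir r \<theta>) * cir r \<theta> / (\<Prod>j<N. cir r \<theta> - u j))
  = integral\<^sup>L U01 (%\<theta>. \<Sum>i<N. f (cir r \<theta>) * cir r \<theta> / (cir r \<theta> - u i) / (\<Prod>j\<in>{..<N} - {i}. u i - u j))"
 proof (rule Bochner_Integration.integral_cong[OF refl])
  fix \<theta>
  have "f (cir r \<theta>) * cir r \<theta> / (\<Prod>j<N. cir r \<theta> - u j) = f (cir r \<theta>) * cir r \<theta> * (1 / (\<Prod>j<N. cir r \<theta> - u j))"
   by simp
  also have "1 / (\<Prod>j<N. cir r \<theta> - u j) = (\<Sum>i<N. 1 / ((cir r \<theta> - u i) * (\<Prod>j\<in>{..<N} - {i}. u i - u j)))"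
   using N u(2) ne by (intro partial_fractions) auto
  finally show "f (cir r \<theta>) * cir r \<theta> / (\<Prod>j<N. cir r \<theta> - u j)
   = (\<Sum>i<N. f (cir r \<theta>) * cir r \<theta> / (cir r \<theta> - u i) / (\<Prod>j\<in>{..<N} - {i}. u i - u j))"
   by (simp add: sum_distrib_left)
 qed
 also have "\<dots> = (\<Sum>i<N. integral\<^sup>L U01 (%\<theta>. f (cir r \<theta>) * cir r \<theta> / (cir r \<theta> - u i) / (\<Prod>j\<in>{..<N} - {i}. u i - u j)))"
  using int by (intro Bochner_Integration.integral_sum integrable_divide_zero) auto
 also have "\<dots> = (\<Sum>i<N. f (u i) / (\<Prod>j\<in>{..<N} - {i}. u i - u j))"
  using u(1) by (intro sum.cong refl) (subst integral_divide_zero, subst cir_avg_cauchy[OF f r], auto)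
 finally show ?thesis .
qed

subsection \<open>Product measures of angles\<close>

interpretation U01: prob_space U01 by (rule prob_U01)

interpretation PU: product_sigma_finite "%_ :: nat \<times> bool. U01" by unfold_locales

text \<open>Each operator a owns two independent angles: (a, True) for its contour variable v_a and
  (a, False) for the auxiliary variable t_a. One further index carries the angle of h.\<close>

definition PU :: "(nat \<times> bool) set => (nat \<times> bool => real) measure" where
 "PU I = PiM I (%_. U01)"

lemma prob_PU: "prob_space (PU I)"
 unfolding PU_def by (intro prob_space_PiM prob_U01)

lemma finite_measure_PU: "finite_measure (PU I)"
 using prob_PU by (rule prob_space.finite_measure)

lemma bmeas_PU_integrable: "bmeas (PU I) f ==> integrable (PU I) f"
 by (rule bmeas_integrable[OF finite_measure_PU])

lemma PU_coord: "i \<in> I ==> (%om. om i) \<in> borel_measurable (PU I)"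
 using measurable_component_singleton[of i I "%_. U01"] by (simp add: PU_def measurable_def)

lemma bmeas_cir: "i \<in> I ==> bmeas (PU I) (%om. cir r (om i))"
 by (rule bmeasI[where C = "\<bar>r\<bar>"]) (auto intro!: measurable_compose[OF PU_coord measurable_cir])

lemma PU_insert:
 assumes "finite I" "i \<notin> I" "bmeas (PU (insert i I)) f"
 shows "integral\<^sup>L (PU (insert i I)) f = integral\<^sup>L (PU I) (%om. integral\<^sup>L U01 (%\<theta>. f (fun_upd om i \<theta>)))"
 using PU.product_integral_insert[OF assms(1,2), of f] bmeas_PU_integrable[OF assms(3)]
 by (simp add: PU_def)

lemma PU_fold:
 assumes "finite I" "finite J" "I \<inter> J = {}" "bmeas (PU (I \<union> J)) f"
 shows "integral\<^sup>L (PU (I \<union> J)) f = integral\<^sup>L (PU I) (%om. integral\<^sup>L (PU J) (%om'. f (merge I J (om, om'))))"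
 using PU.product_integral_fold[OF assms(3,1,2), of f] bmeas_PU_integrable[OF assms(4)]
 by (simp add: PU_def)

text \<open>Independence of disjoint blocks of angles. The hypothesis \<open>dep\<close> lets a
  factor on a block be read as a function on any larger index set.\<close>

lemma PU_factor:
 assumes "finite H" "\<And>T. T \<in> H ==> finite T" "\<And>S T. S \<in> H ==> T \<in> H ==> S \<noteq> T ==> S \<inter> T = {}"
  and dep: "\<And>T om om'. T \<in> H ==> (\<And>i. i \<in> T ==> om i = om' i) ==> f T om = f T om'"
  and bm: "\<And>T. T \<in> H ==> bmeas (PU T) (f T)"
 shows "bmeas (PU (\<Union>H)) (%om. \<Prod>T\<in>H. f T om) \<and>
  integral\<^sup>L (PU (\<Union>H)) (%om. \<Prod>T\<in>H. f T om) = (\<Prod>T\<in>H. integral\<^sup>L (PU T) (f T))"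
 using assms
proof (induction H rule: finite_induct)
 case empty
 interpret prob_space "PU {}" by (rule prob_PU)
 show ?case by (simp add: prob_space)
next
 case (insert T H)
 have sub: "bmeas (PU I) (f S)" if "S \<in> insert T H" "S \<subseteq> I" for S I
 proof -
  have "(%om. restrict om S) \<in> measurable (PU I) (PU S)"
   unfolding PU_def by (rule measurable_restrict_subset[OF that(2)])
  then have "bmeas (PU I) (%om. f S (restrict om S))" by (rule bmeas_comp[OF insert.prems(4)[OF that(1)]])
  moreover have "f S (restrict om S) = f S om" for om
   by (rule insert.prems(3)[OF that(1)]) auto
  ultimately show ?thesis by simp
 qed
 have IH: "integral\<^sup>L (PU (\<Union>H)) (%om. \<Prod>T\<in>H. f T om) = (\<Prod>T\<in>H. integral\<^sup>L (PU T) (f T))"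
 proof (rule insert.IH[THEN conjunct2])
  show "finite S" if "S \<in> H" for S using insert.prems(1) that by blast
  show "S \<inter> S' = {}" if "S \<in> H" "S' \<in> H" "S \<noteq> S'" for S S'
   using insert.prems(2)[of S S'] that by blast
  show "f S om = f S om'" if "S \<in> H" "\<And>i. i \<in> S ==> om i = om' i" for S om om'
   using insert.prems(3)[of S om om'] that by simp
  show "bmeas (PU S) (f S)" if "S \<in> H" for S using insert.prems(4) that by blast
 qed
 have bm: "bmeas (PU (T \<union> \<Union>H)) (%om. f T om * (\<Prod>T\<in>H. f T om))"
  by (intro bconv_mult bconv_prod sub) auto
 have disj: "T \<inter> \<Union>H = {}"
 proof -
  have "T \<inter> S = {}" if "S \<in> H" for S
   using insert.prems(2)[of T S] insert.hyps(2) that by (cases "T = S") auto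
  then show ?thesis by blast
 qed
 have fin: "finite T" "finite (\<Union>H)"
  using insert.hyps(1) insert.prems(1) by auto
 have "integral\<^sup>L (PU (T \<union> \<Union>H)) (%om. f T om * (\<Prod>T\<in>H. f T om))
  = integral\<^sup>L (PU T) (%om. integral\<^sup>L (PU (\<Union>H)) (%om'. f T (merge T (\<Union>H) (om, om')) * (\<Prod>S\<in>H. f S (merge T (\<Union>H) (om, om')))))"
  by (rule PU_fold[OF fin disj bm])
 also have "\<dots> = integral\<^sup>L (PU T) (%om. integral\<^sup>L (PU (\<Union>H)) (%om'. f T om * (\<Prod>S\<in>H. f S om')))"
 proof -
  have "f T (merge T (\<Union>H) (om, om')) = f T om" for om om'
   by (rule insert.prems(3)) (auto simp: merge_def)
  moreover have "f S (merge T (\<Union>H) (om, om')) = f S om'" if "S \<in> H" for S om om'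
   using that disj by (intro insert.prems(3)) (auto simp: merge_def)
  ultimately show ?thesis by simp
 qed
 also have "\<dots> = integral\<^sup>L (PU T) (f T) * integral\<^sup>L (PU (\<Union>H)) (%om. \<Prod>S\<in>H. f S om)"
  by simp
 finally show ?case using insert.hyps IH bm by simp
qed

section \<open>The integrand attached to a family of operators\<close>

text \<open>With P the power sums this is a symmetric polynomial. Set partitions, rather than
  integer partitions, index it because the coefficients will come from Moebius inversion over index
  lists.\<close>

definition lpoly :: "nat set set set => (nat set set => complex) => (nat => complex) => complex" where
 "lpoly Ps E P = (\<Sum>\<pi>\<in>Ps. E \<pi> * (\<Prod>B\<in>\<pi>. P (card B)))"

text \<open>The dilation of x by exp t, written in the coordinate v = x - 1.\<close>

definition shw :: "complex => complex => complex" where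
 "shw t v = exp t * (1 + v) - 1"

text \<open>The change of the n-th power sum in x - 1 caused by one dilation.\<close>

definition gch :: "complex => complex => nat => complex" where
 "gch t v n = shw t v ^ n - v ^ n"

text \<open>A cross ratio of the two contour variables and their dilated images, the factor through
  which two operators interact. It equals 1 if either dilation is trivial.\<close>

definition crs :: "complex => complex => complex => complex => complex" where
 "crs t v t' v' = (shw t v - shw t' v') * (v - v') / ((v - shw t' v') * (shw t v - v'))"

definition psum :: "nat => (nat => complex) => nat => complex" where
 "psum N x n = (\<Sum>j<N. (x j - 1) ^ n)"

text \<open>The part of the integrand that still depends on the evaluation point x;
  \<open>WC\<close> is the part that depends on the contour variables alone.\<close>

definition WX where
 "WX N Ps E A t v x = (\<Prod>a\<in>A. \<Prod>j<N. (shw (t a) (v a) - (x j - 1)) / (v a - (x j - 1))) *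
  exp (lpoly Ps E (%n. psum N x n + (\<Sum>a\<in>A. gch (t a) (v a) n)))" for A :: "nat set"

definition WC where
 "WC A t v = (\<Prod>a\<in>A. v a / ((exp (t a) - 1) * (1 + v a))) *
  (\<Prod>a\<in>A. \<Prod>b\<in>{b\<in>A. a < b}. crs (t a) (v a) (t b) (v b))" for A :: "nat set"

lemma shw_diff: "shw t v - v = (exp t - 1) * (1 + v)"
 by (simp add: shw_def algebra_simps)

lemma holomorphic_lpoly:
 "(\<And>n. (%z. G z n) holomorphic_on S) ==> (%z. lpoly Ps E (G z)) holomorphic_on S"
 unfolding lpoly_def by (intro holomorphic_intros)

lemma bconv_lpoly:
 assumes "\<And>n. bconv M (%k x. G k x n) (%x. H x n)" "\<And>\<pi>. \<pi> \<in> Ps ==> (%k. E k \<pi>) \<longlonglongrightarrow> E' \<pi>"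
 shows "bconv M (%k x. lpoly Ps (E k) (G k x)) (%x. lpoly Ps E' (H x))"
 unfolding lpoly_def by (intro bconv_sum bconv_mult bconv_prod bconv_const assms)

lemma bmeas_shw: "bmeas M t ==> bmeas M v ==> bmeas M (%x. shw (t x) (v x))"
 unfolding shw_def by (intro bconv_diff bconv_mult bconv_add bconv_exp bmeas_const)

lemma bmeas_gch: "bmeas M t ==> bmeas M v ==> bmeas M (%x. gch (t x) (v x) n)"
 unfolding gch_def by (intro bconv_diff bconv_power bmeas_shw)

lemma bmeas_psum: "(\<And>j. j < N ==> bmeas M (%om. x om j)) ==> bmeas M (%om. psum N (x om) n)"
 unfolding psum_def by (intro bconv_sum bconv_power bconv_diff bmeas_const) auto

lemma bmeas_crs:
 assumes "bmeas M t" "bmeas M v" "bmeas M t'" "bmeas M v'" "c > 0"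
  "\<And>om. c \<le> cmod (v om - shw (t' om) (v' om))" "\<And>om. c \<le> cmod (shw (t om) (v om) - v' om)"
 shows "bmeas M (%om. crs (t om) (v om) (t' om) (v' om))"
 unfolding crs_def
proof (rule bmeas_divide)
 show "0 < c * c" using assms by simp
 show "c * c \<le> cmod ((v om - shw (t' om) (v' om)) * (shw (t om) (v om) - v' om))" for om
  unfolding norm_mult using assms(5-7) by (intro mult_mono) auto
qed (intro bconv_mult bconv_diff bmeas_shw assms)+

lemma bmeas_WX:
 assumes A: "finite A" and t: "\<And>a. a \<in> A ==> bmeas M (%om. t om a)" and v: "\<And>a. a \<in> A ==> bmeas M (%om. v om a)"
  and x: "\<And>j. j < N ==> bmeas M (%om. x om j)" and c: "c > 0"
  and low: "\<And>a j om. a \<in> A ==> j < N ==> c \<le> cmod (v om a - (x om j - 1))"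
 shows "bmeas M (%om. WX N Ps E A (t om) (v om) (x om))"
 unfolding WX_def
 by (intro bconv_mult bconv_prod bmeas_divide[OF _ _ c] bconv_diff bmeas_shw t v x bmeas_const bconv_exp
    bconv_lpoly bconv_add bmeas_psum bconv_sum bmeas_gch low tendsto_const) auto

lemma bmeas_WC:
 assumes A: "finite A" and t: "\<And>a. a \<in> A ==> bmeas M (%om. t om a)" and v: "\<And>a. a \<in> A ==> bmeas M (%om. v om a)"
  and c: "c > 0"
  and low: "\<And>a om. a \<in> A ==> c \<le> cmod ((exp (t om a) - 1) * (1 + v om a))"
  and low1: "\<And>a b om. a \<in> A ==> b \<in> A ==> a < b ==> c \<le> cmod (v om a - shw (t om b) (v om b))"
  and low2: "\<And>a b om. a \<in> A ==> b \<in> A ==> a < b ==> c \<le> cmod (shw (t om a) (v om a) - v om b)"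
 shows "bmeas M (%om. WC A (t om) (v om))"
 unfolding WC_def
proof (intro bconv_mult bconv_prod)
 fix a assume a: "a \<in> A"
 show "bmeas M (%om. v om a / ((exp (t om a) - 1) * (1 + v om a)))"
  using a by (intro bmeas_divide[OF _ _ c] bconv_mult bconv_diff bconv_add bconv_exp t v bmeas_const low)
 fix b assume "b \<in> {b \<in> A. a < b}"
 then show "bmeas M (%om. crs (t om a) (v om a) (t om b) (v om b))"
  using a by (intro bmeas_crs[OF _ _ _ _ c] t v low1 low2) auto
qed

fun Dqs :: "nat => complex list => ((nat => complex) => complex) => (nat => complex) => complex" where
 "Dqs N [] F = F"
| "Dqs N (q # qs) F = Dq N q (Dqs N qs F)"

lemma psum_upd:
 assumes "i < N"
 shows "psum N (x(i := y)) n = psum N x n + ((y - 1) ^ n - (x i - 1) ^ n)"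
proof -
 have "psum N z n = (z i - 1) ^ n + (\<Sum>j\<in>{..<N} - {i}. (z j - 1) ^ n)" for z
  unfolding psum_def using assms by (intro sum.remove) auto
 then show ?thesis by simp
qed

text \<open>Dilating x_i changes only the factors with j = i, each by a cross ratio, and moves the
  power sums by one more \<open>gch\<close>. The dilated coordinate thus behaves like a further
  contour variable located at x_i - 1.\<close>

lemma WX_shift:
 assumes i: "i < N" and A: "finite A"
  and nz: "\<And>a. a \<in> A ==> v a \<noteq> x i - 1" "\<And>a. a \<in> A ==> shw (t a) (v a) \<noteq> x i - 1"
 shows "WX N Ps E A t v (x(i := exp s * x i)) =
  (\<Prod>a\<in>A. crs s (x i - 1) (t a) (v a)) * (\<Prod>a\<in>A. \<Prod>j<N. (shw (t a) (v a) - (x j - 1)) / (v a - (x j - 1))) *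
  exp (lpoly Ps E (%n. psum N x n + (gch s (x i - 1) n + (\<Sum>a\<in>A. gch (t a) (v a) n))))"
proof -
 let ?y = "exp s * x i"
 have y: "shw s (x i - 1) = ?y - 1" by (simp add: shw_def)
 have "(\<Prod>j<N. (shw (t a) (v a) - ((x(i := ?y)) j - 1)) / (v a - ((x(i := ?y)) j - 1)))
  = crs s (x i - 1) (t a) (v a) * (\<Prod>j<N. (shw (t a) (v a) - (x j - 1)) / (v a - (x j - 1)))"
  if a: "a \<in> A" for a
 proof -
  let ?w = "shw (t a) (v a)"
  have rem: "(\<Prod>j<N. (?w - (z j - 1)) / (v a - (z j - 1)))
    = (?w - (z i - 1)) / (v a - (z i - 1)) * (\<Prod>j\<in>{..<N} - {i}. (?w - (z j - 1)) / (v a - (z j - 1)))" for z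
   using i by (intro prod.remove) auto
  have "(?w - (?y - 1)) / (v a - (?y - 1)) = crs s (x i - 1) (t a) (v a) * ((?w - (x i - 1)) / (v a - (x i - 1)))"
  proof -
   let ?u = "x i - 1"
   have n: "v a - ?u \<noteq> 0" "?w - ?u \<noteq> 0" "?u - v a \<noteq> 0" "?u - ?w \<noteq> 0" using nz[OF a] by auto
   have "crs s ?u (t a) (v a) = ((?y - 1) - ?w) * (?u - v a) / ((?u - ?w) * ((?y - 1) - v a))"
    by (simp only: crs_def y)
   also have "\<dots> = (- (?w - (?y - 1))) * (- (v a - ?u)) / ((- (?w - ?u)) * (- (v a - (?y - 1))))" by simp
   also have "\<dots> = (?w - (?y - 1)) * (v a - ?u) / ((?w - ?u) * (v a - (?y - 1)))"
    by (simp only: minus_mult_minus)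
   finally show ?thesis using n(1,2) by simp
  qed
  then show ?thesis
   by (subst (1 2) rem) simp
 qed
 then have "(\<Prod>a\<in>A. \<Prod>j<N. (shw (t a) (v a) - ((x(i := ?y)) j - 1)) / (v a - ((x(i := ?y)) j - 1)))
  = (\<Prod>a\<in>A. crs s (x i - 1) (t a) (v a)) * (\<Prod>a\<in>A. \<Prod>j<N. (shw (t a) (v a) - (x j - 1)) / (v a - (x j - 1)))"
  by (subst prod.distrib[symmetric]) (rule prod.cong, auto)
 moreover have "psum N (x(i := ?y)) n + (\<Sum>a\<in>A. gch (t a) (v a) n)
  = psum N x n + (gch s (x i - 1) n + (\<Sum>a\<in>A. gch (t a) (v a) n))" for n
  by (simp add: psum_upd[OF i] gch_def y)
 ultimately show ?thesis unfolding WX_def by (simp only:)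
qed

text \<open>The sum in \<open>Dq\<close> is a sum of residues at the points x_i - 1 and is replaced
  by a circle enclosing them. The conditions \<open>nz1\<close> and \<open>nz2\<close> keep the
  poles of the existing contours outside, and R <= 1 excludes z = -1.\<close>

lemma Dq_WX:
 assumes N: "N > 0" and A: "finite A" "c \<notin> A" and q: "exp (t c) \<noteq> 1" and rR: "0 < rc" "rc < R" "R \<le> 1"
  and x: "\<And>j. j < N ==> cmod (x j - 1) < rc" "inj_on x {..<N}"
  and nz1: "\<And>a z. a \<in> A ==> cmod z < R ==> z \<noteq> v a" "\<And>a z. a \<in> A ==> cmod z < R ==> z \<noteq> shw (t a) (v a)"
  and nz2: "\<And>a z. a \<in> A ==> cmod z < R ==> shw (t c) z \<noteq> v a"
 shows "Dq N (exp (t c)) (WX N Ps E A t v) x =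
  integral\<^sup>L U01 (%\<theta>. cir rc \<theta> / ((exp (t c) - 1) * (1 + cir rc \<theta>)) * (\<Prod>a\<in>A. crs (t c) (cir rc \<theta>) (t a) (v a)) *
    WX N Ps E (insert c A) t (v(c := cir rc \<theta>)) x)"
proof -
 let ?K = "\<Prod>a\<in>A. \<Prod>j<N. (shw (t a) (v a) - (x j - 1)) / (v a - (x j - 1))"
 let ?ex = "%z. exp (lpoly Ps E (%n. psum N x n + (gch (t c) z n + (\<Sum>a\<in>A. gch (t a) (v a) n))))"
 \<comment> \<open>At z = x_i - 1 the product over all j contains the extra factor j = i, namely
   exp(t_c) * x_i - x_i. The denominator (exp(t_c) - 1)(1 + z) removes exactly this factor.\<close>
 define \<Psi> where "\<Psi> z = (\<Prod>j<N. shw (t c) z - (x j - 1)) / ((exp (t c) - 1) * (1 + z)) *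
   ((\<Prod>a\<in>A. crs (t c) z (t a) (v a)) * ?K * ?ex z)" for z
 have one: "1 + z \<noteq> 0" if "cmod z < R" for z
 proof
  assume "1 + z = 0"
  then have "z = -1" by (simp add: add_eq_0_iff)
  then show False using that rR by simp
 qed
 have hol: "\<Psi> holomorphic_on ball 0 R"
  unfolding \<Psi>_def
 proof (intro holomorphic_intros holomorphic_lpoly)
  show "(%z. crs (t c) z (t a) (v a)) holomorphic_on ball 0 R" if "a \<in> A" for a
   unfolding crs_def shw_def[of "t c"]
   using nz1(2)[OF that] nz2[OF that, unfolded shw_def[of "t c"]]
   by (intro holomorphic_intros) auto
  show "(exp (t c) - 1) * (1 + z) \<noteq> 0" if "z \<in> ball 0 R" for z using that one q by simp
 qed (auto simp: shw_def gch_def intro!: holomorphic_intros)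
 have u: "inj_on (%j. x j - 1) {..<N}" using x(2) by (auto simp: inj_on_def)
 have "Dq N (exp (t c)) (WX N Ps E A t v) x = (\<Sum>i<N. \<Psi> (x i - 1) / (\<Prod>j\<in>{..<N} - {i}. (x i - 1) - (x j - 1)))"
  unfolding Dq_def
 proof (rule sum.cong[OF refl])
  fix i assume "i \<in> {..<N}"
  then have i: "i < N" by simp
  have ui: "cmod (x i - 1) < R" using x(1)[OF i] rR by simp
  have xi: "x i \<noteq> 0" using one[OF ui] by simp
  have w: "shw (t c) (x i - 1) = exp (t c) * x i - 1" by (simp add: shw_def)
  have "(\<Prod>j<N. shw (t c) (x i - 1) - (x j - 1)) = (exp (t c) * x i - x i) * (\<Prod>j\<in>{..<N} - {i}. exp (t c) * x i - x j)"
   using i by (subst prod.remove[of _ i]) (auto simp: w)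
  moreover have "(exp (t c) - 1) * (1 + (x i - 1)) = exp (t c) * x i - x i" by (simp add: algebra_simps)
  moreover have "exp (t c) * x i - x i \<noteq> 0" using q xi by auto
  ultimately have 1: "(\<Prod>j<N. shw (t c) (x i - 1) - (x j - 1)) / ((exp (t c) - 1) * (1 + (x i - 1)))
    = (\<Prod>j\<in>{..<N} - {i}. exp (t c) * x i - x j)" by simp
  have 2: "WX N Ps E A t v (x(i := exp (t c) * x i))
   = (\<Prod>a\<in>A. crs (t c) (x i - 1) (t a) (v a)) * ?K * ?ex (x i - 1)"
   by (rule WX_shift[OF i A(1)]) (use nz1 ui in metis)+
  show "(\<Prod>j\<in>{..<N} - {i}. (exp (t c) * x i - x j) / (x i - x j)) * WX N Ps E A t v (x(i := exp (t c) * x i))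
   = \<Psi> (x i - 1) / (\<Prod>j\<in>{..<N} - {i}. (x i - 1) - (x j - 1))"
   unfolding \<Psi>_def 1 2 by (simp add: prod_dividef)
 qed
 also have "\<dots> = integral\<^sup>L U01 (%\<theta>. \<Psi> (cir rc \<theta>) * cir rc \<theta> / (\<Prod>j<N. cir rc \<theta> - (x j - 1)))"
  by (rule cir_avg_residues[OF hol rR(1,2) N x(1) u, symmetric])
 also have "\<dots> = integral\<^sup>L U01 (%\<theta>. cir rc \<theta> / ((exp (t c) - 1) * (1 + cir rc \<theta>)) * (\<Prod>a\<in>A. crs (t c) (cir rc \<theta>) (t a) (v a)) *
    WX N Ps E (insert c A) t (v(c := cir rc \<theta>)) x)"
 proof (rule Bochner_Integration.integral_cong[OF refl])
  fix \<theta>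
  let ?z = "cir rc \<theta>"
  have pA: "(\<Prod>a\<in>A. h a ((v(c := ?z)) a)) = (\<Prod>a\<in>A. h a (v a))" for h :: "nat => complex => complex"
   using A by (intro prod.cong) auto
  have sA: "(\<Sum>a\<in>A. h a ((v(c := ?z)) a)) = (\<Sum>a\<in>A. h a (v a))" for h :: "nat => complex => complex"
   using A by (intro sum.cong) auto
  have "WX N Ps E (insert c A) t (v(c := ?z)) x
   = (\<Prod>j<N. (shw (t c) ?z - (x j - 1)) / (?z - (x j - 1))) * ?K * ?ex ?z"
   unfolding WX_def using A pA[of "%a z. \<Prod>j<N. (shw (t a) z - (x j - 1)) / (z - (x j - 1))"]
    sA[of "%a z. gch (t a) z n" for n] by simp
  then show "\<Psi> ?z * ?z / (\<Prod>j<N. ?z - (x j - 1)) = ?z / ((exp (t c) - 1) * (1 + ?z)) * (\<Prod>a\<in>A. crs (t c) ?z (t a) (v a)) *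
    WX N Ps E (insert c A) t (v(c := ?z)) x"
   unfolding \<Psi>_def by (simp add: prod_dividef mult_ac)
 qed
 finally show ?thesis .
qed

text \<open>Two quantities deteriorate when operators are iterated: by \<open>spread_shift\<close> a
  dilation costs 2 * eta of the gap between coordinates and as much of the distance to the
  circles.\<close>

definition spread :: "nat => real => real => (nat => complex) => bool" where
 "spread N \<gamma> B x \<longleftrightarrow> (\<forall>j<N. cmod (x j - 1) < B) \<and> (\<forall>i<N. \<forall>j<N. i \<noteq> j \<longrightarrow> \<gamma> \<le> cmod (x i - x j))"

lemma spread_shift:
 assumes x: "spread N \<gamma> B x" and q: "cmod (q - 1) \<le> \<eta>" and B: "B \<le> 1" and i: "i < N"
 shows "spread N (\<gamma> - 2 * \<eta>) (B + 2 * \<eta>) (x(i := q * x i))"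
proof -
 have \<eta>: "0 \<le> \<eta>" using q order_trans[OF norm_ge_zero] by blast
 have "cmod (x i) \<le> 2"
  using x i B norm_triangle_ineq[of "x i - 1" 1] unfolding spread_def by force
 then have d: "cmod (q * x i - x i) \<le> 2 * \<eta>"
  using mult_mono[OF q \<open>cmod (x i) \<le> 2\<close>] \<eta> norm_mult[of "q - 1" "x i"] by (simp add: algebra_simps)
 show ?thesis
  unfolding spread_def
 proof (intro conjI allI impI)
  fix j assume j: "j < N"
  show "cmod ((x(i := q * x i)) j - 1) < B + 2 * \<eta>"
  proof (cases "j = i")
   case True
   have "cmod (q * x i - 1) \<le> cmod (q * x i - x i) + cmod (x i - 1)"
    by (rule norm_diff_triangle_ineq[of "q * x i" "x i" "x i" 1, simplified])
   then show ?thesis using True x i d unfolding spread_def by force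
  next
   case False
   then show ?thesis using x j \<eta> unfolding spread_def by force
  qed
  fix k assume k: "k < N" "j \<noteq> k"
  have tri: "\<gamma> - 2 * \<eta> \<le> cmod (q * x i - x m)" if "m < N" "m \<noteq> i" for m
  proof -
   have "\<gamma> \<le> cmod (x i - x m)" using x i that unfolding spread_def by blast
   also have "\<dots> \<le> cmod (q * x i - x i) + cmod (q * x i - x m)"
    by (metis norm_minus_commute norm_diff_triangle_le order_refl)
   finally show ?thesis using d by linarith
  qed
  have far: "\<gamma> \<le> cmod (x j - x k)" using x j k unfolding spread_def by blast
  show "\<gamma> - 2 * \<eta> \<le> cmod ((x(i := q * x i)) j - (x(i := q * x i)) k)"
   using tri[of k] tri[of j] far j k \<eta> by (auto simp: norm_minus_commute)
 qed
qed

lemma spread_inj: "spread N \<gamma> B x ==> 0 < \<gamma> ==> inj_on x {..<N}"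
 unfolding spread_def inj_on_def by force

definition vv :: "(nat => real) => (nat \<times> bool => real) => nat => complex" where
 "vv r om a = cir (r a) (om (a, True))"

text \<open>Radii of the contours: consecutive circles are separated by more than the size
 of a shift, so that no pole of the interaction factors is crossed.\<close>

definition radii :: "nat set => real => (nat => real) => bool" where
 "radii A \<eta> r \<longleftrightarrow> \<eta> > 0 \<and> (\<forall>a\<in>A. 0 < r a \<and> r a + \<eta> \<le> 1) \<and> (\<forall>a\<in>A. \<forall>b\<in>A. a < b \<longrightarrow> r a + 4 * \<eta> \<le> r b)"

lemma radii_bounds:
 assumes "radii A \<eta> r" "a \<in> A" "cmod (exp t - 1) \<le> \<eta>" "cmod v = r a"
 shows "cmod (shw t v - v) \<le> 2 * \<eta>"
proof -
 have v: "cmod (1 + v) \<le> 2"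
  using assms norm_triangle_ineq[of 1 v] unfolding radii_def by force
 show ?thesis unfolding shw_diff norm_mult
  using mult_mono[OF assms(3) v] assms by (auto simp: radii_def)
qed

text \<open>A dilation moves a contour variable by at most 2 * eta, half of the distance between
  consecutive circles.\<close>

lemma radii_low:
 assumes r: "radii A \<eta> r" and ab: "a \<in> A" "b \<in> A" "a < b"
  and t: "cmod (exp t - 1) \<le> \<eta>" "cmod (exp t' - 1) \<le> \<eta>" and v: "cmod v = r a" "cmod v' = r b"
 shows "2 * \<eta> \<le> cmod (v - shw t' v')" "2 * \<eta> \<le> cmod (shw t v - v')"
proof -
 have g: "r a + 4 * \<eta> \<le> r b" using r ab unfolding radii_def by blast
 have "cmod v' - cmod v \<le> cmod (v - shw t' v') + cmod (shw t' v' - v')"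
  using norm_triangle_ineq4[of "v - shw t' v'" "v' - shw t' v'"] norm_triangle_ineq2[of v' v]
  by (simp add: norm_minus_commute)
 then show "2 * \<eta> \<le> cmod (v - shw t' v')" using radii_bounds[OF r ab(2) t(2) v(2)] g v by linarith
 have "cmod v' - cmod v \<le> cmod (shw t v - v') + cmod (shw t v - v)"
  using norm_triangle_ineq4[of "shw t v - v'" "shw t v - v"] norm_triangle_ineq2[of v' v]
  by (simp add: norm_minus_commute)
 then show "2 * \<eta> \<le> cmod (shw t v - v')" using radii_bounds[OF r ab(1) t(1) v(1)] g v by linarith
qed

lemma radii_mono: "radii A \<eta> r ==> B \<subseteq> A ==> radii B \<eta> r"
 unfolding radii_def by blast

lemma norm_one_plus: "cmod v = r ==> 1 - r \<le> cmod (1 + v)"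
 using norm_triangle_ineq2[of 1 "- v"] by simp

lemma bmeas_weight:
 assumes A: "finite A" and r: "radii A \<eta> r" and \<tau>: "\<tau> > 0"
  and t: "\<And>a. a \<in> A ==> bmeas M (%om. t om a)" "\<And>a om. a \<in> A ==> cmod (exp (t om a) - 1) \<le> \<eta>"
   "\<And>a om. a \<in> A ==> \<tau> \<le> cmod (exp (t om a) - 1)"
  and v: "\<And>a. a \<in> A ==> bmeas M (%om. v om a)" "\<And>a om. a \<in> A ==> cmod (v om a) = r a"
  and x: "\<And>j. j < N ==> bmeas M (%om. x om j)" "\<And>j om. j < N ==> cmod (x om j - 1) \<le> B"
   "\<And>a. a \<in> A ==> B < r a"
 shows "bmeas M (%om. WC A (t om) (v om) * WX N Ps E A (t om) (v om) (x om))"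
proof (rule bconv_mult)
 have \<eta>: "\<eta> > 0" using r by (simp add: radii_def)
 show "bmeas M (%om. WC A (t om) (v om))"
 proof (rule bmeas_WC[where c = "min (\<tau> * \<eta>) (2 * \<eta>)", OF A t(1) v(1)])
  show "0 < min (\<tau> * \<eta>) (2 * \<eta>)" using \<eta> \<tau> by simp
  show "min (\<tau> * \<eta>) (2 * \<eta>) \<le> cmod ((exp (t om a) - 1) * (1 + v om a))" if "a \<in> A" for a om
  proof -
   have "\<eta> \<le> cmod (1 + v om a)"
    using norm_one_plus[OF v(2)[OF that, of om]] r that unfolding radii_def by force
   then have "\<tau> * \<eta> \<le> cmod ((exp (t om a) - 1) * (1 + v om a))"
    unfolding norm_mult using t(3)[OF that] \<tau> \<eta> by (intro mult_mono) auto
   then show ?thesis by linarith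
  qed
  show "min (\<tau> * \<eta>) (2 * \<eta>) \<le> cmod (v om a - shw (t om b) (v om b))" if "a \<in> A" "b \<in> A" "a < b" for a b om
   using radii_low(1)[OF r that t(2)[OF that(1)] t(2)[OF that(2)] v(2)[OF that(1)] v(2)[OF that(2)]]
   by (simp add: min_le_iff_disj)
  show "min (\<tau> * \<eta>) (2 * \<eta>) \<le> cmod (shw (t om a) (v om a) - v om b)" if "a \<in> A" "b \<in> A" "a < b" for a b om
   using radii_low(2)[OF r that t(2)[OF that(1)] t(2)[OF that(2)] v(2)[OF that(1)] v(2)[OF that(2)]]
   by (simp add: min_le_iff_disj)
 qed
 define c where "c = Min (insert 1 ((%a. r a - B) ` A))"
 have c: "c > 0" "\<And>a. a \<in> A ==> c \<le> r a - B"
  unfolding c_def using A x(3) by (auto simp: Min_gr_iff)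
 show "bmeas M (%om. WX N Ps E A (t om) (v om) (x om))"
 proof (rule bmeas_WX[OF A t(1) v(1) x(1) c(1)])
  fix a j om assume aj: "a \<in> A" "j < N"
  show "c \<le> cmod (v om a - (x om j - 1))"
   using norm_triangle_ineq2[of "v om a" "x om j - 1"] v(2)[OF aj(1), of om] x(2)[OF aj(2), of om] c(2)[OF aj(1)] by linarith
 qed
qed

lemma bmeas_vv: "(a, True) \<in> I ==> bmeas (PU I) (%om. vv r om a)"
 unfolding vv_def by (rule bmeas_cir)

lemma WC_insert:
 assumes "finite A" "c \<notin> A" "\<And>a. a \<in> A ==> c < a"
 shows "WC (insert c A) t (v(c := z)) =
  z / ((exp (t c) - 1) * (1 + z)) * (\<Prod>a\<in>A. crs (t c) z (t a) (v a)) * WC A t v"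
proof -
 have 1: "{b \<in> insert c A. c < b} = A" using assms by auto
 have 2: "{b \<in> insert c A. a < b} = {b \<in> A. a < b}" if "a \<in> A" for a using assms(3)[OF that] by auto
 have 3: "(\<Prod>a\<in>A. h a ((v(c := z)) a)) = (\<Prod>a\<in>A. h a (v a))" for h :: "nat => complex => complex"
  using assms by (intro prod.cong) auto
 have 4: "(\<Prod>a\<in>A. \<Prod>b\<in>{b \<in> insert c A. a < b}. crs (t a) ((v(c := z)) a) (t b) ((v(c := z)) b))
   = (\<Prod>a\<in>A. \<Prod>b\<in>{b \<in> A. a < b}. crs (t a) (v a) (t b) (v b))"
 proof (rule prod.cong[OF refl])
  fix a assume a: "a \<in> A"
  show "(\<Prod>b\<in>{b \<in> insert c A. a < b}. crs (t a) ((v(c := z)) a) (t b) ((v(c := z)) b))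
   = (\<Prod>b\<in>{b \<in> A. a < b}. crs (t a) (v a) (t b) (v b))"
   unfolding 2[OF a] using assms(2) a by (intro prod.cong) auto
 qed
 show ?thesis
  unfolding WC_def using assms(1,2) 4 1
   3[of "%a z. z / ((exp (t a) - 1) * (1 + z))"] 3[of "%a z'. crs (t c) z (t a) z'"]
  by (simp del: fun_upd_apply) (simp add: mult_ac)
qed

text \<open>The head of the list is the outermost operator and gets the innermost circle. The
  formula for the tail is needed at points already shifted by the head, and these must still lie
  inside the circles of the tail; the gap 4 * eta between radii pays for the displacement.\<close>

lemma nested_formula:
 assumes N: "N > 0" and sorted: "sorted_wrt (<) as" and r: "radii (set as) \<eta> r"
  and t: "\<And>a. a \<in> set as ==> exp (t a) \<noteq> 1" "\<And>a. a \<in> set as ==> cmod (exp (t a) - 1) \<le> \<eta>"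
  and x: "spread N \<gamma> B x" "2 * \<eta> * real (length as) < \<gamma>" "\<And>a. a \<in> set as ==> B \<le> r a"
 shows "Dqs N (map (%a. exp (t a)) as) (%x. exp (lpoly Ps E (psum N x))) x =
  integral\<^sup>L (PU (set as \<times> {True})) (%om. WC (set as) t (vv r om) * WX N Ps E (set as) t (vv r om) x)"
 using sorted r t x
proof (induction as arbitrary: x \<gamma> B)
 case Nil
 interpret prob_space "PU {}" by (rule prob_PU)
 show ?case by (simp add: WC_def WX_def prob_space)
next
 case (Cons c as)
 define A where "A = set as"
 have A: "finite A" "c \<notin> A" "\<And>a. a \<in> A ==> c < a" using Cons.prems(1) by (auto simp: A_def)
 have rA: "radii A \<eta> r" "radii (insert c A) \<eta> r"
  using Cons.prems(2) radii_mono[of "insert c A" \<eta> r A] by (auto simp: A_def)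
 have \<eta>: "\<eta> > 0" using rA by (simp add: radii_def)
 have rc: "0 < r c" "r c + \<eta> \<le> 1" "\<And>a. a \<in> A ==> r c + 4 * \<eta> \<le> r a"
  using rA(2) A(3) unfolding radii_def by auto
 have B: "B \<le> r c" using Cons.prems(7) by simp
 have tA: "\<And>a. a \<in> insert c A ==> exp (t a) \<noteq> 1" "\<And>a. a \<in> insert c A ==> cmod (exp (t a) - 1) \<le> \<eta>"
  using Cons.prems(3,4) by (auto simp: A_def)
 have \<gamma>: "\<gamma> > 0" "2 * \<eta> * real (length as) < \<gamma> - 2 * \<eta>"
  using Cons.prems(6) \<eta> by (auto simp: algebra_simps intro: le_less_trans[rotated])
 let ?J = "A \<times> {True}"
 let ?I = "insert (c, True) ?J"
 let ?W = "%A t v x. WC A t v * WX N Ps E A t v x"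
 define \<tau> where "\<tau> = Min ((%a. cmod (exp (t a) - 1)) ` insert c A)"
 have \<tau>: "\<tau> > 0" "\<And>a. a \<in> insert c A ==> \<tau> \<le> cmod (exp (t a) - 1)"
  unfolding \<tau>_def using A tA(1) by (auto simp: Min_gr_iff simp del: Min_insert)
 have bm: "bmeas (PU (A' \<times> {True})) (%om. ?W A' t (vv r om) y)"
  if "A' \<subseteq> insert c A" "spread N \<gamma>' B' y" "\<And>a. a \<in> A' ==> B' \<le> r a" for A' \<gamma>' B' y
 proof -
  have "finite A'" using that A finite_subset by blast
  define B'' where "B'' = Max (insert (-1) ((%j. cmod (y j - 1)) ` {..<N}))"
  have B'': "\<And>j. j < N ==> cmod (y j - 1) \<le> B''" unfolding B''_def by (intro Max_ge) auto
  have "B'' < r a" if "a \<in> A'" for a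
   unfolding B''_def
  proof (subst Max_less_iff)
   have "0 < r a" using rA(2) that \<open>A' \<subseteq> insert c A\<close> unfolding radii_def by blast
   then show "\<forall>z\<in>insert (-1) ((%j. cmod (y j - 1)) ` {..<N}). z < r a"
    using \<open>spread N \<gamma>' B' y\<close> \<open>\<And>a. a \<in> A' ==> B' \<le> r a\<close>[OF that] unfolding spread_def by force
  qed auto
  then show ?thesis
   using that tA \<tau> B'' \<open>finite A'\<close> radii_mono[OF rA(2) that(1)]
   by (intro bmeas_weight[where \<tau> = \<tau> and \<eta> = \<eta> and r = r and B = B'']) (auto intro!: bmeas_cir simp: vv_def radii_def)
 qed
 have sh: "spread N (\<gamma> - 2 * \<eta>) (B + 2 * \<eta>) (x(i := exp (t c) * x i))" if "i < N" for i
  using B rc \<eta> by (intro spread_shift[OF Cons.prems(5) tA(2) _ that]) auto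
 have B2: "B + 2 * \<eta> \<le> r a" if "a \<in> A" for a using rc(3)[OF that] B \<eta> by linarith
 have IH: "Dqs N (map (%a. exp (t a)) as) (%x. exp (lpoly Ps E (psum N x))) (x(i := exp (t c) * x i))
  = integral\<^sup>L (PU ?J) (%om. ?W A t (vv r om) (x(i := exp (t c) * x i)))" if "i < N" for i
  unfolding A_def
  using Cons.prems(1) rA(1) tA B2 \<gamma>(2) by (intro Cons.IH[OF _ _ _ _ sh[OF that]]) (auto simp: A_def)
 have "Dqs N (map (%a. exp (t a)) (c # as)) (%x. exp (lpoly Ps E (psum N x))) x
  = (\<Sum>i<N. (\<Prod>j\<in>{..<N} - {i}. (exp (t c) * x i - x j) / (x i - x j)) *
    integral\<^sup>L (PU ?J) (%om. ?W A t (vv r om) (x(i := exp (t c) * x i))))"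
  unfolding list.map Dqs.simps Dq_def using IH by (intro sum.cong) auto
 also have "\<dots> = integral\<^sup>L (PU ?J) (%om. \<Sum>i<N. (\<Prod>j\<in>{..<N} - {i}. (exp (t c) * x i - x j) / (x i - x j)) *
    ?W A t (vv r om) (x(i := exp (t c) * x i)))"
  using bm[OF subset_insertI sh B2]
  by (subst Bochner_Integration.integral_sum)
   (auto intro!: bmeas_PU_integrable integrable_mult_right)
 also have "\<dots> = integral\<^sup>L (PU ?J) (%om. WC A t (vv r om) * Dq N (exp (t c)) (WX N Ps E A t (vv r om)) x)"
  unfolding Dq_def sum_distrib_left by (simp add: mult_ac)
 also have "\<dots> = integral\<^sup>L (PU ?J) (%om. integral\<^sup>L U01 (%\<theta>. ?W (insert c A) t ((vv r om)(c := cir (r c) \<theta>)) x))"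
 proof (rule Bochner_Integration.integral_cong[OF refl])
  fix om
  let ?v = "vv r om"
  have nv: "cmod (?v a) = r a" if "a \<in> A" for a
   using rA(1) that unfolding radii_def by (auto simp: vv_def abs_of_pos)
  have wv: "cmod (shw (t a) (?v a)) \<ge> r a - 2 * \<eta>" if "a \<in> A" for a
   using radii_bounds[OF rA(1) that tA(2) nv[OF that], of a] that nv[OF that]
    norm_triangle_ineq2[of "?v a" "shw (t a) (?v a)"]
   by (simp add: norm_minus_commute)
  have wz: "cmod (shw (t c) z) < r c + 3 * \<eta>" if "cmod z < r c + \<eta>" for z
  proof -
   have "cmod (1 + z) \<le> 2" using norm_triangle_ineq[of 1 z] that rc(2) by simp
   then have "cmod (shw (t c) z - z) \<le> \<eta> * 2"
    unfolding shw_diff norm_mult using tA(2)[of c] \<eta> by (intro mult_mono) auto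
   then show ?thesis using norm_triangle_ineq2[of "shw (t c) z" z] that by linarith
  qed
  have "Dq N (exp (t c)) (WX N Ps E A t ?v) x =
   integral\<^sup>L U01 (%\<theta>. cir (r c) \<theta> / ((exp (t c) - 1) * (1 + cir (r c) \<theta>)) * (\<Prod>a\<in>A. crs (t c) (cir (r c) \<theta>) (t a) (?v a)) *
    WX N Ps E (insert c A) t (?v(c := cir (r c) \<theta>)) x)"
  proof (rule Dq_WX[OF N A(1,2) _ rc(1) _ rc(2)])
   show "exp (t c) \<noteq> 1" using tA by simp
   show "r c < r c + \<eta>" using \<eta> by simp
   show "cmod (x j - 1) < r c" if "j < N" for j
    using Cons.prems(5) that B unfolding spread_def by force
   show "inj_on x {..<N}" by (rule spread_inj[OF Cons.prems(5) \<gamma>(1)])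
   fix a z assume az: "a \<in> A" "cmod z < r c + \<eta>"
   show "z \<noteq> ?v a" using nv[OF az(1)] rc(3)[OF az(1)] az(2) \<eta> by auto
   show "z \<noteq> shw (t a) (?v a)" using wv[OF az(1)] rc(3)[OF az(1)] az(2) \<eta> by auto
   show "shw (t c) z \<noteq> ?v a" using wz[OF az(2)] nv[OF az(1)] rc(3)[OF az(1)] \<eta> by auto
  qed
  moreover have "?W (insert c A) t (?v(c := z)) x = WC A t ?v * (z / ((exp (t c) - 1) * (1 + z)) *
    (\<Prod>a\<in>A. crs (t c) z (t a) (?v a)) * WX N Ps E (insert c A) t (?v(c := z)) x)" for z
   by (subst WC_insert[OF A(1,2)]) (simp_all add: A(3))
  ultimately show "WC A t ?v * Dq N (exp (t c)) (WX N Ps E A t ?v) x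
   = integral\<^sup>L U01 (%\<theta>. ?W (insert c A) t (?v(c := cir (r c) \<theta>)) x)"
   by (simp only: integral_mult_right_zero)
 qed
 also have "\<dots> = integral\<^sup>L (PU ?I) (%om. ?W (insert c A) t (vv r om) x)"
 proof -
  have u: "vv r (fun_upd om (c, True) \<theta>) = (vv r om)(c := cir (r c) \<theta>)" for om \<theta>
   by (auto simp: vv_def)
  have I: "?I = insert c A \<times> {True}" by auto
  have "integral\<^sup>L (PU ?I) (%om. ?W (insert c A) t (vv r om) x)
   = integral\<^sup>L (PU ?J) (%om. integral\<^sup>L U01 (%\<theta>. ?W (insert c A) t (vv r (fun_upd om (c, True) \<theta>)) x))"
  proof (rule PU_insert)
   have "B \<le> r a" if "a \<in> insert c A" for a using Cons.prems(7)[of a] that by (simp add: A_def)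
   from bm[OF order_refl Cons.prems(5) this]
   show "bmeas (PU ?I) (%om. ?W (insert c A) t (vv r om) x)" by (simp only: I)
  qed (use A in auto)
  then show ?thesis unfolding u by simp
 qed
 finally show ?case by (simp add: A_def insert_Times_insert)
qed

text \<open>A crude bound, sufficient because it is used for fixed N. Each factor has modulus at
  most 2, since the dilation changes its numerator by at most 2 * eta, which does not exceed the
  gap.\<close>

lemma Dqs_bound:
 assumes "\<And>q. q \<in> set qs ==> cmod (q - 1) \<le> \<eta>" "spread N \<gamma> B x" "0 < \<eta>" "2 * \<eta> * (real (length qs) + 1) \<le> \<gamma>"
  "B + 2 * \<eta> * real (length qs) \<le> B'" "B' \<le> 1" "\<And>j. j \<ge> N ==> x j = 1" "0 \<le> M"
  "\<And>y. (\<And>j. j < N ==> cmod (y j - 1) < B') ==> (\<And>j. j \<ge> N ==> y j = 1) ==> cmod (F y) \<le> M"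
 shows "cmod (Dqs N qs F x) \<le> (real N * 2 ^ N) ^ length qs * M"
 using assms
proof (induction qs arbitrary: x \<gamma> B)
 case Nil
 have "B \<le> B'" using Nil.prems(5) by simp
 then have "cmod (F x) \<le> M"
  using Nil.prems(2,7) unfolding spread_def by (intro Nil.prems(9)) (auto intro: less_le_trans)
 then show ?case by simp
next
 case (Cons q qs)
 have q: "cmod (q - 1) \<le> \<eta>" using Cons.prems(1) by simp
 have \<eta>: "\<eta> > 0" by fact
 have \<gamma>: "2 * \<eta> * (real (length qs) + 1) \<le> \<gamma> - 2 * \<eta>" "2 * \<eta> \<le> \<gamma>" "0 < \<gamma>"
 proof -
  have "2 * \<eta> * (real (length qs) + 1) \<ge> 0" using \<eta> by simp
  then show "2 * \<eta> * (real (length qs) + 1) \<le> \<gamma> - 2 * \<eta>" "2 * \<eta> \<le> \<gamma>"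
   using Cons.prems(4) by (simp_all add: algebra_simps)
  then show "0 < \<gamma>" using \<eta> by linarith
 qed
 have BB: "(B + 2 * \<eta>) + 2 * \<eta> * real (length qs) \<le> B'" using Cons.prems(5) by (simp add: algebra_simps)
 have B: "B \<le> 1"
 proof -
  have "2 * \<eta> * real (length (q # qs)) \<ge> 0" using \<eta> by simp
  then show ?thesis using Cons.prems(5,6) by linarith
 qed
 have "cmod (Dqs N (q # qs) F x) \<le> (\<Sum>i<N. 2 ^ N * ((real N * 2 ^ N) ^ length qs * M))"
  unfolding Dqs.simps Dq_def
 proof (rule sum_norm_le)
  fix i assume "i \<in> {..<N}"
  then have i: "i < N" by simp
  have IH: "cmod (Dqs N qs F (x(i := q * x i))) \<le> (real N * 2 ^ N) ^ length qs * M"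
   using Cons.prems(1,6,7,8,9) i
   by (intro Cons.IH[OF _ spread_shift[OF Cons.prems(2) q B i] \<eta> \<gamma>(1) BB]) auto
  have "cmod (\<Prod>j\<in>{..<N} - {i}. (q * x i - x j) / (x i - x j)) \<le> (\<Prod>j\<in>{..<N} - {i}. 2)"
   unfolding prod_norm[symmetric]
  proof (rule prod_mono, rule conjI)
   fix j assume j: "j \<in> {..<N} - {i}"
   have d: "\<gamma> \<le> cmod (x i - x j)" using Cons.prems(2) i j unfolding spread_def by auto
   have xi: "cmod (x i) \<le> 2"
    using Cons.prems(2) i B norm_triangle_ineq[of "x i - 1" 1] unfolding spread_def by force
   have "cmod (q * x i - x j) \<le> cmod ((q - 1) * x i) + cmod (x i - x j)"
    using norm_triangle_ineq[of "(q - 1) * x i" "x i - x j"] by (simp add: algebra_simps)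
   also have "cmod ((q - 1) * x i) \<le> \<eta> * 2"
    unfolding norm_mult using q xi \<eta> by (intro mult_mono) auto
   finally have "cmod (q * x i - x j) \<le> 2 * cmod (x i - x j)" using d \<gamma> by linarith
   then show "cmod ((q * x i - x j) / (x i - x j)) \<le> 2"
    using d \<gamma>(3) by (simp add: norm_divide divide_le_eq)
  qed simp
  also have "(\<Prod>j\<in>{..<N} - {i}. 2) \<le> (2 :: real) ^ N"
   using card_mono[of "{..<N}" "{..<N} - {i}"] by (simp add: prod_constant power_increasing)
  finally show "cmod ((\<Prod>j\<in>{..<N} - {i}. (q * x i - x j) / (x i - x j)) * Dqs N qs F (x(i := q * x i)))
   \<le> 2 ^ N * ((real N * 2 ^ N) ^ length qs * M)"
   unfolding norm_mult using IH by (intro mult_mono) auto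
 qed
 also have "\<dots> = (real N * 2 ^ N) ^ length (q # qs) * M" by simp
 finally show ?case .
qed

lemma Dq_cong:
 "(\<And>i. i < N ==> F (x(i := q * x i)) = G (x(i := q * x i))) ==> Dq N q F x = Dq N q G x"
 unfolding Dq_def by (intro sum.cong) auto

lemma Dqs_schur:
 assumes "\<And>q. q \<in> set qs ==> cmod (q - 1) \<le> \<eta> \<and> q \<noteq> 0" "spread N \<gamma> B x" "0 < \<eta>" "2 * \<eta> * (real (length qs) + 1) \<le> \<gamma>"
  "B + 2 * \<eta> * real (length qs) \<le> 1"
 shows "Dqs N qs (schur N l) x = (\<Prod>q\<leftarrow>qs. \<Sum>j<N. q powi sig_exp N l j) * schur N l x"
 using assms
proof (induction qs arbitrary: x \<gamma> B)
 case (Cons q qs)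
 have q: "cmod (q - 1) \<le> \<eta>" "q \<noteq> 0" using Cons.prems(1) by auto
 have \<eta>: "\<eta> > 0" by fact
 have \<gamma>: "2 * \<eta> * (real (length qs) + 1) \<le> \<gamma> - 2 * \<eta>" "0 < \<gamma> - 2 * \<eta>" "0 < \<gamma>"
 proof -
  have "2 * \<eta> * (real (length qs) + 1) > 0" using \<eta> by (simp add: add_nonneg_pos)
  then show "2 * \<eta> * (real (length qs) + 1) \<le> \<gamma> - 2 * \<eta>" "0 < \<gamma> - 2 * \<eta>"
   using Cons.prems(4) by (simp_all add: algebra_simps)
  then show "0 < \<gamma>" using \<eta> by linarith
 qed
 have BB: "(B + 2 * \<eta>) + 2 * \<eta> * real (length qs) \<le> 1" using Cons.prems(5) by (simp add: algebra_simps)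
 have B: "B \<le> 1"
 proof -
  have "2 * \<eta> * real (length (q # qs)) \<ge> 0" using \<eta> by simp
  then show ?thesis using Cons.prems(5) by linarith
 qed
 have sh: "spread N (\<gamma> - 2 * \<eta>) (B + 2 * \<eta>) (x(i := q * x i))" if "i < N" for i
  by (rule spread_shift[OF Cons.prems(2) q(1) B that])
 have dist: "y \<in> distinct_pts N" if "spread N g b y" "0 < g" for y g b
  using spread_inj[OF that] unfolding distinct_pts_def inj_on_def by force
 have nz: "x i \<noteq> 0" if "i < N" for i
  using Cons.prems(2) that B unfolding spread_def by force
 have "Dqs N (q # qs) (schur N l) x = Dq N q (%y. (\<Prod>q\<leftarrow>qs. \<Sum>j<N. q powi sig_exp N l j) * schur N l y) x"
  unfolding Dqs.simps using Cons.prems(1)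
  by (intro Dq_cong Cons.IH[OF _ sh \<eta> \<gamma>(1) BB]) auto
 also have "\<dots> = (\<Prod>q\<leftarrow>qs. \<Sum>j<N. q powi sig_exp N l j) * Dq N q (schur N l) x"
  unfolding Dq_def by (simp add: sum_distrib_left mult_ac)
 also have "Dq N q (schur N l) x = (\<Sum>j<N. q powi sig_exp N l j) * schur N l x"
  by (rule schur_eigen[OF q(2) nz dist[OF Cons.prems(2) \<gamma>(3)] dist[OF sh \<gamma>(2)]])
 finally show ?case by simp
qed simp

lemma Dqs_linear:
 "finite L ==> Dqs N qs (%x. (\<Sum>l\<in>L. c l * F l x) - b * G x) x = (\<Sum>l\<in>L. c l * Dqs N qs (F l) x) - b * Dqs N qs G x"
proof (induction qs arbitrary: x)
 case (Cons q qs)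
 have "Dqs N (q # qs) (%x. (\<Sum>l\<in>L. c l * F l x) - b * G x) x
  = Dq N q (%y. (\<Sum>l\<in>L. c l * Dqs N qs (F l) y) - b * Dqs N qs G y) x"
  unfolding Dqs.simps using Cons by (intro Dq_cong) auto
 also have "\<dots> = (\<Sum>i<N. (\<Sum>l\<in>L. c l * ((\<Prod>j\<in>{..<N} - {i}. (q * x i - x j) / (x i - x j)) * Dqs N qs (F l) (x(i := q * x i))))
   - b * ((\<Prod>j\<in>{..<N} - {i}. (q * x i - x j) / (x i - x j)) * Dqs N qs G (x(i := q * x i))))"
  unfolding Dq_def by (intro sum.cong refl) (simp add: right_diff_distrib left_diff_distrib sum_distrib_left sum_distrib_right mult_ac)
 also have "\<dots> = (\<Sum>l\<in>L. c l * Dq N q (Dqs N qs (F l)) x) - b * Dq N q (Dqs N qs G) x"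
  unfolding Dq_def sum_subtractf sum_distrib_left by (subst sum.swap) (rule refl)
 finally show ?case by simp
qed simp

lemma bmeas_Dqs:
 fixes F :: "(nat => complex) => complex"
 assumes F: "\<And>X. (\<And>j. j < N ==> bmeas M (%om. X om j)) ==> bmeas M (%om. F (X om))"
  and "\<And>g. g \<in> set gs ==> bmeas M g" "\<And>g om. g \<in> set gs ==> cmod (g om - 1) \<le> \<eta>"
  "\<And>j. j < N ==> bmeas M (%om. X om j)" "\<And>om. spread N \<gamma> B (X om)" "0 < \<eta>" "2 * \<eta> * (real (length gs) + 1) \<le> \<gamma>"
  "B + 2 * \<eta> * real (length gs) \<le> 1"
 shows "bmeas M (%om. Dqs N (map (%g. g om) gs) F (X om))"
 using assms(2-)
proof (induction gs arbitrary: X \<gamma> B)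
 case Nil
 then show ?case using F[of X] by simp
next
 case (Cons g gs)
 have \<eta>: "\<eta> > 0" by fact
 have \<gamma>: "2 * \<eta> * (real (length gs) + 1) \<le> \<gamma> - 2 * \<eta>" "0 < \<gamma>"
 proof -
  have "2 * \<eta> * (real (length gs) + 1) > 0" using \<eta> by (simp add: add_nonneg_pos)
  then show "2 * \<eta> * (real (length gs) + 1) \<le> \<gamma> - 2 * \<eta>" "0 < \<gamma>"
   using Cons.prems(6) \<eta> by (simp_all add: algebra_simps)
 qed
 have BB: "(B + 2 * \<eta>) + 2 * \<eta> * real (length gs) \<le> 1" using Cons.prems(7) by (simp add: algebra_simps)
 have B: "B \<le> 1"
 proof -
  have "2 * \<eta> * real (length (g # gs)) \<ge> 0" using \<eta> by simp
  then show ?thesis using Cons.prems(7) by linarith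
 qed
 have g: "bmeas M g" "\<And>om. cmod (g om - 1) \<le> \<eta>" using Cons.prems(1,2) by auto
 have IH: "bmeas M (%om. Dqs N (map (%g. g om) gs) F ((X om)(i := g om * X om i)))" if i: "i < N" for i
 proof (rule Cons.IH[OF _ _ _ spread_shift[OF Cons.prems(4) g(2) B i] \<eta> \<gamma>(1) BB])
  fix j assume "j < N"
  then show "bmeas M (%om. ((X om)(i := g om * X om i)) j)"
   using Cons.prems(3) g i by (cases "j = i") (auto intro: bconv_mult)
 qed (use Cons.prems in auto)
 have r: "bmeas M (%om. (g om * X om i - X om j) / (X om i - X om j))" if ij: "i < N" "j \<in> {..<N} - {i}" for i j
 proof (rule bmeas_divide[OF _ _ \<gamma>(2)])
  show "\<gamma> \<le> cmod (X om i - X om j)" for om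
   using Cons.prems(4)[of om] ij unfolding spread_def by auto
 qed (use ij g Cons.prems(3) in \<open>auto intro!: bconv_diff bconv_mult\<close>)
 show ?case
  unfolding list.map Dqs.simps Dq_def
  by (intro bconv_sum bconv_mult bconv_prod r IH) auto
qed

section \<open>Reading off moments by averages over t and h\<close>

definition tt :: "(nat => real) => (nat \<times> bool => real) => nat => complex" where
 "tt \<rho> om a = cir (\<rho> a) (om (a, False))"

text \<open>Points with pairwise distinct coordinates, separated by at least |h|, that collapse to
  (1,...,1) at h = 0. A complex h permits the mean value property.\<close>

definition ray :: "nat => complex => nat => complex" where
 "ray N h j = (if j < N then 1 + h * of_nat j else 1)"

lemma ray_spread: "N > 0 ==> h \<noteq> 0 ==> spread N (cmod h) (real N * cmod h) (ray N h)"
 unfolding spread_def ray_def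
proof (intro conjI allI impI)
 fix i j assume "N > 0" "i < N" "j < N" "i \<noteq> j" "h \<noteq> 0"
 then have "cmod (of_int (int i - int j)) \<ge> 1" by (subst norm_of_int) auto
 then have "cmod h * 1 \<le> cmod h * cmod (of_int (int i - int j))" by (intro mult_left_mono) auto
 then show "cmod h \<le> cmod ((if i < N then 1 + h * of_nat i else 1) - (if j < N then 1 + h * of_nat j else 1))"
  using \<open>i < N\<close> \<open>j < N\<close> by (simp add: norm_mult[symmetric] algebra_simps)
qed (auto simp: norm_mult mult.commute)

lemma norm_expm1_le: "cmod t \<le> 1 ==> cmod (exp t - 1) \<le> 3 * cmod t"
proof -
 assume t: "cmod t \<le> 1"
 have "cmod (exp t - (\<Sum>i\<le>0. t ^ i / fact i)) \<le> exp \<bar>Re t\<bar> * cmod t ^ Suc 0 / fact 0"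
  by (rule Taylor_exp)
 then have "cmod (exp t - 1) \<le> exp \<bar>Re t\<bar> * cmod t" by simp
 also have "exp \<bar>Re t\<bar> \<le> exp 1" using abs_Re_le_cmod[of t] t by simp
 also have "exp (1 :: real) \<le> 3" by (rule exp_le)
 finally show ?thesis by (simp add: mult_right_mono)
qed

lemma norm_expm1_ge: "cmod t \<le> 1 / 4 ==> cmod t / 4 \<le> cmod (exp t - 1)"
proof -
 assume t: "cmod t \<le> 1 / 4"
 have "cmod (exp t - (\<Sum>i\<le>1. t ^ i / fact i)) \<le> exp \<bar>Re t\<bar> * cmod t ^ Suc 1 / fact 1"
  by (rule Taylor_exp)
 then have "cmod (exp t - 1 - t) \<le> exp \<bar>Re t\<bar> * (cmod t * cmod t)" by (simp add: algebra_simps)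
 also have "\<dots> \<le> 3 * (1 / 4 * cmod t)"
 proof (intro mult_mono)
  have "exp \<bar>Re t\<bar> \<le> exp 1" using abs_Re_le_cmod[of t] t by simp
  also have "exp (1 :: real) \<le> 3" by (rule exp_le)
  finally show "exp \<bar>Re t\<bar> \<le> 3" .
 qed (use t in auto)
 finally have "cmod (exp t - 1 - t) \<le> 3 / 4 * cmod t" by simp
 moreover have "cmod t \<le> cmod (exp t - 1) + cmod (exp t - 1 - t)"
  using norm_triangle_ineq4[of "exp t - 1" "exp t - 1 - t"] by simp
 ultimately show ?thesis by linarith
qed

lemma higher_deriv_exp_sum:
 fixes c :: "nat => complex"
 shows "(deriv ^^ k) (%t. \<Sum>j<N. exp (c j * t)) = (%t. \<Sum>j<N. c j ^ k * exp (c j * t))"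
proof (induction k)
 case (Suc k)
 have "deriv (%t. \<Sum>j<N. c j ^ k * exp (c j * t)) = (%t. \<Sum>j<N. c j ^ Suc k * exp (c j * t))"
  by (rule ext, rule DERIV_imp_deriv) (auto intro!: derivative_eq_intros sum.cong)
 then show ?case using Suc by simp
qed simp

lemma p_k_complex: "(\<Sum>j<N. complex_of_int (sig_exp N l j) ^ k) = of_real (p_k N k l)"
 unfolding p_k_def sig_exp_def by simp

text \<open>With q = e^t the eigenvalue is the exponential generating function of the power sums in
  lambda_j + N - j, so its k-th Taylor coefficient is p_k / k!.\<close>

lemma eigenvalue_coeff:
 assumes "0 < \<rho>"
 shows "integral\<^sup>L U01 (%\<theta>. (\<Sum>j<N. exp (cir \<rho> \<theta>) powi sig_exp N l j) / cir \<rho> \<theta> ^ k) = of_real (p_k N k l) / fact k"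
proof -
 let ?f = "%t. \<Sum>j<N. exp (of_int (sig_exp N l j) * t)"
 have "integral\<^sup>L U01 (%\<theta>. ?f (cir \<rho> \<theta>) / cir \<rho> \<theta> ^ k) = (deriv ^^ k) ?f 0 / fact k"
  using assms by (intro cir_avg_deriv[of _ "\<rho> + 1"] holomorphic_intros) auto
 then show ?thesis by (simp add: higher_deriv_exp_sum p_k_complex exp_power_int)
qed

lemma holo_bmeas_cir:
 assumes f: "f holomorphic_on ball 0 R" and r: "0 < r" "r < R"
 shows "bmeas U01 (%\<theta>. f (cir r \<theta>))"
proof -
 have c: "continuous_on (sphere 0 r) f"
  using r by (intro holomorphic_on_imp_continuous_on holomorphic_on_subset[OF f]) auto
 obtain C where C: "\<And>z. z \<in> sphere 0 r ==> cmod (f z) \<le> C"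
  using compact_imp_bounded[OF compact_continuous_image[OF c compact_sphere]] unfolding bounded_iff by blast
 have s: "cir r \<theta> \<in> sphere 0 r" for \<theta> using r by simp
 have "continuous_on UNIV (%\<theta>. f (cir r \<theta>))"
  using s by (intro continuous_on_compose2[OF c]) (auto simp: cir_def intro!: continuous_intros)
 then have "(%\<theta>. f (cir r \<theta>)) \<in> borel_measurable U01"
  using borel_measurable_continuous_onI by (simp cong: measurable_cong_sets)
 then show ?thesis
  using C s by (intro bmeasI[where C = C]) auto
qed

lemma schur_ray_holo:
 "0 < R ==> real N * R \<le> 1 ==> (%h. schur N l (ray N h)) holomorphic_on ball 0 R"
proof -
 assume R: "0 < R" "real N * R \<le> 1"
 have nz: "ray N h i \<noteq> 0" if "h \<in> ball 0 R" "i < N" for h i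
 proof
  assume "ray N h i = 0"
  then have "h * of_nat i = - 1" using that by (simp add: ray_def add_eq_0_iff)
  then have "cmod h * real i = 1" by (metis norm_minus_cancel norm_mult norm_of_nat norm_one)
  moreover have "cmod h * real i \<le> cmod h * real N" using that by (intro mult_left_mono) auto
  moreover have "cmod h * real N < 1" if "h \<noteq> 0"
  proof -
   have "cmod h * real N < R * real N" using \<open>h \<in> ball 0 R\<close> \<open>i < N\<close> by (intro mult_strict_right_mono) auto
   then show ?thesis using R by (simp add: mult.commute)
  qed
  ultimately show False by (cases "h = 0") auto
 qed
 have "(%h. schur_cont N l (ray N h)) holomorphic_on ball 0 R"
 proof (rule holomorphic_schur_cont)
  show "(%h. ray N h i) holomorphic_on ball 0 R" for i
   unfolding ray_def by (cases "i < N") (auto intro!: holomorphic_intros)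
 qed (use nz in auto)
 then show ?thesis
  by (rule holomorphic_transform) (use nz in \<open>auto simp: schur_eq\<close>)
qed

text \<open>The value that the extraction of coefficients in t assigns to the exponential of the
  polynomial \<open>lpoly\<close>: the circle average of the nested formula at (1,...,1).\<close>

definition JJ where
 "JJ N Ps E A k \<rho> r = integral\<^sup>L (PU (A \<times> UNIV)) (%om. (\<Prod>a\<in>A. 1 / tt \<rho> om a ^ k a) *
  (WC A (tt \<rho> om) (vv r om) * WX N Ps E A (tt \<rho> om) (vv r om) one_pt))" for k :: "nat => nat"

lemma radii_shrink: "radii A \<eta> r ==> 0 < \<eta>' ==> \<eta>' \<le> \<eta> ==> radii A \<eta>' r"
 unfolding radii_def by (smt (verit, best))

lemma bmeas_tt: "(a, False) \<in> I ==> bmeas (PU I) (%om. tt \<rho> om a)"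
 unfolding tt_def by (rule bmeas_cir)

lemma norm_tt: "0 < \<rho> a ==> cmod (tt \<rho> om a) = \<rho> a"
 unfolding tt_def by simp

lemma norm_vv: "0 < r a ==> cmod (vv r om a) = r a"
 unfolding vv_def by simp

lemma moment_weight_bmeas:
 assumes A: "finite A" and r: "radii A \<eta> r" and \<rho>: "\<And>a. a \<in> A ==> 0 < \<rho> a" "\<And>a. a \<in> A ==> \<rho> a \<le> 1 / 4" "\<And>a. a \<in> A ==> 3 * \<rho> a \<le> \<eta>"
  and I: "A \<times> UNIV \<subseteq> I"
  and x: "\<And>j. j < N ==> bmeas (PU I) (%om. x om j)" "\<And>j om. j < N ==> cmod (x om j - 1) \<le> B"
   "\<And>a. a \<in> A ==> B < r a"
 shows "bmeas (PU I) (%om. (\<Prod>a\<in>A. 1 / tt \<rho> om a ^ k a) *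
  (WC A (tt \<rho> om) (vv r om) * WX N Ps E A (tt \<rho> om) (vv r om) (x om)))"
proof (rule bconv_mult)
 show "bmeas (PU I) (%om. \<Prod>a\<in>A. 1 / tt \<rho> om a ^ k a)"
 proof (rule bconv_prod)
  fix a assume a: "a \<in> A"
  have I': "(a, False) \<in> I" using I a by auto
  have nt: "cmod (tt \<rho> om a) = \<rho> a" for om by (rule norm_tt) (rule \<rho>(1)[OF a])
  show "bmeas (PU I) (%om. 1 / tt \<rho> om a ^ k a)"
   by (rule bmeas_divide[where c = "\<rho> a ^ k a"])
    (use I' \<rho>(1)[OF a] in \<open>auto intro!: bconv_power bmeas_tt simp: norm_power nt\<close>)
 qed
 define \<tau> where "\<tau> = Min (insert 1 ((%a. \<rho> a / 4) ` A))"
 have \<tau>: "\<tau> > 0" unfolding \<tau>_def using A \<rho>(1) by (auto simp: Min_gr_iff)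
 have \<tau>2: "\<tau> \<le> \<rho> a / 4" if "a \<in> A" for a unfolding \<tau>_def using A that by (intro Min_le) auto
 have nt: "cmod (tt \<rho> om a) = \<rho> a" if "a \<in> A" for om a
  by (rule norm_tt) (rule \<rho>(1)[OF that])
 show "bmeas (PU I) (%om. WC A (tt \<rho> om) (vv r om) * WX N Ps E A (tt \<rho> om) (vv r om) (x om))"
 proof (rule bmeas_weight[OF A r \<tau> _ _ _ _ _ x])
  fix a om assume a: "a \<in> A"
  have I': "(a, False) \<in> I" "(a, True) \<in> I" using I a by auto
  show "bmeas (PU I) (%om. tt \<rho> om a)" "bmeas (PU I) (%om. vv r om a)" using I' by (auto intro: bmeas_tt bmeas_vv)
  show "cmod (exp (tt \<rho> om a) - 1) \<le> \<eta>"
   using norm_expm1_le[of "tt \<rho> om a"] nt[OF a, of om] \<rho>(2,3)[OF a] by simp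
  show "\<tau> \<le> cmod (exp (tt \<rho> om a) - 1)"
   using norm_expm1_ge[of "tt \<rho> om a"] nt[OF a, of om] \<rho>(2)[OF a] \<tau>2[OF a] by simp
  show "cmod (vv r om a) = r a" using r a unfolding radii_def by (intro norm_vv) auto
 qed
qed

lemma one_pt_simp [simp]: "one_pt j = 1"
 by (simp add: one_pt_def)

text \<open>By the eigenvalue relation every angle sits in a factor of its own. The average over h
  gives the value of the Schur function at (1,...,1) and each t-average gives one power sum.\<close>

lemma moment_integral_schur:
 assumes N: "N > 0" and A: "finite A" "hh \<notin> A" and h: "0 < h" "real N * h < 1 / 2" and \<rho>: "0 < \<rho>"
 shows "bmeas (PU (insert (hh, False) (A \<times> {False}))) (%om. (\<Prod>a\<in>A. 1 / tt (%_. \<rho>) om a ^ k a) *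
   ((\<Prod>a\<in>A. \<Sum>j<N. exp (tt (%_. \<rho>) om a) powi sig_exp N l j) * schur N l (ray N (cir h (om (hh, False))))))"
  and "integral\<^sup>L (PU (insert (hh, False) (A \<times> {False}))) (%om. (\<Prod>a\<in>A. 1 / tt (%_. \<rho>) om a ^ k a) *
   ((\<Prod>a\<in>A. \<Sum>j<N. exp (tt (%_. \<rho>) om a) powi sig_exp N l j) * schur N l (ray N (cir h (om (hh, False))))))
   = schur N l one_pt * (\<Prod>a\<in>A. of_real (p_k N (k a) l) / fact (k a))"
proof -
 let ?I = "insert (hh, False) (A \<times> {False})"
 define g where "g i \<theta> = (if i = (hh, False) then schur N l (ray N (cir h \<theta>)) else
  (\<Sum>j<N. exp (cir \<rho> \<theta>) powi sig_exp N l j) / cir \<rho> \<theta> ^ k (fst i))" for i \<theta>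
 have split: "(\<Prod>i\<in>?I. X i) = X (hh, False) * (\<Prod>a\<in>A. X (a, False))" for X :: "nat \<times> bool => complex"
 proof -
  have "(\<Prod>i\<in>A \<times> {False}. X i) = (\<Prod>a\<in>A. X (a, False))"
   by (rule prod.reindex_bij_witness[of _ "%a. (a, False)" fst]) auto
  then show ?thesis using A by (subst prod.insert) auto
 qed
 have eq: "(\<Prod>i\<in>?I. g i (om i)) = (\<Prod>a\<in>A. 1 / tt (%_. \<rho>) om a ^ k a) *
   ((\<Prod>a\<in>A. \<Sum>j<N. exp (tt (%_. \<rho>) om a) powi sig_exp N l j) * schur N l (ray N (cir h (om (hh, False)))))" for om
 proof -
  have p: "(\<Prod>a\<in>A. g (a, False) (om (a, False))) = (\<Prod>a\<in>A. 1 / tt (%_. \<rho>) om a ^ k a) * (\<Prod>a\<in>A. \<Sum>j<N. exp (tt (%_. \<rho>) om a) powi sig_exp N l j)"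
   unfolding prod.distrib[symmetric] using A by (intro prod.cong refl) (auto simp: g_def tt_def)
  show ?thesis unfolding split p by (simp add: g_def)
 qed
 have NR: "real N * (h + h) \<le> 1" using h by (simp add: algebra_simps)
 have hol: "(%h. schur N l (ray N h)) holomorphic_on ball 0 (h + h)"
  by (rule schur_ray_holo) (use h NR in auto)
 have bg: "bmeas U01 (g i)" for i
 proof (cases "i = (hh, False)")
  case True
  then have "g i = (%\<theta>. schur N l (ray N (cir h \<theta>)))" by (auto simp: g_def)
  then show ?thesis using holo_bmeas_cir[OF hol, of h] h by simp
 next
  case False
  have "bmeas U01 (%\<theta>. (%t. \<Sum>j<N. exp (of_int (sig_exp N l j) * t)) (cir \<rho> \<theta>))"
   using \<rho> by (intro holo_bmeas_cir[where R = "\<rho> + 1"] holomorphic_intros) auto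
  moreover have "bmeas U01 (%\<theta>. cir \<rho> \<theta> ^ k (fst i))"
   using \<rho> by (intro holo_bmeas_cir[where R = "\<rho> + 1" and f = "%t. t ^ k (fst i)"] holomorphic_intros) auto
  ultimately have "bmeas U01 (%\<theta>. (\<Sum>j<N. exp (of_int (sig_exp N l j) * cir \<rho> \<theta>)) / cir \<rho> \<theta> ^ k (fst i))"
   using \<rho> by (intro bmeas_divide[where c = "\<rho> ^ k (fst i)"]) (auto simp: norm_power)
  moreover have "g i = (%\<theta>. (\<Sum>j<N. exp (of_int (sig_exp N l j) * cir \<rho> \<theta>)) / cir \<rho> \<theta> ^ k (fst i))"
   using False by (auto simp: g_def exp_power_int)
  ultimately show ?thesis by simp
 qed
 show "bmeas (PU ?I) (%om. (\<Prod>a\<in>A. 1 / tt (%_. \<rho>) om a ^ k a) *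
   ((\<Prod>a\<in>A. \<Sum>j<N. exp (tt (%_. \<rho>) om a) powi sig_exp N l j) * schur N l (ray N (cir h (om (hh, False))))))"
  unfolding eq[symmetric]
 proof (rule bconv_prod)
  fix i assume "i \<in> ?I"
  then have "(%om. om i) \<in> measurable (PU ?I) U01"
   unfolding PU_def by (rule measurable_component_singleton)
  then show "bmeas (PU ?I) (%om. g i (om i))" by (rule bmeas_comp[OF bg])
 qed
 have "integral\<^sup>L (PU ?I) (%om. \<Prod>i\<in>?I. g i (om i)) = (\<Prod>i\<in>?I. integral\<^sup>L U01 (g i))"
  unfolding PU_def using A bmeas_integrable[OF U01.finite_measure_axioms bg]
  by (intro PU.product_integral_prod) auto
 also have "\<dots> = integral\<^sup>L U01 (g (hh, False)) * (\<Prod>a\<in>A. integral\<^sup>L U01 (g (a, False)))"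
  by (rule split)
 also have "integral\<^sup>L U01 (g (hh, False)) = schur N l (ray N 0)"
  unfolding g_def using cir_avg_mean[OF hol, of h] h by simp
 also have "ray N 0 = one_pt" by (auto simp: ray_def one_pt_def)
 also have "(\<Prod>a\<in>A. integral\<^sup>L U01 (g (a, False))) = (\<Prod>a\<in>A. of_real (p_k N (k a) l) / fact (k a))"
 proof (rule prod.cong[OF refl])
  fix a assume "a \<in> A"
  then have "a \<noteq> hh" using A by auto
  then have "g (a, False) = (%\<theta>. (\<Sum>j<N. exp (cir \<rho> \<theta>) powi sig_exp N l j) / cir \<rho> \<theta> ^ k a)"
   by (auto simp: g_def)
  then show "integral\<^sup>L U01 (g (a, False)) = of_real (p_k N (k a) l) / fact (k a)"
   by (simp add: eigenvalue_coeff[OF \<rho>])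
 qed
 finally show "integral\<^sup>L (PU ?I) (%om. (\<Prod>a\<in>A. 1 / tt (%_. \<rho>) om a ^ k a) *
   ((\<Prod>a\<in>A. \<Sum>j<N. exp (tt (%_. \<rho>) om a) powi sig_exp N l j) * schur N l (ray N (cir h (om (hh, False))))))
   = schur N l one_pt * (\<Prod>a\<in>A. of_real (p_k N (k a) l) / fact (k a))"
  unfolding eq .
qed

lemma holomorphic_WX_ray:
 assumes A: "finite A" and R: "\<And>a. a \<in> A ==> real N * R < cmod (v a)" "0 < R"
 shows "(%h. WX N Ps E A t v (ray N h)) holomorphic_on ball 0 R"
proof -
 have r: "(%h. ray N h j) holomorphic_on ball 0 R" for j
  unfolding ray_def by (cases "j < N") (auto intro!: holomorphic_intros)
 show ?thesis
  unfolding WX_def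
 proof (intro holomorphic_intros holomorphic_lpoly r)
  fix a j and h :: complex assume a: "a \<in> A" "j \<in> {..<N}" "h \<in> ball 0 R"
  have "cmod (ray N h j - 1) \<le> cmod h * real N"
   using a by (simp add: ray_def norm_mult mult_left_mono)
  also have "\<dots> \<le> R * real N" using a by (intro mult_right_mono) auto
  also have "\<dots> < cmod (v a)" using R(1)[OF a(1)] by (simp add: mult.commute)
  finally show "v a - (ray N h j - 1) \<noteq> 0" by auto
 next
  show "(%h. psum N (ray N h) n) holomorphic_on ball 0 R" for n
   unfolding psum_def by (intro holomorphic_intros r)
 qed
qed

lemma integral_norm_bound_prob:
 assumes "prob_space M" "\<And>x. cmod (f x) \<le> C"
 shows "cmod (integral\<^sup>L M f) \<le> C"
proof -
 interpret prob_space M by fact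
 have "cmod (integral\<^sup>L M f) \<le> integral\<^sup>L M (%x. cmod (f x))" by (rule integral_norm_bound)
 also have "\<dots> \<le> C"
 proof (cases "integrable M (%x. cmod (f x))")
  case True
  then have "integral\<^sup>L M (%x. cmod (f x)) \<le> integral\<^sup>L M (%_. C)"
   using assms(2) by (intro integral_mono) auto
  then show ?thesis by (simp add: prob_space)
 next
  case False
  then show ?thesis using order_trans[OF norm_ge_zero assms(2)] by (simp add: not_integrable_integral_eq)
 qed
 finally show ?thesis .
qed

lemma WC_cong:
 "(\<And>a. a \<in> A ==> t a = t' a) ==> (\<And>a. a \<in> A ==> v a = v' a) ==> WC A t v = WC A t' v'"
 unfolding WC_def by (intro arg_cong2[where f = "(*)"] prod.cong) auto

lemma WX_cong:
 assumes "\<And>a. a \<in> A ==> t a = t' a" "\<And>a. a \<in> A ==> v a = v' a"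
 shows "WX N Ps E A t v x = WX N Ps E A t' v' x"
proof -
 have "(\<Sum>a\<in>A. gch (t a) (v a) n) = (\<Sum>a\<in>A. gch (t' a) (v' a) n)" for n
  using assms by (intro sum.cong) auto
 moreover have "(\<Prod>a\<in>A. \<Prod>j<N. (shw (t a) (v a) - (x j - 1)) / (v a - (x j - 1)))
   = (\<Prod>a\<in>A. \<Prod>j<N. (shw (t' a) (v' a) - (x j - 1)) / (v' a - (x j - 1)))"
  using assms by (intro prod.cong) auto
 ultimately show ?thesis unfolding WX_def by simp
qed

text \<open>The nested formula holds pointwise in t and h. By Fubini the h-average can be taken
  first; h enters only through \<open>WX\<close>, which is holomorphic while the ray stays inside
  all circles, so the mean value property applies.\<close>

lemma moment_integral_exp:
 assumes N: "N > 0" and sorted: "sorted_wrt (<) as" and hh: "hh \<notin> set as"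
  and \<eta>: "\<eta> = 3 * \<rho>" "\<rho> > 0" "\<rho> \<le> 1 / 4" and r: "radii (set as) \<eta> r"
  and h: "0 < h" "2 * \<eta> * (real (length as) + 1) \<le> h" "(real N + 1) * h \<le> 1 / 2"
   "\<And>a. a \<in> set as ==> 2 * (real N * h) < r a"
 shows "bmeas (PU (insert (hh, False) (set as \<times> {False}))) (%om. (\<Prod>a\<in>set as. 1 / tt (%_. \<rho>) om a ^ k a) *
   Dqs N (map (%a. exp (tt (%_. \<rho>) om a)) as) (%x. exp (lpoly Ps E (psum N x))) (ray N (cir h (om (hh, False)))))"
  and "integral\<^sup>L (PU (insert (hh, False) (set as \<times> {False}))) (%om. (\<Prod>a\<in>set as. 1 / tt (%_. \<rho>) om a ^ k a) *
   Dqs N (map (%a. exp (tt (%_. \<rho>) om a)) as) (%x. exp (lpoly Ps E (psum N x))) (ray N (cir h (om (hh, False)))))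
   = JJ N Ps E (set as) k (%_. \<rho>) r"
proof -
 let ?A = "set as"
 let ?I = "insert (hh, False) (?A \<times> {False})" and ?J = "?A \<times> {True}" and ?T = "tt (%_. \<rho>)"
 let ?F = "%x. exp (lpoly Ps E (psum N x))"
 have \<eta>0: "\<eta> > 0" using \<eta> by simp
 have s: "2 * \<eta> * real (length as) < h"
 proof -
  have "2 * \<eta> * (real (length as) + 1) = 2 * \<eta> * real (length as) + 2 * \<eta>" by (simp add: algebra_simps)
  then show ?thesis using h(2) \<eta>0 by linarith
 qed
 have nt: "cmod (?T om a) = \<rho>" for om a by (rule norm_tt) (rule \<eta>)
 have e1: "cmod (exp (?T om a) - 1) \<le> \<eta>" for om a
  using norm_expm1_le[of "?T om a"] nt[of om a] \<eta> by simp
 have e2: "exp (?T om a) \<noteq> 1" for om a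
  using norm_expm1_ge[of "?T om a"] nt[of om a] \<eta> by auto
 have sp: "spread N h (real N * h) (ray N (cir h \<theta>))" for \<theta>
  using ray_spread[OF N, of "cir h \<theta>"] cir_nonzero[OF h(1)] h(1) by simp
 have bray: "bmeas (PU I) (%om. ray N (cir h (om (hh, False))) j)" if "(hh, False) \<in> I" for I j
  unfolding ray_def using that by (cases "j < N") (auto intro!: bconv_add bconv_mult bmeas_cir)
 have nray: "cmod (ray N (cir h \<theta>) j - 1) \<le> real N * h" if "j < N" for \<theta> j
  using sp[of \<theta>] that unfolding spread_def by (simp add: less_imp_le)
 have bexp: "bmeas M (%om. ?F (X om))" if "\<And>j. j < N ==> bmeas M (%om. X om j)"
  for M :: "(nat \<times> bool => real) measure" and X
  by (intro bconv_exp bconv_lpoly bmeas_psum that tendsto_const)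
 have BB: "real N * h + 2 * \<eta> * real (length as) \<le> 1"
 proof -
  have "real N * h + h = (real N + 1) * h" by (simp add: algebra_simps)
  then show ?thesis using s h(3) by linarith
 qed
 have bpre: "bmeas (PU I) (%om. \<Prod>a\<in>?A. 1 / ?T om a ^ k a)" if "?A \<times> {False} \<subseteq> I" for I
 proof (rule bconv_prod)
  fix a assume a: "a \<in> ?A"
  then have "(a, False) \<in> I" using that by auto
  then show "bmeas (PU I) (%om. 1 / ?T om a ^ k a)"
   using \<eta> by (intro bmeas_divide[where c = "\<rho> ^ k a"]) (auto intro!: bconv_power bmeas_tt simp: norm_power nt)
 qed
 let ?gs = "map (%a om. exp (?T om a)) as"
 have "bmeas (PU ?I) (%om. Dqs N (map (%g. g om) ?gs) ?F (ray N (cir h (om (hh, False)))))"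
 proof (rule bmeas_Dqs[OF bexp _ _ _ sp \<eta>0])
  show "bmeas (PU ?I) g" if "g \<in> set ?gs" for g
   using that by (auto intro!: bconv_exp bmeas_tt)
  show "cmod (g om - 1) \<le> \<eta>" if "g \<in> set ?gs" for g om using that e1 by auto
 qed (use bray h BB in auto)
 then show "bmeas (PU ?I) (%om. (\<Prod>a\<in>?A. 1 / ?T om a ^ k a) *
   Dqs N (map (%a. exp (?T om a)) as) ?F (ray N (cir h (om (hh, False)))))"
  by (intro bconv_mult bpre) (auto simp: comp_def)
 let ?G = "%om x. (\<Prod>a\<in>?A. 1 / ?T om a ^ k a) * (WC ?A (?T om) (vv r om) * WX N Ps E ?A (?T om) (vv r om) x)"
 have Bneg: "real N * h < r a" if "a \<in> ?A" for a
  using h(4)[OF that] h(1) by (smt (verit) mult_nonneg_nonneg of_nat_0_le_iff)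
 have bG: "bmeas (PU I) (%om. ?G om (ray N (cir h (om (hh, False)))))" if "?A \<times> UNIV \<subseteq> I" "(hh, False) \<in> I" for I
  using \<eta> r that(1) bray[OF that(2)] nray Bneg
  by (intro moment_weight_bmeas[where \<eta> = \<eta> and B = "real N * h"]) auto
 have "integral\<^sup>L (PU ?I) (%om. (\<Prod>a\<in>?A. 1 / ?T om a ^ k a) *
   Dqs N (map (%a. exp (?T om a)) as) ?F (ray N (cir h (om (hh, False)))))
  = integral\<^sup>L (PU ?I) (%om. integral\<^sup>L (PU ?J) (%om'. (\<Prod>a\<in>?A. 1 / ?T om a ^ k a) *
    (WC ?A (?T om) (vv r om') * WX N Ps E ?A (?T om) (vv r om') (ray N (cir h (om (hh, False)))))))"
  using e1 e2 Bneg
  by (subst nested_formula[OF N sorted r _ _ sp s]) (auto intro: less_imp_le)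
 also have "\<dots> = integral\<^sup>L (PU ?I) (%om. integral\<^sup>L (PU ?J) (%om'.
   (%om. ?G om (ray N (cir h (om (hh, False))))) (merge ?I ?J (om, om'))))"
 proof -
  have m1: "?T (merge ?I ?J (om, om')) a = ?T om a" if "a \<in> ?A" for a om om'
   using that by (simp add: tt_def merge_def)
  have m2: "vv r (merge ?I ?J (om, om')) a = vv r om' a" if "a \<in> ?A" for a om om'
   using that by (simp add: vv_def merge_def)
  have m3: "merge ?I ?J (om, om') (hh, False) = om (hh, False)" for om om' by (simp add: merge_def)
  show ?thesis
   unfolding m3 using m1 m2
   by (intro Bochner_Integration.integral_cong refl arg_cong2[where f = "(*)"] prod.cong WC_cong WX_cong) simp_all
 qed
 also have "\<dots> = integral\<^sup>L (PU (?I \<union> ?J)) (%om. ?G om (ray N (cir h (om (hh, False)))))"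
  using hh by (intro PU_fold[symmetric] bG) auto
 also have "?I \<union> ?J = insert (hh, False) (?A \<times> UNIV)" by (auto simp: UNIV_bool)
 also have "integral\<^sup>L (PU (insert (hh, False) (?A \<times> UNIV))) (%om. ?G om (ray N (cir h (om (hh, False)))))
  = integral\<^sup>L (PU (?A \<times> UNIV)) (%om. integral\<^sup>L U01 (%\<theta>. ?G (fun_upd om (hh, False) \<theta>) (ray N (cir h \<theta>))))"
  using hh by (subst PU_insert) (auto intro: bG)
 also have "\<dots> = integral\<^sup>L (PU (?A \<times> UNIV)) (%om. ?G om one_pt)"
 proof (rule Bochner_Integration.integral_cong[OF refl])
  fix om
  let ?c = "(\<Prod>a\<in>?A. 1 / ?T om a ^ k a) * WC ?A (?T om) (vv r om)"
  have u1: "vv r (fun_upd om (hh, False) \<theta>) = vv r om" for \<theta> by (auto simp: vv_def)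
  have cW: "?G (fun_upd om (hh, False) \<theta>) x = ?c * WX N Ps E ?A (?T om) (vv r om) x" for \<theta> x
  proof -
   have "?T (fun_upd om (hh, False) \<theta>) a = ?T om a" if "a \<in> ?A" for a using that hh by (auto simp: tt_def)
   note T = this
   have p: "(\<Prod>a\<in>?A. 1 / ?T (fun_upd om (hh, False) \<theta>) a ^ k a) = (\<Prod>a\<in>?A. 1 / ?T om a ^ k a)"
    by (rule prod.cong) (simp_all add: T)
   have wc: "WC ?A (?T (fun_upd om (hh, False) \<theta>)) (vv r om) = WC ?A (?T om) (vv r om)"
    by (rule WC_cong) (simp_all add: T)
   have wx: "WX N Ps E ?A (?T (fun_upd om (hh, False) \<theta>)) (vv r om) x = WX N Ps E ?A (?T om) (vv r om) x"
    by (rule WX_cong) (simp_all add: T)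
   show ?thesis unfolding u1 p wc wx mult.assoc ..
  qed
  have "(%h. WX N Ps E ?A (?T om) (vv r om) (ray N h)) holomorphic_on ball 0 (2 * h)"
  proof (rule holomorphic_WX_ray)
   fix a assume a: "a \<in> ?A"
   have "cmod (vv r om a) = r a" using r a unfolding radii_def by (intro norm_vv) auto
   then show "real N * (2 * h) < cmod (vv r om a)" using h(4)[OF a] by simp
  qed (use h in auto)
  then have "integral\<^sup>L U01 (%\<theta>. WX N Ps E ?A (?T om) (vv r om) (ray N (cir h \<theta>))) = WX N Ps E ?A (?T om) (vv r om) (ray N 0)"
   using h by (intro cir_avg_mean) auto
  moreover have "ray N 0 = one_pt" by (auto simp: ray_def one_pt_def)
  ultimately show "integral\<^sup>L U01 (%\<theta>. ?G (fun_upd om (hh, False) \<theta>) (ray N (cir h \<theta>))) = ?G om one_pt"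
   unfolding cW by simp
 qed
 finally show "integral\<^sup>L (PU ?I) (%om. (\<Prod>a\<in>?A. 1 / ?T om a ^ k a) *
   Dqs N (map (%a. exp (?T om a)) as) ?F (ray N (cir h (om (hh, False)))))
   = JJ N Ps E ?A k (%_. \<rho>) r"
  unfolding JJ_def .
qed

section \<open>Independence of the radius of the auxiliary circles\<close>

lemma expm1_quot:
 obtains E where "E holomorphic_on UNIV" "\<And>t. exp t - 1 = t * E t" "\<And>t. cmod t \<le> 1 / 4 ==> E t \<noteq> 0"
proof
 let ?E = "%z :: complex. if z = 0 then deriv exp 0 else (exp z - exp 0) / (z - 0)"
 show "?E holomorphic_on UNIV" by (rule pole_lemma) (auto intro: holomorphic_intros)
 have d: "deriv exp (0 :: complex) = 1" using DERIV_imp_deriv[OF DERIV_exp[of "0 :: complex"]] by simp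
 show "exp t - 1 = t * ?E t" for t by simp
 show "?E t \<noteq> 0" if "cmod t \<le> 1 / 4" for t
  using norm_expm1_ge[OF that] d by (auto split: if_splits)
qed

lemma holomorphic_WX_param:
 assumes hs: "\<And>a. a \<in> A ==> (%\<tau>. shw (t \<tau> a) (v a)) holomorphic_on S" and v: "\<And>a. a \<in> A ==> v a \<noteq> 0"
 shows "(%\<tau>. WX N Ps E A (t \<tau>) v one_pt) holomorphic_on S"
proof -
 have 1: "(%\<tau>. \<Prod>a\<in>A. \<Prod>j<N. (shw (t \<tau> a) (v a) - (one_pt j - 1)) / (v a - (one_pt j - 1))) holomorphic_on S"
  using v by (intro holomorphic_on_prod holomorphic_on_divide holomorphic_on_diff hs holomorphic_on_const) auto
 have 2: "(%\<tau>. lpoly Ps E (%n. psum N one_pt n + (\<Sum>a\<in>A. gch (t \<tau> a) (v a) n))) holomorphic_on S"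
  unfolding gch_def
  by (intro holomorphic_lpoly holomorphic_on_add holomorphic_on_sum holomorphic_on_diff holomorphic_on_power hs holomorphic_on_const)
 from holomorphic_on_mult[OF 1 holomorphic_on_compose[OF 2 holomorphic_on_exp, unfolded o_def]] show ?thesis unfolding WX_def .
qed

text \<open>As a function of t_c the integrand has its only pole at 0, of order at most k c + 1: the
  power t^(k c) and one more from 1/(e^t - 1). The average is therefore a Taylor coefficient of the
  remaining holomorphic function f, whatever the radius.\<close>

lemma JJ_update:
 assumes A: "finite A" "c \<in> A" and r: "radii A \<eta> r" and R: "R \<le> 1 / 4" "3 * R \<le> \<eta>"
  and \<rho>: "\<And>a. a \<in> A ==> 0 < \<rho> a" "\<And>a. a \<in> A ==> \<rho> a < R" and \<rho>1: "0 < \<rho>1" "\<rho>1 < R"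
 shows "JJ N Ps E A k (\<rho>(c := \<rho>1)) r = JJ N Ps E A k \<rho> r"
proof -
 obtain E1 where E1: "E1 holomorphic_on UNIV" "\<And>t. exp t - 1 = t * E1 t" "\<And>t. cmod t \<le> 1 / 4 ==> E1 t \<noteq> 0"
  using expm1_quot by metis
 let ?i = "(c, False)"
 let ?I = "A \<times> UNIV - {?i}"
 have I: "A \<times> UNIV = insert ?i ?I" using A by auto
 define f where "f om \<tau> = (\<Prod>a\<in>A - {c}. 1 / tt \<rho> om a ^ k a) *
   ((1 / E1 \<tau>) * (vv r om c / (1 + vv r om c)) * (\<Prod>a\<in>A - {c}. vv r om a / ((exp (tt \<rho> om a) - 1) * (1 + vv r om a))) *
   (\<Prod>a\<in>A. \<Prod>b\<in>{b\<in>A. a < b}. crs (((tt \<rho> om)(c := \<tau>)) a) (vv r om a) (((tt \<rho> om)(c := \<tau>)) b) (vv r om b)) *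
   WX N Ps E A ((tt \<rho> om)(c := \<tau>)) (vv r om) one_pt)" for om \<tau>
 have main: "JJ N Ps E A k \<rho>' r = integral\<^sup>L (PU ?I) (%om. (deriv ^^ Suc (k c)) (f om) 0 / fact (Suc (k c)))"
  if \<rho>': "\<And>a. a \<in> A ==> 0 < \<rho>' a" "\<And>a. a \<in> A ==> \<rho>' a < R" "\<And>a. a \<in> A ==> a \<noteq> c ==> \<rho>' a = \<rho> a" for \<rho>'
 proof -
  let ?G = "%om. (\<Prod>a\<in>A. 1 / tt \<rho>' om a ^ k a) *
   (WC A (tt \<rho>' om) (vv r om) * WX N Ps E A (tt \<rho>' om) (vv r om) one_pt)"
  have Rl: "\<rho>' a \<le> 1 / 4" "3 * \<rho>' a \<le> \<eta>" if "a \<in> A" for a using \<rho>'(2)[OF that] R by auto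
  have bG: "bmeas (PU (insert ?i ?I)) ?G"
   unfolding I[symmetric] using \<rho>'(1) Rl r
   by (intro moment_weight_bmeas[OF A(1) r, where B = 0]) (auto simp: radii_def)
  have "JJ N Ps E A k \<rho>' r = integral\<^sup>L (PU (insert ?i ?I)) ?G" unfolding JJ_def I[symmetric] ..
  also have "\<dots> = integral\<^sup>L (PU ?I) (%om. integral\<^sup>L U01 (%\<theta>. ?G (fun_upd om ?i \<theta>)))"
   using A by (intro PU_insert bG) auto
  also have "\<dots> = integral\<^sup>L (PU ?I) (%om. (deriv ^^ Suc (k c)) (f om) 0 / fact (Suc (k c)))"
  proof (rule Bochner_Integration.integral_cong[OF refl])
   fix om
   let ?v = "vv r om"
   have nv: "cmod (?v a) = r a" if "a \<in> A" for a using r that unfolding radii_def by (intro norm_vv) auto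
   have eq: "?G (fun_upd om ?i \<theta>) = f om (cir (\<rho>' c) \<theta>) / cir (\<rho>' c) \<theta> ^ Suc (k c)" for \<theta>
   proof -
    let ?t = "tt \<rho>' (fun_upd om ?i \<theta>)" and ?\<tau> = "cir (\<rho>' c) \<theta>"
    have tc: "?t c = ?\<tau>" by (simp add: tt_def)
    have ta: "?t a = tt \<rho> om a" if "a \<in> A" "a \<noteq> c" for a using that \<rho>'(3) by (simp add: tt_def)
    have tu: "?t a = ((tt \<rho> om)(c := ?\<tau>)) a" if "a \<in> A" for a using ta[OF that] tc by simp
    have va: "vv r (fun_upd om ?i \<theta>) = ?v" by (auto simp: vv_def)
    have 1: "(\<Prod>a\<in>A. 1 / ?t a ^ k a) = 1 / ?\<tau> ^ k c * (\<Prod>a\<in>A - {c}. 1 / tt \<rho> om a ^ k a)"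
     using A by (subst prod.remove[of _ c]) (auto simp: tc ta intro!: prod.cong)
    have 2: "(\<Prod>a\<in>A. ?v a / ((exp (?t a) - 1) * (1 + ?v a)))
     = ?v c / ((?\<tau> * E1 ?\<tau>) * (1 + ?v c)) * (\<Prod>a\<in>A - {c}. ?v a / ((exp (tt \<rho> om a) - 1) * (1 + ?v a)))"
     using A by (subst prod.remove[of _ c]) (auto simp: tc ta E1(2) intro!: prod.cong)
    have 3: "(\<Prod>a\<in>A. \<Prod>b\<in>{b\<in>A. a < b}. crs (?t a) (?v a) (?t b) (?v b))
     = (\<Prod>a\<in>A. \<Prod>b\<in>{b\<in>A. a < b}. crs (((tt \<rho> om)(c := ?\<tau>)) a) (?v a) (((tt \<rho> om)(c := ?\<tau>)) b) (?v b))"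
     by (intro prod.cong refl) (simp_all only: tu mem_Collect_eq)
    have 4: "WX N Ps E A ?t ?v one_pt = WX N Ps E A ((tt \<rho> om)(c := ?\<tau>)) ?v one_pt"
     by (rule WX_cong[OF tu refl])
    show ?thesis unfolding va WC_def 1 2 3 4 f_def by (simp add: mult_ac)
   qed
   have hol: "f om holomorphic_on ball 0 R"
   proof -
    have tb: "cmod (exp (((tt \<rho> om)(c := \<tau>)) a) - 1) \<le> \<eta>" if "a \<in> A" "\<tau> \<in> ball 0 R" for a and \<tau> :: complex
    proof -
     have "cmod (((tt \<rho> om)(c := \<tau>)) a) < R"
      using that \<rho>(1,2)[OF that(1)] by (simp add: tt_def)
     then show ?thesis using norm_expm1_le[of "((tt \<rho> om)(c := \<tau>)) a"] R by linarith
    qed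
    have ht: "(%\<tau>. ((tt \<rho> om)(c := \<tau>)) a) holomorphic_on ball 0 R" for a
     by (cases "a = c") (auto intro: holomorphic_intros)
    have hs: "(%\<tau>. shw (((tt \<rho> om)(c := \<tau>)) a) (?v a)) holomorphic_on ball 0 R" for a
     unfolding shw_def by (intro holomorphic_intros ht)
    have hc: "(%\<tau>. crs (((tt \<rho> om)(c := \<tau>)) a) (?v a) (((tt \<rho> om)(c := \<tau>)) b) (?v b)) holomorphic_on ball 0 R"
     if ab: "a \<in> A" "b \<in> A" "a < b" for a b
     unfolding crs_def
    proof (intro holomorphic_on_divide holomorphic_on_mult holomorphic_on_diff hs holomorphic_on_const)
     fix \<tau> :: complex assume t: "\<tau> \<in> ball 0 R"
     have "\<eta> > 0" using r by (simp add: radii_def)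
     then show "(?v a - shw (((tt \<rho> om)(c := \<tau>)) b) (?v b)) * (shw (((tt \<rho> om)(c := \<tau>)) a) (?v a) - ?v b) \<noteq> 0"
      using radii_low[OF r ab tb[OF ab(1) t] tb[OF ab(2) t] nv[OF ab(1)] nv[OF ab(2)]] by auto
    qed
    have hW: "(%\<tau>. WX N Ps E A ((tt \<rho> om)(c := \<tau>)) ?v one_pt) holomorphic_on ball 0 R"
    proof (rule holomorphic_WX_param[OF hs])
     fix a assume "a \<in> A"
     then show "?v a \<noteq> 0" using nv[of a] r unfolding radii_def by force
    qed
    have hE: "E1 holomorphic_on ball 0 R" using E1(1) by (rule holomorphic_on_subset) auto
    show ?thesis
     unfolding f_def using R E1(3)
     by (intro holomorphic_on_mult holomorphic_on_const hW holomorphic_on_prod hc holomorphic_on_divide hE) auto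
   qed
   show "integral\<^sup>L U01 (%\<theta>. ?G (fun_upd om ?i \<theta>)) = (deriv ^^ Suc (k c)) (f om) 0 / fact (Suc (k c))"
    unfolding eq using \<rho>'(1,2)[OF A(2)] by (intro cir_avg_deriv[OF hol])
  qed
  finally show ?thesis .
 qed
 show ?thesis
  using main[of "\<rho>(c := \<rho>1)"] main[of \<rho>] \<rho> \<rho>1 by auto
qed

lemma JJ_radius:
 assumes A: "finite A" and r: "radii A \<eta> r" and R: "R \<le> 1 / 4" "3 * R \<le> \<eta>"
  and \<rho>: "\<And>a. a \<in> A ==> 0 < \<rho> a \<and> \<rho> a < R" "\<And>a. a \<in> A ==> 0 < \<rho>' a \<and> \<rho>' a < R"
 shows "JJ N Ps E A k \<rho>' r = JJ N Ps E A k \<rho> r"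
proof -
 have "JJ N Ps E A k (%a. if a \<in> S then \<rho>' a else \<rho> a) r = JJ N Ps E A k \<rho> r" if "finite S" "S \<subseteq> A" for S
  using that
 proof (induction S rule: finite_induct)
  case (insert c S)
  have "(%a. if a \<in> insert c S then \<rho>' a else \<rho> a) = (%a. if a \<in> S then \<rho>' a else \<rho> a)(c := \<rho>' c)" by auto
  moreover have "JJ N Ps E A k ((%a. if a \<in> S then \<rho>' a else \<rho> a)(c := \<rho>' c)) r = JJ N Ps E A k (%a. if a \<in> S then \<rho>' a else \<rho> a) r"
   using insert.prems \<rho> by (intro JJ_update[OF A _ r R]) auto
  ultimately show ?case using insert.IH insert.prems by simp
 qed simp
 from this[OF A order_refl] have "JJ N Ps E A k (%a. if a \<in> A then \<rho>' a else \<rho> a) r = JJ N Ps E A k \<rho> r" .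
 moreover have "JJ N Ps E A k (%a. if a \<in> A then \<rho>' a else \<rho> a) r = JJ N Ps E A k \<rho>' r"
  unfolding JJ_def
  by (intro Bochner_Integration.integral_cong refl arg_cong2[where f = "(*)"] prod.cong WC_cong WX_cong) (auto simp: tt_def)
 ultimately show ?thesis by simp
qed

text \<open>The scale at which the moments are read off: all points of evaluation stay within
 distance of order h of (1,...,1), so only the jet of the generating function matters.\<close>

lemma moment_compare:
 assumes N: "N > 0" and sorted: "sorted_wrt (<) as" and L: "finite L"
  and \<kappa>: "\<kappa> = 1 / (12 * (real (length as) + 1))" and r: "radii (set as) (3 * (\<kappa> * h)) r"
  and h: "0 < h" "(real N + 1) * h \<le> 1 / 2" "\<And>a. a \<in> set as ==> 2 * (real N * h) < r a"
  and M: "0 \<le> M" "\<And>y. (\<And>j. j < N ==> cmod (y j - 1) < (real N + 1) * h) ==> (\<And>j. j \<ge> N ==> y j = 1) ==>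
   cmod ((\<Sum>l\<in>L. c l * schur N l y) - b * exp (lpoly Ps E (psum N y))) \<le> M"
 shows "cmod ((\<Sum>l\<in>L. c l * (schur N l one_pt * (\<Prod>a\<in>set as. of_real (p_k N (k a) l) / fact (k a))))
   - b * JJ N Ps E (set as) k (%_. \<kappa> * h) r) \<le> (real N * 2 ^ N) ^ length as * M / (\<kappa> * h) ^ (\<Sum>a\<in>set as. k a)"
proof -
 let ?A = "set as" and ?F = "%x. exp (lpoly Ps E (psum N x))"
 define \<rho> where "\<rho> = \<kappa> * h"
 define \<eta> where "\<eta> = 3 * \<rho>"
 obtain hh where hh: "hh \<notin> ?A" using ex_new_if_finite[of ?A] by auto
 have \<kappa>0: "\<kappa> > 0" "\<kappa> \<le> 1 / 12" unfolding \<kappa> by (auto simp: field_simps)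
 have h1: "h \<le> 1 / 2"
 proof -
  have "1 * h \<le> (real N + 1) * h" using h(1) by (intro mult_right_mono) auto
  then show ?thesis using h(2) by simp
 qed
 have \<rho>: "\<rho> > 0" "\<rho> \<le> 1 / 4"
 proof -
  show "\<rho> > 0" using \<kappa>0 h by (simp add: \<rho>_def)
  have "\<rho> \<le> 1 / 12 * (1 / 2)" unfolding \<rho>_def using \<kappa>0 h h1 by (intro mult_mono) auto
  then show "\<rho> \<le> 1 / 4" by simp
 qed
 \<comment> \<open>The 12 in kappa comes from eta = 3 * kappa * h: the total displacement 2 * eta *
   (length as + 1) is then exactly h / 2, below the gap h between the coordinates of the
   ray.\<close>
 have \<eta>: "\<eta> > 0" "2 * \<eta> * (real (length as) + 1) \<le> h"
 proof -
  have "2 * \<eta> * (real (length as) + 1) = h / 2" unfolding \<eta>_def \<rho>_def \<kappa> by (simp add: field_simps)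
  then show "2 * \<eta> * (real (length as) + 1) \<le> h" using h by simp
 qed (use \<rho> in \<open>simp add: \<eta>_def\<close>)
 let ?T = "tt (%_. \<rho>)" and ?I = "insert (hh, False) (?A \<times> {False})"
 have nt: "cmod (?T om a) = \<rho>" for om a by (rule norm_tt) (rule \<rho>)
 have e1: "cmod (exp (?T om a) - 1) \<le> \<eta>" for om a
  using norm_expm1_le[of "?T om a"] nt[of om a] \<rho> by (simp add: \<eta>_def)
 have sp: "spread N h (real N * h) (ray N (cir h \<theta>))" for \<theta>
  using ray_spread[OF N, of "cir h \<theta>"] cir_nonzero[OF h(1)] h(1) by simp
 have BB: "real N * h + 2 * \<eta> * real (length as) \<le> (real N + 1) * h"
  using \<eta> by (simp add: algebra_simps)
 let ?qs = "%om. map (%a. exp (?T om a)) as"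
 let ?x = "%om. ray N (cir h (om (hh, False)))"
 let ?pre = "%om. \<Prod>a\<in>?A. 1 / ?T om a ^ k a"
 have dist: "distinct as" using sorted by (simp add: strict_sorted_iff)
 have ds: "Dqs N (?qs om) (schur N l) (?x om) = (\<Prod>a\<in>?A. \<Sum>j<N. exp (?T om a) powi sig_exp N l j) * schur N l (?x om)" for om l
  using e1 BB h(2) \<eta> dist
  by (subst Dqs_schur[OF _ sp \<eta>(1)]) (auto simp: prod.distinct_set_conv_list o_def)
 note S = moment_integral_schur[OF N finite_set hh h(1) _ \<rho>(1), of k, folded ds]
 have Nh: "real N * h < 1 / 2" using h by (simp add: algebra_simps)
 have r': "radii ?A \<eta> r" using r by (simp add: \<eta>_def \<rho>_def)
 note X = moment_integral_exp[OF N sorted hh \<eta>_def \<rho> r' h(1) \<eta>(2) h(2,3), of k Ps E]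
 have "(\<Sum>l\<in>L. c l * (schur N l one_pt * (\<Prod>a\<in>?A. of_real (p_k N (k a) l) / fact (k a)))) - b * JJ N Ps E ?A k (%_. \<rho>) r
  = (\<Sum>l\<in>L. c l * integral\<^sup>L (PU ?I) (%om. ?pre om * Dqs N (?qs om) (schur N l) (?x om)))
   - b * integral\<^sup>L (PU ?I) (%om. ?pre om * Dqs N (?qs om) ?F (?x om))"
  using S(2)[OF Nh] X(2) by simp
 also have "\<dots> = integral\<^sup>L (PU ?I) (%om. (\<Sum>l\<in>L. c l * (?pre om * Dqs N (?qs om) (schur N l) (?x om))) - b * (?pre om * Dqs N (?qs om) ?F (?x om)))"
 proof -
  have i1: "integrable (PU ?I) (%om. c l * (?pre om * Dqs N (?qs om) (schur N l) (?x om)))" for l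
   by (intro bmeas_PU_integrable bconv_mult bmeas_const S(1)[OF Nh])
  have i2: "integrable (PU ?I) (%om. b * (?pre om * Dqs N (?qs om) ?F (?x om)))"
   by (intro bmeas_PU_integrable bconv_mult bmeas_const X(1))
  show ?thesis
   by (subst Bochner_Integration.integral_diff[OF Bochner_Integration.integrable_sum[OF i1] i2], subst Bochner_Integration.integral_sum[OF i1]) simp
 qed
 also have "\<dots> = integral\<^sup>L (PU ?I) (%om. ?pre om * Dqs N (?qs om) (%x. (\<Sum>l\<in>L. c l * schur N l x) - b * ?F x) (?x om))"
  unfolding Dqs_linear[OF L] by (simp add: right_diff_distrib sum_distrib_left mult_ac)
 also have "cmod \<dots> \<le> (real N * 2 ^ N) ^ length as * M / \<rho> ^ (\<Sum>a\<in>?A. k a)"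
 proof (rule integral_norm_bound_prob[OF prob_PU])
  fix om
  have "cmod (Dqs N (?qs om) (%x. (\<Sum>l\<in>L. c l * schur N l x) - b * ?F x) (?x om)) \<le> (real N * 2 ^ N) ^ length (?qs om) * M"
   using e1 \<eta> BB h(2) M
   by (intro Dqs_bound[where B' = "(real N + 1) * h", OF _ sp \<eta>(1)]) (auto simp: ray_def)
  moreover have "cmod (?pre om) = 1 / \<rho> ^ (\<Sum>a\<in>?A. k a)"
   by (simp add: prod_norm[symmetric] norm_divide norm_power nt power_sum prod_dividef)
  ultimately show "cmod (?pre om * Dqs N (?qs om) (%x. (\<Sum>l\<in>L. c l * schur N l x) - b * ?F x) (?x om))
   \<le> (real N * 2 ^ N) ^ length as * M / \<rho> ^ (\<Sum>a\<in>?A. k a)"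
   using \<rho>(1) by (simp add: norm_mult divide_right_mono)
 qed
 finally show ?thesis unfolding \<rho>_def .
qed

section \<open>The exact moment formula and existence of moments\<close>

lemma eventually_small:
 fixes c b :: real
 assumes "b > 0"
 shows "eventually (%h. c * h < b) (at_right 0)"
proof -
 have "((%h. c * h) \<longlongrightarrow> c * 0) (at_right 0)" by (intro tendsto_intros)
 then show ?thesis using assms by (intro order_tendstoD(2)[of _ 0]) auto
qed

lemma sgf_unif_close:
 assumes "SGF_unif_conv N \<rho>"
 obtains R where "R > 0" "\<And>e. e > 0 ==> eventually (%L. \<forall>x\<in>polydisc N R. cmod ((\<Sum>l\<in>L. sgf_term N \<rho> l x) - SGF N \<rho> x) < e)
  (finite_subsets_at_top (set_pmf \<rho>))"
 using assms unfolding SGF_unif_conv_def uniform_limit_iff dist_norm by blast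

lemma radii_exists:
 assumes "finite (A :: nat set)"
 shows "\<exists>\<eta> r. radii A \<eta> r"
proof -
 obtain m where m: "A \<subseteq> {..<m}" using assms finite_nat_set_iff_bounded by (metis lessThan_iff subsetI)
 define \<eta> where "\<eta> = 1 / (4 * real m + 1)"
 have \<eta>: "\<eta> > 0" "\<eta> * (4 * real m + 1) = 1" unfolding \<eta>_def by (auto simp: field_simps)
 have "radii A \<eta> (%a. 4 * \<eta> * (real a + 1))"
  unfolding radii_def
 proof (intro conjI ballI impI)
  fix a assume a: "a \<in> A"
  show "0 < 4 * \<eta> * (real a + 1)" using \<eta> by simp
  have "real a + 1 \<le> real m" using a m by (auto simp: less_eq_Suc_le[symmetric] Suc_le_eq)
  then have "4 * \<eta> * (real a + 1) \<le> 4 * \<eta> * real m" using \<eta> by (intro mult_left_mono) auto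
  then show "4 * \<eta> * (real a + 1) + \<eta> \<le> 1" using \<eta>(2) by (simp add: algebra_simps)
  fix b assume "b \<in> A" "a < b"
  then have "4 * \<eta> * (real a + 2) \<le> 4 * \<eta> * (real b + 1)" using \<eta> by (intro mult_left_mono) auto
  then show "4 * \<eta> * (real a + 1) + 4 * \<eta> \<le> 4 * \<eta> * (real b + 1)" by (simp add: algebra_simps)
 qed (use \<eta> in auto)
 then show ?thesis by blast
qed

lemma scale_exists:
 fixes \<eta> R d R1 c \<epsilon> \<kappa> :: real
 assumes A: "finite A" and pos: "\<eta> > 0" "R > 0" "d > 0" "R1 > 0" "\<epsilon> > 0" and r: "\<And>a. a \<in> A ==> r a > 0"
 obtains h where "0 < h" "h \<le> 1" "(real N + 1) * h \<le> 1 / 2" "\<And>a. a \<in> A ==> 2 * (real N * h) < r a"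
  "3 * (\<kappa> * h) \<le> \<eta>" "\<kappa> * h < R" "(real N + 1) * h < d" "(real N + 1) * h < R1" "c * h < \<epsilon>"
proof -
 have "eventually (%h. \<forall>a\<in>A. (2 * real N) * h < r a) (at_right 0)"
  using A r by (intro eventually_ball_finite ballI eventually_small) auto
 then have "eventually (%h. 0 < h \<and> 1 * h < 1 \<and> (real N + 1) * h < 1 / 2 \<and> (\<forall>a\<in>A. (2 * real N) * h < r a) \<and>
  (3 * \<kappa>) * h < \<eta> \<and> \<kappa> * h < R \<and> (real N + 1) * h < d \<and> (real N + 1) * h < R1 \<and> c * h < \<epsilon>) (at_right 0)"
  using pos by (intro eventually_conj eventually_small eventually_at_right_less) auto
 then obtain h where "0 < h \<and> 1 * h < 1 \<and> (real N + 1) * h < 1 / 2 \<and> (\<forall>a\<in>A. (2 * real N) * h < r a) \<and>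
  (3 * \<kappa>) * h < \<eta> \<and> \<kappa> * h < R \<and> (real N + 1) * h < d \<and> (real N + 1) * h < R1 \<and> c * h < \<epsilon>"
  using eventually_happens'[OF trivial_limit_at_right_real] by blast
 then show ?thesis by (intro that[of h]) (auto simp: mult.assoc)
qed

lemma normalized_term:
 assumes "schur N l one_pt \<noteq> 0"
 shows "of_real (pmf \<rho> l) / schur N l one_pt * (schur N l one_pt * (\<Prod>a\<in>A. of_real (p_k N (k a) l) / fact (k a)))
  = complex_of_real (pmf \<rho> l * (\<Prod>a\<in>A. p_k N (k a) l)) / (\<Prod>a\<in>A. fact (k a))"
 using assms by (simp add: prod_dividef)

text \<open>The t-circles shrink with h, so extracting s = sum of the k a derivatives costs h^(-s).
  The jet error is O(h^(K+1)), and K >= s leaves a positive power of h, while the main term does not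
  depend on h by \<open>JJ_radius\<close>. Letting h tend to 0 removes the error altogether.\<close>

lemma exact_formula:
 assumes N: "N > 0" and supp: "set_pmf \<rho> \<subseteq> GT N" and conv: "SGF_unif_conv N \<rho>"
  and A: "finite A" and r: "radii A \<eta> r"
  and jet: "\<exists>d>0. \<exists>C. \<forall>u \<delta>. (\<forall>j\<ge>N. u j = 0) \<longrightarrow> (\<forall>j<N. cmod (u j) \<le> \<delta>) \<longrightarrow> \<delta> < d \<longrightarrow>
   cmod (SGF N \<rho> (%j. 1 + u j) - exp (lpoly Ps E (psum N (%j. 1 + u j)))) \<le> C * \<delta> ^ Suc K"
  and K: "(\<Sum>a\<in>A. k a) \<le> K"
  and \<rho>t: "\<And>a. a \<in> A ==> 0 < \<rho>t a \<and> \<rho>t a < R" "R \<le> 1 / 4" "3 * R \<le> \<eta>" "R > 0"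
 shows "((%l. complex_of_real (pmf \<rho> l * (\<Prod>a\<in>A. p_k N (k a) l))) has_sum
  ((\<Prod>a\<in>A. fact (k a)) * JJ N Ps E A k \<rho>t r)) (set_pmf \<rho>)"
proof -
 define as where "as = sorted_list_of_set A"
 have as: "sorted_wrt (<) as" "set as = A" using A by (auto simp: as_def strict_sorted_list_of_set)
 define \<kappa> where "\<kappa> = 1 / (12 * (real (length as) + 1))"
 have \<kappa>: "\<kappa> > 0" by (simp add: \<kappa>_def add_nonneg_pos)
 define s where "s = (\<Sum>a\<in>A. k a)"
 define D where "D = (real N * 2 ^ N) ^ length as / \<kappa> ^ s"
 have D: "D > 0" using N \<kappa> by (simp add: D_def)
 let ?F = "%x. exp (lpoly Ps E (psum N x))"
 obtain R1 where R1: "R1 > 0" "\<And>e. e > 0 ==> eventually (%L. \<forall>x\<in>polydisc N R1. cmod ((\<Sum>l\<in>L. sgf_term N \<rho> l x) - SGF N \<rho> x) < e)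
  (finite_subsets_at_top (set_pmf \<rho>))" using sgf_unif_close[OF conv] by blast
 obtain d C where d: "d > 0" and C0: "\<And>u \<delta>. (\<forall>j\<ge>N. u j = 0) ==> (\<forall>j<N. cmod (u j) \<le> \<delta>) ==> \<delta> < d ==>
   cmod (SGF N \<rho> (%j. 1 + u j) - ?F (%j. 1 + u j)) \<le> C * \<delta> ^ Suc K"
  using jet by blast
 let ?c = "%l. of_real (pmf \<rho> l) / schur N l one_pt"
 let ?t = "%l. ?c l * (schur N l one_pt * (\<Prod>a\<in>A. of_real (p_k N (k a) l) / fact (k a)))"
 define C' where "C' = \<bar>C\<bar> * (real N + 1) ^ Suc K"
 have lim: "(sum ?t \<longlongrightarrow> JJ N Ps E A k \<rho>t r) (finite_subsets_at_top (set_pmf \<rho>))"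
 proof (rule tendstoI)
  fix \<epsilon> :: real assume \<epsilon>: "\<epsilon> > 0"
  obtain h where h: "0 < h" "h \<le> 1" "(real N + 1) * h \<le> 1 / 2" "\<And>a. a \<in> A ==> 2 * (real N * h) < r a"
   "3 * (\<kappa> * h) \<le> \<eta>" "\<kappa> * h < R" "(real N + 1) * h < d" "(real N + 1) * h < R1" "(D * C') * h < \<epsilon> / 2"
  proof (rule scale_exists[OF A _ \<rho>t(4) d R1(1)])
   show "\<eta> > 0" "\<epsilon> / 2 > 0" using r \<epsilon> by (auto simp: radii_def)
   show "0 < r a" if "a \<in> A" for a using r that by (auto simp: radii_def)
  qed (rule that)
  \<comment> \<open>The tolerance of the uniform convergence is fixed after h, so that after
    division by h^s and multiplication by D it contributes exactly epsilon / 2.\<close>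
  define e where "e = \<epsilon> / 2 * h ^ s / D"
  have e: "e > 0" using \<epsilon> h D by (simp add: e_def)
  have "eventually (%L. finite L \<and> L \<subseteq> set_pmf \<rho>) (finite_subsets_at_top (set_pmf \<rho>))"
   by (rule eventually_finite_subsets_at_top_weakI) auto
  then show "eventually (%L. dist (sum ?t L) (JJ N Ps E A k \<rho>t r) < \<epsilon>) (finite_subsets_at_top (set_pmf \<rho>))"
   using R1(2)[OF e]
  proof eventually_elim
   case (elim L)
   let ?M = "e + C' * h ^ Suc K"
   have "cmod (sum ?t L - 1 * JJ N Ps E (set as) k (%_. \<kappa> * h) r) \<le> (real N * 2 ^ N) ^ length as * ?M / (\<kappa> * h) ^ (\<Sum>a\<in>set as. k a)"
    unfolding as(2)[symmetric]
   proof (rule moment_compare[OF N as(1) _ \<kappa>_def])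
    show "finite L" using elim by simp
    show "radii (set as) (3 * (\<kappa> * h)) r"
     unfolding as by (rule radii_shrink[OF r]) (use h \<kappa> in auto)
    show "2 * (real N * h) < r a" if "a \<in> set as" for a using h(4) that as by simp
    show "0 \<le> ?M" using e h by (simp add: C'_def)
    fix y :: "nat => complex"
    assume y: "\<And>j. j < N ==> cmod (y j - 1) < (real N + 1) * h" "\<And>j. j \<ge> N ==> y j = 1"
    have "y \<in> polydisc N R1" using y(1) h(8) unfolding polydisc_def by (auto intro: less_trans)
    then have 1: "cmod ((\<Sum>l\<in>L. sgf_term N \<rho> l y) - SGF N \<rho> y) < e" using elim by blast
    have "cmod (SGF N \<rho> (%j. 1 + (y j - 1)) - ?F (%j. 1 + (y j - 1))) \<le> C * ((real N + 1) * h) ^ Suc K"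
     using y h(7) by (intro C0) (auto intro: less_imp_le)
    also have "\<dots> \<le> C' * h ^ Suc K"
     unfolding C'_def power_mult_distrib mult.assoc[symmetric] using h(1) by (intro mult_right_mono) auto
    finally have 2: "cmod (SGF N \<rho> y - ?F y) \<le> C' * h ^ Suc K" by simp
    have eq: "(\<Sum>l\<in>L. ?c l * schur N l y) - 1 * ?F y = ((\<Sum>l\<in>L. sgf_term N \<rho> l y) - SGF N \<rho> y) + (SGF N \<rho> y - ?F y)"
     by (simp add: sgf_term_def)
    show "cmod ((\<Sum>l\<in>L. ?c l * schur N l y) - 1 * ?F y) \<le> ?M"
     unfolding eq using 1 2 norm_triangle_ineq[of "(\<Sum>l\<in>L. sgf_term N \<rho> l y) - SGF N \<rho> y" "SGF N \<rho> y - ?F y"] by linarith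
   qed (use h in auto)
   also have "JJ N Ps E (set as) k (%_. \<kappa> * h) r = JJ N Ps E A k \<rho>t r"
    unfolding as using h \<kappa> \<rho>t by (intro JJ_radius[OF A r \<rho>t(2,3)]) auto
   also have "(real N * 2 ^ N) ^ length as * ?M / (\<kappa> * h) ^ (\<Sum>a\<in>set as. k a) = D * (e / h ^ s) + D * C' * (h ^ Suc K / h ^ s)"
    unfolding as D_def s_def by (simp add: power_mult_distrib algebra_simps add_divide_distrib)
   also have "D * (e / h ^ s) = \<epsilon> / 2" using D h by (simp add: e_def)
   also have "h ^ Suc K / h ^ s = h ^ (Suc K - s)"
    using K h by (simp add: s_def power_diff)
   also have "D * C' * h ^ (Suc K - s) \<le> D * C' * h"
   proof (rule mult_left_mono)
    have "h ^ (Suc K - s) \<le> h ^ 1" using h K by (intro power_decreasing) (auto simp: s_def)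
    then show "h ^ (Suc K - s) \<le> h" by simp
   qed (use D in \<open>simp add: C'_def\<close>)
   finally have "cmod (sum ?t L - JJ N Ps E A k \<rho>t r) < \<epsilon>" unfolding mult_1 using h(9) by linarith
   then show ?case by (simp add: dist_norm)
  qed
 qed
 have eq: "?t l = complex_of_real (pmf \<rho> l * (\<Prod>a\<in>A. p_k N (k a) l)) / (\<Prod>a\<in>A. fact (k a))" if "l \<in> set_pmf \<rho>" for l
  by (rule normalized_term, rule schur_one_nonzero) (use supp that in auto)
 have "(?t has_sum JJ N Ps E A k \<rho>t r) (set_pmf \<rho>)" using lim by (simp add: has_sum_def)
 then have "((%l. complex_of_real (pmf \<rho> l * (\<Prod>a\<in>A. p_k N (k a) l)) / (\<Prod>a\<in>A. fact (k a))) has_sum JJ N Ps E A k \<rho>t r) (set_pmf \<rho>)"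
  using eq by (simp cong: has_sum_cong)
 moreover have "(\<Prod>a\<in>A. fact (k a) :: complex) \<noteq> 0" using A by simp
 ultimately show ?thesis
  using has_sum_cmult_right[of "%l. complex_of_real (pmf \<rho> l * (\<Prod>a\<in>A. p_k N (k a) l)) / (\<Prod>a\<in>A. fact (k a))" _ _ "\<Prod>a\<in>A. fact (k a)"]
  by simp
qed

text \<open>Split a finite set into the nonnegative and the negative terms; each part is itself an
  admissible partial sum.\<close>

lemma bounded_partial_sums_abs_summable:
 fixes f :: "'a => real"
 assumes "\<And>F. finite F ==> F \<subseteq> S ==> \<bar>sum f F\<bar> \<le> B"
 shows "(%x. norm (f x)) summable_on S"
proof (rule nonneg_bdd_above_summable_on)
 show "bdd_above (sum (%x. norm (f x)) ` {F. F \<subseteq> S \<and> finite F})"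
 proof (rule bdd_aboveI2)
  fix F assume F: "F \<in> {F. F \<subseteq> S \<and> finite F}"
  let ?P = "{x \<in> F. f x \<ge> 0}" and ?Q = "{x \<in> F. f x < 0}"
  have "F = ?P \<union> ?Q" by auto
  then have "sum (%x. norm (f x)) F = sum (%x. norm (f x)) (?P \<union> ?Q)" by simp
  also have "\<dots> = sum (%x. norm (f x)) ?P + sum (%x. norm (f x)) ?Q"
   using F by (intro sum.union_disjoint) auto
  also have "\<dots> = sum f ?P - sum f ?Q"
   unfolding sum_negf[symmetric] diff_conv_add_uminus by (intro arg_cong2[where f = "(+)"] sum.cong) auto
  also have "\<dots> \<le> 2 * B"
  proof -
   have "?P \<subseteq> S" "?Q \<subseteq> S" "finite ?P" "finite ?Q" using F by auto
   then show ?thesis using assms[of ?P] assms[of ?Q] by linarith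
  qed
  finally show "sum (%x. norm (f x)) F \<le> 2 * B" .
 qed
qed simp

text \<open>The comparison is used with b = 0. Outside a finite set L0 all finite subsums of the
  generating function are bounded by 2 on one polydisc, and the operators turn this into a bound on
  finite subsums of the moments that does not depend on the subset.\<close>

lemma moments_summable:
 assumes N: "N > 0" and supp: "set_pmf \<rho> \<subseteq> GT N" and conv: "SGF_unif_conv N \<rho>" and A: "finite (A :: nat set)"
 shows "(%l. norm (pmf \<rho> l * (\<Prod>a\<in>A. p_k N (k a) l))) summable_on (set_pmf \<rho>)"
proof -
 define as where "as = sorted_list_of_set A"
 have as: "sorted_wrt (<) as" "set as = A" using A by (auto simp: as_def strict_sorted_list_of_set)
 obtain \<eta> r where r: "radii A \<eta> r" using radii_exists[OF A] by blast
 define \<kappa> where "\<kappa> = 1 / (12 * (real (length as) + 1))"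
 have \<kappa>: "\<kappa> > 0" by (simp add: \<kappa>_def add_nonneg_pos)
 obtain R1 where R1: "R1 > 0" "\<And>e. e > 0 ==> eventually (%L. \<forall>x\<in>polydisc N R1. cmod ((\<Sum>l\<in>L. sgf_term N \<rho> l x) - SGF N \<rho> x) < e)
  (finite_subsets_at_top (set_pmf \<rho>))" using sgf_unif_close[OF conv] by blast
 have \<eta>0: "\<eta> > 0" and r0: "\<And>a. a \<in> A ==> 0 < r a" and one: "(0 :: real) < 1"
  using r by (auto simp: radii_def)
 obtain h where h: "0 < h" "(real N + 1) * h \<le> 1 / 2" "\<And>a. a \<in> A ==> 2 * (real N * h) < r a"
   "3 * (\<kappa> * h) \<le> \<eta>" "(real N + 1) * h < R1"
  by (rule scale_exists[where N = N and \<kappa> = \<kappa> and c = 0 and r = r, OF A \<eta>0 one one R1(1) one r0]) (blast, rule that)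
 let ?f = "%l. pmf \<rho> l * (\<Prod>a\<in>A. p_k N (k a) l)"
 let ?c = "%l. of_real (pmf \<rho> l) / schur N l one_pt"
 define B where "B = (real N * 2 ^ N) ^ length as * 2 / (\<kappa> * h) ^ (\<Sum>a\<in>set as. k a) * (\<Prod>a\<in>A. fact (k a))"
 obtain L0 where L0: "finite L0" "L0 \<subseteq> set_pmf \<rho>"
  "\<And>L x. finite L ==> L0 \<subseteq> L ==> L \<subseteq> set_pmf \<rho> ==> x \<in> polydisc N R1 ==> cmod ((\<Sum>l\<in>L. sgf_term N \<rho> l x) - SGF N \<rho> x) < 1"
  using R1(2)[of 1] unfolding eventually_finite_subsets_at_top by auto
 have "(%l. norm (?f l)) summable_on (set_pmf \<rho> - L0)"
 proof (rule bounded_partial_sums_abs_summable)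
  fix L assume L: "finite L" "L \<subseteq> set_pmf \<rho> - L0"
  have "cmod ((\<Sum>l\<in>L. ?c l * (schur N l one_pt * (\<Prod>a\<in>set as. of_real (p_k N (k a) l) / fact (k a))))
   - 0 * JJ N {} (%_. 0) (set as) k (%_. \<kappa> * h) r) \<le> (real N * 2 ^ N) ^ length as * 2 / (\<kappa> * h) ^ (\<Sum>a\<in>set as. k a)"
  proof (rule moment_compare[OF N as(1) L(1) \<kappa>_def])
   show "radii (set as) (3 * (\<kappa> * h)) r"
    unfolding as by (rule radii_shrink[OF r]) (use h \<kappa> in auto)
   show "2 * (real N * h) < r a" if "a \<in> set as" for a using h(3) that as by simp
   fix y :: "nat => complex"
   assume y: "\<And>j. j < N ==> cmod (y j - 1) < (real N + 1) * h"
   have "y \<in> polydisc N R1" using y(1) h(5) unfolding polydisc_def by (auto intro: less_trans)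
   note L0' = L0(3)[OF _ _ _ this]
   have 1: "cmod ((\<Sum>l\<in>L0. sgf_term N \<rho> l y) - SGF N \<rho> y) < 1" by (rule L0') (use L0 in auto)
   have 2: "cmod ((\<Sum>l\<in>L0 \<union> L. sgf_term N \<rho> l y) - SGF N \<rho> y) < 1" by (rule L0') (use L0(1,2) L in auto)
   have "(\<Sum>l\<in>L0 \<union> L. sgf_term N \<rho> l y) = (\<Sum>l\<in>L0. sgf_term N \<rho> l y) + (\<Sum>l\<in>L. sgf_term N \<rho> l y)"
    using L0 L by (intro sum.union_disjoint) auto
   then have "(\<Sum>l\<in>L. ?c l * schur N l y) = ((\<Sum>l\<in>L0 \<union> L. sgf_term N \<rho> l y) - SGF N \<rho> y) - ((\<Sum>l\<in>L0. sgf_term N \<rho> l y) - SGF N \<rho> y)"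
    by (simp add: sgf_term_def)
   then show "cmod ((\<Sum>l\<in>L. ?c l * schur N l y) - 0 * exp (lpoly {} (%_. 0) (psum N y))) \<le> 2"
    using 1 2 norm_triangle_ineq4[of "(\<Sum>l\<in>L0 \<union> L. sgf_term N \<rho> l y) - SGF N \<rho> y" "(\<Sum>l\<in>L0. sgf_term N \<rho> l y) - SGF N \<rho> y"] by simp
  qed (use h in auto)
  moreover have "(\<Sum>l\<in>L. ?c l * (schur N l one_pt * (\<Prod>a\<in>set as. of_real (p_k N (k a) l) / fact (k a))))
   = of_real (sum ?f L) / (\<Prod>a\<in>A. fact (k a))"
   unfolding as of_real_sum sum_divide_distrib
   by (intro sum.cong refl normalized_term schur_one_nonzero) (use supp L in auto)
  ultimately have "cmod (of_real (sum ?f L) / (\<Prod>a\<in>A. fact (k a))) \<le> (real N * 2 ^ N) ^ length as * 2 / (\<kappa> * h) ^ (\<Sum>a\<in>set as. k a)"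
   by simp
  moreover have "cmod (of_real (sum ?f L) / (\<Prod>a\<in>A. fact (k a))) = \<bar>sum ?f L\<bar> / (\<Prod>a\<in>A. fact (k a))"
   by (simp add: norm_divide prod_norm[symmetric] del: of_real_sum)
  moreover have "(\<Prod>a\<in>A. fact (k a) :: real) > 0" by (intro prod_pos) auto
  ultimately show "\<bar>sum ?f L\<bar> \<le> B" unfolding B_def by (simp add: divide_le_eq)
 qed
 then have "(%l. norm (?f l)) summable_on ((set_pmf \<rho> - L0) \<union> L0)"
  by (rule summable_on_Un_disjoint) (use L0(1) in auto)
 moreover have "(set_pmf \<rho> - L0) \<union> L0 = set_pmf \<rho>" using L0 by auto
 ultimately show ?thesis by simp
qed

lemma pmf_expectation:
 fixes f :: "'a => real"
 assumes "(%x. norm (pmf \<rho> x * f x)) summable_on (set_pmf \<rho>)"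
 shows "integrable (measure_pmf \<rho>) f"
  and "((%x. pmf \<rho> x * f x) has_sum measure_pmf.expectation \<rho> f) (set_pmf \<rho>)"
proof -
 let ?g = "%x. pmf \<rho> x * f x"
 have s: "(%x. norm (?g x)) summable_on UNIV"
  using assms by (subst summable_on_cong_neutral[where T = "set_pmf \<rho>" and g = "%x. norm (?g x)"]) (auto simp: set_pmf_iff)
 then have s': "Infinite_Set_Sum.abs_summable_on ?g UNIV" by (simp only: abs_summable_equivalent[symmetric])
 then have "integrable (count_space UNIV) ?g" by (simp add: Infinite_Set_Sum.abs_summable_on_def)
 then show "integrable (measure_pmf \<rho>) f"
  unfolding measure_pmf_eq_density by (subst integrable_density) auto
 have "measure_pmf.expectation \<rho> f = infsetsum ?g UNIV"
  unfolding measure_pmf_eq_density infsetsum_def by (subst integral_density) auto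
 also have "\<dots> = infsum ?g UNIV" using s' by (simp add: infsetsum_infsum)
 finally have e: "measure_pmf.expectation \<rho> f = infsum ?g UNIV" .
 have "?g summable_on UNIV" using s by (rule abs_summable_summable)
 then have "(?g has_sum measure_pmf.expectation \<rho> f) UNIV" unfolding e by (rule has_sum_infsum)
 then show "(?g has_sum measure_pmf.expectation \<rho> f) (set_pmf \<rho>)"
  by (rule has_sum_cong_neutral[THEN iffD1, rotated -1]) (auto simp: set_pmf_iff)
qed

subsection \<open>Cluster expansion of the centred moments\<close>

definition big_subsets :: "nat set => nat set set" where
 "big_subsets A = {T. T \<subseteq> A \<and> 2 \<le> card T}"

lemma finite_big_subsets [simp]: "finite A ==> finite (big_subsets A)"
 unfolding big_subsets_def by (rule finite_subset[of _ "Pow A"]) auto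

lemma prod_one_plus:
 fixes f :: "'a => complex"
 assumes "finite S"
 shows "(\<Prod>x\<in>S. 1 + f x) = (\<Sum>X\<in>Pow S. \<Prod>x\<in>X. f x)"
 using prod_add[OF assms, of f "%_. 1"] by (simp add: add.commute)

lemma sum_alternating_Pow:
 assumes "finite X"
 shows "(\<Sum>C\<in>Pow X. (- 1) ^ card C) = (if X = {} then 1 else 0 :: complex)"
proof -
 have "(\<Sum>C\<in>Pow X. (- 1) ^ card C) = (\<Sum>C\<in>Pow X. \<Prod>x\<in>C. - 1 :: complex)" by simp
 also have "\<dots> = (\<Prod>x\<in>X. 1 + (- 1))" by (rule prod_one_plus[OF assms, symmetric])
 finally show ?thesis using assms by auto
qed

text \<open>After expanding the products a family H occurs for every B that contains its union. The
  alternating sum over these B vanishes unless the union is all of A.\<close>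

lemma cluster_expansion:
 fixes \<xi> :: "nat set => complex"
 assumes A: "finite A"
 shows "(\<Sum>B\<in>Pow A. (- 1) ^ card (A - B) * (\<Prod>T\<in>big_subsets B. 1 + \<xi> T))
  = (\<Sum>H\<in>{H. H \<subseteq> big_subsets A \<and> \<Union>H = A}. \<Prod>T\<in>H. \<xi> T)"
proof -
 have fP: "finite (Pow (big_subsets A))" using A by simp
 have "(\<Sum>B\<in>Pow A. (- 1) ^ card (A - B) * (\<Prod>T\<in>big_subsets B. 1 + \<xi> T))
  = (\<Sum>B\<in>Pow A. \<Sum>H\<in>Pow (big_subsets A). if \<Union>H \<subseteq> B then (- 1) ^ card (A - B) * (\<Prod>T\<in>H. \<xi> T) else 0)"
 proof (rule sum.cong[OF refl])
  fix B assume B: "B \<in> Pow A"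
  then have fB: "finite B" using A finite_subset by auto
  have eq: "Pow (big_subsets B) = {H \<in> Pow (big_subsets A). \<Union>H \<subseteq> B}"
   using B unfolding big_subsets_def by blast
  show "(- 1) ^ card (A - B) * (\<Prod>T\<in>big_subsets B. 1 + \<xi> T)
   = (\<Sum>H\<in>Pow (big_subsets A). if \<Union>H \<subseteq> B then (- 1) ^ card (A - B) * (\<Prod>T\<in>H. \<xi> T) else 0)"
   unfolding prod_one_plus[OF finite_big_subsets[OF fB]] sum_distrib_left eq
   by (rule sum.inter_filter[OF fP])
 qed
 also have "\<dots> = (\<Sum>H\<in>Pow (big_subsets A). \<Sum>B\<in>Pow A. if \<Union>H \<subseteq> B then (- 1) ^ card (A - B) * (\<Prod>T\<in>H. \<xi> T) else 0)"
  by (rule sum.swap)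
 also have "\<dots> = (\<Sum>H\<in>Pow (big_subsets A). if \<Union>H = A then \<Prod>T\<in>H. \<xi> T else 0)"
 proof (rule sum.cong[OF refl])
  fix H assume "H \<in> Pow (big_subsets A)"
  then have UH: "\<Union>H \<subseteq> A" by (auto simp: big_subsets_def)
  have "(\<Sum>B\<in>Pow A. if \<Union>H \<subseteq> B then (- 1) ^ card (A - B) * (\<Prod>T\<in>H. \<xi> T) else 0)
   = (\<Sum>B\<in>{B\<in>Pow A. \<Union>H \<subseteq> B}. (- 1) ^ card (A - B) * (\<Prod>T\<in>H. \<xi> T))"
   using A by (intro sum.inter_filter[symmetric]) auto
  also have "\<dots> = (\<Sum>C\<in>Pow (A - \<Union>H). (- 1) ^ card C * (\<Prod>T\<in>H. \<xi> T))"
   using UH by (intro sum.reindex_bij_witness[of _ "%C. A - C" "%B. A - B"]) auto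
  also have "\<dots> = (\<Sum>C\<in>Pow (A - \<Union>H). (- 1) ^ card C) * (\<Prod>T\<in>H. \<xi> T)" by (simp add: sum_distrib_right)
  also have "(\<Sum>C\<in>Pow (A - \<Union>H). (- 1) ^ card C) = (if A - \<Union>H = {} then 1 else 0 :: complex)"
   using A by (intro sum_alternating_Pow) auto
  also have "A - \<Union>H = {} \<longleftrightarrow> \<Union>H = A" using UH by auto
  finally show "(\<Sum>B\<in>Pow A. if \<Union>H \<subseteq> B then (- 1) ^ card (A - B) * (\<Prod>T\<in>H. \<xi> T) else 0)
   = (if \<Union>H = A then \<Prod>T\<in>H. \<xi> T else 0)" by simp
 qed
 also have "\<dots> = (\<Sum>H\<in>{H\<in>Pow (big_subsets A). \<Union>H = A}. \<Prod>T\<in>H. \<xi> T)"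
  by (rule sum.inter_filter[OF fP, symmetric])
 finally show ?thesis by (simp add: Pow_def)
qed

text \<open>A map h assigns the blocks of a partition to operators. Surjectivity onto T selects the
  terms in which exactly the operators in T take part, so these parts add up to the whole
  polynomial.\<close>

definition psi :: "nat set set set => (nat set set => complex) => nat set => (nat => nat => complex) => complex" where
 "psi Ps E T g = (\<Sum>\<pi>\<in>Ps. E \<pi> * (\<Sum>h\<in>{h\<in>\<pi> \<rightarrow>\<^sub>E T. h ` \<pi> = T}. \<Prod>b\<in>\<pi>. g (h b) (card b)))"

lemma lpoly_expand:
 assumes B: "finite B" and Ps: "\<And>\<pi>. \<pi> \<in> Ps ==> finite \<pi>"
 shows "lpoly Ps E (%n. \<Sum>a\<in>B. g a n) = (\<Sum>T\<in>Pow B. psi Ps E T g)"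
proof -
 have "(\<Prod>b\<in>\<pi>. \<Sum>a\<in>B. g a (card b)) = (\<Sum>T\<in>Pow B. \<Sum>h\<in>{h\<in>\<pi> \<rightarrow>\<^sub>E T. h ` \<pi> = T}. \<Prod>b\<in>\<pi>. g (h b) (card b))"
  if "\<pi> \<in> Ps" for \<pi>
 proof -
  have "(\<Prod>b\<in>\<pi>. \<Sum>a\<in>B. g a (card b)) = (\<Sum>h\<in>\<pi> \<rightarrow>\<^sub>E B. \<Prod>b\<in>\<pi>. g (h b) (card b))"
   using Ps[OF that] B by (intro prod_sum_PiE) auto
  also have "\<dots> = (\<Sum>T\<in>Pow B. \<Sum>h\<in>{h\<in>\<pi> \<rightarrow>\<^sub>E B. h ` \<pi> = T}. \<Prod>b\<in>\<pi>. g (h b) (card b))"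
   using Ps[OF that] B by (intro sum.group[symmetric] finite_PiE) auto
  also have "\<dots> = (\<Sum>T\<in>Pow B. \<Sum>h\<in>{h\<in>\<pi> \<rightarrow>\<^sub>E T. h ` \<pi> = T}. \<Prod>b\<in>\<pi>. g (h b) (card b))"
   by (intro sum.cong refl) (auto simp: PiE_iff)
  finally show ?thesis .
 qed
 then have "lpoly Ps E (%n. \<Sum>a\<in>B. g a n) = (\<Sum>\<pi>\<in>Ps. \<Sum>T\<in>Pow B. E \<pi> * (\<Sum>h\<in>{h\<in>\<pi> \<rightarrow>\<^sub>E T. h ` \<pi> = T}. \<Prod>b\<in>\<pi>. g (h b) (card b)))"
  unfolding lpoly_def by (simp add: sum_distrib_left)
 also have "\<dots> = (\<Sum>T\<in>Pow B. psi Ps E T g)" unfolding psi_def by (rule sum.swap)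
 finally show ?thesis .
qed

definition good_parts :: "nat set set set => bool" where
 "good_parts Ps \<longleftrightarrow> finite Ps \<and> (\<forall>\<pi>\<in>Ps. finite \<pi> \<and> \<pi> \<noteq> {} \<and> (\<forall>b\<in>\<pi>. finite b \<and> b \<noteq> {}))"

text \<open>The auxiliary variable rescaled to the unit circle: t_a is \<open>TT\<close> divided by
  N.\<close>

definition TT :: "(nat \<times> bool => real) => nat => complex" where
 "TT om a = cir 1 (om (a, False))"

lemma tt_TT: "tt (%_. 1 / real N) om a = of_real (1 / real N) * TT om a"
 by (simp add: tt_def TT_def cir_def)

lemma norm_TT [simp]: "cmod (TT om a) = 1"
 by (simp add: TT_def)

lemma bmeas_TT: "(a, False) \<in> I ==> bmeas (PU I) (%om. TT om a)"
 unfolding TT_def by (rule bmeas_cir)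

lemma inverse_real_lim: "(%N. complex_of_real (1 / real N)) \<longlonglongrightarrow> 0"
 using lim_1_over_n[where 'a = complex] by simp

lemma bconv_cong_ev:
 assumes "bconv M f g" "\<And>n. f' n \<in> borel_measurable M" "eventually (%n. \<forall>x. f' n x = f n x) sequentially"
 shows "bconv M f' g"
proof -
 obtain C where C: "eventually (%n. \<forall>x. cmod (f n x) \<le> C) sequentially" using assms(1) unfolding bconv_def by blast
 show ?thesis
 proof (rule bconvI[OF assms(2) bconv_meas(2)[OF assms(1)]])
  show "eventually (%n. \<forall>x. cmod (f' n x) \<le> C) sequentially"
   using C assms(3) by eventually_elim simp
  fix x
  have "eventually (%n. f n x = f' n x) sequentially" using assms(3) by eventually_elim simp
  then show "(%n. f' n x) \<longlonglongrightarrow> g x" by (rule Lim_transform_eventually[OF bconv_lim[OF assms(1)]])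
 qed
qed

definition matchings :: "nat set => nat set set set" where
 "matchings A = {H. H \<subseteq> Pow A \<and> \<Union>H = A \<and> (\<forall>T\<in>H. card T = 2) \<and> (\<forall>S\<in>H. \<forall>T\<in>H. S \<noteq> T \<longrightarrow> S \<inter> T = {})}"

lemma finite_matchings: "finite A ==> finite (matchings A)"
 unfolding matchings_def by (rule finite_subset[of _ "Pow (Pow A)"]) auto

text \<open>A point common to two members would be counted twice on the left and once on the
  right.\<close>

lemma disjoint_if_card_sum:
 assumes H: "finite H" "\<And>T. T \<in> H ==> finite T" and c: "(\<Sum>T\<in>H. card T) = card (\<Union>H)"
  and ST: "S \<in> H" "T \<in> H" "S \<noteq> T"
 shows "S \<inter> T = {}"
proof (rule ccontr)
 assume "S \<inter> T \<noteq> {}"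
 then obtain x where x: "x \<in> S" "x \<in> T" by blast
 have "\<Union>H = (S - {x}) \<union> \<Union>(H - {S})" using x ST by auto
 then have "card (\<Union>H) \<le> card (S - {x}) + card (\<Union>(H - {S}))" by (metis card_Un_le)
 also have "card (\<Union>(H - {S})) \<le> (\<Sum>T\<in>H - {S}. card T)"
  using H by (intro card_Union_le_sum_card_weak) auto
 also have "card (S - {x}) + (\<Sum>T\<in>H - {S}. card T) < card S + (\<Sum>T\<in>H - {S}. card T)"
  using card_Diff1_less[OF H(2)[OF ST(1)] x(1)] by linarith
 also have "\<dots> = (\<Sum>T\<in>H. card T)" using H(1) ST(1) by (simp add: sum.remove)
 finally show False using c by simp
qed

lemma bconv_ev_bmeas:
 assumes "bconv M f g"
 shows "eventually (%n. bmeas M (f n)) sequentially"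
proof -
 obtain C where C: "eventually (%n. \<forall>x. cmod (f n x) \<le> C) sequentially" using assms unfolding bconv_def by blast
 show ?thesis using C
  by eventually_elim (use bconv_meas(1)[OF assms] in \<open>auto intro!: bmeasI\<close>)
qed

section \<open>Asymptotics of one-body and interaction factors\<close>

text \<open>The growth of the coefficients is that of the derivatives of the logarithm: order N for
  one distinct index, order 1 for two, vanishing for three or more.\<close>

locale asymp =
 fixes Ps :: "nat set set set" and E :: "nat => nat set set => complex" and e :: "nat set set => complex"
  and A :: "nat set" and r :: "nat => real" and \<eta> :: real and k :: "nat => nat"
 assumes Ps: "good_parts Ps" and A: "finite A" and r: "radii A \<eta> r"
  and E1: "\<And>\<pi>. \<pi> \<in> Ps ==> card \<pi> = 1 ==> (%N. E N \<pi> / of_nat N) \<longlonglongrightarrow> e \<pi>"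
  and E2: "\<And>\<pi>. \<pi> \<in> Ps ==> card \<pi> = 2 ==> (%N. E N \<pi>) \<longlonglongrightarrow> e \<pi>"
  and E3: "\<And>\<pi>. \<pi> \<in> Ps ==> card \<pi> \<ge> 3 ==> (%N. E N \<pi>) \<longlonglongrightarrow> 0"
begin

abbreviation "I \<equiv> A \<times> (UNIV :: bool set)"

definition tN where "tN N om a = tt (%_. 1 / real N) om a"
definition wN where "wN N om a = shw (tN N om a) (vv r om a)"
definition gN where "gN N om a n = gch (tN N om a) (vv r om a) n"
text \<open>The limit of N times the change of v^n: its derivative in the direction T * (1 + v) of
  the infinitesimal dilation.\<close>

definition gL where "gL om a n = TT om a * (1 + vv r om a) * (of_nat n * vv r om a ^ (n - 1))"
definition psL where "psL om T = (\<Sum>\<pi>\<in>{\<pi>\<in>Ps. card \<pi> = card T}. e \<pi> * (\<Sum>h\<in>{h\<in>\<pi> \<rightarrow>\<^sub>E T. h ` \<pi> = T}. \<Prod>b\<in>\<pi>. gL om (h b) (card b)))"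

lemma \<eta>: "\<eta> > 0" using r by (simp add: radii_def)

lemma rpos: "a \<in> A ==> 0 < r a" using r by (simp add: radii_def)

lemma nv: "a \<in> A ==> cmod (vv r om a) = r a" using rpos by (intro norm_vv)

lemma bv: "a \<in> A ==> bmeas (PU I) (%om. vv r om a)" by (rule bmeas_vv) auto

lemma bT: "a \<in> A ==> bmeas (PU I) (%om. TT om a)" by (rule bmeas_TT) auto

lemma bt: "a \<in> A ==> bconv (PU I) (%N om. tN N om a) (%_. 0)"
 using bconv_mult[OF bconv_const[OF inverse_real_lim] bT, of a] unfolding tN_def tt_TT by simp

lemma bNe: "a \<in> A ==> bconv (PU I) (%N om. of_nat N * (exp (tN N om a) - 1)) (%om. TT om a)"
 using bconv_expm1[OF bT filterlim_real_sequentially, of a] unfolding tN_def tt_TT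
 by (simp add: divide_inverse mult.commute)

lemma bw: "a \<in> A ==> bconv (PU I) (%N om. wN N om a) (%om. vv r om a)"
proof -
 assume a: "a \<in> A"
 have "bconv (PU I) (%N om. exp (tN N om a) * (1 + vv r om a) - 1) (%om. exp 0 * (1 + vv r om a) - 1)"
  by (intro bconv_diff bconv_mult bconv_exp bt a bconv_add bv bmeas_const)
 then show ?thesis by (simp add: wN_def shw_def)
qed

lemma bNw: "a \<in> A ==> bconv (PU I) (%N om. of_nat N * (wN N om a - vv r om a)) (%om. TT om a * (1 + vv r om a))"
 using bconv_mult[OF bNe bconv_add[OF bmeas_const[of _ 1] bv], of a a]
 unfolding wN_def shw_diff by (simp add: mult.assoc)

lemma bg: "a \<in> A ==> n > 0 ==> bconv (PU I) (%N om. of_nat N * gN N om a n) (%om. gL om a n)"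
proof -
 assume a: "a \<in> A" and n: "n > 0"
 have "bconv (PU I) (%N om. of_nat N * (wN N om a - vv r om a) * (\<Sum>i<n. vv r om a ^ (n - Suc i) * wN N om a ^ i))
  (%om. TT om a * (1 + vv r om a) * (\<Sum>i<n. vv r om a ^ (n - Suc i) * vv r om a ^ i))"
  by (intro bconv_mult bNw a bconv_sum bconv_power bv bw)
 moreover have "(\<Sum>i<n. vv r om a ^ (n - Suc i) * vv r om a ^ i) = of_nat n * vv r om a ^ (n - 1)" for om
  by (simp add: power_add[symmetric])
 moreover have "gN N om a n = (wN N om a - vv r om a) * (\<Sum>i<n. vv r om a ^ (n - Suc i) * wN N om a ^ i)" for N om
  unfolding gN_def gch_def wN_def[symmetric] by (rule power_diff_sumr2)
 ultimately show ?thesis by (simp add: gL_def mult.assoc)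
qed

text \<open>Power counting. Every block of a partition contributes a factor of order 1/N, and
  surjectivity forces at least |T| blocks. A singleton T lives on scale 1 because its leading
  coefficient is of order N; a larger T lives on scale N^(-|T|), and only |T| = 2 has a nonzero
  limit there.\<close>

lemma coeff_lim:
 assumes \<pi>: "\<pi> \<in> Ps" and T: "T \<noteq> {}" "card T \<le> card \<pi>" "finite T"
 shows "(%N. (if card T = 1 then 1 else of_nat N ^ card T) * E N \<pi> / of_nat N ^ card \<pi>)
  \<longlonglongrightarrow> (if card \<pi> = card T \<and> card T \<le> 2 then e \<pi> else 0)"
proof -
 have inv: "(%N. 1 / complex_of_nat N ^ m) \<longlonglongrightarrow> (if m = 0 then 1 else 0)" for m
 proof (cases "m = 0")
  case False
  have "(%N. (1 / complex_of_nat N) ^ m) \<longlonglongrightarrow> 0 ^ m" by (intro tendsto_power lim_1_over_n)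
  then show ?thesis using False by (simp add: power_one_over power_0_left)
 qed simp
 have c: "card T \<ge> 1" using T by (simp add: Suc_le_eq card_gt_0_iff)
 consider "card T = 1" "card \<pi> = 1" | "card T = 1" "card \<pi> = 2" | "card T = 1" "card \<pi> \<ge> 3"
  | "card T = 2" "card \<pi> = 2" | "card T \<ge> 2" "card \<pi> \<ge> 3"
  using c T(2) by linarith
 then show ?thesis
 proof cases
  case 1
  then show ?thesis using E1[OF \<pi>] by simp
 next
  case 2
  then show ?thesis using tendsto_mult[OF E2[OF \<pi>] inv[of 2]] by simp
 next
  case 3
  then show ?thesis using tendsto_mult[OF E3[OF \<pi>] inv[of "card \<pi>"]] by simp
 next
  case 4
  have "eventually (%N. E N \<pi> = of_nat N ^ 2 * E N \<pi> / of_nat N ^ 2) sequentially"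
   using eventually_gt_at_top[of 0] by eventually_elim simp
  from Lim_transform_eventually[OF E2[OF \<pi> 4(2)] this] show ?thesis using 4 by simp
 next
  case 5
  have "(%N. E N \<pi> * (1 / of_nat N ^ (card \<pi> - card T))) \<longlonglongrightarrow> 0 * (if card \<pi> - card T = 0 then 1 else 0)"
   by (intro tendsto_mult E3 \<pi> 5 inv)
  then have l: "(%N. E N \<pi> * (1 / of_nat N ^ (card \<pi> - card T))) \<longlonglongrightarrow> 0" by simp
  have "eventually (%N. E N \<pi> * (1 / of_nat N ^ (card \<pi> - card T)) = of_nat N ^ card T * E N \<pi> / of_nat N ^ card \<pi>) sequentially"
   using eventually_gt_at_top[of 0] by eventually_elim (use T(2) in \<open>simp add: power_diff field_simps\<close>)
  from Lim_transform_eventually[OF l this] show ?thesis using 5 by auto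
 qed
qed

lemma bpsi:
 assumes T: "T \<subseteq> A" "T \<noteq> {}"
 shows "bconv (PU I) (%N om. (if card T = 1 then 1 else of_nat N ^ card T) * psi Ps (E N) T (gN N om))
  (%om. if card T \<le> 2 then psL om T else 0)"
proof -
 have fT: "finite T" using T A finite_subset by blast
 let ?S = "%\<pi>. {h\<in>\<pi> \<rightarrow>\<^sub>E T. h ` \<pi> = T}"
 let ?c = "%N. if card T = 1 then 1 else complex_of_nat N ^ card T"
 have fin: "finite \<pi>" "\<pi> \<noteq> {}" "\<And>b. b \<in> \<pi> ==> card b > 0" if "\<pi> \<in> Ps" for \<pi>
  using Ps that unfolding good_parts_def by (auto simp: card_gt_0_iff)
 have hA: "h b \<in> A" if "h \<in> ?S \<pi>" "b \<in> \<pi>" for h b \<pi> using that T by (auto simp: PiE_iff)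
 have 1: "bconv (PU I) (%N om. \<Sum>\<pi>\<in>Ps. \<Sum>h\<in>?S \<pi>. (?c N * E N \<pi> / of_nat N ^ card \<pi>) * (\<Prod>b\<in>\<pi>. of_nat N * gN N om (h b) (card b)))
  (%om. \<Sum>\<pi>\<in>Ps. \<Sum>h\<in>?S \<pi>. (if card \<pi> = card T \<and> card T \<le> 2 then e \<pi> else 0) * (\<Prod>b\<in>\<pi>. gL om (h b) (card b)))"
 proof (intro bconv_sum bconv_mult bconv_prod bg)
  fix \<pi> h assume p: "\<pi> \<in> Ps" "h \<in> ?S \<pi>"
  then have "card T \<le> card \<pi>" using card_image_le[OF fin(1)[OF p(1)], of h] by auto
  then show "bconv (PU I) (%N om. ?c N * E N \<pi> / of_nat N ^ card \<pi>) (%om. if card \<pi> = card T \<and> card T \<le> 2 then e \<pi> else 0)"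
   by (intro bconv_const coeff_lim p(1) T(2) fT)
  fix b assume b: "b \<in> \<pi>"
  show "h b \<in> A" by (rule hA[OF p(2) b])
  show "0 < card b" by (rule fin(3)[OF p(1) b])
 qed
 have fPs: "finite Ps" using Ps by (simp add: good_parts_def)
 have "(\<Sum>\<pi>\<in>Ps. \<Sum>h\<in>?S \<pi>. (if card \<pi> = card T \<and> card T \<le> 2 then e \<pi> else 0) * (\<Prod>b\<in>\<pi>. gL om (h b) (card b)))
  = (if card T \<le> 2 then psL om T else 0)" for om
  unfolding psL_def sum_distrib_left[symmetric] using fPs
  by (auto simp: sum.inter_filter intro!: sum.cong)
 then have 2: "bconv (PU I) (%N om. \<Sum>\<pi>\<in>Ps. \<Sum>h\<in>?S \<pi>. (?c N * E N \<pi> / of_nat N ^ card \<pi>) * (\<Prod>b\<in>\<pi>. of_nat N * gN N om (h b) (card b)))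
  (%om. if card T \<le> 2 then psL om T else 0)" using 1 by simp
 have gm: "(%om. gN N om a n) \<in> borel_measurable (PU I)" if "a \<in> A" for N a n
 proof -
  have "(%om. wN N om a) \<in> borel_measurable (PU I)" "(%om. vv r om a) \<in> borel_measurable (PU I)"
   using bconv_meas(1)[OF bw[OF that]] bconv_meas(2)[OF bv[OF that]] by auto
  then show ?thesis unfolding gN_def gch_def wN_def[symmetric] by measurable
 qed
 show ?thesis
 proof (rule bconv_cong_ev[OF 2])
  show "(%om. ?c N * psi Ps (E N) T (gN N om)) \<in> borel_measurable (PU I)" for N
   unfolding psi_def
   by (intro borel_measurable_times borel_measurable_const borel_measurable_sum borel_measurable_prod gm hA)
  show "eventually (%N. \<forall>om. ?c N * psi Ps (E N) T (gN N om) =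
   (\<Sum>\<pi>\<in>Ps. \<Sum>h\<in>?S \<pi>. (?c N * E N \<pi> / of_nat N ^ card \<pi>) * (\<Prod>b\<in>\<pi>. of_nat N * gN N om (h b) (card b)))) sequentially"
   using eventually_gt_at_top[of 0]
  proof eventually_elim
   case (elim N)
   show ?case
   proof
    fix om
    have "?c N * E N \<pi> / of_nat N ^ card \<pi> * (\<Prod>b\<in>\<pi>. of_nat N * gN N om (h b) (card b)) = ?c N * (E N \<pi> * (\<Prod>b\<in>\<pi>. gN N om (h b) (card b)))" for \<pi> h
     using elim by (simp add: prod.distrib)
    then show "?c N * psi Ps (E N) T (gN N om) =
     (\<Sum>\<pi>\<in>Ps. \<Sum>h\<in>?S \<pi>. (?c N * E N \<pi> / of_nat N ^ card \<pi>) * (\<Prod>b\<in>\<pi>. of_nat N * gN N om (h b) (card b)))"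
     unfolding psi_def by (simp only: sum_distrib_left)
   qed
  qed
 qed
qed

definition crs_set where
 "crs_set N om T = (\<Prod>a\<in>T. \<Prod>b\<in>{b\<in>T. a < b}. crs (tN N om a) (vv r om a) (tN N om b) (vv r om b))"

text \<open>The full interaction of T minus 1, as for Mayer bonds in statistical mechanics. Cross
  ratios belong to pairs, so they occur only for |T| = 2.\<close>

definition chi where
 "chi N om T = (if card T = 2 then crs_set N om T else 1) * exp (psi Ps (E N) T (gN N om)) - 1"

text \<open>\<open>Min\<close> and \<open>Max\<close> merely name the two elements of a pair; the
  square makes their order immaterial.\<close>

definition KK where
 "KK om T = (if card T = 2 then (\<Prod>a\<in>T. TT om a * (1 + vv r om a)) / (vv r om (Min T) - vv r om (Max T)) ^ 2 + psL om T else 0)"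

text \<open>The cross ratio minus 1 has numerator (w_a - v_a)(w_b - v_b), a product of two
  displacements of order 1/N. This is the origin of the term 1/(x - y)^2 in Q.\<close>

lemma bNcrs:
 assumes ab: "a \<in> A" "b \<in> A" "a < b"
 shows "bconv (PU I) (%N om. of_nat N ^ 2 * (crs (tN N om a) (vv r om a) (tN N om b) (vv r om b) - 1))
  (%om. (TT om a * (1 + vv r om a)) * (TT om b * (1 + vv r om b)) / (vv r om a - vv r om b) ^ 2)"
proof -
 have small: "eventually (%N. N > 0 \<and> (\<forall>om a. cmod (exp (tN N om a) - 1) \<le> \<eta>)) sequentially"
 proof -
  have "eventually (%N. N > 0 \<and> 3 / \<eta> \<le> real N) sequentially"
   using eventually_conj[OF eventually_gt_at_top[of 0] eventually_ge_at_top[of "nat \<lceil>3 / \<eta>\<rceil>"]]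
   by (rule eventually_mono) linarith
  then show ?thesis
  proof eventually_elim
   case (elim N)
   have n: "cmod (tN N om c) = 1 / real N" for om c using elim by (simp add: tN_def tt_TT norm_mult norm_divide)
   have l: "3 * (1 / real N) \<le> \<eta>" using elim \<eta> by (simp add: field_simps)
   have "cmod (exp (tN N om c) - 1) \<le> \<eta>" for om c
   proof -
    have "cmod (tN N om c) \<le> 1" unfolding n using elim by (simp add: divide_simps)
    from norm_expm1_le[OF this] show ?thesis unfolding n using l by linarith
   qed
   then show ?case using elim by blast
  qed
 qed
 have low: "eventually (%N. \<forall>om. 2 * \<eta> \<le> cmod (vv r om a - wN N om b) \<and> 2 * \<eta> \<le> cmod (wN N om a - vv r om b)) sequentially"
  using small
 proof eventually_elim
  case (elim N)
  show ?case
  proof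
   fix om
   have ta: "cmod (exp (tN N om a) - 1) \<le> \<eta>" and tb: "cmod (exp (tN N om b) - 1) \<le> \<eta>" using elim by auto
   show "2 * \<eta> \<le> cmod (vv r om a - wN N om b) \<and> 2 * \<eta> \<le> cmod (wN N om a - vv r om b)"
    unfolding wN_def using radii_low[OF r ab ta tb nv[OF ab(1)] nv[OF ab(2)]] by blast
  qed
 qed
 have low2: "eventually (%N. \<forall>om. 2 * \<eta> * (2 * \<eta>) \<le> cmod ((vv r om a - wN N om b) * (wN N om a - vv r om b))) sequentially"
  using low
 proof eventually_elim
  case (elim N)
  then show ?case unfolding norm_mult using \<eta> by (intro allI mult_mono) auto
 qed
 have 1: "bconv (PU I) (%N om. (of_nat N * (wN N om a - vv r om a)) * (of_nat N * (wN N om b - vv r om b)) /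
   ((vv r om a - wN N om b) * (wN N om a - vv r om b)))
  (%om. (TT om a * (1 + vv r om a)) * (TT om b * (1 + vv r om b)) / ((vv r om a - vv r om b) * (vv r om a - vv r om b)))"
  by (intro bconv_divide[OF _ _ _ low2] bconv_mult bNw bconv_diff bw bv ab) (use \<eta> in simp)
 have m: "(%om. wN N om a) \<in> borel_measurable (PU I)" "(%om. wN N om b) \<in> borel_measurable (PU I)" for N
  using bconv_meas(1)[OF bw] ab by auto
 have m': "(%om. vv r om a) \<in> borel_measurable (PU I)" "(%om. vv r om b) \<in> borel_measurable (PU I)"
  using bconv_meas(2)[OF bv] ab by auto
 have "bconv (PU I) (%N om. of_nat N ^ 2 * (crs (tN N om a) (vv r om a) (tN N om b) (vv r om b) - 1))
  (%om. (TT om a * (1 + vv r om a)) * (TT om b * (1 + vv r om b)) / ((vv r om a - vv r om b) * (vv r om a - vv r om b)))"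
 proof (rule bconv_cong_ev[OF 1])
  show "(%om. of_nat N ^ 2 * (crs (tN N om a) (vv r om a) (tN N om b) (vv r om b) - 1)) \<in> borel_measurable (PU I)" for N
   unfolding crs_def wN_def[symmetric] using m[of N] m' by measurable
  show "eventually (%N. \<forall>om. of_nat N ^ 2 * (crs (tN N om a) (vv r om a) (tN N om b) (vv r om b) - 1) =
   (of_nat N * (wN N om a - vv r om a)) * (of_nat N * (wN N om b - vv r om b)) /
   ((vv r om a - wN N om b) * (wN N om a - vv r om b))) sequentially"
   using low
  proof eventually_elim
   case (elim N)
   show ?case
   proof
    fix om
    have lo: "2 * \<eta> \<le> cmod (vv r om a - wN N om b)" "2 * \<eta> \<le> cmod (wN N om a - vv r om b)" using elim by auto
    have nz: "vv r om a - wN N om b \<noteq> 0" "wN N om a - vv r om b \<noteq> 0"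
    proof -
     show "vv r om a - wN N om b \<noteq> 0"
     proof
      assume z: "vv r om a - wN N om b = 0"
      show False using lo(1) \<eta> unfolding z by simp
     qed
     show "wN N om a - vv r om b \<noteq> 0"
     proof
      assume z: "wN N om a - vv r om b = 0"
      show False using lo(2) \<eta> unfolding z by simp
     qed
    qed
    then have "crs (tN N om a) (vv r om a) (tN N om b) (vv r om b) - 1 =
     ((wN N om a - wN N om b) * (vv r om a - vv r om b) - (vv r om a - wN N om b) * (wN N om a - vv r om b)) / ((vv r om a - wN N om b) * (wN N om a - vv r om b))"
     unfolding crs_def wN_def[symmetric] by (simp add: diff_divide_distrib)
    also have "(wN N om a - wN N om b) * (vv r om a - vv r om b) - (vv r om a - wN N om b) * (wN N om a - vv r om b)
     = (wN N om a - vv r om a) * (wN N om b - vv r om b)" by (simp add: algebra_simps)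
    finally show "of_nat N ^ 2 * (crs (tN N om a) (vv r om a) (tN N om b) (vv r om b) - 1) =
     (of_nat N * (wN N om a - vv r om a)) * (of_nat N * (wN N om b - vv r om b)) /
     ((vv r om a - wN N om b) * (wN N om a - vv r om b))" by (simp add: power2_eq_square mult_ac)
   qed
  qed
 qed
 then show ?thesis by (simp add: power2_eq_square)
qed

text \<open>For a pair, chi is (crs - 1) * e^psi + (e^psi - 1), and both summands live on scale
  N^(-2). For larger T only psi is left, which is smaller than N^(-|T|).\<close>

lemma bchi:
 assumes T: "T \<subseteq> A" "2 \<le> card T"
 shows "bconv (PU I) (%N om. of_nat N ^ card T * chi N om T) (%om. KK om T)"
proof -
 let ?p = "%N om. psi Ps (E N) T (gN N om)" and ?c = "card T"
 have T0: "T \<noteq> {}" using T by auto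
 have b: "bconv (PU I) (%N om. of_nat N ^ ?c * ?p N om) (%om. if ?c \<le> 2 then psL om T else 0)"
  using bpsi[OF T(1) T0] T(2) by simp
 have pm: "(%om. ?p N om) \<in> borel_measurable (PU I)" for N
 proof (cases "N = 0")
  case False
  have "(%om. inverse (of_nat N ^ ?c) * (of_nat N ^ ?c * ?p N om)) \<in> borel_measurable (PU I)"
   by (rule borel_measurable_times[OF borel_measurable_const bconv_meas(1)[OF b]])
  then show ?thesis using False by (simp add: mult.assoc[symmetric])
 next
  case True
  \<comment> \<open>Measurability in \<open>bconv\<close> is demanded for every N. At N = 0 the
    convention 1 / 0 = 0 puts t at 0, so nothing changes under the dilation.\<close>
  have "gN 0 om a n = 0" for om a n by (simp add: gN_def tN_def tt_def cir_def gch_def shw_def)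
  then show ?thesis using True by (simp add: psi_def)
 qed
 have A': "filterlim (%N. real N ^ ?c) at_top sequentially"
  by (rule filterlim_pow_at_top) (use T filterlim_real_sequentially in auto)
 have e0: "bconv (PU I) (%N om. of_real (real N ^ ?c) * (exp (of_nat N ^ ?c * ?p N om / of_real (real N ^ ?c)) - 1)) (%om. if ?c \<le> 2 then psL om T else 0)"
  by (rule bconv_expm1[OF b A'])
 have e1: "bconv (PU I) (%N om. of_nat N ^ ?c * (exp (?p N om) - 1)) (%om. if ?c \<le> 2 then psL om T else 0)"
 proof (rule bconv_cong_ev[OF e0])
  show "(%om. of_nat N ^ ?c * (exp (?p N om) - 1)) \<in> borel_measurable (PU I)" for N
   using pm[of N] by measurable
  show "eventually (%N. \<forall>om. of_nat N ^ ?c * (exp (?p N om) - 1) =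
   of_real (real N ^ ?c) * (exp (of_nat N ^ ?c * ?p N om / of_real (real N ^ ?c)) - 1)) sequentially"
   using eventually_gt_at_top[of 0] by eventually_elim simp
 qed
 show ?thesis
 proof (cases "?c = 2")
  case False
  then show ?thesis using e1 T by (simp add: chi_def KK_def)
 next
  case True
  then obtain a b where ab: "T = {a, b}" "a < b"
   by (metis card_2_iff insert_commute linorder_neqE_nat)
  have abA: "a \<in> A" "b \<in> A" using T ab by auto
  have s1: "{b' \<in> T. a < b'} = {b}" "{b' \<in> T. b < b'} = {}" using ab by auto
  have cs: "crs_set N om T = crs (tN N om a) (vv r om a) (tN N om b) (vv r om b)" for N om
  proof -
   have "crs_set N om T = (\<Prod>c\<in>{b'\<in>T. a < b'}. crs (tN N om a) (vv r om a) (tN N om c) (vv r om c)) *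
     (\<Prod>c\<in>{b'\<in>T. b < b'}. crs (tN N om b) (vv r om b) (tN N om c) (vv r om c))"
    unfolding crs_set_def by (subst (1) ab(1)) (use ab(2) in simp)
   then show ?thesis unfolding s1 by simp
  qed
  have ep: "bconv (PU I) (%N om. exp (?p N om)) (%_. 1)"
  proof -
   have "bconv (PU I) (%N om. of_real (1 / real N) ^ 2 * (of_nat N ^ ?c * (exp (?p N om) - 1)) + 1) (%om. 0 ^ 2 * (if ?c \<le> 2 then psL om T else 0) + 1)"
    by (intro bconv_add bconv_mult e1 bconv_const tendsto_power inverse_real_lim bmeas_const)
   then have l: "bconv (PU I) (%N om. of_real (1 / real N) ^ 2 * (of_nat N ^ ?c * (exp (?p N om) - 1)) + 1) (%om. 1)" by simp
   show ?thesis
   proof (rule bconv_cong_ev[OF l])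
    show "(%om. exp (?p N om)) \<in> borel_measurable (PU I)" for N using pm[of N] by measurable
    show "eventually (%N. \<forall>om. exp (?p N om) = of_real (1 / real N) ^ 2 * (of_nat N ^ ?c * (exp (?p N om) - 1)) + 1) sequentially"
     using eventually_gt_at_top[of 0] by eventually_elim (simp add: True power_divide)
   qed
  qed
  have "bconv (PU I) (%N om. of_nat N ^ 2 * (crs (tN N om a) (vv r om a) (tN N om b) (vv r om b) - 1) * exp (?p N om) + of_nat N ^ ?c * (exp (?p N om) - 1))
   (%om. (TT om a * (1 + vv r om a)) * (TT om b * (1 + vv r om b)) / (vv r om a - vv r om b) ^ 2 * 1 + (if ?c \<le> 2 then psL om T else 0))"
   by (intro bconv_add bconv_mult[OF bNcrs ep] abA ab(2) e1)
  moreover have "of_nat N ^ 2 * (crs (tN N om a) (vv r om a) (tN N om b) (vv r om b) - 1) * exp (?p N om) + of_nat N ^ ?c * (exp (?p N om) - 1)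
   = of_nat N ^ ?c * chi N om T" for N om
   using True by (simp add: chi_def cs algebra_simps)
  moreover have "Min T = a" "Max T = b" using ab by auto
  ultimately show ?thesis using True ab by (simp add: KK_def)
 qed
qed

text \<open>The one-body factor of operator a, with the factor N coming from 1/(e^t - 1) taken out.
  The N-th power is the product over the N coordinates, all equal to 1, in a form suited to (1 +
  z/N)^N.\<close>

definition muN where
 "muN N om a = 1 / TT om a ^ k a * (vv r om a / (of_nat N * (exp (tN N om a) - 1) * (1 + vv r om a))) *
  (1 + of_nat N * (exp (tN N om a) - 1) * (1 + vv r om a) / vv r om a / of_nat N) ^ N * exp (psi Ps (E N) {a} (gN N om))"

definition muL where
 "muL om a = 1 / TT om a ^ k a * (vv r om a / (TT om a * (1 + vv r om a))) *
  exp (TT om a * (1 + vv r om a) / vv r om a) * exp (psL om {a})"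

lemma one_plus_low: "a \<in> A ==> \<eta> \<le> cmod (1 + vv r om a)"
 using norm_one_plus[OF nv, of a om] r unfolding radii_def by force

lemma bmu:
 assumes a: "a \<in> A"
 shows "bconv (PU I) (%N om. muN N om a) (%om. muL om a)"
proof -
 have vlow: "r a \<le> cmod (vv r om a)" for om using nv[OF a, of om] by simp
 have Nlow: "eventually (%N. \<forall>om. 1 / 4 * \<eta> \<le> cmod (of_nat N * (exp (tN N om a) - 1) * (1 + vv r om a))) sequentially"
  using eventually_ge_at_top[of 4]
 proof eventually_elim
  case (elim N)
  show ?case
  proof
   fix om
   have n: "cmod (tN N om a) = 1 / real N" using elim by (simp add: tN_def tt_TT norm_mult norm_divide)
   have "cmod (tN N om a) / 4 \<le> cmod (exp (tN N om a) - 1)"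
    by (rule norm_expm1_ge) (unfold n, use elim in \<open>simp add: divide_simps\<close>)
   then have "real N * (1 / real N / 4) \<le> real N * cmod (exp (tN N om a) - 1)"
    unfolding n by (rule mult_left_mono) simp
   then have "1 / 4 \<le> real N * cmod (exp (tN N om a) - 1)" using elim by simp
   then show "1 / 4 * \<eta> \<le> cmod (of_nat N * (exp (tN N om a) - 1) * (1 + vv r om a))"
    unfolding norm_mult norm_of_nat using one_plus_low[OF a, of om] \<eta> by (intro mult_mono) auto
  qed
 qed
 have b1: "bconv (PU I) (%_ om. 1 / TT om a ^ k a) (%om. 1 / TT om a ^ k a)"
  by (rule bmeas_divide[where c = 1]) (auto intro!: bconv_power bT a simp: norm_power)
 have b2: "bconv (PU I) (%N om. vv r om a / (of_nat N * (exp (tN N om a) - 1) * (1 + vv r om a))) (%om. vv r om a / (TT om a * (1 + vv r om a)))"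
  by (rule bconv_divide[OF bv[OF a] _ _ Nlow]) (use \<eta> in \<open>auto intro!: bconv_mult bNe bconv_add bv a\<close>)
 have b3: "bconv (PU I) (%N om. of_nat N * (exp (tN N om a) - 1) * (1 + vv r om a) / vv r om a) (%om. TT om a * (1 + vv r om a) / vv r om a)"
  by (rule bconv_divide[OF _ bv[OF a] rpos[OF a]]) (use vlow in \<open>auto intro!: bconv_mult bNe bconv_add bv a\<close>)
 have b4: "bconv (PU I) (%N om. psi Ps (E N) {a} (gN N om)) (%om. psL om {a})"
  using bpsi[of "{a}"] a by simp
 show ?thesis
  unfolding muN_def muL_def by (intro bconv_mult b1 b2 bconv_power_exp b3 bconv_exp b4)
qed

lemma KK_bmeas:
 assumes "T \<subseteq> A" "2 \<le> card T"
 shows "bmeas (PU I) (%om. KK om T)"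
 using bconv_imp_bmeas[OF bchi[OF assms]] .

text \<open>Up to the product of the factorials of the k a, this is the mixed moment of the power
  sums divided by N to the total degree.\<close>

definition MM where "MM N B = complex_of_real (1 / real N) ^ (\<Sum>a\<in>B. k a) * JJ N Ps (E N) B k (%_. 1 / real N) r"

text \<open>At (1,...,1) the power sums of x - 1 vanish, so the exponent is the polynomial in the
  changes alone. Its decomposition over subsets gives nothing for the empty set, one-body factors
  for singletons and interactions for the rest, where the cross ratios join the pairs.\<close>

lemma MM_eq:
 assumes B: "B \<subseteq> A" and N: "N > 0"
 shows "MM N B = integral\<^sup>L (PU (B \<times> UNIV)) (%om. (\<Prod>a\<in>B. of_nat N * muN N om a) * (\<Prod>T\<in>big_subsets B. 1 + chi N om T))"
proof -
 have fB: "finite B" using B A finite_subset by blast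
 have Pf: "\<And>\<pi>. \<pi> \<in> Ps ==> finite \<pi>" and Pne: "\<And>\<pi> b. \<pi> \<in> Ps ==> b \<in> \<pi> ==> card b > 0" and Pn0: "\<And>\<pi>. \<pi> \<in> Ps ==> \<pi> \<noteq> {}"
  using Ps unfolding good_parts_def by (auto simp: card_gt_0_iff)
 have "complex_of_real (1 / real N) ^ (\<Sum>a\<in>B. k a) * ((\<Prod>a\<in>B. 1 / tt (%_. 1 / real N) om a ^ k a) *
  (WC B (tt (%_. 1 / real N) om) (vv r om) * WX N Ps (E N) B (tt (%_. 1 / real N) om) (vv r om) one_pt))
  = (\<Prod>a\<in>B. of_nat N * muN N om a) * (\<Prod>T\<in>big_subsets B. 1 + chi N om T)" for om
 proof -
  have v0: "vv r om a \<noteq> 0" if "a \<in> B" for a using nv[of a om] rpos[of a] B that by force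
  have T0: "TT om a \<noteq> 0" for a using norm_TT[of om a] by force
  have f1: "complex_of_real (1 / real N) ^ (\<Sum>a\<in>B. k a) * (\<Prod>a\<in>B. 1 / tt (%_. 1 / real N) om a ^ k a) = (\<Prod>a\<in>B. 1 / TT om a ^ k a)"
   unfolding power_sum prod.distrib[symmetric] tt_TT using N T0
   by (intro prod.cong refl) (simp add: power_mult_distrib power_divide field_simps)
  have f2: "WC B (tt (%_. 1 / real N) om) (vv r om) = (\<Prod>a\<in>B. of_nat N * (vv r om a / (of_nat N * (exp (tN N om a) - 1) * (1 + vv r om a)))) * crs_set N om B"
   unfolding WC_def crs_set_def tN_def using N by (intro arg_cong2[where f = "(*)"] prod.cong refl) auto
  have f3: "(\<Prod>a\<in>B. \<Prod>j<N. (shw (tt (%_. 1 / real N) om a) (vv r om a) - (one_pt j - 1)) / (vv r om a - (one_pt j - 1)))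
   = (\<Prod>a\<in>B. (1 + of_nat N * (exp (tN N om a) - 1) * (1 + vv r om a) / vv r om a / of_nat N) ^ N)"
  proof (rule prod.cong[OF refl])
   fix a assume a: "a \<in> B"
   have "shw (tN N om a) (vv r om a) / vv r om a = 1 + (exp (tN N om a) - 1) * (1 + vv r om a) / vv r om a"
    using v0[OF a] shw_diff[of "tN N om a" "vv r om a"] by (simp add: field_simps)
   also have "\<dots> = 1 + of_nat N * (exp (tN N om a) - 1) * (1 + vv r om a) / vv r om a / of_nat N" using N by simp
   finally show "(\<Prod>j<N. (shw (tt (%_. 1 / real N) om a) (vv r om a) - (one_pt j - 1)) / (vv r om a - (one_pt j - 1)))
    = (1 + of_nat N * (exp (tN N om a) - 1) * (1 + vv r om a) / vv r om a / of_nat N) ^ N"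
    by (simp add: tN_def)
  qed
  have "lpoly Ps (E N) (%n. psum N one_pt n + (\<Sum>a\<in>B. gch (tt (%_. 1 / real N) om a) (vv r om a) n))
   = lpoly Ps (E N) (%n. \<Sum>a\<in>B. gN N om a n)"
   unfolding lpoly_def
  proof (intro sum.cong refl arg_cong2[where f = "(*)"] prod.cong)
   fix \<pi> b assume "\<pi> \<in> Ps" "b \<in> \<pi>"
   then have "psum N one_pt (card b) = 0" using Pne[of \<pi> b] by (simp add: psum_def power_0_left)
   then show "psum N one_pt (card b) + (\<Sum>a\<in>B. gch (tt (%_. 1 / real N) om a) (vv r om a) (card b)) = (\<Sum>a\<in>B. gN N om a (card b))"
    by (simp add: gN_def tN_def)
  qed
  also have "\<dots> = (\<Sum>T\<in>Pow B. psi Ps (E N) T (gN N om))"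
   by (rule lpoly_expand[OF fB Pf])
  also have "Pow B = {{}} \<union> (%a. {a}) ` B \<union> big_subsets B"
  proof (intro subset_antisym subsetI)
   fix T assume "T \<in> Pow B"
   then have T: "T \<subseteq> B" "finite T" using fB finite_subset by auto
   consider "card T = 0" | "card T = 1" | "2 \<le> card T" by linarith
   then show "T \<in> {{}} \<union> (%a. {a}) ` B \<union> big_subsets B"
    using T by cases (auto simp: big_subsets_def card_1_singleton_iff)
  qed (auto simp: big_subsets_def)
  also have "(\<Sum>T\<in>{{}} \<union> (%a. {a}) ` B \<union> big_subsets B. psi Ps (E N) T (gN N om))
   = psi Ps (E N) {} (gN N om) + (\<Sum>a\<in>B. psi Ps (E N) {a} (gN N om)) + (\<Sum>T\<in>big_subsets B. psi Ps (E N) T (gN N om))"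
  proof -
   have "(\<Sum>T\<in>(%a. {a}) ` B. psi Ps (E N) T (gN N om)) = (\<Sum>a\<in>B. psi Ps (E N) {a} (gN N om))"
    by (subst sum.reindex) auto
   then show ?thesis using fB by (subst sum.union_disjoint, simp, simp, force simp: big_subsets_def)
     (subst sum.union_disjoint, auto)
  qed
  also have "psi Ps (E N) {} (gN N om) = 0"
   unfolding psi_def using Pn0 by (intro sum.neutral ballI) (auto simp: PiE_iff intro!: sum.neutral)
  finally have L: "lpoly Ps (E N) (%n. psum N one_pt n + (\<Sum>a\<in>B. gch (tt (%_. 1 / real N) om a) (vv r om a) n))
   = 0 + (\<Sum>a\<in>B. psi Ps (E N) {a} (gN N om)) + (\<Sum>T\<in>big_subsets B. psi Ps (E N) T (gN N om))" .
  have "exp (lpoly Ps (E N) (%n. psum N one_pt n + (\<Sum>a\<in>B. gch (tt (%_. 1 / real N) om a) (vv r om a) n)))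
   = (\<Prod>a\<in>B. exp (psi Ps (E N) {a} (gN N om))) * (\<Prod>T\<in>big_subsets B. exp (psi Ps (E N) T (gN N om)))"
   unfolding L using fB by (simp add: exp_add exp_sum)
  moreover have "(\<Prod>T\<in>big_subsets B. 1 + chi N om T) = crs_set N om B * (\<Prod>T\<in>big_subsets B. exp (psi Ps (E N) T (gN N om)))"
  proof -
   have "(\<Prod>T\<in>big_subsets B. 1 + chi N om T) = (\<Prod>T\<in>big_subsets B. if card T = 2 then crs_set N om T else 1) * (\<Prod>T\<in>big_subsets B. exp (psi Ps (E N) T (gN N om)))"
    by (simp add: chi_def prod.distrib)
   also have "(\<Prod>T\<in>big_subsets B. if card T = 2 then crs_set N om T else 1) = (\<Prod>T\<in>{T\<in>big_subsets B. card T = 2}. crs_set N om T)"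
    using fB by (intro prod.inter_filter[symmetric]) auto
   also have "\<dots> = (\<Prod>(a, b)\<in>Sigma B (%a. {b\<in>B. a < b}). crs (tN N om a) (vv r om a) (tN N om b) (vv r om b))"
   proof (rule prod.reindex_bij_witness[of _ "%(a, b). {a, b}" "%T. (Min T, Max T)"])
    fix T assume "T \<in> {T\<in>big_subsets B. card T = 2}"
    then obtain a b where ab: "T = {a, b}" "a < b" "a \<in> B" "b \<in> B"
     by (auto simp: big_subsets_def) (metis card_2_iff insert_commute insert_subset linorder_neqE_nat)
    show "(case (Min T, Max T) of (a, b) => {a, b}) = T" "(Min T, Max T) \<in> Sigma B (%a. {b\<in>B. a < b})"
     using ab by auto
    have s: "{c \<in> {a, b}. a < c} = {b}" "{c \<in> {a, b}. b < c} = {}" using ab by auto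
    have "crs_set N om T = (\<Prod>c\<in>{c\<in>{a, b}. a < c}. crs (tN N om a) (vv r om a) (tN N om c) (vv r om c)) *
     (\<Prod>c\<in>{c\<in>{a, b}. b < c}. crs (tN N om b) (vv r om b) (tN N om c) (vv r om c))"
     unfolding crs_set_def ab(1) using ab(2) by (subst prod.insert) auto
    then show "(case (Min T, Max T) of (a, b) => crs (tN N om a) (vv r om a) (tN N om b) (vv r om b)) = crs_set N om T"
     unfolding s using ab by simp
   qed (auto simp: big_subsets_def)
   also have "\<dots> = crs_set N om B"
    unfolding crs_set_def using fB by (subst prod.Sigma) auto
   finally show ?thesis .
  qed
  ultimately show ?thesis
   unfolding WX_def f2 f3 mult.assoc[symmetric] f1
   unfolding muN_def prod.distrib by (simp add: mult_ac)
 qed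
 then show ?thesis
  unfolding MM_def JJ_def integral_mult_right_zero[symmetric] by simp
qed

end

section \<open>The limit of the centred moments\<close>

context asymp
begin

lemma subset_asymp: "B \<subseteq> A ==> asymp Ps E e B r \<eta>"
proof -
 assume B: "B \<subseteq> A"
 have "radii B \<eta> r" using r B unfolding radii_def by blast
 then show ?thesis using Ps A E1 E2 E3 finite_subset[OF B] by unfold_locales auto
qed

definition FF where
 "FF N B om = (\<Prod>a\<in>B. of_nat N * muN N om a) * (\<Prod>T\<in>big_subsets B. 1 + chi N om T)"

definition LL where
 "LL T om = (\<Prod>a\<in>T. muL om a) * KK om T"

lemma own_coords:
 assumes "\<And>i. i \<in> T \<times> UNIV ==> om i = om' i" "a \<in> T"
 shows "tN N om a = tN N om' a" "vv r om a = vv r om' a" "TT om a = TT om' a" "gN N om a n = gN N om' a n" "gL om a n = gL om' a n"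
 using assms by (auto simp: tN_def tt_def vv_def TT_def gN_def gL_def)

lemma psi_cong:
 assumes "\<And>i. i \<in> T \<times> UNIV ==> om i = om' i"
 shows "psi Ps (E N) T (gN N om) = psi Ps (E N) T (gN N om')" "psL om T = psL om' T"
 unfolding psi_def psL_def
 by (intro sum.cong arg_cong2[where f = "(*)"] prod.cong refl own_coords[where T = T] assms; auto simp: PiE_iff)+

lemma muN_cong:
 assumes "\<And>i. i \<in> {a} \<times> UNIV ==> om i = om' i"
 shows "muN N om a = muN N om' a" "muL om a = muL om' a"
 unfolding muN_def muL_def
 using own_coords[of "{a}" om om' a, OF assms] psi_cong[of "{a}" om om', OF assms] by auto

lemma chi_cong:
 assumes "\<And>i. i \<in> T \<times> UNIV ==> om i = om' i"
 shows "chi N om T = chi N om' T"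
proof -
 have "crs_set N om T = crs_set N om' T"
  unfolding crs_set_def by (intro prod.cong refl) (simp add: own_coords[of T om om', OF assms])
 then show ?thesis unfolding chi_def using psi_cong[of T om om', OF assms] by simp
qed

lemma KK_cong:
 assumes "\<And>i. i \<in> T \<times> UNIV ==> om i = om' i"
 shows "KK om T = KK om' T"
proof (cases "card T = 2")
 case True
 then have T: "finite T" "T \<noteq> {}" by (auto intro: card_ge_0_finite)
 have v: "vv r om a = vv r om' a" "TT om a = TT om' a" if "a \<in> T" for a
  using own_coords[of T om om' a, OF assms that] by auto
 have "(\<Prod>a\<in>T. TT om a * (1 + vv r om a)) = (\<Prod>a\<in>T. TT om' a * (1 + vv r om' a))" using v by (intro prod.cong) auto
 moreover have "psL om T = psL om' T" by (rule psi_cong(2)) (rule assms)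
 ultimately show ?thesis unfolding KK_def v(1)[OF Min_in[OF T]] v(1)[OF Max_in[OF T]] by simp
qed (simp add: KK_def)

lemma FF_cong:
 assumes "\<And>i. i \<in> B \<times> UNIV ==> om i = om' i"
 shows "FF N B om = FF N B om'"
 unfolding FF_def
 by (intro arg_cong2[where f = "(*)"] arg_cong2[where f = "(+)"] prod.cong refl muN_cong chi_cong assms) (auto simp: big_subsets_def)

lemma LL_cong:
 assumes "\<And>i. i \<in> T \<times> UNIV ==> om i = om' i"
 shows "LL T om = LL T om'"
 unfolding LL_def
 by (intro arg_cong2[where f = "(*)"] prod.cong refl muN_cong KK_cong assms) auto

lemma chi_bmeas_ev:
 assumes "T \<subseteq> A" "2 \<le> card T"
 shows "eventually (%N. bmeas (PU I) (%om. chi N om T)) sequentially"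
 using bconv_ev_bmeas[OF bchi[OF assms]] eventually_gt_at_top[of 0]
proof eventually_elim
 case (elim N)
 have "bmeas (PU I) (%om. 1 / of_nat N ^ card T * (of_nat N ^ card T * chi N om T))"
  by (intro bconv_mult bmeas_const elim(1))
 then show ?case using elim(2) by simp
qed

lemma FF_bmeas_ev: "eventually (%N. bmeas (PU I) (FF N A)) sequentially"
proof -
 have "eventually (%N. \<forall>T\<in>big_subsets A. bmeas (PU I) (%om. chi N om T)) sequentially"
  using A by (intro eventually_ball_finite) (auto simp: big_subsets_def intro: chi_bmeas_ev)
 moreover have "eventually (%N. \<forall>a\<in>A. bmeas (PU I) (%om. muN N om a)) sequentially"
  using A by (intro eventually_ball_finite) (auto intro: bconv_ev_bmeas bmu)
 ultimately show ?thesis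
 proof eventually_elim
  case (elim N)
  have "bmeas (PU I) (%om. (\<Prod>a\<in>A. of_nat N * muN N om a) * (\<Prod>T\<in>big_subsets A. 1 + chi N om T))"
   by (intro bconv_mult bconv_prod bconv_add bmeas_const) (use elim in auto)
  then show ?case by (simp add: FF_def[abs_def])
 qed
qed

lemma LL_bmeas: "card A \<ge> 2 ==> bmeas (PU I) (LL A)"
proof -
 assume "card A \<ge> 2"
 then have "bmeas (PU I) (%om. (\<Prod>a\<in>A. muL om a) * KK om A)"
  by (intro bconv_mult bconv_prod KK_bmeas bconv_imp_bmeas[OF bmu]) auto
 then show ?thesis by (simp add: LL_def[abs_def])
qed

lemma integral_blocks:
 assumes H: "finite H" "{} \<notin> H" "\<And>S T. S \<in> H ==> T \<in> H ==> S \<noteq> T ==> S \<inter> T = {}" "\<Union>H \<subseteq> A"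
  and dep: "\<And>T om om'. T \<in> H ==> (\<And>i. i \<in> T \<times> UNIV ==> om i = om' i) ==> f T om = f T om'"
  and bm: "\<And>T. T \<in> H ==> bmeas (PU (T \<times> UNIV)) (f T)"
 shows "bmeas (PU (\<Union>H \<times> UNIV)) (%om. \<Prod>T\<in>H. f T om)"
  "integral\<^sup>L (PU (\<Union>H \<times> UNIV)) (%om. \<Prod>T\<in>H. f T om) = (\<Prod>T\<in>H. integral\<^sup>L (PU (T \<times> UNIV)) (f T))"
proof -
 let ?i = "%T :: nat set. T \<times> (UNIV :: bool set)" and ?g = "%S. f (fst ` S)"
 have inj: "inj_on ?i H" by (auto simp: inj_on_def)
 have fi: "fst ` ?i T = T" for T by force
 have U: "\<Union>(?i ` H) = \<Union>H \<times> UNIV" by auto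
 have *: "bmeas (PU (\<Union>(?i ` H))) (%om. \<Prod>S\<in>?i ` H. ?g S om) \<and>
  integral\<^sup>L (PU (\<Union>(?i ` H))) (%om. \<Prod>S\<in>?i ` H. ?g S om) = (\<Prod>S\<in>?i ` H. integral\<^sup>L (PU S) (?g S))"
 proof (rule PU_factor)
  show "finite S" if S: "S \<in> ?i ` H" for S
  proof -
   obtain T where T: "T \<in> H" "S = ?i T" using S by auto
   then have "finite T" using H(4) A finite_subset[of T A] by auto
   then show ?thesis using T by simp
  qed
  show "S \<inter> S' = {}" if SH: "S \<in> ?i ` H" "S' \<in> ?i ` H" "S \<noteq> S'" for S S'
  proof -
   obtain T where T1: "T \<in> H" "S = ?i T" using SH(1) by blast
   obtain T' where T2: "T' \<in> H" "S' = ?i T'" using SH(2) by blast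
   note T = T1 T2
   then have "T \<inter> T' = {}" using H(3)[of T T'] SH(3) by auto
   then show ?thesis using T by auto
  qed
  show "?g S om = ?g S om'" if SH: "S \<in> ?i ` H" "\<And>i. i \<in> S ==> om i = om' i" for S om om'
  proof -
   obtain T where T: "T \<in> H" "S = ?i T" using SH(1) by blast
   show ?thesis unfolding T(2) fi by (rule dep[OF T(1)]) (use SH(2) T(2) in auto)
  qed
  show "bmeas (PU S) (?g S)" if SH: "S \<in> ?i ` H" for S
  proof -
   obtain T where T: "T \<in> H" "S = ?i T" using SH by blast
   show ?thesis unfolding T(2) fi by (rule bm[OF T(1)])
  qed
 qed (use H in auto)
 then show "bmeas (PU (\<Union>H \<times> UNIV)) (%om. \<Prod>T\<in>H. f T om)"
  "integral\<^sup>L (PU (\<Union>H \<times> UNIV)) (%om. \<Prod>T\<in>H. f T om) = (\<Prod>T\<in>H. integral\<^sup>L (PU (T \<times> UNIV)) (f T))"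
  unfolding U prod.reindex[OF inj] comp_def fi by auto
qed

lemma MM_FF:
 assumes "B \<subseteq> A" "N > 0"
 shows "MM N B = integral\<^sup>L (PU (B \<times> UNIV)) (FF N B)"
 unfolding MM_eq[OF assms] FF_def[abs_def] ..

lemma big_subsets_singleton [simp]: "big_subsets {a} = {}"
proof -
 have "\<not> 2 \<le> card T" if "T \<subseteq> {a}" for T using card_mono[OF _ that] by simp
 then show ?thesis unfolding big_subsets_def by blast
qed

text \<open>Independent angles turn a product of moments into one integral over all angles. The
  alternating sum can then be carried out inside the integral before any limit, which is essential
  because its terms are separately of order N^|A|.\<close>

lemma MM_product:
 assumes B: "B \<subseteq> A" and N: "N > 0"
  and bm: "\<forall>B\<in>Pow A. bmeas (PU (B \<times> UNIV)) (FF N B)"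
 shows "bmeas (PU I) (%om. FF N B om * (\<Prod>a\<in>A - B. - FF N {a} om)) \<and>
  MM N B * (\<Prod>a\<in>A - B. - MM N {a}) = integral\<^sup>L (PU I) (%om. FF N B om * (\<Prod>a\<in>A - B. - FF N {a} om))"
proof (cases "B = {}")
 \<comment> \<open>\<open>integral_blocks\<close> admits no empty block, so B = {} is treated apart;
   its factor is 1.\<close>
 case True
 let ?H = "(%a. {a}) ` A"
 have inj: "inj_on (%a. {a}) A" by (auto simp: inj_on_def)
 have "big_subsets {} = {}" by (auto simp: big_subsets_def)
 then have F0: "FF N {} om = 1" for om by (simp add: FF_def)
 have MM0: "MM N {} = 1" using MM_FF[of "{}" N] N unfolding F0 by (simp add: prob_space.prob_space[OF prob_PU])
 have U: "\<Union>?H = A" by auto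
 have b: "bmeas (PU (T \<times> UNIV)) (%om. - FF N T om)" if "T \<in> ?H" for T
  by (intro bconv_uminus) (use bm that in auto)
 have d: "- FF N T om = - FF N T om'" if "T \<in> ?H" "\<And>i. i \<in> T \<times> UNIV ==> om i = om' i" for T om om'
  by (rule arg_cong[where f = uminus], rule FF_cong) (rule that(2))
 have fH: "finite ?H" and ne: "{} \<notin> ?H" and sub: "\<Union>?H \<subseteq> A" using A by auto
 have dis: "S \<inter> T = {}" if "S \<in> ?H" "T \<in> ?H" "S \<noteq> T" for S T using that by auto
 have 1: "bmeas (PU (\<Union>?H \<times> UNIV)) (%om. \<Prod>T\<in>?H. - FF N T om)"
  by (rule integral_blocks(1)[where f = "%T om. - FF N T om", OF fH ne dis sub d b])
 have 2: "integral\<^sup>L (PU (\<Union>?H \<times> UNIV)) (%om. \<Prod>T\<in>?H. - FF N T om) = (\<Prod>T\<in>?H. integral\<^sup>L (PU (T \<times> UNIV)) (%om. - FF N T om))"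
  by (rule integral_blocks(2)[where f = "%T om. - FF N T om", OF fH ne dis sub d b])
 have 3: "(\<Prod>a\<in>A. - MM N {a}) = (\<Prod>T\<in>?H. integral\<^sup>L (PU (T \<times> UNIV)) (%om. - FF N T om))"
  unfolding prod.reindex[OF inj] comp_def by (intro prod.cong refl) (simp add: MM_FF N)
 have 4: "(%om. \<Prod>T\<in>?H. - FF N T om) = (%om. FF N {} om * (\<Prod>a\<in>A - {}. - FF N {a} om))"
  unfolding prod.reindex[OF inj] comp_def F0 by simp
 show ?thesis using 1 2 unfolding U 4 3[symmetric] True MM0 by simp
next
 case False
 let ?H = "insert B ((%a. {a}) ` (A - B))"
 let ?f = "%T om. if T = B then FF N B om else - FF N T om"
 have inj: "inj_on (%a. {a}) (A - B)" by (auto simp: inj_on_def)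
 have nin: "B \<notin> (%a. {a}) ` (A - B)" by auto
 have U: "\<Union>?H = A" using B by auto
 have split: "(\<Prod>T\<in>?H. g T) = g B * (\<Prod>a\<in>A - B. g {a})" for g :: "nat set => complex"
  using A nin by (subst prod.insert) (auto simp: prod.reindex[OF inj])
 have sB: "{a} \<noteq> B" if "a \<in> A - B" for a using that by auto
 have b: "bmeas (PU (T \<times> UNIV)) (?f T)" if "T \<in> ?H" for T
  by (cases "T = B") (use bm that B in \<open>auto intro!: bconv_uminus\<close>)
 have d: "?f T om = ?f T om'" if "T \<in> ?H" "\<And>i. i \<in> T \<times> UNIV ==> om i = om' i" for T om om'
 proof -
  have "FF N T om = FF N T om'" by (rule FF_cong) (rule that(2))
  then show ?thesis by (cases "T = B") simp_all
 qed
 have dis: "S \<inter> T = {}" if "S \<in> ?H" "T \<in> ?H" "S \<noteq> T" for S T using that by auto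
 have fH: "finite ?H" and ne: "{} \<notin> ?H" and sub: "\<Union>?H \<subseteq> A" using A B False by auto
 have 1: "bmeas (PU (\<Union>?H \<times> UNIV)) (%om. \<Prod>T\<in>?H. ?f T om)"
  by (rule integral_blocks(1)[where f = ?f, OF fH ne dis sub d b])
 have 2: "integral\<^sup>L (PU (\<Union>?H \<times> UNIV)) (%om. \<Prod>T\<in>?H. ?f T om) = (\<Prod>T\<in>?H. integral\<^sup>L (PU (T \<times> UNIV)) (?f T))"
  by (rule integral_blocks(2)[where f = ?f, OF fH ne dis sub d b])
 have 3: "(\<Prod>T\<in>?H. ?f T om) = FF N B om * (\<Prod>a\<in>A - B. - FF N {a} om)" for om
  unfolding split using sB by simp
 have 4: "(\<Prod>T\<in>?H. integral\<^sup>L (PU (T \<times> UNIV)) (?f T)) = MM N B * (\<Prod>a\<in>A - B. - MM N {a})"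
  unfolding split using sB by (simp add: MM_FF[OF B N] MM_FF N)
 show ?thesis using 1 2 unfolding U 3 4 by (intro conjI) (simp_all only:)
qed

text \<open>The product of the chi lives on scale N to the minus sum of the |T|, and for a cover
  this sum is at least |A|, with equality only for disjoint members. Members with three or more
  elements have limit weight 0, so perfect matchings remain.\<close>

lemma covering_limit:
 assumes H: "H \<subseteq> big_subsets A" "\<Union>H = A"
 shows "bconv (PU I) (%N om. of_nat N ^ card A * (\<Prod>T\<in>H. chi N om T))
  (%om. if H \<in> matchings A then \<Prod>T\<in>H. KK om T else 0)"
proof -
 have fH: "finite H" using finite_subset[OF H(1)] A by simp
 have fT: "finite T" if "T \<in> H" for T using that H A finite_subset[of T A] by (auto simp: big_subsets_def)
 let ?s = "\<Sum>T\<in>H. card T"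
 have sge: "card A \<le> ?s" using card_Union_le_sum_card_weak[of H] fT H(2) by simp
 define m where "m = ?s - card A"
 have l: "bconv (PU I) (%N om. of_real (1 / real N) ^ m * (\<Prod>T\<in>H. of_nat N ^ card T * chi N om T)) (%om. 0 ^ m * (\<Prod>T\<in>H. KK om T))"
  by (intro bconv_mult bconv_const tendsto_power inverse_real_lim bconv_prod bchi) (use H in \<open>auto simp: big_subsets_def\<close>)
 have m0: "m = 0 \<and> (\<forall>T\<in>H. card T = 2) \<longleftrightarrow> H \<in> matchings A"
 proof
  assume a: "m = 0 \<and> (\<forall>T\<in>H. card T = 2)"
  then have "?s = card (\<Union>H)" unfolding H(2) using sge m_def by linarith
  then show "H \<in> matchings A"
   unfolding matchings_def using disjoint_if_card_sum[OF fH fT] a H by (auto simp: big_subsets_def)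
 next
  assume a: "H \<in> matchings A"
  then have "card (\<Union>H) = ?s" by (intro card_Union_disjoint) (auto simp: matchings_def pairwise_def disjnt_def fT)
  then show "m = 0 \<and> (\<forall>T\<in>H. card T = 2)" using a H(2) by (auto simp: m_def matchings_def)
 qed
 have "0 ^ m * (\<Prod>T\<in>H. KK om T) = (if H \<in> matchings A then \<Prod>T\<in>H. KK om T else 0)" for om
 proof (cases "H \<in> matchings A")
  case False
  have "m \<noteq> 0 \<or> (\<exists>T\<in>H. card T \<noteq> 2)" using m0 False by auto
  then consider "m \<noteq> 0" | T where "T \<in> H" "card T \<noteq> 2" by auto
  then show ?thesis
  proof cases
   case 2
   then have "KK om T = 0" by (simp add: KK_def)
   then have "(\<Prod>T\<in>H. KK om T) = 0" using fH 2 by auto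
   then show ?thesis using False by simp
  qed (use False in \<open>simp add: power_0_left\<close>)
 qed (use m0 in auto)
 then have l': "bconv (PU I) (%N om. of_real (1 / real N) ^ m * (\<Prod>T\<in>H. of_nat N ^ card T * chi N om T))
  (%om. if H \<in> matchings A then \<Prod>T\<in>H. KK om T else 0)" using l by simp
 have chm: "(%om. chi N om T) \<in> borel_measurable (PU I)" if "T \<in> H" for N T
 proof (cases "N = 0")
  case True
  have t0: "tN 0 om a = 0" for om a unfolding tN_def tt_TT by simp
  have "gN 0 om = (%_ _. 0)" for om by (intro ext) (simp add: gN_def gch_def t0 shw_def)
  then have p: "psi Ps (E 0) T (gN 0 om) = psi Ps (E 0) T (%_ _. 0)" for om by simp
  have "crs_set 0 om T = (\<Prod>a\<in>T. \<Prod>b\<in>{b\<in>T. a < b}. (vv r om a - vv r om b) * (vv r om a - vv r om b) / ((vv r om a - vv r om b) * (vv r om a - vv r om b)))" for om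
   unfolding crs_set_def crs_def by (simp add: t0 shw_def)
  moreover have "(%om. vv r om a) \<in> borel_measurable (PU I)" if "a \<in> T" for a
   using bconv_meas(2)[OF bv] \<open>T \<in> H\<close> that H by blast
  ultimately have "(%om. crs_set 0 om T) \<in> borel_measurable (PU I)"
   by (auto intro!: borel_measurable_diff borel_measurable_times borel_measurable_prod borel_measurable_divide)
  then show ?thesis unfolding chi_def True p by (cases "card T = 2") simp_all
 next
  case False
  have "(%om. of_nat N ^ card T * chi N om T) \<in> borel_measurable (PU I)"
   by (rule bconv_meas(1)[OF bchi]) (use that H in \<open>auto simp: big_subsets_def\<close>)
  then have "(%om. 1 / of_nat N ^ card T * (of_nat N ^ card T * chi N om T)) \<in> borel_measurable (PU I)" by (rule borel_measurable_times[OF borel_measurable_const])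
  moreover have "1 / of_nat N ^ card T * (of_nat N ^ card T * chi N om T) = chi N om T" for om using False by simp
  ultimately show ?thesis by (simp only:)
 qed
 show ?thesis
 proof (rule bconv_cong_ev[OF l'])
  show "(%om. of_nat N ^ card A * (\<Prod>T\<in>H. chi N om T)) \<in> borel_measurable (PU I)" for N
   by (intro borel_measurable_times borel_measurable_const borel_measurable_prod chm)
  show "eventually (%N. \<forall>om. of_nat N ^ card A * (\<Prod>T\<in>H. chi N om T) = of_real (1 / real N) ^ m * (\<Prod>T\<in>H. of_nat N ^ card T * chi N om T)) sequentially"
   using eventually_gt_at_top[of 0]
  proof eventually_elim
   case (elim N)
   have "complex_of_nat N ^ ?s = of_nat N ^ m * of_nat N ^ card A" using sge by (simp add: m_def power_add[symmetric])
   then have "of_real (1 / real N) ^ m * complex_of_nat N ^ ?s = of_nat N ^ card A"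
    using elim by (simp add: power_divide)
   then show ?case by (simp add: prod.distrib power_sum[symmetric] mult.assoc[symmetric])
  qed
 qed
qed

text \<open>The sum over B is the centred mixed moment. Under the integral, the cluster expansion
  leaves only covering families, weighted by N^|A|; in the limit the integral factors over the pairs
  of a matching.\<close>

lemma cumulant_limit:
 "(%N. \<Sum>B\<in>Pow A. MM N B * (\<Prod>a\<in>A - B. - MM N {a}))
  \<longlonglongrightarrow> (\<Sum>H\<in>matchings A. \<Prod>T\<in>H. integral\<^sup>L (PU (T \<times> UNIV)) (LL T))"
proof -
 define cov where "cov = {H. H \<subseteq> big_subsets A \<and> \<Union>H = A}"
 have fcov: "finite cov" unfolding cov_def using A by (rule_tac finite_subset[of _ "Pow (big_subsets A)"]) auto
 let ?G = "%N om. (\<Prod>a\<in>A. muN N om a) * (\<Sum>H\<in>cov. of_nat N ^ card A * (\<Prod>T\<in>H. chi N om T))"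
 have l: "bconv (PU I) ?G (%om. (\<Prod>a\<in>A. muL om a) * (\<Sum>H\<in>cov. if H \<in> matchings A then \<Prod>T\<in>H. KK om T else 0))"
  by (intro bconv_mult bconv_prod bmu bconv_sum covering_limit) (auto simp: cov_def)
 have mc: "matchings A \<subseteq> cov" unfolding matchings_def cov_def big_subsets_def by auto
 have fm: "finite (matchings A)" using finite_matchings[OF A] .
 have Hprops: "finite H" "{} \<notin> H" "\<And>S T. S \<in> H ==> T \<in> H ==> S \<noteq> T ==> S \<inter> T = {}" "\<Union>H = A" "\<And>T. T \<in> H ==> T \<subseteq> A \<and> card T = 2 \<and> finite T"
  if "H \<in> matchings A" for H
  using that A finite_subset[of H "Pow A"] by (auto simp: matchings_def intro: finite_subset)
 have LLprod: "(\<Prod>T\<in>H. LL T om) = (\<Prod>a\<in>A. muL om a) * (\<Prod>T\<in>H. KK om T)" if H: "H \<in> matchings A" for H om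
 proof -
  have "prod (muL om) (\<Union>H) = (\<Prod>T\<in>H. \<Prod>a\<in>T. muL om a)"
   using prod.Union_disjoint[of H "muL om"] Hprops[OF H] by (auto simp: comp_def)
  then show ?thesis unfolding LL_def prod.distrib Hprops(4)[OF H] by simp
 qed
 have lim_eq: "(\<Prod>a\<in>A. muL om a) * (\<Sum>H\<in>cov. if H \<in> matchings A then \<Prod>T\<in>H. KK om T else 0) = (\<Sum>H\<in>matchings A. \<Prod>T\<in>H. LL T om)" for om
 proof -
  have "(\<Sum>H\<in>cov. if H \<in> matchings A then \<Prod>T\<in>H. KK om T else 0) = (\<Sum>H\<in>matchings A. \<Prod>T\<in>H. KK om T)"
   using mc fcov by (simp add: sum.inter_restrict[symmetric] Int_absorb1)
  then show ?thesis by (simp add: sum_distrib_left LLprod)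
 qed
 have blk: "bmeas (PU I) (%om. \<Prod>T\<in>H. LL T om) \<and> integral\<^sup>L (PU I) (%om. \<Prod>T\<in>H. LL T om) = (\<Prod>T\<in>H. integral\<^sup>L (PU (T \<times> UNIV)) (LL T))"
  if H: "H \<in> matchings A" for H
 proof -
  note h = Hprops[OF H]
  have b: "bmeas (PU (T \<times> UNIV)) (LL T)" if "T \<in> H" for T
   using asymp.LL_bmeas[OF subset_asymp[of T]] h(5)[OF that] by simp
  have sub: "\<Union>H \<subseteq> A" using h(4) by simp
  note ib = integral_blocks[where H = H and f = LL, OF h(1) h(2) h(3) sub LL_cong b]
  show ?thesis using ib unfolding h(4) by blast
 qed
 have int_lim: "integral\<^sup>L (PU I) (%om. \<Sum>H\<in>matchings A. \<Prod>T\<in>H. LL T om) = (\<Sum>H\<in>matchings A. \<Prod>T\<in>H. integral\<^sup>L (PU (T \<times> UNIV)) (LL T))"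
 proof -
  have "integral\<^sup>L (PU I) (%om. \<Sum>H\<in>matchings A. \<Prod>T\<in>H. LL T om) = (\<Sum>H\<in>matchings A. integral\<^sup>L (PU I) (%om. \<Prod>T\<in>H. LL T om))"
   by (rule Bochner_Integration.integral_sum) (use blk bmeas_PU_integrable in blast)
  then show ?thesis using blk by simp
 qed
 have ev: "eventually (%N. \<forall>B\<in>Pow A. bmeas (PU (B \<times> UNIV)) (FF N B)) sequentially"
  using A asymp.FF_bmeas_ev[OF subset_asymp] by (intro eventually_ball_finite) auto
 have "eventually (%N. integral\<^sup>L (PU I) (?G N) = (\<Sum>B\<in>Pow A. MM N B * (\<Prod>a\<in>A - B. - MM N {a}))) sequentially"
  using ev eventually_gt_at_top[of 0]
 proof eventually_elim
  case (elim N)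
  note mp = MM_product[OF _ elim(2) elim(1)]
  have pt: "(\<Sum>B\<in>Pow A. FF N B om * (\<Prod>a\<in>A - B. - FF N {a} om)) = ?G N om" for om
  proof -
   have "FF N B om * (\<Prod>a\<in>A - B. - FF N {a} om) = (\<Prod>a\<in>A. of_nat N * muN N om a) * ((- 1) ^ card (A - B) * (\<Prod>T\<in>big_subsets B. 1 + chi N om T))" if "B \<in> Pow A" for B
   proof -
    have "(\<Prod>a\<in>A - B. - FF N {a} om) = (\<Prod>a\<in>A - B. (- 1) * (of_nat N * muN N om a))" by (simp add: FF_def)
    also have "\<dots> = (- 1) ^ card (A - B) * (\<Prod>a\<in>A - B. of_nat N * muN N om a)"
     by (subst prod.distrib) simp
    finally have e: "(\<Prod>a\<in>A - B. - FF N {a} om) = (- 1) ^ card (A - B) * (\<Prod>a\<in>A - B. of_nat N * muN N om a)" .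
    have "(\<Prod>a\<in>A. of_nat N * muN N om a) = (\<Prod>a\<in>A - B. of_nat N * muN N om a) * (\<Prod>a\<in>B. of_nat N * muN N om a)"
     using that A by (intro prod.subset_diff) auto
    then show ?thesis unfolding e unfolding FF_def by (simp only: mult_ac)
   qed
   then have "(\<Sum>B\<in>Pow A. FF N B om * (\<Prod>a\<in>A - B. - FF N {a} om)) = (\<Prod>a\<in>A. of_nat N * muN N om a) * (\<Sum>B\<in>Pow A. (- 1) ^ card (A - B) * (\<Prod>T\<in>big_subsets B. 1 + chi N om T))"
    by (simp add: sum_distrib_left)
   also have "\<dots> = ?G N om"
    unfolding cluster_expansion[OF A] cov_def[symmetric] sum_distrib_left[symmetric] prod.distrib by (simp add: mult_ac)
   finally show ?thesis .
  qed
  have "(\<Sum>B\<in>Pow A. MM N B * (\<Prod>a\<in>A - B. - MM N {a})) = (\<Sum>B\<in>Pow A. integral\<^sup>L (PU I) (%om. FF N B om * (\<Prod>a\<in>A - B. - FF N {a} om)))"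
   using mp by (intro sum.cong) auto
  also have "\<dots> = integral\<^sup>L (PU I) (%om. \<Sum>B\<in>Pow A. FF N B om * (\<Prod>a\<in>A - B. - FF N {a} om))"
   by (rule Bochner_Integration.integral_sum[symmetric]) (use mp bmeas_PU_integrable in blast)
  finally show ?case unfolding pt by simp
 qed
 moreover have "(%N. integral\<^sup>L (PU I) (?G N)) \<longlonglongrightarrow> integral\<^sup>L (PU I) (%om. \<Sum>H\<in>matchings A. \<Prod>T\<in>H. LL T om)"
  using bconv_integral[OF finite_measure_PU l] unfolding lim_eq .
 ultimately show ?thesis unfolding int_lim by (rule Lim_transform_eventually[rotated])
qed

end

subsection \<open>Gaussian vectors and matchings\<close>

definition SN :: "(nat => real) measure" where
 "SN = PiM UNIV (%_. density lborel std_normal_density)"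

lemma prob_std_normal: "prob_space (density lborel std_normal_density)"
 by (rule prob_space_normal_density) simp

interpretation SNp: product_prob_space "%_ :: nat. density lborel std_normal_density" UNIV
 unfolding product_prob_space_def product_prob_space_axioms_def product_sigma_finite_def
 using prob_std_normal prob_space_imp_sigma_finite by blast

lemma prob_SN: "prob_space SN"
 unfolding SN_def by (rule prob_space_PiM) (rule prob_std_normal)

interpretation SN: prob_space SN by (rule prob_SN)

lemma SN_coord [measurable]: "(%om. om i) \<in> borel_measurable SN"
proof -
 have "(%om. om i) \<in> measurable SN (density lborel std_normal_density)"
  unfolding SN_def by (rule measurable_component_singleton) simp
 also have "measurable SN (density lborel std_normal_density) = borel_measurable SN"
  by (rule measurable_cong_sets) auto
 finally show ?thesis .
qed

lemma distr_SN: "distr SN borel (%om. om i) = density lborel std_normal_density"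
proof -
 have "distr SN borel (%om. om i) = distr SN (density lborel std_normal_density) (%om. om i)"
  by (rule distr_cong) auto
 then show ?thesis unfolding SN_def using SNp.PiM_component[of i] by simp
qed

lemma SN_distributed: "distributed SN lborel (%om. om i) std_normal_density"
proof -
 have "distr SN lborel (%om. om i) = distr SN borel (%om. om i)" by (rule distr_cong) auto
 then show ?thesis unfolding distributed_def distr_SN by simp
qed

lemma indep_SN: "SN.indep_vars (%_. borel) (%i om. om i) I"
proof -
 have "SN.indep_vars (%_. borel) (%i om. om i) UNIV"
 proof (subst SN.indep_vars_iff_distr_eq_PiM)
  have "distr SN (PiM UNIV (%_. borel)) (%x. \<lambda>i\<in>UNIV. x i) = distr SN SN (%x. x)"
   by (rule distr_cong) (auto simp: SN_def intro!: sets_PiM_cong)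
  also have "\<dots> = SN" by simp
  finally show "distr SN (PiM UNIV (%_. borel)) (%x. \<lambda>i\<in>UNIV. x i) = PiM UNIV (%i. distr SN borel (%om. om i))"
   unfolding distr_SN by (simp add: SN_def)
 qed auto
 then show ?thesis by (rule SN.indep_vars_subset) simp
qed

definition gmom :: "nat => real" where
 "gmom n = integral\<^sup>L lborel (%x. std_normal_density x * x ^ n)"

lemma gmom_0 [simp]: "gmom 0 = 1"
 using integral_std_normal_moment_even[of 0] by (simp add: gmom_def)

lemma gmom_1 [simp]: "gmom (Suc 0) = 0"
 using integral_std_normal_moment_odd[of 0] by (simp add: gmom_def)

text \<open>Stein's identity E[X f(X)] = E[f'(X)] for the monomial f(x) = x^n.\<close>

lemma gmom_rec: "gmom (Suc n) = real n * gmom (n - 1)"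
proof (cases "even n")
 case True
 then obtain k where k: "n = 2 * k" by (elim evenE)
 have "gmom (Suc n) = 0" using integral_std_normal_moment_odd[of k] by (simp add: gmom_def k)
 moreover have "real n * gmom (n - 1) = 0"
 proof (cases k)
  case (Suc m)
  then show ?thesis using integral_std_normal_moment_odd[of m] by (simp add: gmom_def k)
 qed (simp add: k)
 ultimately show ?thesis by simp
next
 case False
 then obtain k where k: "n = 2 * k + 1" by (elim oddE)
 have "gmom (Suc n) = fact (2 * Suc k) / (2 ^ Suc k * fact (Suc k))"
  using integral_std_normal_moment_even[of "Suc k"] by (simp add: gmom_def k)
 moreover have "gmom (n - 1) = fact (2 * k) / (2 ^ k * fact k)"
  using integral_std_normal_moment_even[of k] by (simp add: gmom_def k)
 moreover have "fact (2 * Suc k) / (2 ^ Suc k * fact (Suc k)) =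
  (2 * (real k + 1)) * ((2 * real k + 1) * fact (2 * k)) / ((2 * (real k + 1)) * (2 ^ k * fact k))"
  by (simp add: algebra_simps)
 moreover have nz: "2 * (real k + 1) \<noteq> 0" by simp
 ultimately have "gmom (Suc n) = (2 * real k + 1) * fact (2 * k) / (2 ^ k * fact k)"
  using mult_divide_mult_cancel_left[OF nz, of "(2 * real k + 1) * fact (2 * k)" "2 ^ k * fact k"] by (simp only:)
 then show ?thesis using \<open>gmom (n - 1) = fact (2 * k) / (2 ^ k * fact k)\<close> by (simp add: k)
qed

lemma SN_moment: "integrable SN (%om. om i ^ n)" "integral\<^sup>L SN (%om. om i ^ n) = gmom n"
proof -
 have 1: "integrable (distr SN borel (%om. om i)) (%x. x ^ n)"
  unfolding distr_SN using integrable_std_normal_moment[of n]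
  by (subst integrable_density) auto
 then show "integrable SN (%om. om i ^ n)"
  by (subst (asm) integrable_distr_eq) auto
 have "integral\<^sup>L SN (%om. om i ^ n) = integral\<^sup>L (distr SN borel (%om. om i)) (%x. x ^ n)"
  by (subst integral_distr) auto
 also have "\<dots> = gmom n" unfolding distr_SN gmom_def by (subst integral_density) auto
 finally show "integral\<^sup>L SN (%om. om i ^ n) = gmom n" .
qed

lemma SN_monomial:
 assumes "finite I"
 shows "integrable SN (%om. \<Prod>i\<in>I. om i ^ n i)" "integral\<^sup>L SN (%om. \<Prod>i\<in>I. om i ^ n i) = (\<Prod>i\<in>I. gmom (n i))"
proof -
 have ind: "SN.indep_vars (%_. borel) (%i om. om i ^ n i) I"
  by (rule SN.indep_vars_compose2[OF indep_SN]) auto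
 show "integrable SN (%om. \<Prod>i\<in>I. om i ^ n i)"
  by (rule SN.indep_vars_integrable[OF assms ind]) (rule SN_moment)
 show "integral\<^sup>L SN (%om. \<Prod>i\<in>I. om i ^ n i) = (\<Prod>i\<in>I. gmom (n i))"
  using SN.indep_vars_lebesgue_integral[OF assms ind] SN_moment by simp
qed

lemma prod_coords:
 fixes h :: "'a => nat"
 assumes "finite B" "\<And>a. a \<in> B ==> h a \<le> m"
 shows "(\<Prod>a\<in>B. om (h a)) = (\<Prod>i\<le>m. om i ^ card {a\<in>B. h a = i} :: real)"
proof -
 have "(\<Prod>a\<in>B. om (h a)) = (\<Prod>i\<in>{..m}. \<Prod>a\<in>{a\<in>B. h a = i}. om (h a))"
  by (rule prod.group[symmetric]) (use assms in auto)
 also have "\<dots> = (\<Prod>i\<le>m. om i ^ card {a\<in>B. h a = i})" by (intro prod.cong refl) simp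
 finally show ?thesis .
qed

lemma SN_coord_prod:
 assumes "finite B" "\<And>a. a \<in> B ==> h a \<le> m"
 shows "integrable SN (%om. \<Prod>a\<in>B. om (h a))"
  "integral\<^sup>L SN (%om. \<Prod>a\<in>B. om (h a)) = (\<Prod>i\<le>m. gmom (card {a\<in>B. h a = i}))"
proof -
 have e: "(%om. \<Prod>a\<in>B. om (h a)) = (%om. \<Prod>i\<le>m. om i ^ card {a\<in>B. h a = i} :: real)"
  by (intro ext prod_coords[OF assms])
 show "integrable SN (%om. \<Prod>a\<in>B. om (h a))"
  "integral\<^sup>L SN (%om. \<Prod>a\<in>B. om (h a)) = (\<Prod>i\<le>m. gmom (card {a\<in>B. h a = i}))"
  unfolding e by (rule SN_monomial, simp)+
qed

text \<open>Gaussian integration by parts in coordinate j: the exponent produced by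
  \<open>gmom_rec\<close> counts the factors equal to that coordinate, and each of them is removed
  once.\<close>

lemma stein_coords:
 assumes B: "finite B" "\<And>a. a \<in> B ==> h a \<le> m" and j: "j \<le> m"
 shows "integrable SN (%om. om j * (\<Prod>a\<in>B. om (h a)))"
  "integral\<^sup>L SN (%om. om j * (\<Prod>a\<in>B. om (h a))) =
   (\<Sum>a\<in>B. if h a = j then integral\<^sup>L SN (%om. \<Prod>b\<in>B - {a}. om (h b)) else 0)"
proof -
 let ?n = "%i. card {a\<in>B. h a = i}"
 have e: "om j * (\<Prod>a\<in>B. om (h a)) = (\<Prod>i\<le>m. om i ^ (if i = j then Suc (?n i) else ?n i))" for om :: "nat => real"
 proof -
  have "(\<Prod>i\<le>m. om i ^ (if i = j then Suc (?n i) else ?n i)) = (\<Prod>i\<le>m. (if i = j then om i else 1) * om i ^ ?n i)"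
   by (intro prod.cong) auto
  also have "\<dots> = om j * (\<Prod>i\<le>m. om i ^ ?n i)" using j by (simp add: prod.distrib)
  also have "(\<Prod>i\<le>m. om i ^ ?n i) = (\<Prod>a\<in>B. om (h a))" by (rule prod_coords[OF B, symmetric])
  finally show ?thesis by (rule sym)
 qed
 show "integrable SN (%om. om j * (\<Prod>a\<in>B. om (h a)))" unfolding e by (rule SN_monomial) simp
 let ?R = "\<Prod>i\<in>{..m} - {j}. gmom (?n i)"
 have "integral\<^sup>L SN (%om. om j * (\<Prod>a\<in>B. om (h a))) = (\<Prod>i\<le>m. gmom (if i = j then Suc (?n i) else ?n i))"
  unfolding e by (rule SN_monomial) simp
 also have "\<dots> = gmom (Suc (?n j)) * (\<Prod>i\<in>{..m} - {j}. gmom (if i = j then Suc (?n i) else ?n i))"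
  using j by (subst prod.remove[of _ j]) auto
 also have "(\<Prod>i\<in>{..m} - {j}. gmom (if i = j then Suc (?n i) else ?n i)) = ?R"
  by (intro prod.cong) auto
 finally have L: "integral\<^sup>L SN (%om. om j * (\<Prod>a\<in>B. om (h a))) = real (?n j) * gmom (?n j - 1) * ?R"
  by (simp add: gmom_rec)
 have "integral\<^sup>L SN (%om. \<Prod>b\<in>B - {a}. om (h b)) = gmom (?n j - 1) * ?R" if a: "a \<in> B" "h a = j" for a
 proof -
  have s: "{b \<in> B - {a}. h b = i} = (if i = j then {b\<in>B. h b = j} - {a} else {b\<in>B. h b = i})" for i
   using a by auto
  have c: "card {b \<in> B - {a}. h b = i} = (if i = j then ?n j - 1 else ?n i)" for i
   unfolding s using a B by (simp add: card_Diff_singleton)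
  have "integral\<^sup>L SN (%om. \<Prod>b\<in>B - {a}. om (h b)) = (\<Prod>i\<le>m. gmom (card {b \<in> B - {a}. h b = i}))"
   by (rule SN_coord_prod(2)) (use B in auto)
  also have "\<dots> = (\<Prod>i\<le>m. gmom (if i = j then ?n j - 1 else ?n i))" unfolding c ..
  also have "\<dots> = gmom (?n j - 1) * (\<Prod>i\<in>{..m} - {j}. gmom (if i = j then ?n j - 1 else ?n i))"
   using j by (subst prod.remove[of _ j]) auto
  also have "(\<Prod>i\<in>{..m} - {j}. gmom (if i = j then ?n j - 1 else ?n i)) = ?R"
   by (intro prod.cong) auto
  finally show ?thesis .
 qed
 then have "(\<Sum>a\<in>B. if h a = j then integral\<^sup>L SN (%om. \<Prod>b\<in>B - {a}. om (h b)) else 0)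
  = (\<Sum>a\<in>B. if h a = j then gmom (?n j - 1) * ?R else 0)"
  by (intro sum.cong) auto
 also have "\<dots> = (\<Sum>a\<in>{a\<in>B. h a = j}. gmom (?n j - 1) * ?R)" using B by (intro sum.inter_filter[symmetric])
 finally show "integral\<^sup>L SN (%om. om j * (\<Prod>a\<in>B. om (h a))) =
   (\<Sum>a\<in>B. if h a = j then integral\<^sup>L SN (%om. \<Prod>b\<in>B - {a}. om (h b)) else 0)"
  unfolding L by simp
qed

definition lin :: "nat => (nat => real) => (nat => real) => real" where
 "lin m v om = (\<Sum>j\<le>m. v j * om j)"

lemma prod_lin:
 assumes "finite B"
 shows "(\<Prod>a\<in>B. lin m (v a) om) = (\<Sum>h\<in>B \<rightarrow>\<^sub>E {..m}. (\<Prod>a\<in>B. v a (h a)) * (\<Prod>a\<in>B. om (h a)))"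
 unfolding lin_def by (subst prod_sum_PiE[OF assms]) (auto simp: prod.distrib)

text \<open>Both sides are multilinear in the vectors v, so expanding over assignments of
  coordinates reduces to \<open>stein_coords\<close>. Removing the factor a leaves its j-th
  component as weight.\<close>

lemma stein_lin:
 assumes B: "finite B" and j: "j \<le> m"
 shows "integrable SN (%om. om j * (\<Prod>a\<in>B. lin m (v a) om))"
  "integral\<^sup>L SN (%om. om j * (\<Prod>a\<in>B. lin m (v a) om)) =
   (\<Sum>a\<in>B. v a j * integral\<^sup>L SN (%om. \<Prod>b\<in>B - {a}. lin m (v b) om))"
proof -
 let ?P = "B \<rightarrow>\<^sub>E {..m}"
 have hm: "h a \<le> m" if "h \<in> ?P" "a \<in> B" for h a using that by auto
 have e: "om j * (\<Prod>a\<in>B. lin m (v a) om) = (\<Sum>h\<in>?P. (\<Prod>a\<in>B. v a (h a)) * (om j * (\<Prod>a\<in>B. om (h a))))" for om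
  unfolding prod_lin[OF B] sum_distrib_left by (simp add: mult_ac)
 have it: "integrable SN (%om. (\<Prod>a\<in>B. v a (h a)) * (om j * (\<Prod>a\<in>B. om (h a))))" if "h \<in> ?P" for h
  by (intro integrable_mult_right stein_coords(1)[OF B _ j]) (use hm[OF that] in auto)
 show "integrable SN (%om. om j * (\<Prod>a\<in>B. lin m (v a) om))"
  unfolding e by (rule Bochner_Integration.integrable_sum) (rule it)
 have "integral\<^sup>L SN (%om. om j * (\<Prod>a\<in>B. lin m (v a) om)) =
  (\<Sum>h\<in>?P. integral\<^sup>L SN (%om. (\<Prod>a\<in>B. v a (h a)) * (om j * (\<Prod>a\<in>B. om (h a)))))"
  unfolding e by (rule Bochner_Integration.integral_sum) (rule it)
 also have "\<dots> = (\<Sum>h\<in>?P. (\<Prod>a\<in>B. v a (h a)) * (\<Sum>a\<in>B. if h a = j then integral\<^sup>L SN (%om. \<Prod>b\<in>B - {a}. om (h b)) else 0))"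
 proof (rule sum.cong[OF refl])
  fix h assume h: "h \<in> ?P"
  show "integral\<^sup>L SN (%om. (\<Prod>a\<in>B. v a (h a)) * (om j * (\<Prod>a\<in>B. om (h a)))) =
   (\<Prod>a\<in>B. v a (h a)) * (\<Sum>a\<in>B. if h a = j then integral\<^sup>L SN (%om. \<Prod>b\<in>B - {a}. om (h b)) else 0)"
   unfolding integral_mult_right_zero using stein_coords(2)[OF B hm[OF h] j] by simp
 qed
 also have "\<dots> = (\<Sum>a\<in>B. \<Sum>h\<in>?P. (\<Prod>a\<in>B. v a (h a)) * (if h a = j then integral\<^sup>L SN (%om. \<Prod>b\<in>B - {a}. om (h b)) else 0))"
  unfolding sum_distrib_left by (rule sum.swap)
 also have "\<dots> = (\<Sum>a\<in>B. v a j * integral\<^sup>L SN (%om. \<Prod>b\<in>B - {a}. lin m (v b) om))"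
 proof (rule sum.cong[OF refl])
  fix a assume a: "a \<in> B"
  let ?Q = "(B - {a}) \<rightarrow>\<^sub>E {..m}"
  let ?f = "%h. (\<Prod>a\<in>B. v a (h a)) * (if h a = j then integral\<^sup>L SN (%om. \<Prod>b\<in>B - {a}. om (h b)) else 0)"
  have Pe: "?P = (%(y, g). g(a := y)) ` ({..m} \<times> ?Q)"
   using PiE_insert_eq[of a "B - {a}" "%_. {..m}"] a by (simp add: insert_absorb)
  have inj: "inj_on (%(y, g). g(a := y)) ({..m} \<times> ?Q)"
   using inj_combinator[of a "B - {a}" "%_. {..m}"] by simp
  have fQ: "finite ?Q" using B by (intro finite_PiE) auto
  have fu: "?f (g(a := y)) = (if y = j then v a j * (\<Prod>b\<in>B - {a}. v b (g b)) * integral\<^sup>L SN (%om. \<Prod>b\<in>B - {a}. om (g b)) else 0)" for y g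
  proof -
   have 1: "(\<Prod>c\<in>B. v c ((g(a := y)) c)) = v a y * (\<Prod>b\<in>B - {a}. v b (g b))"
    using B a by (subst prod.remove[of _ a]) auto
   have 2: "(\<Prod>b\<in>B - {a}. om ((g(a := y)) b)) = (\<Prod>b\<in>B - {a}. om (g b))" for om :: "nat => real"
    by (intro prod.cong) auto
   show ?thesis unfolding 1 2 by simp
  qed
  have "(\<Sum>h\<in>?P. ?f h) = (\<Sum>(y, g)\<in>{..m} \<times> ?Q. ?f (g(a := y)))"
   unfolding Pe by (subst sum.reindex[OF inj]) (simp add: case_prod_unfold)
  also have "\<dots> = (\<Sum>y\<le>m. \<Sum>g\<in>?Q. ?f (g(a := y)))" by (rule sum.cartesian_product[symmetric])
  also have "\<dots> = (\<Sum>y\<le>m. if y = j then (\<Sum>g\<in>?Q. v a j * (\<Prod>b\<in>B - {a}. v b (g b)) * integral\<^sup>L SN (%om. \<Prod>b\<in>B - {a}. om (g b))) else 0)"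
   unfolding fu by (intro sum.cong) auto
  also have "\<dots> = (\<Sum>g\<in>?Q. v a j * ((\<Prod>b\<in>B - {a}. v b (g b)) * integral\<^sup>L SN (%om. \<Prod>b\<in>B - {a}. om (g b))))"
   using j by (simp add: mult.assoc)
  also have "\<dots> = v a j * (\<Sum>g\<in>?Q. integral\<^sup>L SN (%om. (\<Prod>b\<in>B - {a}. v b (g b)) * (\<Prod>b\<in>B - {a}. om (g b))))"
   by (simp add: sum_distrib_left)
  also have "(\<Sum>g\<in>?Q. integral\<^sup>L SN (%om. (\<Prod>b\<in>B - {a}. v b (g b)) * (\<Prod>b\<in>B - {a}. om (g b))))
   = integral\<^sup>L SN (%om. \<Prod>b\<in>B - {a}. lin m (v b) om)"
  proof -
   have fB: "finite (B - {a})" using B by simp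
   show ?thesis unfolding prod_lin[OF fB]
    by (intro Bochner_Integration.integral_sum[symmetric] integrable_mult_right SN_coord_prod(1)[where m = m] fB) auto
  qed
  finally show "(\<Sum>h\<in>?P. ?f h) = v a j * integral\<^sup>L SN (%om. \<Prod>b\<in>B - {a}. lin m (v b) om)" .
 qed
 finally show "integral\<^sup>L SN (%om. om j * (\<Prod>a\<in>B. lin m (v a) om)) =
   (\<Sum>a\<in>B. v a j * integral\<^sup>L SN (%om. \<Prod>b\<in>B - {a}. lin m (v b) om))" .
qed

lemma matchingsI:
 assumes "\<Union>H = A" "\<And>T. T \<in> H ==> card T = 2" "\<And>S T. S \<in> H ==> T \<in> H ==> S \<noteq> T ==> S \<inter> T = {}"
 shows "H \<in> matchings A"
 using assms unfolding matchings_def by blast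

lemma matchings_empty: "matchings {} = {{}}"
proof (intro subset_antisym subsetI)
 fix H assume "H \<in> matchings {}"
 then have "H \<subseteq> {{}}" "\<And>T. T \<in> H ==> card T = 2" unfolding matchings_def by auto
 then have "H = {}" by force
 then show "H \<in> {{}}" by simp
qed (simp add: matchings_def)

text \<open>A matching of an enlarged set is determined by the partner b of the new point a and a
  matching of the rest. These are the recursion and the bijectivity needed for Wick's rule.\<close>

lemma matchings_insert:
 assumes a: "a \<notin> B"
 shows "matchings (insert a B) = (%(b, H). insert {a, b} H) ` Sigma B (%b. matchings (B - {b}))"
  "inj_on (%(b, H). insert {a, b} H) (Sigma B (%b. matchings (B - {b})))"
  "b \<in> B ==> H \<in> matchings (B - {b}) ==> {a, b} \<notin> H"
proof -
 have na: "a \<notin> T" if "H \<in> matchings (B - {b})" "T \<in> H" for b H T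
  using that a unfolding matchings_def by auto
 show nin: "b \<in> B ==> H \<in> matchings (B - {b}) ==> {a, b} \<notin> H" for b H using na by blast
 show "inj_on (%(b, H). insert {a, b} H) (Sigma B (%b. matchings (B - {b})))"
 proof (rule inj_onI, clarify)
  fix b H b' H' assume b: "b \<in> B" "b' \<in> B" and H: "H \<in> matchings (B - {b})" "H' \<in> matchings (B - {b'})"
   and e: "insert {a, b} H = insert {a, b'} H'"
  have "{a, b} \<in> insert {a, b'} H'" using e by auto
  then have "{a, b} = {a, b'}" using na[OF H(2), of "{a, b}"] by auto
  then have bb: "b = b'" using b a by (auto simp: doubleton_eq_iff)
  have "H = insert {a, b} H - {{a, b}}" using nin[OF b(1) H(1)] by auto
  also have "\<dots> = H'" using e bb nin[OF b(2) H(2)] by auto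
  finally show "b = b' \<and> H = H'" using bb by simp
 qed
 show "matchings (insert a B) = (%(b, H). insert {a, b} H) ` Sigma B (%b. matchings (B - {b}))"
 proof (intro subset_antisym subsetI)
  fix H assume H: "H \<in> matchings (insert a B)"
  then have h: "\<Union>H = insert a B" "\<And>T. T \<in> H ==> card T = 2" "\<And>S T. S \<in> H ==> T \<in> H ==> S \<noteq> T ==> S \<inter> T = {}"
   unfolding matchings_def by auto
  obtain T where T: "T \<in> H" "a \<in> T" using h(1) by blast
  obtain b where b: "T = {a, b}" "b \<noteq> a" using h(2)[OF T(1)] T(2) by (auto simp: card_2_iff)
  have bB: "b \<in> B" using h(1) T b by auto
  have un: "\<Union>(H - {T}) = B - {b}"
  proof (intro subset_antisym subsetI)
   fix x assume "x \<in> \<Union>(H - {T})"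
   then obtain S where S: "S \<in> H" "S \<noteq> T" "x \<in> S" by blast
   then show "x \<in> B - {b}" using h(3)[OF S(1) T(1) S(2)] h(1) b by blast
  next
   fix x assume x: "x \<in> B - {b}"
   then obtain S where S: "S \<in> H" "x \<in> S" using h(1) by blast
   then show "x \<in> \<Union>(H - {T})" using x a b by (cases "S = T") auto
  qed
  have m: "H - {T} \<in> matchings (B - {b})" by (rule matchingsI[OF un]) (use h(2,3) in blast)+
  have e: "H = insert {a, b} (H - {T})" using T(1) unfolding b(1) by (rule insert_Diff[symmetric])
  show "H \<in> (%(b, H). insert {a, b} H) ` Sigma B (%b. matchings (B - {b}))"
  proof (rule image_eqI[where x = "(b, H - {T})"])
   show "H = (case (b, H - {T}) of (b, H) => insert {a, b} H)" unfolding prod.case by (rule e)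
   show "(b, H - {T}) \<in> Sigma B (%b. matchings (B - {b}))" using bB m by (rule SigmaI)
  qed
 next
  fix H assume "H \<in> (%(b, H). insert {a, b} H) ` Sigma B (%b. matchings (B - {b}))"
  then obtain b H' where b: "b \<in> B" and H': "H' \<in> matchings (B - {b})" and H: "H = insert {a, b} H'" by auto
  have h: "\<Union>H' = B - {b}" "\<And>T. T \<in> H' ==> card T = 2" "\<And>S T. S \<in> H' ==> T \<in> H' ==> S \<noteq> T ==> S \<inter> T = {}"
   using H' unfolding matchings_def by auto
  have "a \<noteq> b" using a b by auto
  then have c: "card {a, b} = 2" by simp
  have d: "T \<inter> {a, b} = {}" if "T \<in> H'" for T using that h(1) a by auto
  have u: "\<Union>H = insert a B" unfolding H using h(1) b by auto
  show "H \<in> matchings (insert a B)"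
  proof (rule matchingsI[OF u])
   show "card T = 2" if "T \<in> H" for T using that c h(2) unfolding H by blast
   show "S \<inter> T = {}" if ST: "S \<in> H" "T \<in> H" "S \<noteq> T" for S T
   proof -
    consider "S \<in> H'" "T \<in> H'" | "S = {a, b}" "T \<in> H'" | "S \<in> H'" "T = {a, b}" using ST unfolding H by blast
    then show ?thesis using h(3)[OF _ _ ST(3)] d by cases (simp, blast, blast)
   qed
  qed
 qed
qed

lemma sum_matchings_insert:
 assumes a: "a \<notin> B" and B: "finite B"
 shows "(\<Sum>H\<in>matchings (insert a B). \<Prod>T\<in>H. w T) =
  (\<Sum>b\<in>B. w {a, b} * (\<Sum>H\<in>matchings (B - {b}). \<Prod>T\<in>H. w T :: real))"
proof -
 have fH: "finite H" if "H \<in> matchings (B - {b})" for b H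
  using that B unfolding matchings_def by (auto intro: finite_subset[of H "Pow (B - {b})"])
 have "(\<Sum>H\<in>matchings (insert a B). \<Prod>T\<in>H. w T) =
  (\<Sum>p\<in>Sigma B (%b. matchings (B - {b})). \<Prod>T\<in>(case p of (b, H) => insert {a, b} H). w T)"
  unfolding matchings_insert(1)[OF a] by (subst sum.reindex[OF matchings_insert(2)[OF a]]) simp
 also have "\<dots> = (\<Sum>(b, H)\<in>Sigma B (%b. matchings (B - {b})). w {a, b} * (\<Prod>T\<in>H. w T))"
  by (rule sum.cong[OF refl]) (auto simp: fH matchings_insert(3)[OF a])
 also have "\<dots> = (\<Sum>b\<in>B. \<Sum>H\<in>matchings (B - {b}). w {a, b} * (\<Prod>T\<in>H. w T))"
  using B by (intro sum.Sigma[symmetric]) (auto intro: finite_matchings)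
 finally show ?thesis by (simp add: sum_distrib_left)
qed

text \<open>One factor is split off and integrated by parts against the others; the coordinates
  recombine to the covariance of the split pair, and the remaining integral obeys the same recursion
  as the matchings.\<close>

theorem wick:
 fixes w :: "nat set => real"
 assumes "finite A" "\<And>a b. a \<in> A ==> b \<in> A ==> a \<noteq> b ==> w {a, b} = (\<Sum>j\<le>m. v a j * v b j)"
 shows "integral\<^sup>L SN (%om. \<Prod>a\<in>A. lin m (v a) om) = (\<Sum>H\<in>matchings A. \<Prod>T\<in>H. w T)"
 using assms
proof (induction "card A" arbitrary: A rule: less_induct)
 case less
 show ?case
 proof (cases "A = {}")
  case True
  then show ?thesis using SN.prob_space by (simp add: matchings_empty)
 next
  case False
  then obtain a where a: "a \<in> A" by auto
  define B where "B = A - {a}"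
  have AB: "A = insert a B" "a \<notin> B" "finite B" using a less.prems by (auto simp: B_def)
  have cB: "card (B - {b}) < card A" for b
   using AB by (intro psubset_card_mono[OF less.prems(1)]) auto
  have IH: "integral\<^sup>L SN (%om. \<Prod>a\<in>B - {b}. lin m (v a) om) = (\<Sum>H\<in>matchings (B - {b}). \<Prod>T\<in>H. w T)" for b
   by (rule less.hyps[OF cB]) (use AB less.prems in auto)
  have "(\<Prod>c\<in>A. lin m (v c) om) = (\<Sum>j\<le>m. v a j * (om j * (\<Prod>b\<in>B. lin m (v b) om)))" for om
   unfolding AB(1) using AB(2,3) by (simp add: lin_def[of m "v a"] sum_distrib_right mult.assoc)
  then have "integral\<^sup>L SN (%om. \<Prod>c\<in>A. lin m (v c) om) = integral\<^sup>L SN (%om. \<Sum>j\<le>m. v a j * (om j * (\<Prod>b\<in>B. lin m (v b) om)))"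
   by simp
  also have "\<dots> = (\<Sum>j\<le>m. integral\<^sup>L SN (%om. v a j * (om j * (\<Prod>b\<in>B. lin m (v b) om))))"
   by (intro Bochner_Integration.integral_sum integrable_mult_right stein_lin(1) AB(3)) auto
  also have "\<dots> = (\<Sum>j\<le>m. \<Sum>b\<in>B. v a j * (v b j * (\<Sum>H\<in>matchings (B - {b}). \<Prod>T\<in>H. w T)))"
   by (intro sum.cong refl) (simp add: stein_lin(2)[OF AB(3)] IH sum_distrib_left)
  also have "\<dots> = (\<Sum>b\<in>B. (\<Sum>j\<le>m. v a j * v b j) * (\<Sum>H\<in>matchings (B - {b}). \<Prod>T\<in>H. w T))"
   by (subst sum.swap) (simp add: sum_distrib_right mult.assoc)
  also have "\<dots> = (\<Sum>b\<in>B. w {a, b} * (\<Sum>H\<in>matchings (B - {b}). \<Prod>T\<in>H. w T))"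
  proof (rule sum.cong[OF refl])
   fix b assume "b \<in> B"
   then have "w {a, b} = (\<Sum>j\<le>m. v a j * v b j)" using AB by (intro less.prems(2)) auto
   then show "(\<Sum>j\<le>m. v a j * v b j) * (\<Sum>H\<in>matchings (B - {b}). \<Prod>T\<in>H. w T) = w {a, b} * (\<Sum>H\<in>matchings (B - {b}). \<Prod>T\<in>H. w T)" by simp
  qed
  also have "\<dots> = (\<Sum>H\<in>matchings A. \<Prod>T\<in>H. w T)"
   unfolding AB(1) by (rule sum_matchings_insert[OF AB(2,3), symmetric])
  finally show ?thesis .
 qed
qed

lemma lin_normal:
 assumes v: "(\<Sum>j\<le>m. v j ^ 2) > 0"
 shows "distributed SN lborel (lin m v) (%x. ennreal (normal_density 0 (sqrt (\<Sum>j\<le>m. v j ^ 2)) x))"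
proof -
 \<comment> \<open>Zero coefficients are dropped because a normal density requires a positive
   standard deviation.\<close>
 let ?I = "{j. j \<le> m \<and> v j \<noteq> 0}"
 have I: "finite ?I" by simp
 have sq: "(\<Sum>j\<in>?I. \<bar>v j\<bar> ^ 2) = (\<Sum>j\<le>m. v j ^ 2)"
  unfolding power2_abs by (rule sum.mono_neutral_left) auto
 have ne: "?I \<noteq> {}" using v sq by force
 have l: "lin m v om = (\<Sum>j\<in>?I. v j * om j)" for om
  unfolding lin_def by (rule sum.mono_neutral_right) auto
 have ind: "SN.indep_vars (%_. borel) (%j om. v j * om j) ?I"
  by (rule SN.indep_vars_compose2[OF indep_SN]) auto
 have nrm: "distributed SN lborel (%om. v j * om j) (normal_density 0 \<bar>v j\<bar>)" if "j \<in> ?I" for j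
  using SN.normal_density_affine[OF SN_distributed, of "v j" 0 j] that by simp
 have "distributed SN lborel (%om. \<Sum>j\<in>?I. v j * om j) (normal_density (\<Sum>j\<in>?I. 0) (sqrt (\<Sum>j\<in>?I. \<bar>v j\<bar> ^ 2)))"
  by (rule SN.sum_indep_normal[OF I ne ind _ nrm]) auto
 then show ?thesis unfolding sq l[abs_def] by simp
qed

definition psd :: "(nat => nat => real) => bool" where
 "psd D \<longleftrightarrow> (\<forall>k l. D k l = D l k) \<and> (\<forall>F a. finite F \<longrightarrow> 0 \<le> (\<Sum>k\<in>F. \<Sum>l\<in>F. a k * a l * D k l))"

lemma psdD: "psd D ==> finite F ==> 0 \<le> (\<Sum>k\<in>F. \<Sum>l\<in>F. a k * a l * D k l)"
 unfolding psd_def by blast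

text \<open>With a zero diagonal entry the form is affine in the n-th coefficient. If the
  off-diagonal entry were nonzero, s would be the coefficient that makes the form equal to
  -1.\<close>

lemma psd_zero_row:
 assumes D: "psd D" and z: "D n n = 0"
 shows "D n l = 0"
proof (rule ccontr)
 assume nz: "D n l \<noteq> 0"
 then have nl: "n \<noteq> l" using z by auto
 define s where "s = - (D l l + 1) / (2 * D n l)"
 have "0 \<le> (\<Sum>k\<in>{n, l}. \<Sum>j\<in>{n, l}. (if k = n then s else 1) * (if j = n then s else 1) * D k j)"
  by (rule psdD[OF D, of "{n, l}" "%k. if k = n then s else 1"]) simp
 also have "\<dots> = 2 * s * D n l + D l l" using nl z D by (simp add: psd_def)
 also have "2 * s * D n l = - (D l l + 1)" using nz by (simp add: s_def)
 also have "- (D l l + 1) + D l l = - 1" by simp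
 finally show False by simp
qed

text \<open>A Schur complement is the minimum of the quadratic form over the n-th coefficient,
  attained by adding t = -b / D n n to it. If D n n = 0, division by zero gives 0 and the matrix
  stays as it was.\<close>

lemma psd_step:
 assumes D: "psd D"
 shows "psd (%k l. D k l - D k n * D n l / D n n)"
 unfolding psd_def
proof (intro conjI allI impI)
 have sym: "D k l = D l k" for k l using D unfolding psd_def by blast
 show "D k l - D k n * D n l / D n n = D l k - D l n * D n k / D n n" for k l
  unfolding sym[of k l] sym[of k n] sym[of l n] by simp
 fix F :: "nat set" and a :: "nat => real" assume F: "finite F"
 define b where "b = (\<Sum>k\<in>F. a k * D k n)"
 define q where "q = (\<Sum>k\<in>F. \<Sum>l\<in>F. a k * a l * D k l)"
 have red: "(\<Sum>k\<in>F. \<Sum>l\<in>F. a k * a l * (D k l - D k n * D n l / D n n)) = q - b ^ 2 / D n n"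
 proof -
  have "b ^ 2 / D n n = (\<Sum>k\<in>F. \<Sum>l\<in>F. (a k * D k n) * (a l * D l n)) / D n n"
   unfolding power2_eq_square b_def sum_product by simp
  also have "\<dots> = (\<Sum>k\<in>F. \<Sum>l\<in>F. a k * a l * (D k n * D n l / D n n))"
  proof -
   have "a k * D k n * (a l * D l n) / D n n = a k * a l * (D k n * D n l / D n n)" for k l
    unfolding sym[of l n] by simp
   then show ?thesis unfolding sum_divide_distrib by (intro sum.cong refl)
  qed
  finally show ?thesis unfolding q_def by (simp add: right_diff_distrib sum_subtractf)
 qed
 show "0 \<le> (\<Sum>k\<in>F. \<Sum>l\<in>F. a k * a l * (D k l - D k n * D n l / D n n))"
 proof (cases "D n n = 0")
  case True
  then show ?thesis unfolding red using D F by (simp add: q_def psd_def)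
 next
  case False
  define G where "G = insert n F"
  define a' where "a' k = (if k \<in> F then a k else 0)" for k
  define t where "t = - b / D n n"
  define e where "e k = (if k = n then t else 0)" for k
  have G: "finite G" "F \<subseteq> G" "n \<in> G" using F by (auto simp: G_def)
  have ext: "(\<Sum>k\<in>G. a' k * f k) = (\<Sum>k\<in>F. a k * f k)" for f
   using G by (intro sum.mono_neutral_cong_right) (auto simp: a'_def)
  have ee: "(\<Sum>k\<in>G. e k * f k) = t * f n" for f
  proof -
   have "(\<Sum>k\<in>G. e k * f k) = (\<Sum>k\<in>G. if k = n then t * f k else 0)" by (intro sum.cong) (auto simp: e_def)
   then show ?thesis using G by simp
  qed
  have "0 \<le> (\<Sum>k\<in>G. \<Sum>l\<in>G. (a' k + e k) * (a' l + e l) * D k l)"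
   by (rule psdD[OF D G(1)])
  also have "\<dots> = (\<Sum>k\<in>G. a' k * (\<Sum>l\<in>G. a' l * D k l)) + (\<Sum>k\<in>G. a' k * (\<Sum>l\<in>G. e l * D k l))
    + (\<Sum>k\<in>G. e k * (\<Sum>l\<in>G. a' l * D k l)) + (\<Sum>k\<in>G. e k * (\<Sum>l\<in>G. e l * D k l))"
   unfolding sum_distrib_left sum.distrib[symmetric] by (simp add: algebra_simps)
  also have "\<dots> = q + t * b + t * b + t * (t * D n n)"
  proof -
   have 1: "(\<Sum>k\<in>G. a' k * (\<Sum>l\<in>G. a' l * D k l)) = q"
    unfolding ext q_def by (simp add: sum_distrib_left mult.assoc)
   have 2: "(\<Sum>k\<in>F. a k * (t * D k n)) = t * b" unfolding b_def by (simp add: sum_distrib_left mult_ac)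
   have 3: "(\<Sum>l\<in>F. a l * D n l) = b" unfolding b_def by (rule sum.cong[OF refl]) (simp only: sym[of n])
   show ?thesis unfolding 1 unfolding ee ext 2 3 ..
  qed
  also have "\<dots> = q - b ^ 2 / D n n" using False by (simp add: t_def field_simps power2_eq_square)
  finally show ?thesis unfolding red .
 qed
qed

text \<open>What remains of C after eliminating the indices 0, ..., n - 1 one at a time.\<close>

fun schurc :: "(nat => nat => real) => nat => nat => nat => real" where
 "schurc C 0 k l = C k l"
| "schurc C (Suc n) k l = schurc C n k l - schurc C n k n * schurc C n n l / schurc C n n n"

text \<open>Each elimination removes the product of two entries of one column of L, and the sum
  telescopes. Rows already eliminated vanish, also at a zero pivot thanks to
  \<open>psd_zero_row\<close>, so no remainder is left once k <= m.\<close>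

lemma cholesky:
 assumes C: "psd C"
 shows "\<exists>L. (\<forall>k j. k < j \<longrightarrow> L k j = 0) \<and> (\<forall>k l m. k \<le> m \<longrightarrow> C k l = (\<Sum>j\<le>m. L k j * L l j))"
proof -
 let ?D = "schurc C"
 have psd: "psd (?D n)" for n
 proof (induction n)
  case 0
  have "?D 0 = C" by (intro ext) simp
  then show ?case using C by simp
 next
  case (Suc n)
  have "?D (Suc n) = (%k l. ?D n k l - ?D n k n * ?D n n l / ?D n n n)" by (intro ext) simp
  then show ?case using psd_step[OF Suc] by simp
 qed
 have sym: "?D n k l = ?D n l k" for n k l using psd[of n] unfolding psd_def by blast
 have zero: "k < n ==> ?D n k l = 0" for n k l
 proof (induction n arbitrary: k l)
  case (Suc n)
  show ?case
  proof (cases "k = n")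
   case True
   then show ?thesis using psd_zero_row[OF psd[of n], of n l] by (cases "?D n n n = 0") auto
  next
   case False
   then have "k < n" using Suc.prems by simp
   then show ?thesis using Suc.IH[of k] by simp
  qed
 qed simp
 define L where "L k j = ?D j k j / sqrt (?D j j j)" for k j
 have diag: "?D n n n \<ge> 0" for n
 proof -
  have "0 \<le> (\<Sum>k\<in>{n}. \<Sum>l\<in>{n}. 1 * 1 * ?D n k l)" by (rule psdD[OF psd, of "{n}" "%_. 1"]) simp
  then show ?thesis by simp
 qed
 have tel: "C k l = ?D n k l + (\<Sum>j<n. L k j * L l j)" for k l n
 proof (induction n)
  case (Suc n)
  have "L k n * L l n = ?D n k n * ?D n n l / ?D n n n"
   unfolding L_def using diag[of n] sym[of n l n] by simp
  then show ?case using Suc by simp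
 qed simp
 have "L k j = 0" if "k < j" for k j using zero[OF that] by (simp add: L_def)
 moreover have "C k l = (\<Sum>j\<le>m. L k j * L l j)" if "k \<le> m" for k l m
  using tel[of k l "Suc m"] zero[of k "Suc m" l] that by (simp add: lessThan_Suc_atMost)
 ultimately show ?thesis by blast
qed

text \<open>The factor L is triangular, so Z k involves only the coordinates up to k, and one
  sequence of independent normals serves all k at once. Indices a and b may carry the same k, which
  covers repeated factors in a moment.\<close>

theorem gaussian_exists:
 assumes C: "psd C"
 shows "\<exists>Z. gaussian_family SN Z C \<and>
  (\<forall>A w (k :: nat => nat). finite A \<longrightarrow> (\<forall>a\<in>A. \<forall>b\<in>A. a \<noteq> b \<longrightarrow> w {a, b} = C (k a) (k b)) \<longrightarrow>
   integral\<^sup>L SN (%om. \<Prod>a\<in>A. Z (k a) om) = (\<Sum>H\<in>matchings A. \<Prod>T\<in>H. w T))"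
proof -
 obtain L where L0: "\<And>k j. k < j ==> L k j = 0" and LC: "\<And>k l m. k \<le> m ==> C k l = (\<Sum>j\<le>m. L k j * L l j)"
  using cholesky[OF C] by blast
 define Z where "Z k = lin k (L k)" for k
 have Zm: "Z k om = lin m (L k) om" if "k \<le> m" for k m om
  unfolding Z_def lin_def using that by (intro sum.mono_neutral_left) (auto simp: L0)
 have meas: "lin m v \<in> borel_measurable SN" for m v unfolding lin_def[abs_def] by measurable
 have "gaussian_family SN Z C"
  unfolding gaussian_family_def Let_def
 proof (intro conjI allI prob_SN)
  show "Z k \<in> borel_measurable SN" for k unfolding Z_def by (rule meas)
  fix n :: nat and a :: "nat => real"
  define v where "v j = (\<Sum>k\<in>{1..n}. a k * L k j)" for j
  have Y: "(\<Sum>k\<in>{1..n}. a k * Z k om) = lin n v om" for om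
  proof -
   have "(\<Sum>k\<in>{1..n}. a k * Z k om) = (\<Sum>k\<in>{1..n}. \<Sum>j\<le>n. a k * L k j * om j)"
    by (intro sum.cong refl) (simp add: Zm[where m = n] lin_def sum_distrib_left mult.assoc)
   also have "\<dots> = lin n v om" unfolding lin_def v_def sum_distrib_right by (rule sum.swap)
   finally show ?thesis .
  qed
  have V: "(\<Sum>k\<in>{1..n}. \<Sum>j\<in>{1..n}. a k * a j * C k j) = (\<Sum>j\<le>n. v j ^ 2)"
  proof -
   have "(\<Sum>k\<in>{1..n}. \<Sum>l\<in>{1..n}. a k * a l * C k l) = (\<Sum>k\<in>{1..n}. \<Sum>l\<in>{1..n}. \<Sum>j\<le>n. (a k * L k j) * (a l * L l j))"
    by (intro sum.cong refl) (simp add: LC[where m = n] sum_distrib_left mult_ac)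
   also have "\<dots> = (\<Sum>k\<in>{1..n}. \<Sum>j\<le>n. \<Sum>l\<in>{1..n}. (a k * L k j) * (a l * L l j))"
    by (intro sum.cong refl sum.swap)
   also have "\<dots> = (\<Sum>j\<le>n. \<Sum>k\<in>{1..n}. \<Sum>l\<in>{1..n}. (a k * L k j) * (a l * L l j))" by (rule sum.swap)
   also have "\<dots> = (\<Sum>j\<le>n. v j ^ 2)" unfolding v_def power2_eq_square sum_product ..
   finally show ?thesis .
  qed
  show "0 \<le> (\<Sum>k\<in>{1..n}. \<Sum>j\<in>{1..n}. a k * a j * C k j)" unfolding V by (rule sum_nonneg) simp
  show "0 < (\<Sum>k\<in>{1..n}. \<Sum>j\<in>{1..n}. a k * a j * C k j) \<longrightarrow>
   distributed SN lborel (%om. \<Sum>k\<in>{1..n}. a k * Z k om)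
    (%x. ennreal (normal_density 0 (sqrt (\<Sum>k\<in>{1..n}. \<Sum>j\<in>{1..n}. a k * a j * C k j)) x))"
   unfolding V Y using lin_normal[of v n] by blast
  show "(\<Sum>k\<in>{1..n}. \<Sum>j\<in>{1..n}. a k * a j * C k j) = 0 \<longrightarrow> (AE om in SN. (\<Sum>k\<in>{1..n}. a k * Z k om) = 0)"
   unfolding V Y
  proof
   assume "(\<Sum>j\<le>n. v j ^ 2) = 0"
   then have "v j = 0" if "j \<le> n" for j using that by (simp add: sum_nonneg_eq_0_iff)
   then have "lin n v om = 0" for om by (simp add: lin_def)
   then show "AE om in SN. lin n v om = 0" by simp
  qed
 qed
 moreover have "integral\<^sup>L SN (%om. \<Prod>a\<in>A. Z (k a) om) = (\<Sum>H\<in>matchings A. \<Prod>T\<in>H. w T)"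
  if A: "finite A" and w: "\<forall>a\<in>A. \<forall>b\<in>A. a \<noteq> b \<longrightarrow> w {a, b} = C (k a) (k b)" for A w and k :: "nat => nat"
 proof -
  define m where "m = (\<Sum>a\<in>A. k a)"
  have km: "k a \<le> m" if "a \<in> A" for a unfolding m_def using A that by (rule member_le_sum[rotated 2]) simp
  have "(\<Prod>a\<in>A. Z (k a) om) = (\<Prod>a\<in>A. lin m (L (k a)) om)" for om
   by (intro prod.cong refl Zm km)
  moreover have "w {a, b} = (\<Sum>j\<le>m. L (k a) j * L (k b) j)" if "a \<in> A" "b \<in> A" "a \<noteq> b" for a b
   using w that LC[OF km[OF that(1)]] by simp
  ultimately show ?thesis using wick[OF A, of w "%a. L (k a)" m] by simp
 qed
 ultimately show ?thesis by blast
qed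

subsection \<open>Taylor coefficients of symmetric functions indexed by set partitions\<close>

text \<open>The kernel of the list viewed as a function on positions.\<close>

definition kr :: "nat list => nat set set" where
 "kr xs = (%p. {q. q < length xs \<and> xs ! q = xs ! p}) ` {..<length xs}"

definition const_on :: "nat list => nat set set => bool" where
 "const_on xs \<pi> \<longleftrightarrow> (\<forall>B\<in>\<pi>. \<forall>p\<in>B. \<forall>q\<in>B. xs ! p = xs ! q)"

definition blk :: "nat set set => nat => nat set" where
 "blk \<pi> p = (THE B. B \<in> \<pi> \<and> p \<in> B)"

text \<open>A canonical list with prescribed kernel. Its entries lie below r, so it is a valid list
  of derivative indices as soon as N >= r.\<close>

definition rep :: "nat => nat set set => nat list" where
 "rep r \<pi> = map (%p. Min (blk \<pi> p)) [0..<r]"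

lemma kr_partition: "partition_on {..<length xs} (kr xs)"
proof (rule partition_onI)
 show "\<Union>(kr xs) = {..<length xs}" unfolding kr_def by auto
 show "{} \<notin> kr xs" unfolding kr_def by auto
 fix P Q assume "P \<in> kr xs" "Q \<in> kr xs" "P \<noteq> Q"
 then show "disjnt P Q" unfolding kr_def disjnt_def by auto
qed

lemma kr_eq_iff:
 assumes "p < length xs" "q < length xs"
 shows "xs ! p = xs ! q \<longleftrightarrow> (\<exists>B\<in>kr xs. p \<in> B \<and> q \<in> B)"
 using assms unfolding kr_def by auto

lemma refines_kr:
 assumes \<pi>: "partition_on {..<length xs} \<pi>"
 shows "refines {..<length xs} \<pi> (kr xs) \<longleftrightarrow> const_on xs \<pi>"
proof
 assume "refines {..<length xs} \<pi> (kr xs)"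
 then have r: "\<And>B. B \<in> \<pi> ==> \<exists>Y\<in>kr xs. B \<subseteq> Y" unfolding refines_def by blast
 show "const_on xs \<pi>"
  unfolding const_on_def
 proof (intro ballI)
  fix B p q assume B: "B \<in> \<pi>" "p \<in> B" "q \<in> B"
  obtain Y where Y: "Y \<in> kr xs" "B \<subseteq> Y" using r[OF B(1)] by blast
  then obtain t where "Y = {q. q < length xs \<and> xs ! q = xs ! t}" unfolding kr_def by blast
  then have "xs ! p = xs ! t" "xs ! q = xs ! t" using B(2,3) Y(2) by blast+
  then show "xs ! p = xs ! q" by simp
 qed
next
 assume c: "const_on xs \<pi>"
 have "\<exists>Y\<in>kr xs. B \<subseteq> Y" if B: "B \<in> \<pi>" for B
 proof -
  have Bs: "B \<subseteq> {..<length xs}" "B \<noteq> {}" using \<pi> B unfolding partition_on_def by auto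
  then obtain p where p: "p \<in> B" by blast
  then have "p < length xs" using Bs by blast
  moreover have "B \<subseteq> {q. q < length xs \<and> xs ! q = xs ! p}"
   using c B p Bs(1) unfolding const_on_def by blast
  ultimately show ?thesis unfolding kr_def by blast
 qed
 then show "refines {..<length xs} \<pi> (kr xs)" using \<pi> kr_partition unfolding refines_def by blast
qed

lemma blk_eq:
 assumes \<pi>: "partition_on A \<pi>" and B: "B \<in> \<pi>" "p \<in> B"
 shows "blk \<pi> p = B"
 unfolding blk_def
proof (rule the_equality)
 show "B \<in> \<pi> \<and> p \<in> B" using B by simp
 fix C assume C: "C \<in> \<pi> \<and> p \<in> C"
 show "C = B"
 proof (rule ccontr)
  assume "C \<noteq> B"
  then have "C \<inter> B = {}" using partition_onD2[OF \<pi>] C B unfolding disjoint_def by blast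
  then show False using C B by blast
 qed
qed

lemma blk_in:
 assumes \<pi>: "partition_on A \<pi>" and p: "p \<in> A"
 shows "blk \<pi> p \<in> \<pi>" "p \<in> blk \<pi> p"
proof -
 obtain B where B: "B \<in> \<pi>" "p \<in> B" using partition_onD1[OF \<pi>] p by blast
 show "blk \<pi> p \<in> \<pi>" "p \<in> blk \<pi> p" unfolding blk_eq[OF \<pi> B] by (rule B)+
qed

lemma part_block:
 fixes A :: "nat set"
 assumes \<pi>: "partition_on A \<pi>" and A: "finite A" and B: "B \<in> \<pi>"
 shows "finite B" "B \<noteq> {}" "B \<subseteq> A" "card B > 0" "Min B \<in> B"
proof -
 show s: "B \<subseteq> A" using partition_onD1[OF \<pi>] B by blast
 show n: "B \<noteq> {}" using partition_onD3[OF \<pi>] B by blast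
 show f: "finite B" using finite_subset[OF s A] .
 show "card B > 0" using f n by (simp add: card_gt_0_iff)
 show "Min B \<in> B" using f n by simp
qed

lemma inj_Min:
 fixes A :: "nat set"
 assumes \<pi>: "partition_on A \<pi>" and A: "finite A"
 shows "inj_on Min \<pi>"
proof (rule inj_onI)
 fix B C assume BC: "B \<in> \<pi>" "C \<in> \<pi>" "Min B = Min C"
 have "blk \<pi> (Min B) = B" by (rule blk_eq[OF \<pi> BC(1) part_block(5)[OF \<pi> A BC(1)]])
 moreover have "blk \<pi> (Min C) = C" by (rule blk_eq[OF \<pi> BC(2) part_block(5)[OF \<pi> A BC(2)]])
 moreover have "blk \<pi> (Min B) = blk \<pi> (Min C)" by (simp only: BC(3))
 ultimately show "B = C" by (metis (no_types))
qed

lemma card_part_le: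
 assumes \<pi>: "partition_on {..<r} \<pi>"
 shows "card \<pi> \<le> r"
proof -
 have "Min ` \<pi> \<subseteq> {..<r}" using part_block[OF \<pi>] by blast
 then have "card (Min ` \<pi>) \<le> r" using card_mono[of "{..<r}" "Min ` \<pi>"] by simp
 then show ?thesis using card_image[OF inj_Min[OF \<pi>]] by simp
qed

lemma length_rep [simp]: "length (rep r \<pi>) = r" by (simp add: rep_def)

lemma nth_rep: "p < r ==> rep r \<pi> ! p = Min (blk \<pi> p)" by (simp add: rep_def)

lemma rep_eq_iff:
 assumes \<pi>: "partition_on {..<r} \<pi>" and "p < r" "q < r"
 shows "Min (blk \<pi> q) = Min (blk \<pi> p) \<longleftrightarrow> q \<in> blk \<pi> p"
proof
 assume "Min (blk \<pi> q) = Min (blk \<pi> p)"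
 then have "blk \<pi> q = blk \<pi> p"
  by (rule inj_onD[OF inj_Min[OF \<pi> finite_lessThan]]) (use blk_in(1)[OF \<pi>] assms in auto)
 then show "q \<in> blk \<pi> p" using blk_in(2)[OF \<pi>, of q] assms by simp
next
 assume "q \<in> blk \<pi> p"
 then have "blk \<pi> q = blk \<pi> p" using blk_eq[OF \<pi> blk_in(1)[OF \<pi>, of p]] assms by simp
 then show "Min (blk \<pi> q) = Min (blk \<pi> p)" by simp
qed

lemma blk_image:
 assumes \<pi>: "partition_on {..<r} \<pi>"
 shows "blk \<pi> ` {..<r} = \<pi>"
proof (intro subset_antisym subsetI)
 fix B assume "B \<in> blk \<pi> ` {..<r}"
 then show "B \<in> \<pi>" using blk_in(1)[OF \<pi>] by auto
next
 fix B assume B: "B \<in> \<pi>"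
 have m: "Min B \<in> B" "B \<subseteq> {..<r}" using part_block[OF \<pi> _ B] by auto
 have "B = blk \<pi> (Min B)" using blk_eq[OF \<pi> B m(1)] by simp
 then show "B \<in> blk \<pi> ` {..<r}" using m by blast
qed

lemma set_rep: "partition_on {..<r} \<pi> ==> set (rep r \<pi>) = Min ` \<pi>"
 unfolding rep_def by (subst blk_image[symmetric, of r \<pi>]) (auto simp: image_image)

lemma rep_bound: "partition_on {..<r} \<pi> ==> set (rep r \<pi>) \<subseteq> {..<r}"
 unfolding set_rep using part_block by blast

lemma kr_rep:
 assumes \<pi>: "partition_on {..<r} \<pi>"
 shows "kr (rep r \<pi>) = \<pi>"
proof -
 have "{q. q < r \<and> rep r \<pi> ! q = rep r \<pi> ! p} = blk \<pi> p" if p: "p < r" for p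
 proof -
  have "blk \<pi> p \<subseteq> {..<r}" using part_block(3)[OF \<pi> _ blk_in(1)[OF \<pi>, of p]] p by simp
  then show ?thesis using rep_eq_iff[OF \<pi> p] p by (auto simp: nth_rep)
 qed
 then have "kr (rep r \<pi>) = blk \<pi> ` {..<r}" unfolding kr_def by (intro image_cong) auto
 then show ?thesis using blk_image[OF \<pi>] by simp
qed

text \<open>A list that is constant on the blocks is the same as a function on the blocks, and
  summing over such functions factors into power sums.\<close>

lemma sum_const_lists:
 fixes u :: "nat => complex"
 assumes \<pi>: "partition_on {..<r} \<pi>"
 shows "(\<Sum>xs\<in>{xs \<in> idx_lists N r. const_on xs \<pi>}. prod_list (map u xs)) = (\<Prod>B\<in>\<pi>. \<Sum>j<N. u j ^ card B)"
proof -
 have f\<pi>: "finite \<pi>" using finite_elements[OF _ \<pi>] by simp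
 note pb = part_block[OF \<pi> finite_lessThan]
 have "(\<Prod>B\<in>\<pi>. \<Sum>j<N. u j ^ card B) = (\<Sum>h\<in>\<pi> \<rightarrow>\<^sub>E {..<N}. \<Prod>B\<in>\<pi>. u (h B) ^ card B)"
  using f\<pi> by (intro prod_sum_PiE) auto
 also have "(\<Sum>xs\<in>{xs \<in> idx_lists N r. const_on xs \<pi>}. prod_list (map u xs)) = \<dots>"
 proof (rule sum.reindex_bij_witness[of _ "%h. map (%p. h (blk \<pi> p)) [0..<r]" "%xs. \<lambda>B\<in>\<pi>. xs ! Min B"])
  fix xs assume a: "xs \<in> {xs \<in> idx_lists N r. const_on xs \<pi>}"
  then have xs: "length xs = r" "set xs \<subseteq> {..<N}" by (simp_all add: idx_lists_def)
  have c: "xs ! p = xs ! q" if "B \<in> \<pi>" "p \<in> B" "q \<in> B" for B p q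
   using a that unfolding const_on_def by blast
  show "map (%p. (\<lambda>B\<in>\<pi>. xs ! Min B) (blk \<pi> p)) [0..<r] = xs"
  proof (rule nth_equalityI)
   fix p assume "p < length (map (%p. (\<lambda>B\<in>\<pi>. xs ! Min B) (blk \<pi> p)) [0..<r])"
   then have p: "p < r" by simp
   have b: "blk \<pi> p \<in> \<pi>" "p \<in> blk \<pi> p" using blk_in[OF \<pi>] p by auto
   have "xs ! Min (blk \<pi> p) = xs ! p" by (rule c[OF b(1) pb(5)[OF b(1)] b(2)])
   then show "map (%p. (\<lambda>B\<in>\<pi>. xs ! Min B) (blk \<pi> p)) [0..<r] ! p = xs ! p" using p b by simp
  qed (simp add: xs)
  show "(\<lambda>B\<in>\<pi>. xs ! Min B) \<in> \<pi> \<rightarrow>\<^sub>E {..<N}"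
  proof (rule restrict_PiE_iff[THEN iffD2], intro ballI)
   fix B assume B: "B \<in> \<pi>"
   have "Min B < length xs" using pb(3,5)[OF B] xs(1) by blast
   then show "xs ! Min B \<in> {..<N}" using xs(2) nth_mem by blast
  qed
  have "prod_list (map u xs) = (\<Prod>p<r. u (xs ! p))"
   unfolding prod.list_conv_set_nth using xs(1) by (simp add: atLeast0LessThan)
  also have "\<dots> = (\<Prod>p\<in>\<Union>\<pi>. u (xs ! p))" using partition_onD1[OF \<pi>] by simp
  also have "\<dots> = (\<Prod>B\<in>\<pi>. \<Prod>p\<in>B. u (xs ! p))"
   using partition_onD2[OF \<pi>] pb(1) unfolding disjoint_def
   by (subst prod.Union_disjoint) auto
  also have "\<dots> = (\<Prod>B\<in>\<pi>. u (xs ! Min B) ^ card B)"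
  proof (rule prod.cong[OF refl])
   fix B assume B: "B \<in> \<pi>"
   have "(\<Prod>p\<in>B. u (xs ! p)) = (\<Prod>p\<in>B. u (xs ! Min B))"
    by (intro prod.cong refl arg_cong[where f = u] c[OF B] pb(5)[OF B])
   then show "(\<Prod>p\<in>B. u (xs ! p)) = u (xs ! Min B) ^ card B" by simp
  qed
  finally show "(\<Prod>B\<in>\<pi>. u ((\<lambda>B\<in>\<pi>. xs ! Min B) B) ^ card B) = prod_list (map u xs)" by simp
 next
  fix h assume h: "h \<in> \<pi> \<rightarrow>\<^sub>E {..<N}"
  have bl: "blk \<pi> p = B" if "B \<in> \<pi>" "p \<in> B" for p B by (rule blk_eq[OF \<pi> that])
  have lt: "p < r" if "B \<in> \<pi>" "p \<in> B" for p B using pb(3)[OF that(1)] that(2) by blast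
  show "(\<lambda>B\<in>\<pi>. map (%p. h (blk \<pi> p)) [0..<r] ! Min B) = h"
  proof
   fix B
   show "(\<lambda>B\<in>\<pi>. map (%p. h (blk \<pi> p)) [0..<r] ! Min B) B = h B"
   proof (cases "B \<in> \<pi>")
    case True
    then show ?thesis using bl[OF True pb(5)[OF True]] lt[OF True pb(5)[OF True]] by simp
   next
    case False
    then show ?thesis using PiE_arb[OF h False] by simp
   qed
  qed
  have "const_on (map (%p. h (blk \<pi> p)) [0..<r]) \<pi>"
   unfolding const_on_def
  proof (intro ballI)
   fix B p q assume B: "B \<in> \<pi>" "p \<in> B" "q \<in> B"
   show "map (%p. h (blk \<pi> p)) [0..<r] ! p = map (%p. h (blk \<pi> p)) [0..<r] ! q"
    using bl[OF B(1,2)] bl[OF B(1,3)] lt[OF B(1,2)] lt[OF B(1,3)] by simp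
  qed
  moreover have "set (map (%p. h (blk \<pi> p)) [0..<r]) \<subseteq> {..<N}"
   using PiE_mem[OF h] blk_in(1)[OF \<pi>] by auto
  ultimately show "map (%p. h (blk \<pi> p)) [0..<r] \<in> {xs \<in> idx_lists N r. const_on xs \<pi>}"
   unfolding idx_lists_def by simp
 qed
 finally show ?thesis by simp
qed

text \<open>Sending a block to the coarser block containing it is a surjection, and it is injective
  only if both partitions agree. This strict increase drives the termination and the limits of the
  inversion.\<close>

lemma refines_card:
 fixes A :: "nat set"
 assumes ref: "refines A P Q" and A: "finite A" and ne: "P \<noteq> Q"
 shows "card Q < card P"
proof -
 have P: "partition_on A P" and Q: "partition_on A Q" and sub: "\<And>X. X \<in> P ==> \<exists>Y\<in>Q. X \<subseteq> Y"
  using ref unfolding refines_def by auto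
 have fP: "finite P" and fQ: "finite Q" using finite_elements[OF A P] finite_elements[OF A Q] .
 define g where "g X = (SOME Y. Y \<in> Q \<and> X \<subseteq> Y)" for X
 have g: "g X \<in> Q" "X \<subseteq> g X" if "X \<in> P" for X
  using someI_ex[of "%Y. Y \<in> Q \<and> X \<subseteq> Y"] sub[OF that] unfolding g_def by auto
 have surj: "\<exists>X\<in>P. x \<in> X \<and> g X = Y" if Y: "Y \<in> Q" "x \<in> Y" for x Y
 proof -
  have "x \<in> A" using partition_onD1[OF Q] Y by blast
  then obtain X where X: "X \<in> P" "x \<in> X" using partition_onD1[OF P] by blast
  have "g X = blk Q x" using blk_eq[OF Q g(1)[OF X(1)]] g(2)[OF X(1)] X(2) by auto
  also have "\<dots> = Y" by (rule blk_eq[OF Q Y])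
  finally show ?thesis using X by blast
 qed
 have im: "g ` P = Q"
 proof (intro subset_antisym subsetI)
  fix Y assume Y: "Y \<in> Q"
  then obtain x where "x \<in> Y" using partition_onD3[OF Q] by fastforce
  then show "Y \<in> g ` P" using surj[OF Y] by blast
 qed (use g in auto)
 have le: "card Q \<le> card P" using card_image_le[OF fP, of g] im by simp
 have "card Q \<noteq> card P"
 proof
  assume "card Q = card P"
  then have inj: "inj_on g P" using im fP by (intro eq_card_imp_inj_on) auto
  have "Y \<in> P" if Y: "Y \<in> Q" for Y
  proof -
   obtain y where y: "y \<in> Y" using partition_onD3[OF Q] Y by fastforce
   obtain X where X: "X \<in> P" "g X = Y" using surj[OF Y y] by blast
   have "Y \<subseteq> X"
   proof
    fix x assume "x \<in> Y"
    then obtain X' where X': "X' \<in> P" "x \<in> X'" "g X' = Y" using surj[OF Y] by blast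
    then have "X' = X" using inj_onD[OF inj, of X' X] X by simp
    then show "x \<in> X" using X'(2) by simp
   qed
   then have "Y = X" using g(2)[OF X(1)] X(2) by blast
   then show ?thesis using X by simp
  qed
  then have "Q \<subseteq> P" by blast
  then have "Q = P" using card_subset_eq[OF fP] \<open>card Q = card P\<close> by blast
  then show False using ne by simp
 qed
 then show ?thesis using le by simp
qed

definition finer :: "nat => nat set set => nat set set set" where
 "finer r \<pi> = {\<pi>'. refines {..<r} \<pi>' \<pi> \<and> \<pi>' \<noteq> \<pi>}"

text \<open>Moebius inversion on the partition lattice by iteration: the values stabilise as
 soon as the counter exceeds the length of every chain below the partition.\<close>

fun mob :: "(nat set set => complex) => nat => nat => nat set set => complex" where
 "mob D r 0 \<pi> = D \<pi>"
| "mob D r (Suc m) \<pi> = D \<pi> - (\<Sum>\<pi>'\<in>finer r \<pi>. mob D r m \<pi>')"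

lemma finite_parts: "finite {\<pi>. partition_on {..<r :: nat} \<pi>}"
 by (rule finitely_many_partition_on) simp

lemma finite_finer: "finite (finer r \<pi>)"
 by (rule finite_subset[OF _ finite_parts[of r]]) (auto simp: finer_def refines_def)

lemma finerD: "\<pi>' \<in> finer r \<pi> ==> partition_on {..<r} \<pi>' \<and> card \<pi> < card \<pi>'"
 unfolding finer_def using refines_card[of "{..<r}" \<pi>' \<pi>] by (auto simp: refines_def)

lemma finer_empty: "r \<le> card \<pi> ==> finer r \<pi> = {}"
 using finerD[of _ r \<pi>] card_part_le[of r] by fastforce

lemma mob_stable:
 assumes "r \<le> m + card \<pi>" "r \<le> m' + card \<pi>"
 shows "mob D r m \<pi> = mob D r m' \<pi>"
 using assms
proof (induction m arbitrary: m' \<pi>)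
 case 0
 then show ?case by (cases m') (simp_all add: finer_empty)
next
 case (Suc m)
 show ?case
 proof (cases m')
  case 0
  then show ?thesis using Suc.prems by (simp add: finer_empty)
 next
  case (Suc n)
  have "mob D r m \<pi>' = mob D r n \<pi>'" if "\<pi>' \<in> finer r \<pi>" for \<pi>'
   using finerD[OF that] Suc.prems Suc by (intro Suc.IH) auto
  then show ?thesis using Suc by simp
 qed
qed

lemma mob_sum:
 assumes \<pi>: "partition_on {..<r} \<pi>"
 shows "D \<pi> = (\<Sum>\<pi>'\<in>{\<pi>'. refines {..<r} \<pi>' \<pi>}. mob D r r \<pi>')"
proof -
 have s: "{\<pi>'. refines {..<r} \<pi>' \<pi>} = insert \<pi> (finer r \<pi>)"
  unfolding finer_def using refines_refl[OF \<pi>] by auto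
 have n: "\<pi> \<notin> finer r \<pi>" by (simp add: finer_def)
 have "mob D r r \<pi> = mob D r (Suc r) \<pi>" by (rule mob_stable) auto
 then show ?thesis unfolding s using finite_finer n by simp
qed

text \<open>The corrections involve strictly finer partitions, hence at least three blocks, and
  these tend to 0.\<close>

lemma mob_limit2:
 assumes "\<And>\<pi>. partition_on {..<r} \<pi> ==> 2 \<le> card \<pi> ==> (%N. D N \<pi>) \<longlonglongrightarrow> (if card \<pi> = 2 then l \<pi> else 0)"
  and "partition_on {..<r} \<pi>" "2 \<le> card \<pi>"
 shows "(%N. mob (D N) r m \<pi>) \<longlonglongrightarrow> (if card \<pi> = 2 then l \<pi> else 0)"
 using assms(2,3)
proof (induction m arbitrary: \<pi>)
 case 0
 then show ?case using assms(1)[OF 0] by simp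
next
 case (Suc m)
 have "(%N. mob (D N) r m \<pi>') \<longlonglongrightarrow> 0" if "\<pi>' \<in> finer r \<pi>" for \<pi>'
  using Suc.IH[of \<pi>'] finerD[OF that] Suc.prems by simp
 then have "(%N. D N \<pi> - (\<Sum>\<pi>'\<in>finer r \<pi>. mob (D N) r m \<pi>')) \<longlonglongrightarrow> (if card \<pi> = 2 then l \<pi> else 0) - (\<Sum>\<pi>'\<in>finer r \<pi>. 0)"
  by (intro tendsto_diff tendsto_sum assms(1) Suc.prems)
 then show ?case by simp
qed

text \<open>The corrections come from partitions with at least two blocks; they stay bounded and are
  suppressed by 1/N.\<close>

lemma mob_limit1:
 assumes D2: "\<And>\<pi>. partition_on {..<r} \<pi> ==> 2 \<le> card \<pi> ==> (%N. D N \<pi>) \<longlonglongrightarrow> (if card \<pi> = 2 then l \<pi> else 0)"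
  and \<pi>: "card \<pi> = 1" and D1: "(%N. D N \<pi> / of_nat N) \<longlonglongrightarrow> c"
 shows "(%N. mob (D N) r m \<pi> / of_nat N) \<longlonglongrightarrow> c"
proof (cases m)
 case 0
 then show ?thesis using D1 by simp
next
 case (Suc n)
 have "(%N. mob (D N) r n \<pi>' * (1 / of_nat N)) \<longlonglongrightarrow> (if card \<pi>' = 2 then l \<pi>' else 0) * 0" if "\<pi>' \<in> finer r \<pi>" for \<pi>'
  using finerD[OF that] \<pi> by (intro tendsto_mult mob_limit2[OF D2] lim_1_over_n) auto
 then have "(%N. D N \<pi> / of_nat N - (\<Sum>\<pi>'\<in>finer r \<pi>. mob (D N) r n \<pi>' * (1 / of_nat N))) \<longlonglongrightarrow> c - (\<Sum>\<pi>'\<in>finer r \<pi>. 0)"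
  by (intro tendsto_diff tendsto_sum D1) simp
 then show ?thesis unfolding Suc by (simp add: diff_divide_distrib sum_divide_distrib)
qed

text \<open>Equal kernels make the map between the entries well defined and injective. It extends to
  a permutation of all N indices because the complements have equally many elements.\<close>

lemma kr_perm:
 assumes xs: "xs \<in> idx_lists N r" "ys \<in> idx_lists N r" and k: "kr xs = kr ys"
 shows "\<exists>\<sigma>. \<sigma> permutes {..<N} \<and> ys = map \<sigma> xs"
proof -
 have l: "length xs = r" "length ys = r" "set xs \<subseteq> {..<N}" "set ys \<subseteq> {..<N}" using xs unfolding idx_lists_def by auto
 have iff: "xs ! p = xs ! q \<longleftrightarrow> ys ! p = ys ! q" if "p < r" "q < r" for p q
  using kr_eq_iff[of p xs q] kr_eq_iff[of p ys q] that l k by simp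
 define w where "w x = (SOME p. p < r \<and> xs ! p = x)" for x
 have w: "w x < r" "xs ! w x = x" if "x \<in> set xs" for x
  using someI_ex[of "%p. p < r \<and> xs ! p = x"] that l(1) unfolding w_def by (auto simp: in_set_conv_nth)
 define g where "g x = ys ! w x" for x
 have gx: "g (xs ! p) = ys ! p" if p: "p < r" for p
 proof -
  have m: "xs ! p \<in> set xs" using p l by simp
  show ?thesis unfolding g_def using iff[OF w(1)[OF m] p] w(2)[OF m] by simp
 qed
 have inj: "inj_on g (set xs)"
 proof (rule inj_onI)
  fix x y assume a: "x \<in> set xs" "y \<in> set xs" "g x = g y"
  then have "xs ! w x = xs ! w y" using iff[OF w(1)[OF a(1)] w(1)[OF a(2)]] unfolding g_def by simp
  then show "x = y" using w(2) a by simp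
 qed
 have im: "g ` set xs = set ys"
 proof (intro subset_antisym subsetI)
  fix y assume "y \<in> set ys"
  then obtain p where p: "p < r" "y = ys ! p" using l(2) by (auto simp: in_set_conv_nth)
  then show "y \<in> g ` set xs" using gx[OF p(1)] l(1) by (intro image_eqI[where x = "xs ! p"]) auto
 next
  fix y assume "y \<in> g ` set xs"
  then obtain x where "x \<in> set xs" "y = ys ! w x" unfolding g_def by blast
  then show "y \<in> set ys" using w(1) l(2) by simp
 qed
 have b1: "bij_betw g (set xs) (set ys)" using inj im unfolding bij_betw_def by simp
 have "card (set xs) = card (set ys)" by (rule bij_betw_same_card[OF b1])
 then have "card ({..<N} - set xs) = card ({..<N} - set ys)" using l by (simp add: card_Diff_subset)
 then obtain h where h: "bij_betw h ({..<N} - set xs) ({..<N} - set ys)"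
  using finite_same_card_bij[of "{..<N} - set xs" "{..<N} - set ys"] by auto
 define \<sigma> where "\<sigma> x = (if x \<in> set xs then g x else if x < N then h x else x)" for x
 have "bij_betw \<sigma> (set xs \<union> ({..<N} - set xs)) (set ys \<union> ({..<N} - set ys))"
 proof (rule bij_betw_combine)
  show "bij_betw \<sigma> (set xs) (set ys)" using b1 by (rule bij_betw_cong[THEN iffD1, rotated]) (simp add: \<sigma>_def)
  show "bij_betw \<sigma> ({..<N} - set xs) ({..<N} - set ys)" using h by (rule bij_betw_cong[THEN iffD1, rotated]) (simp add: \<sigma>_def)
 qed auto
 moreover have "set xs \<union> ({..<N} - set xs) = {..<N}" "set ys \<union> ({..<N} - set ys) = {..<N}" using l by auto
 ultimately have "\<sigma> permutes {..<N}"
  using l(3) by (intro bij_imp_permutes) (auto simp: \<sigma>_def)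
 moreover have "ys = map \<sigma> xs" using l gx by (intro nth_equalityI) (auto simp: \<sigma>_def)
 ultimately show ?thesis by blast
qed

lemma pds_permute:
 assumes sym: "\<And>x. x \<in> polydisc N R ==> f (x \<circ> \<sigma>) = f x" and \<sigma>: "\<sigma> permutes {..<N}"
  and "set xs \<subseteq> {..<N}" "x \<in> polydisc N R"
 shows "pds (map \<sigma> xs) f x = pds xs f (x \<circ> \<sigma>)"
 using assms(3,4)
proof (induction xs arbitrary: x)
 case Nil
 show ?case unfolding list.map pds_Nil using sym[OF Nil(2)] by (simp only:)
next
 case (Cons i xs)
 have \<sigma>i: "\<sigma> i < N" using permutes_in_image[OF \<sigma>, of i] Cons.prems by simp
 have ci: "cmod (x (\<sigma> i) - 1) < R" using Cons.prems(2) \<sigma>i unfolding polydisc_def by blast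
 have "eventually (%t. t \<in> ball 1 R) (nhds (x (\<sigma> i)))"
  by (rule eventually_nhds_in_open) (use ci in \<open>auto simp: dist_norm norm_minus_commute\<close>)
 then have ev: "eventually (%t. pds (map \<sigma> xs) f (x(\<sigma> i := t)) = pds xs f ((x \<circ> \<sigma>)(i := t))) (nhds (x (\<sigma> i)))"
 proof eventually_elim
  case (elim t)
  have m: "x(\<sigma> i := t) \<in> polydisc N R"
   by (rule polydisc_upd[OF Cons.prems(2)]) (use elim in \<open>simp add: dist_norm norm_minus_commute\<close>)
  have e: "(x(\<sigma> i := t)) \<circ> \<sigma> = (x \<circ> \<sigma>)(i := t)"
   using permutes_inj[OF \<sigma>] by (auto simp: fun_eq_iff inj_eq)
  have "set xs \<subseteq> {..<N}" using Cons.prems(1) by simp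
  from Cons.IH[OF this m] show ?case unfolding e .
 qed
 show ?case unfolding list.map pds_Cons pd_def using deriv_cong_ev[OF ev] by simp
qed

lemma pds_append: "pds (xs @ ys) f = pds xs (pds ys f)"
 by (simp add: pds_def)

lemma pds_replicate: "pds (replicate n i) f = (pd i ^^ n) f"
 by (induction n) simp_all

text \<open>By symmetry a derivative depends only on the kernel of its index list. Moebius inversion
  rewrites a condition on the exact kernel through lists that are merely constant on blocks, and
  sums over those are products of power sums.\<close>

lemma jet_sum:
 assumes sym: "\<And>\<sigma> x. \<sigma> permutes {..<N} ==> x \<in> polydisc N R ==> f (x \<circ> \<sigma>) = f x" and R: "R > 0" and rN: "r \<le> N"
 shows "(\<Sum>xs\<in>idx_lists N r. prod_list (map u xs) * pds xs f one_pt)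
  = (\<Sum>\<pi>\<in>{\<pi>. partition_on {..<r} \<pi>}. mob (%\<pi>. pds (rep r \<pi>) f one_pt) r r \<pi> * (\<Prod>B\<in>\<pi>. \<Sum>j<N. u j ^ card B))"
proof -
 let ?D = "%\<pi>. pds (rep r \<pi>) f one_pt" and ?P = "{\<pi>. partition_on {..<r} \<pi>}"
 have one: "one_pt \<in> polydisc N R" using R by (simp add: polydisc_def one_pt_def)
 have D: "pds xs f one_pt = (\<Sum>\<pi>\<in>?P. if const_on xs \<pi> then mob ?D r r \<pi> else 0)" if xs: "xs \<in> idx_lists N r" for xs
 proof -
  have l: "length xs = r" using xs by (simp add: idx_lists_def)
  have k: "partition_on {..<r} (kr xs)" using kr_partition[of xs] l by simp
  have ri: "rep r (kr xs) \<in> idx_lists N r" using rep_bound[OF k] rN by (auto simp: idx_lists_def)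
  obtain \<sigma> where \<sigma>: "\<sigma> permutes {..<N}" "rep r (kr xs) = map \<sigma> xs"
   using kr_perm[OF xs ri] kr_rep[OF k] by auto
  have o: "one_pt \<circ> \<sigma> = one_pt" by (simp add: one_pt_def fun_eq_iff)
  have "?D (kr xs) = pds xs f one_pt"
   unfolding \<sigma>(2) using pds_permute[where f = f and R = R, OF sym[OF \<sigma>(1)] \<sigma>(1) _ one, of xs] xs unfolding o by (simp add: idx_lists_def)
  then have "pds xs f one_pt = (\<Sum>\<pi>\<in>{\<pi>. refines {..<r} \<pi> (kr xs)}. mob ?D r r \<pi>)"
   using mob_sum[OF k, of ?D] by simp
  also have "{\<pi>. refines {..<r} \<pi> (kr xs)} = {\<pi>\<in>?P. const_on xs \<pi>}"
   using refines_kr[of xs] l unfolding refines_def by auto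
  also have "(\<Sum>\<pi>\<in>{\<pi>\<in>?P. const_on xs \<pi>}. mob ?D r r \<pi>) = (\<Sum>\<pi>\<in>?P. if const_on xs \<pi> then mob ?D r r \<pi> else 0)"
   by (rule sum.inter_filter[OF finite_parts])
  finally show ?thesis .
 qed
 have "(\<Sum>xs\<in>idx_lists N r. prod_list (map u xs) * pds xs f one_pt)
  = (\<Sum>xs\<in>idx_lists N r. \<Sum>\<pi>\<in>?P. if const_on xs \<pi> then mob ?D r r \<pi> * prod_list (map u xs) else 0)"
  by (intro sum.cong refl) (simp add: D sum_distrib_left mult.commute if_distrib cong: if_cong)
 also have "\<dots> = (\<Sum>\<pi>\<in>?P. \<Sum>xs\<in>idx_lists N r. if const_on xs \<pi> then mob ?D r r \<pi> * prod_list (map u xs) else 0)"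
  by (rule sum.swap)
 also have "\<dots> = (\<Sum>\<pi>\<in>?P. mob ?D r r \<pi> * (\<Prod>B\<in>\<pi>. \<Sum>j<N. u j ^ card B))"
 proof (rule sum.cong[OF refl])
  fix \<pi> assume "\<pi> \<in> ?P"
  then have \<pi>: "partition_on {..<r} \<pi>" by simp
  have "(\<Sum>xs\<in>idx_lists N r. if const_on xs \<pi> then mob ?D r r \<pi> * prod_list (map u xs) else 0)
   = (\<Sum>xs\<in>{xs\<in>idx_lists N r. const_on xs \<pi>}. mob ?D r r \<pi> * prod_list (map u xs))"
   by (rule sum.inter_filter[symmetric]) simp
  also have "\<dots> = mob ?D r r \<pi> * (\<Prod>B\<in>\<pi>. \<Sum>j<N. u j ^ card B)"
   unfolding sum_distrib_left[symmetric] sum_const_lists[OF \<pi>] ..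
  finally show "(\<Sum>xs\<in>idx_lists N r. if const_on xs \<pi> then mob ?D r r \<pi> * prod_list (map u xs) else 0)
   = mob ?D r r \<pi> * (\<Prod>B\<in>\<pi>. \<Sum>j<N. u j ^ card B)" .
 qed
 finally show ?thesis .
qed

section \<open>Symmetry, normalisation and nonvanishing of the generating function\<close>

lemma SGF_sym:
 assumes "\<sigma> permutes {..<N}" "\<And>i. i < N ==> x i \<noteq> 0"
 shows "SGF N \<rho> (x \<circ> \<sigma>) = SGF N \<rho> x"
 unfolding SGF_def sgf_term_def
 by (intro infsum_cong) (simp add: schur_permute[OF assms(1)] assms(2) del: comp_apply)

lemma sgf_term_one:
 assumes "l \<in> GT N"
 shows "sgf_term N \<rho> l one_pt = of_real (pmf \<rho> l)"
 using schur_one_nonzero[OF assms] by (simp add: sgf_term_def)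

lemma SGF_one:
 assumes N: "N > 0" and supp: "set_pmf \<rho> \<subseteq> GT N" and conv: "SGF_unif_conv N \<rho>"
 shows "SGF N \<rho> one_pt = 1"
proof -
 have "(%l. norm (pmf \<rho> l * 1)) summable_on set_pmf \<rho>"
  using moments_summable[OF N supp conv, of "{}"] by simp
 from pmf_expectation(2)[OF this] have "((%l. pmf \<rho> l) has_sum 1) (set_pmf \<rho>)"
  by simp
 then have "((%l. complex_of_real (pmf \<rho> l)) has_sum of_real 1) (set_pmf \<rho>)" by (rule has_sum_of_real)
 then have "infsum (%l. complex_of_real (pmf \<rho> l)) (set_pmf \<rho>) = 1" by (simp add: infsumI)
 moreover have "SGF N \<rho> one_pt = infsum (%l. complex_of_real (pmf \<rho> l)) (set_pmf \<rho>)"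
  unfolding SGF_def by (intro infsum_cong sgf_term_one) (use supp in auto)
 ultimately show ?thesis by simp
qed

lemma continuous_sgf_term: "continuous_on (polydisc N 1) (sgf_term N \<rho> l)"
proof -
 have nz: "x i \<noteq> 0" if "x \<in> polydisc N 1" "i < N" for x :: "nat => complex" and i
 proof
  assume "x i = 0"
  moreover have "cmod (x i - 1) < 1" using that unfolding polydisc_def by blast
  ultimately show False by simp
 qed
 have c: "continuous_on (polydisc N 1) (%x. schur_cont N l x)"
  by (rule continuous_schur_cont[where f = "%y. y"]) (rule continuous_on_coord, rule nz, assumption+)
 have "continuous_on (polydisc N 1) (%x. of_real (pmf \<rho> l) / schur N l one_pt * schur_cont N l x)"
  by (intro continuous_on_mult continuous_on_const c)
 then show ?thesis
 proof (rule continuous_on_eq)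
  fix x assume "x \<in> polydisc N 1"
  then have "schur N l x = schur_cont N l x" by (intro schur_eq nz)
  then show "of_real (pmf \<rho> l) / schur N l one_pt * schur_cont N l x = sgf_term N \<rho> l x" by (simp add: sgf_term_def)
 qed
qed

text \<open>Needed for exp(Ln S) = S. The value at (1,...,1) is 1, and a continuous finite partial
  sum is within 1/8 of the function, so three errors of size 1/8 cannot reach 0.\<close>

lemma SGF_near_one:
 assumes N: "N > 0" and supp: "set_pmf \<rho> \<subseteq> GT N" and conv: "SGF_unif_conv N \<rho>"
 shows "\<exists>\<delta>>0. \<forall>x. (\<forall>j<N. cmod (x j - 1) < \<delta>) \<longrightarrow> (\<forall>j\<ge>N. x j = 1) \<longrightarrow> SGF N \<rho> x \<noteq> 0"
proof -
 obtain R where R: "R > 0" and cl: "\<And>e. e > 0 ==> eventually (%L. \<forall>x\<in>polydisc N R. cmod ((\<Sum>l\<in>L. sgf_term N \<rho> l x) - SGF N \<rho> x) < e)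
  (finite_subsets_at_top (set_pmf \<rho>))" using sgf_unif_close[OF conv] by blast
 obtain X where X: "finite X" "\<forall>x\<in>polydisc N R. cmod ((\<Sum>l\<in>X. sgf_term N \<rho> l x) - SGF N \<rho> x) < 1 / 8"
  using cl[of "1 / 8"] unfolding eventually_finite_subsets_at_top by auto
 have cont: "continuous_on (polydisc N 1) (%x. \<Sum>l\<in>X. sgf_term N \<rho> l x)"
  by (intro continuous_on_sum continuous_sgf_term)
 obtain e where e: "e > 0" "\<And>x. (\<forall>j<N. cmod (x j - 1) < e) ==> (\<forall>j\<ge>N. x j = 1) ==>
   cmod ((\<Sum>l\<in>X. sgf_term N \<rho> l x) - (\<Sum>l\<in>X. sgf_term N \<rho> l one_pt)) < 1 / 8"
  using near_one_pt[OF cont, of "1 / 8"] by auto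
 show ?thesis
 proof (intro exI[of _ "min e R"] conjI allI impI)
  show "0 < min e R" using e R by simp
  fix x assume x: "\<forall>j<N. cmod (x j - 1) < min e R" "\<forall>j\<ge>N. x j = 1"
  let ?S = "%x. \<Sum>l\<in>X. sgf_term N \<rho> l x"
  have 1: "cmod (?S x - SGF N \<rho> x) < 1 / 8" using X(2) x(1) by (simp add: polydisc_def)
  have 2: "cmod (?S one_pt - SGF N \<rho> one_pt) < 1 / 8" using X(2) R by (simp add: polydisc_def)
  have 3: "cmod (?S x - ?S one_pt) < 1 / 8" using e(2) x by simp
  show "SGF N \<rho> x \<noteq> 0"
  proof
   assume z: "SGF N \<rho> x = 0"
   have "1 = SGF N \<rho> one_pt - SGF N \<rho> x" using SGF_one[OF N supp conv] z by simp
   also have "\<dots> = (?S x - SGF N \<rho> x) - (?S one_pt - SGF N \<rho> one_pt) - (?S x - ?S one_pt)" by simp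
   finally have "1 = cmod ((?S x - SGF N \<rho> x) - (?S one_pt - SGF N \<rho> one_pt) - (?S x - ?S one_pt))" by (metis norm_one)
   also have "\<dots> \<le> cmod (?S x - SGF N \<rho> x) + cmod (?S one_pt - SGF N \<rho> one_pt) + cmod (?S x - ?S one_pt)"
    by (meson add_mono norm_triangle_ineq4 order_trans order_refl)
   finally show False using 1 2 3 by linarith
  qed
 qed
qed

definition parts_upto :: "nat => nat set set set" where
 "parts_upto K = (\<Union>r\<in>{1..K}. {\<pi>. partition_on {..<r} \<pi>})"

text \<open>The limit coefficients c_r / r! and d_{m,r-m} / r!, where r is the size of the ground
  set and m the size of the block that contains 0.\<close>

definition ee :: "(nat => real) => (nat => nat => real) => nat set set => complex" where
 "ee c d \<pi> = of_real (if card \<pi> = 1 then c (card (\<Union>\<pi>)) else d (card (blk \<pi> 0)) (card (\<Union>\<pi>) - card (blk \<pi> 0))) / fact (card (\<Union>\<pi>))"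

lemma good_parts_upto: "good_parts (parts_upto K)"
 unfolding good_parts_def
proof (intro conjI ballI)
 show "finite (parts_upto K)" unfolding parts_upto_def using finite_parts by blast
 fix \<pi> assume "\<pi> \<in> parts_upto K"
 then obtain r where r: "r \<ge> 1" and \<pi>: "partition_on {..<r} \<pi>" unfolding parts_upto_def by auto
 show "finite \<pi>" using finite_elements[OF _ \<pi>] by simp
 have "0 \<in> {..<r}" using r by simp
 then show "\<pi> \<noteq> {}" using partition_onD1[OF \<pi>] by blast
 fix b assume b: "b \<in> \<pi>"
 show "finite b" "b \<noteq> {}" by (rule part_block[OF \<pi> finite_lessThan b])+
qed

section \<open>Coefficient limits and jets for appropriate sequences\<close>

locale approp_seq =
 fixes \<rho> :: "nat => int list pmf" and c :: "nat => real" and d :: "nat => nat => real"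
 assumes supp: "\<forall>N\<ge>1. set_pmf (\<rho> N) \<subseteq> GT N"
  and conv: "\<forall>N\<ge>1. SGF_unif_conv N (\<rho> N)"
  and approp: "appropriate_with (%N. SGF N (\<rho> N)) c d"
begin

definition LS where "LS N = (%x. Ln (SGF N (\<rho> N) x))"

lemma lim1: "k \<ge> 1 ==> (%N. (pd i ^^ k) (LS N) one_pt / of_nat N) \<longlonglongrightarrow> of_real (c k)"
 using approp unfolding appropriate_with_def LS_def by blast

lemma lim2: "i \<noteq> j ==> k \<ge> 1 ==> l \<ge> 1 ==> (%N. (pd i ^^ k) ((pd j ^^ l) (LS N)) one_pt) \<longlonglongrightarrow> of_real (d k l)"
 using approp unfolding appropriate_with_def LS_def by blast

lemma lim3: "card (set xs) \<ge> 3 ==> (%N. pds xs (LS N) one_pt) \<longlonglongrightarrow> 0"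
 using approp unfolding appropriate_with_def LS_def by blast

lemma holo_LS:
 assumes "N \<ge> 1"
 obtains R where "0 < R" "R \<le> 1" "holo_on_polydisc N R (LS N)"
proof -
 obtain R where "R > 0" "holo_on_polydisc N R (LS N)"
  using approp assms unfolding appropriate_with_def LS_def by blast
 then show ?thesis using that[of "min R 1"] holo_on_polydisc_mono[of N R "LS N" "min R 1"] by simp
qed

lemma LS_sym:
 assumes "\<sigma> permutes {..<N}" "x \<in> polydisc N R" "R \<le> 1"
 shows "LS N (x \<circ> \<sigma>) = LS N x"
proof -
 have "x i \<noteq> 0" if "i < N" for i
 proof
  assume "x i = 0"
  moreover have "cmod (x i - 1) < R" using assms(2) that unfolding polydisc_def by blast
  ultimately show False using assms(3) by simp
 qed
 then show ?thesis unfolding LS_def using SGF_sym[OF assms(1)] by simp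
qed

lemma pds_LS_perm:
 assumes N: "N \<ge> 1" and "mset xs = mset ys" "set xs \<subseteq> {..<N}"
 shows "pds xs (LS N) one_pt = pds ys (LS N) one_pt"
proof -
 obtain R where R: "0 < R" "R \<le> 1" "holo_on_polydisc N R (LS N)" using holo_LS[OF N] by blast
 show ?thesis
  by (rule pds_perm[OF R(3) assms(2,3), where R = "R / 2"]) (use R in \<open>auto simp: polydisc_def one_pt_def\<close>)
qed

text \<open>Mixed partial derivatives commute as soon as both indices are below N, and the limits
  inherit it.\<close>

lemma d_sym:
 assumes "k \<ge> 1" "l \<ge> 1"
 shows "d k l = d l k"
proof -
 have "eventually (%N. (pd 0 ^^ k) ((pd 1 ^^ l) (LS N)) one_pt = (pd 1 ^^ l) ((pd 0 ^^ k) (LS N)) one_pt) sequentially"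
  using eventually_ge_at_top[of 2]
 proof eventually_elim
  case (elim N)
  show ?case unfolding pds_replicate[symmetric] pds_append[symmetric]
   by (rule pds_LS_perm) (use elim in auto)
 qed
 from Lim_transform_eventually[OF lim2[of 0 1 k l] this]
 have "(%N. (pd 1 ^^ l) ((pd 0 ^^ k) (LS N)) one_pt) \<longlonglongrightarrow> of_real (d k l)" using assms by simp
 from LIMSEQ_unique[OF this lim2[of 1 0 l k]] show ?thesis using assms by simp
qed

definition DN where "DN r N \<pi> = pds (rep r \<pi>) (LS N) one_pt"

text \<open>The order r of the derivative is recovered from the partition as the size of its union,
  so that partitions of different ground sets share one family of coefficients.\<close>

definition EE where "EE N \<pi> = mob (DN (card (\<Union>\<pi>)) N) (card (\<Union>\<pi>)) (card (\<Union>\<pi>)) \<pi> / fact (card (\<Union>\<pi>))"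

lemma DN_lim1:
 assumes \<pi>: "partition_on {..<r} \<pi>" and c1: "card \<pi> = 1"
 shows "(%N. DN r N \<pi> / of_nat N) \<longlonglongrightarrow> of_real (c r)"
proof -
 obtain B where B: "\<pi> = {B}" using c1 by (auto simp: card_1_singleton_iff)
 have Br: "B = {..<r}" using partition_onD1[OF \<pi>] B by simp
 then have r: "r \<ge> 1" using partition_onD3[OF \<pi>] B by (cases r) auto
 have "Min {..<r} = 0" by (rule Min_eqI) (use r in auto)
 moreover have "blk \<pi> p = {..<r}" if "p < r" for p using blk_in(1)[OF \<pi>, of p] that B Br by simp
 ultimately have "rep r \<pi> = replicate r 0" by (intro nth_equalityI) (simp_all add: nth_rep)
 then show ?thesis using lim1[OF r, of 0] unfolding DN_def by (simp add: pds_replicate)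
qed

lemma two_blocks:
 assumes \<pi>: "partition_on {..<r} \<pi>" and c2: "card \<pi> = 2"
 obtains B where "\<pi> = {blk \<pi> 0, B}" "blk \<pi> 0 \<noteq> B" "0 \<in> blk \<pi> 0" "blk \<pi> 0 \<inter> B = {}" "blk \<pi> 0 \<union> B = {..<r}"
  "card (blk \<pi> 0) \<ge> 1" "card B \<ge> 1" "card B = r - card (blk \<pi> 0)" "finite B" "finite (blk \<pi> 0)"
proof -
 have "r \<ge> 1" using c2 card_part_le[OF \<pi>] by simp
 then have b0: "blk \<pi> 0 \<in> \<pi>" "0 \<in> blk \<pi> 0" using blk_in[OF \<pi>, of 0] by auto
 obtain B where B: "\<pi> = {blk \<pi> 0, B}" "blk \<pi> 0 \<noteq> B" using c2 b0(1) by (auto simp: card_2_iff)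
 have BB: "B \<in> \<pi>" using B(1) by blast
 have dis: "blk \<pi> 0 \<inter> B = {}" using partition_onD2[OF \<pi>] b0(1) BB B(2) unfolding disjoint_def by blast
 have "\<Union>\<pi> = \<Union>{blk \<pi> 0, B}" by (rule arg_cong[OF B(1)])
 also have "\<Union>{blk \<pi> 0, B} = blk \<pi> 0 \<union> B" by simp
 finally have un: "blk \<pi> 0 \<union> B = {..<r}" using partition_onD1[OF \<pi>] by (rule trans[OF sym sym])
 note p0 = part_block[OF \<pi> finite_lessThan b0(1)] and p1 = part_block[OF \<pi> finite_lessThan BB]
 have "card (blk \<pi> 0) + card B = r"
  using card_Un_disjoint[OF p0(1) p1(1) dis] un by simp
 then show ?thesis using that[OF B b0(2) dis un] p0 p1 by simp
qed

text \<open>The canonical list of a two-block partition interleaves its two indices. Derivatives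
  commute for large N, so the list may be sorted into the form in which the limit d is
  given.\<close>

lemma DN_lim2:
 assumes \<pi>: "partition_on {..<r} \<pi>" and c2: "card \<pi> = 2"
 shows "(%N. DN r N \<pi>) \<longlonglongrightarrow> of_real (d (card (blk \<pi> 0)) (r - card (blk \<pi> 0)))"
proof -
 obtain B where B: "\<pi> = {blk \<pi> 0, B}" "blk \<pi> 0 \<noteq> B" "0 \<in> blk \<pi> 0" "blk \<pi> 0 \<inter> B = {}" "blk \<pi> 0 \<union> B = {..<r}"
  "card (blk \<pi> 0) \<ge> 1" "card B \<ge> 1" "card B = r - card (blk \<pi> 0)" "finite B" "finite (blk \<pi> 0)"
  by (rule two_blocks[OF \<pi> c2])
 define B0 where "B0 = blk \<pi> 0"
 define j where "j = Min B"
 have in\<pi>: "B0 \<in> \<pi>" "B \<in> \<pi>" using B(1) unfolding B0_def by blast+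
 have m0: "Min B0 = 0" by (rule Min_eqI) (use B(3,10) in \<open>auto simp: B0_def\<close>)
 have jB: "j \<in> B" unfolding j_def using B(7,9) by (intro Min_in) auto
 have j0: "j \<noteq> 0" "j < r"
 proof -
  show "j \<noteq> 0" using jB B(3,4) by (intro notI) blast
  have "j \<in> {..<r}" using jB B(5) by blast
  then show "j < r" by simp
 qed
 have "mset (rep r \<pi>) = image_mset (%p. Min (blk \<pi> p)) (mset_set {..<r})"
  unfolding rep_def mset_map mset_upt atLeast0LessThan ..
 also have "mset_set {..<r} = mset_set B0 + mset_set B"
  using mset_set_Union[OF B(10,9,4)] unfolding B(5) B0_def .
 also have "image_mset (%p. Min (blk \<pi> p)) (mset_set B0 + mset_set B)
  = image_mset (%_. 0) (mset_set B0) + image_mset (%_. j) (mset_set B)"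
 proof -
  have "image_mset (%p. Min (blk \<pi> p)) (mset_set B0) = image_mset (%_. 0) (mset_set B0)"
   using blk_eq[OF \<pi> in\<pi>(1)] m0 B(10) by (intro image_mset_cong) (simp add: B0_def)
  moreover have "image_mset (%p. Min (blk \<pi> p)) (mset_set B) = image_mset (%_. j) (mset_set B)"
   using blk_eq[OF \<pi> in\<pi>(2)] B(9) by (intro image_mset_cong) (simp add: j_def)
  ultimately show ?thesis by simp
 qed
 also have "\<dots> = mset (replicate (card B0) 0 @ replicate (card B) j)"
  by (simp add: image_mset_const_eq)
 finally have ms: "mset (rep r \<pi>) = mset (replicate (card B0) 0 @ replicate (card B) j)" .
 have ev: "eventually (%N. (pd 0 ^^ card B0) ((pd j ^^ card B) (LS N)) one_pt = DN r N \<pi>) sequentially"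
  using eventually_ge_at_top[of "Suc r"]
 proof eventually_elim
  case (elim N)
  have "pds (rep r \<pi>) (LS N) one_pt = pds (replicate (card B0) 0 @ replicate (card B) j) (LS N) one_pt"
   by (rule pds_LS_perm[OF _ ms]) (use elim rep_bound[OF \<pi>] in auto)
  then show ?case by (simp add: DN_def pds_append pds_replicate)
 qed
 have "(%N. (pd 0 ^^ card B0) ((pd j ^^ card B) (LS N)) one_pt) \<longlonglongrightarrow> of_real (d (card B0) (card B))"
  by (rule lim2) (use j0 B(6,7) in \<open>auto simp: B0_def\<close>)
 from Lim_transform_eventually[OF this ev]
 show "(%N. DN r N \<pi>) \<longlonglongrightarrow> of_real (d (card (blk \<pi> 0)) (r - card (blk \<pi> 0)))"
  unfolding B(8) B0_def .
qed

lemma DN_lim: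
 assumes \<pi>: "partition_on {..<r} \<pi>" and c2: "2 \<le> card \<pi>"
 shows "(%N. DN r N \<pi>) \<longlonglongrightarrow> (if card \<pi> = 2 then of_real (d (card (blk \<pi> 0)) (r - card (blk \<pi> 0))) else 0)"
proof (cases "card \<pi> = 2")
 case True
 then show ?thesis using DN_lim2[OF \<pi>] by simp
next
 case False
 have "card (set (rep r \<pi>)) = card \<pi>" unfolding set_rep[OF \<pi>] by (rule card_image[OF inj_Min[OF \<pi>]]) simp
 then show ?thesis using lim3[of "rep r \<pi>"] False c2 unfolding DN_def by simp
qed

lemma EE_lim:
 assumes "\<pi> \<in> parts_upto K"
 shows "card \<pi> = 1 ==> (%N. EE N \<pi> / of_nat N) \<longlonglongrightarrow> ee c d \<pi>"
  "card \<pi> = 2 ==> (%N. EE N \<pi>) \<longlonglongrightarrow> ee c d \<pi>"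
  "card \<pi> \<ge> 3 ==> (%N. EE N \<pi>) \<longlonglongrightarrow> 0"
proof -
 obtain r where r: "r \<ge> 1" and \<pi>: "partition_on {..<r} \<pi>" using assms unfolding parts_upto_def by auto
 have cr: "card (\<Union>\<pi>) = r" using partition_onD1[OF \<pi>] by (metis card_lessThan)
 have f: "fact r \<noteq> (0 :: complex)" by simp
 note m2 = mob_limit2[where D = "DN r" and r = r and m = r and l = "%\<pi>. complex_of_real (d (card (blk \<pi> 0)) (r - card (blk \<pi> 0)))", OF DN_lim \<pi>]
 show "(%N. EE N \<pi>) \<longlonglongrightarrow> ee c d \<pi>" if "card \<pi> = 2"
  unfolding EE_def ee_def cr using that m2 by (intro tendsto_divide tendsto_const f) auto
 show "(%N. EE N \<pi>) \<longlonglongrightarrow> 0" if "card \<pi> \<ge> 3"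
 proof -
  have "(%N. mob (DN r N) r r \<pi> / fact r) \<longlonglongrightarrow> 0 / fact r" using that m2 by (intro tendsto_divide tendsto_const f) auto
  then show ?thesis unfolding EE_def cr by simp
 qed
 show "(%N. EE N \<pi> / of_nat N) \<longlonglongrightarrow> ee c d \<pi>" if c1: "card \<pi> = 1"
 proof -
  note m1 = mob_limit1[where D = "DN r" and r = r and m = r and l = "%\<pi>. complex_of_real (d (card (blk \<pi> 0)) (r - card (blk \<pi> 0)))", OF DN_lim c1 DN_lim1[OF \<pi> c1]]
  have "(%N. mob (DN r N) r r \<pi> / of_nat N / fact r) \<longlonglongrightarrow> of_real (c r) / fact r"
   by (intro tendsto_divide tendsto_const f m1)
  then show ?thesis unfolding EE_def ee_def cr using c1 by (simp add: divide_divide_eq_left mult.commute)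
 qed
qed

lemma LS_one: "N \<ge> 1 ==> LS N one_pt = 0"
 using SGF_one[of N "\<rho> N"] supp conv by (simp add: LS_def)

text \<open>There is no constant term because the logarithm vanishes at (1,...,1). K <= N ensures
  that the canonical lists use indices below N.\<close>

lemma lpoly_Taylor:
 assumes N: "N \<ge> 1" "K \<le> N"
 shows "(\<Sum>r\<le>K. (\<Sum>xs\<in>idx_lists N r. prod_list (map u xs) * pds xs (LS N) one_pt) / fact r)
  = lpoly (parts_upto K) (EE N) (psum N (%j. 1 + u j))"
proof -
 obtain R where R: "0 < R" "R \<le> 1" "holo_on_polydisc N R (LS N)" using holo_LS[OF N(1)] by blast
 let ?t = "%r. (\<Sum>xs\<in>idx_lists N r. prod_list (map u xs) * pds xs (LS N) one_pt) / fact r"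
 let ?q = "%\<pi>. \<Prod>B\<in>\<pi>. psum N (%j. 1 + u j) (card B)"
 have i0: "idx_lists N 0 = {[]}" unfolding idx_lists_def by auto
 have s: "{..K} = insert 0 {1..K}" by auto
 have "(\<Sum>r\<le>K. ?t r) = (\<Sum>r\<in>{1..K}. ?t r)"
  unfolding s using LS_one[OF N(1)] by (subst sum.insert) (simp_all add: i0)
 also have "\<dots> = (\<Sum>r\<in>{1..K}. \<Sum>\<pi>\<in>{\<pi>. partition_on {..<r} \<pi>}. EE N \<pi> * ?q \<pi>)"
 proof (rule sum.cong[OF refl])
  fix r assume r: "r \<in> {1..K}"
  have "(\<Sum>xs\<in>idx_lists N r. prod_list (map u xs) * pds xs (LS N) one_pt)
   = (\<Sum>\<pi>\<in>{\<pi>. partition_on {..<r} \<pi>}. mob (DN r N) r r \<pi> * (\<Prod>B\<in>\<pi>. \<Sum>j<N. u j ^ card B))"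
   unfolding DN_def[abs_def] by (rule jet_sum[where R = R, OF LS_sym R(1)]) (use R r N in simp_all)
  moreover have "card (\<Union>\<pi>) = r" if "partition_on {..<r} \<pi>" for \<pi> using partition_onD1[OF that] by (metis card_lessThan)
  ultimately show "?t r = (\<Sum>\<pi>\<in>{\<pi>. partition_on {..<r} \<pi>}. EE N \<pi> * ?q \<pi>)"
   unfolding EE_def psum_def by (simp add: sum_divide_distrib)
 qed
 also have "\<dots> = (\<Sum>\<pi>\<in>parts_upto K. EE N \<pi> * ?q \<pi>)"
 proof -
  have "{\<pi>. partition_on {..<r} \<pi>} \<inter> {\<pi>. partition_on {..<r'} \<pi>} = {}" if "r \<noteq> r'" for r r' :: nat
  proof -
   have False if "partition_on {..<r} \<pi>" "partition_on {..<r'} \<pi>" for \<pi>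
    using partition_onD1[OF that(1)] partition_onD1[OF that(2)] \<open>r \<noteq> r'\<close> by (metis card_lessThan)
   then show ?thesis by blast
  qed
  then show ?thesis unfolding parts_upto_def using finite_parts
   by (intro sum.UNION_disjoint[symmetric]) auto
 qed
 finally show ?thesis unfolding lpoly_def .
qed

lemma jet_SGF:
 assumes N: "N \<ge> 1" "K \<le> N"
 shows "\<exists>d>0. \<exists>C. \<forall>u \<delta>. (\<forall>j\<ge>N. u j = 0) \<longrightarrow> (\<forall>j<N. cmod (u j) \<le> \<delta>) \<longrightarrow> \<delta> < d \<longrightarrow>
   cmod (SGF N (\<rho> N) (%j. 1 + u j) - exp (lpoly (parts_upto K) (EE N) (psum N (%j. 1 + u j)))) \<le> C * \<delta> ^ Suc K"
proof -
 obtain R where R: "0 < R" "R \<le> 1" "holo_on_polydisc N R (LS N)" using holo_LS[OF N(1)] by blast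
 obtain d1 C where d1: "d1 > 0" and T: "\<And>u \<delta>. (\<forall>j\<ge>N. u j = 0) ==> (\<forall>j<N. cmod (u j) \<le> \<delta>) ==> \<delta> < d1 ==>
  cmod (LS N (%j. 1 + u j) - lpoly (parts_upto K) (EE N) (psum N (%j. 1 + u j))) \<le> C * \<delta> ^ Suc K"
  using multi_Taylor[OF R(3,1), of K] unfolding lpoly_Taylor[OF N] by blast
 have supp': "set_pmf (\<rho> N) \<subseteq> GT N" and conv': "SGF_unif_conv N (\<rho> N)" and N0: "N > 0" using supp conv N by auto
 obtain d2 where d2: "d2 > 0" "\<And>x. (\<forall>j<N. cmod (x j - 1) < d2) ==> (\<forall>j\<ge>N. x j = 1) ==> SGF N (\<rho> N) x \<noteq> 0"
  using SGF_near_one[OF N0 supp' conv'] by blast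
 have "continuous_on (polydisc N R) (LS N)" using R(3) unfolding holo_on_polydisc_def by blast
 from near_one_pt[OF this R(1), of 1]
 obtain d3 where d3: "d3 > 0" "\<And>x. (\<forall>j<N. cmod (x j - 1) < d3) ==> (\<forall>j\<ge>N. x j = 1) ==> cmod (LS N x) < 1"
  using LS_one[OF N(1)] by auto
 \<comment> \<open>The bounds serve, in turn, the Taylor estimate, S being nonzero, |log S| < 1,
   delta <= 1 and |b - a| <= 1. The last two permit the estimates |e^a| <= e and |e^(b-a) - 1| <= 3
   |b - a|, the source of the constant.\<close>
 define dd where "dd = min (min d1 (min d2 d3)) (min 1 (1 / (\<bar>C\<bar> + 1)))"
 have p: "1 / (\<bar>C\<bar> + 1) > 0" by simp
 have dd: "dd > 0" "dd \<le> d1" "dd \<le> d2" "dd \<le> d3" "dd \<le> 1" "dd \<le> 1 / (\<bar>C\<bar> + 1)"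
  using d1 d2(1) d3(1) p unfolding dd_def by linarith+
 show ?thesis
 proof (rule exI[of _ dd], intro conjI exI[of _ "exp 1 * 3 * C"] allI impI)
  show "dd > 0" by (rule dd)
  fix u :: "nat => complex" and \<delta> :: real assume u: "\<forall>j\<ge>N. u j = 0" "\<forall>j<N. cmod (u j) \<le> \<delta>" "\<delta> < dd"
  have "cmod (u 0) \<le> \<delta>" using u(2) N by simp
  then have \<delta>0: "\<delta> \<ge> 0" using norm_ge_zero[of "u 0"] by linarith
  let ?x = "%j. 1 + u j"
  define a where "a = LS N ?x"
  define b where "b = lpoly (parts_upto K) (EE N) (psum N ?x)"
  have lt: "cmod (?x j - 1) < d2 \<and> cmod (?x j - 1) < d3" if "j < N" for j
  proof -
   have "cmod (u j) \<le> \<delta>" using u(2) that by blast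
   then show ?thesis using u(3) dd(3,4) by simp
  qed
  have Sx: "SGF N (\<rho> N) ?x = exp a"
   unfolding a_def LS_def using d2(2)[of ?x] lt u(1) by simp
  have a1: "cmod a < 1" unfolding a_def using d3(2)[of ?x] lt u(1) by simp
  have ab: "cmod (a - b) \<le> C * \<delta> ^ Suc K" unfolding a_def b_def using T[of u \<delta>] u dd by simp
  have "C * \<delta> ^ Suc K \<le> \<bar>C\<bar> * \<delta>"
  proof -
   have "\<delta> ^ Suc K \<le> \<delta> ^ 1" using \<delta>0 u(3) dd by (intro power_decreasing) auto
   then have "\<bar>C\<bar> * \<delta> ^ Suc K \<le> \<bar>C\<bar> * \<delta>" by (intro mult_left_mono) auto
   moreover have "C * \<delta> ^ Suc K \<le> \<bar>C\<bar> * \<delta> ^ Suc K" using \<delta>0 by (intro mult_right_mono) auto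
   ultimately show ?thesis by linarith
  qed
  also have "\<dots> \<le> 1"
  proof -
   have "\<bar>C\<bar> * \<delta> \<le> \<bar>C\<bar> * (1 / (\<bar>C\<bar> + 1))" using u(3) dd by (intro mult_left_mono) auto
   also have "\<dots> \<le> 1" by (simp add: divide_simps)
   finally show ?thesis .
  qed
  finally have le1: "cmod (b - a) \<le> 1" using ab by (simp add: norm_minus_commute)
  have "exp a - exp b = - (exp a * (exp (b - a) - 1))" by (simp add: algebra_simps exp_add[symmetric])
  then have "cmod (exp a - exp b) = cmod (exp a) * cmod (exp (b - a) - 1)" by (simp add: norm_mult)
  also have "\<dots> \<le> exp 1 * (3 * cmod (b - a))"
  proof (rule mult_mono)
   have "cmod (exp a) \<le> exp (cmod a)" by (rule norm_exp)
   also have "\<dots> \<le> exp 1" using a1 by simp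
   finally show "cmod (exp a) \<le> exp 1" .
  qed (use norm_expm1_le[OF le1] in auto)
  also have "\<dots> \<le> exp 1 * (3 * (C * \<delta> ^ Suc K))"
   using ab by (simp add: norm_minus_commute)
  finally show "cmod (SGF N (\<rho> N) ?x - exp (lpoly (parts_upto K) (EE N) (psum N ?x))) \<le> exp 1 * 3 * C * \<delta> ^ Suc K"
   unfolding Sx b_def by (simp add: mult.assoc)
 qed
qed

text \<open>The limit weight of a block T with the factorials from the Taylor coefficients restored;
  for a pair it is a covariance. K is the order of truncation.\<close>

definition WW where
 "WW K r k T = (\<Prod>a\<in>T. fact (k a)) * integral\<^sup>L (PU (T \<times> UNIV)) (asymp.LL (parts_upto K) (ee c d) r k T)"

lemma asymp_parts:
 assumes "finite A" "radii A \<eta> r"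
 shows "asymp (parts_upto K) EE (ee c d) A r \<eta>"
 by (rule asymp.intro) (rule good_parts_upto assms | erule (1) EE_lim)+

end

subsection \<open>The covariance as a double contour integral\<close>

text \<open>After the limit t enters only through exp(t U) / t^k; its average is a Taylor
  coefficient, and this produces the powers of U in the covariance.\<close>

lemma T_integral:
 "integral\<^sup>L U01 (%\<theta>. exp (cir 1 \<theta> * U) / cir 1 \<theta> ^ k) = U ^ k / fact k"
proof -
 have d: "(deriv ^^ k) (%z. exp (z * U)) = (%z. U ^ k * exp (z * U))" for k
 proof (induction k)
  case (Suc k)
  have "deriv (%z. U ^ k * exp (z * U)) z = U ^ Suc k * exp (z * U)" for z
   by (rule DERIV_imp_deriv) (auto intro!: derivative_eq_intros)
  then show ?case unfolding funpow.simps comp_apply Suc by (intro ext)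
 qed simp
 have "(%z. exp (z * U)) holomorphic_on ball 0 2" by (intro holomorphic_intros)
 from cir_avg_deriv[OF this, of 1 k] show ?thesis unfolding d by simp
qed

lemma bmeas_inner:
 assumes f: "bmeas (PU (insert i I)) f"
 shows "bmeas (PU I) (%om. integral\<^sup>L U01 (%\<theta>. f (fun_upd om i \<theta>)))"
proof -
 obtain C where C: "\<And>x. cmod (f x) \<le> C" using f unfolding bconv_def by (auto simp: eventually_sequentially)
 have "(%(om, \<theta>). fun_upd om i \<theta>) \<in> measurable (PU I \<Otimes>\<^sub>M U01) (PU (insert i I))"
  unfolding PU_def by (rule measurable_add_dim)
 from measurable_compose[OF this bconv_meas(2)[OF f]]
 have "case_prod (%om \<theta>. f (fun_upd om i \<theta>)) \<in> borel_measurable (PU I \<Otimes>\<^sub>M U01)"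
  by (simp add: case_prod_unfold)
 then show ?thesis
  by (intro bmeasI[where C = C] U01.borel_measurable_lebesgue_integral integral_norm_bound_prob prob_U01 C)
qed

lemma integral_U01_bmeas:
 assumes g: "bmeas U01 g"
 shows "integral\<^sup>L U01 g = integral {0..1} g"
proof -
 have m: "g \<in> borel_measurable borel" using bconv_meas(2)[OF g] by (simp add: measurable_def)
 have "integrable U01 g" by (rule bmeas_integrable[OF _ g]) (rule U01.finite_measure_axioms)
 then have "set_integrable lborel {0..1} g"
  unfolding set_integrable_def U01_def using m by (subst (asm) integrable_density) auto
 from set_borel_integral_eq_integral(2)[OF this]
 have "(LINT x:{0..1}|lborel. g x) = integral {0..1} g" .
 moreover have "integral\<^sup>L U01 g = (LINT x:{0..1}|lborel. g x)"
  unfolding U01_def set_lebesgue_integral_def using m by (subst integral_density) auto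
 ultimately show ?thesis by simp
qed

lemma PU_two:
 fixes h :: "real => real => complex"
 assumes ij: "i \<noteq> j" and b: "bmeas (PU {i, j}) (%om. h (om i) (om j))"
 shows "integral\<^sup>L (PU {i, j}) (%om. h (om i) (om j)) = integral {0..1} (%t. integral {0..1} (%s. h s t))"
proof -
 let ?g = "%t. integral\<^sup>L U01 (%s. h s t)"
 have 1: "integral\<^sup>L (PU {i, j}) (%om. h (om i) (om j)) = integral\<^sup>L (PU {j}) (%om. ?g (om j))"
  using PU_insert[OF _ _ b] ij by simp
 have b2: "bmeas (PU {j}) (%om. ?g (om j))"
  using bmeas_inner[OF b] ij by simp
 interpret P: prob_space "PU {}" by (rule prob_PU)
 have 2: "integral\<^sup>L (PU {j}) (%om. ?g (om j)) = integral\<^sup>L U01 ?g"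
  using PU_insert[of "{}" j, OF _ _ b2] by (simp add: P.prob_space)
 have s1: "bmeas U01 (%s. h s t)" for t
 proof -
  have "(%s. \<lambda>x\<in>{i, j}. if x = i then s else t) \<in> measurable U01 (PU {i, j})"
   unfolding PU_def by (rule measurable_restrict) auto
  from bmeas_comp[OF b this] show ?thesis using ij by simp
 qed
 have "(%t. \<lambda>x\<in>{j}. t) \<in> measurable U01 (PU {j})"
  unfolding PU_def by (rule measurable_restrict) auto
 from bmeas_comp[OF b2 this] have s2: "bmeas U01 ?g" by simp
 show ?thesis unfolding 1 2 unfolding integral_U01_bmeas[OF s2] unfolding integral_U01_bmeas[OF s1] ..
qed

lemma integral_two_pi:
 fixes f :: "real => complex"
 shows "integral {0..2 * pi} f = 2 * of_real pi * integral {0..1} (%x. f (2 * pi * x))"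
proof -
 have "(%x. x / (2 * pi)) ` {0..2 * pi} = {0..1}"
  by (simp add: image_divide_atLeastAtMost)
 then have "integral {0..1} (%x. f (2 * pi * x)) = (1 / \<bar>2 * pi\<bar>) *\<^sub>R integral {0..2 * pi} f"
  using integral_stretch_real[of "2 * pi" 0 "2 * pi" f] by simp
 then show ?thesis by (simp add: scaleR_conv_of_real)
qed

text \<open>The velocities i * z and i * w and the two rescalings by 2 pi combine with 1/(2 pi i)^2
  to the plain factor z * w.\<close>

lemma cov_integral_cir:
 "cov_integral c d \<epsilon> k1 k2 = integral {0..1} (%t. integral {0..1} (%s.
  cir \<epsilon> s * cir (2 * \<epsilon>) t * U_fun c (cir \<epsilon> s) ^ k1 * U_fun c (cir (2 * \<epsilon>) t) ^ k2 * Q_lim d (cir \<epsilon> s) (cir (2 * \<epsilon>) t)))"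
proof -
 let ?H = "%z w. z * w * U_fun c z ^ k1 * U_fun c w ^ k2 * Q_lim d z w"
 have cc: "of_real e * cis (2 * pi * x) = cir e x" for e x
  unfolding cir_def cis_conv_exp by (simp add: mult_ac)
 have g: "U_fun c z ^ k1 * U_fun c w ^ k2 * Q_lim d z w * (\<i> * z) * (\<i> * w) = - ?H z w" for z w
  by (simp add: algebra_simps)
 have "cov_integral c d \<epsilon> k1 k2 = 1 / (2 * of_real pi * \<i>) ^ 2 *
  integral {0..2 * pi} (%t. integral {0..2 * pi} (%s. - ?H (of_real \<epsilon> * cis s) (of_real (2 * \<epsilon>) * cis t)))"
  unfolding cov_integral_def Let_def g ..
 also have "\<dots> = 1 / (2 * of_real pi * \<i>) ^ 2 * (2 * of_real pi * (integral {0..1} (%t. 2 * of_real pi * integral {0..1} (%s. - ?H (cir \<epsilon> s) (cir (2 * \<epsilon>) t)))))"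
  unfolding integral_two_pi cc ..
 also have "\<dots> = integral {0..1} (%t. integral {0..1} (%s. ?H (cir \<epsilon> s) (cir (2 * \<epsilon>) t)))"
  by (simp add: power2_eq_square field_simps)
 finally show ?thesis .
qed

section \<open>Limit weights of partitions with one and two blocks\<close>

lemma one_block_parts: "{\<pi> \<in> parts_upto K. card \<pi> = 1} = (%r. {{..<r}}) ` {1..K}"
proof (intro subset_antisym subsetI)
 fix \<pi> assume a: "\<pi> \<in> {\<pi> \<in> parts_upto K. card \<pi> = 1}"
 then obtain r B where r: "r \<in> {1..K}" and \<pi>: "partition_on {..<r} \<pi>" and B: "\<pi> = {B}"
  unfolding parts_upto_def by (auto simp: card_1_singleton_iff)
 have "B = {..<r}" using partition_onD1[OF \<pi>] B by simp
 then show "\<pi> \<in> (%r. {{..<r}}) ` {1..K}" using r B by blast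
next
 fix \<pi> assume "\<pi> \<in> (%r. {{..<r :: nat}}) ` {1..K}"
 then obtain r where r: "r \<in> {1..K}" "\<pi> = {{..<r}}" by blast
 have "0 \<in> {..<r}" using r(1) by simp
 then have "{..<r} \<noteq> {}" by blast
 then have "partition_on {..<r} \<pi>" unfolding r(2) by (rule partition_on_space)
 then show "\<pi> \<in> {\<pi> \<in> parts_upto K. card \<pi> = 1}" using r unfolding parts_upto_def by auto
qed

text \<open>The monomials x^m y^n produced by two blocks of sizes m + 1 and n + 1 inside a ground
  set of size at most K.\<close>

definition SK :: "nat => (nat \<times> nat) set" where
 "SK K = {(m, n). m + n + 2 \<le> K}"

text \<open>A two-block partition with a bijection of its blocks onto {0, 1} is the same as the
  block B sent to 0, a proper nonempty subset of the ground set.\<close>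

definition split_pair :: "nat \<times> nat set => nat set set \<times> (nat set => nat)" where
 "split_pair = (%(r, B). ({B, {..<r} - B}, \<lambda>b\<in>{B, {..<r} - B}. if b = B then 0 else 1))"

definition splits :: "nat => (nat \<times> nat set) set" where
 "splits K = Sigma {1..K} (%r. {B. B \<subseteq> {..<r} \<and> B \<noteq> {} \<and> B \<noteq> {..<r}})"

lemma split_partition:
 assumes "B \<subseteq> {..<r :: nat}" "B \<noteq> {}" "B \<noteq> {..<r}"
 shows "partition_on {..<r} {B, {..<r} - B}" "B \<noteq> {..<r} - B" "card {B, {..<r} - B} = 2" "{..<r} - B \<noteq> {}"
proof -
 show ne: "B \<noteq> {..<r} - B" using assms by blast
 then show "card {B, {..<r} - B} = 2" by (rule card_2_iff[THEN iffD2, OF exI, OF exI, OF conjI[OF refl]])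
 show n2: "{..<r} - B \<noteq> {}" using assms by blast
 show "partition_on {..<r} {B, {..<r} - B}"
  by (rule partition_onI) (use assms n2 in \<open>auto simp: disjnt_def\<close>)
qed

lemma split_pair_bij:
 "inj_on split_pair (splits K)"
 "split_pair ` splits K = Sigma {\<pi> \<in> parts_upto K. card \<pi> = 2} (%\<pi>. {h \<in> \<pi> \<rightarrow>\<^sub>E {0, 1}. h ` \<pi> = {0, 1}})"
proof -
 show "inj_on split_pair (splits K)"
 proof (rule inj_onI, clarify)
  fix r B r' B' assume a: "(r, B) \<in> splits K" "(r', B') \<in> splits K" "split_pair (r, B) = split_pair (r', B')"
  have s: "B \<subseteq> {..<r}" "B' \<subseteq> {..<r'}" using a unfolding splits_def by auto
  have p: "({B, {..<r} - B}, \<lambda>b\<in>{B, {..<r} - B}. if b = B then 0 else 1 :: nat) = ({B', {..<r'} - B'}, \<lambda>b\<in>{B', {..<r'} - B'}. if b = B' then 0 else 1)"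
   using a(3) unfolding split_pair_def prod.case .
  have e1: "{B, {..<r} - B} = {B', {..<r'} - B'}" using p by (elim Pair_inject)
  have "{..<r} = \<Union>{B, {..<r} - B}" using s(1) by blast
  also have "\<dots> = \<Union>{B', {..<r'} - B'}" unfolding e1 ..
  also have "\<dots> = {..<r'}" using s(2) by blast
  finally have "{..<r} = {..<r'}" .
  then have rr: "r = r'" by simp
  have e2: "(\<lambda>b\<in>{B, {..<r} - B}. if b = B then 0 else 1 :: nat) = (\<lambda>b\<in>{B', {..<r'} - B'}. if b = B' then 0 else 1)"
   using p by (elim Pair_inject)
  have BB: "B \<in> {B', {..<r'} - B'}" unfolding e1[symmetric] by simp
  have "(\<lambda>b\<in>{B', {..<r'} - B'}. if b = B' then 0 else 1 :: nat) B = (\<lambda>b\<in>{B, {..<r} - B}. if b = B then 0 else 1) B"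
   by (rule fun_cong[OF e2[symmetric]])
  then have "(if B = B' then 0 else 1 :: nat) = 0" unfolding restrict_apply'[OF BB] by simp
  then have "B = B'" by (simp split: if_splits)
  then show "r = r' \<and> B = B'" using rr by simp
 qed
 show "split_pair ` splits K = Sigma {\<pi> \<in> parts_upto K. card \<pi> = 2} (%\<pi>. {h \<in> \<pi> \<rightarrow>\<^sub>E {0, 1}. h ` \<pi> = {0, 1}})"
 proof (intro subset_antisym subsetI)
  fix p assume "p \<in> split_pair ` splits K"
  then obtain q where q: "p = split_pair q" "q \<in> splits K" by (rule imageE)
  obtain r B where qe: "q = (r, B)" by (cases q)
  have rB: "r \<in> {1..K}" "B \<subseteq> {..<r}" "B \<noteq> {}" "B \<noteq> {..<r}" using q(2) unfolding qe splits_def by simp_all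
  have p: "p = split_pair (r, B)" using q(1) unfolding qe .
  note sp = split_partition[OF rB(2,3,4)]
  have "{B, {..<r} - B} \<in> {\<pi> \<in> parts_upto K. card \<pi> = 2}" using rB(1) sp unfolding parts_upto_def by auto
  moreover have "(\<lambda>b\<in>{B, {..<r} - B}. if b = B then 0 else 1) \<in> {h \<in> {B, {..<r} - B} \<rightarrow>\<^sub>E {0, 1 :: nat}. h ` {B, {..<r} - B} = {0, 1}}"
   using sp(2) by auto
  ultimately show "p \<in> Sigma {\<pi> \<in> parts_upto K. card \<pi> = 2} (%\<pi>. {h \<in> \<pi> \<rightarrow>\<^sub>E {0, 1}. h ` \<pi> = {0, 1}})"
   unfolding p split_pair_def prod.case by (rule SigmaI)
 next
  fix p assume "p \<in> Sigma {\<pi> \<in> parts_upto K. card \<pi> = 2} (%\<pi>. {h \<in> \<pi> \<rightarrow>\<^sub>E {0, 1 :: nat}. h ` \<pi> = {0, 1}})"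
  then obtain \<pi> h where ph: "\<pi> \<in> {\<pi> \<in> parts_upto K. card \<pi> = 2}" "h \<in> {h \<in> \<pi> \<rightarrow>\<^sub>E {0, 1 :: nat}. h ` \<pi> = {0, 1}}" and p: "p = (\<pi>, h)"
   by (rule SigmaE)
  have \<pi>K: "\<pi> \<in> parts_upto K" and c2: "card \<pi> = 2" using ph(1) by simp_all
  have hh: "h \<in> \<pi> \<rightarrow>\<^sub>E {0, 1} \<and> h ` \<pi> = {0, 1}" using ph(2) by (rule CollectD)
  note h = conjunct1[OF hh] conjunct2[OF hh]
  obtain r where r: "r \<in> {1..K}" and \<pi>: "partition_on {..<r} \<pi>" using \<pi>K unfolding parts_upto_def by blast
  have "0 \<in> h ` \<pi>" "1 \<in> h ` \<pi>" unfolding h(2) by simp_all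
  then obtain B B' where "0 = h B" and B1: "B \<in> \<pi>" and "1 = h B'" and B1': "B' \<in> \<pi>" by (elim imageE)
  then have B: "B \<in> \<pi>" "h B = 0" and B': "B' \<in> \<pi>" "h B' = 1" by simp_all
  have ne: "B \<noteq> B'" using B B' by auto
  have f\<pi>: "finite \<pi>" using c2 by (auto intro: card_ge_0_finite)
  have \<pi>e: "\<pi> = {B, B'}"
   by (rule card_subset_eq[OF f\<pi>, symmetric]) (use B B' ne c2 in auto)
  have dis: "B \<inter> B' = {}" using partition_onD2[OF \<pi>] B(1) B'(1) ne unfolding disjoint_def by blast
  have un: "{..<r} = B \<union> B'" using partition_onD1[OF \<pi>] unfolding \<pi>e by simp
  have nz: "B \<noteq> {}" "B' \<noteq> {}" using partition_onD3[OF \<pi>] B(1) B'(1) by blast+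
  have B'e: "B' = {..<r} - B" using un dis by blast
  have he: "h = (\<lambda>b\<in>{B, B'}. if b = B then 0 else 1)"
  proof
   fix b
   show "h b = (\<lambda>b\<in>{B, B'}. if b = B then 0 else 1) b"
   proof (cases "b \<in> \<pi>")
    case True
    then consider "b = B" | "b = B'" unfolding \<pi>e by blast
    then show ?thesis by cases (simp_all add: B(2) B'(2) ne ne[symmetric])
   next
    case False
    then have "h b = undefined" using PiE_arb[OF h(1)] by blast
    moreover have "b \<notin> {B, B'}" using False unfolding \<pi>e .
    ultimately show ?thesis by simp
   qed
  qed
  have "B \<subseteq> {..<r}" using un by blast
  moreover have "B \<noteq> {..<r}" using un nz(2) dis by blast
  ultimately have "(r, B) \<in> splits K" unfolding splits_def using r nz(1) by simp
  moreover have "p = split_pair (r, B)" unfolding p split_pair_def prod.case B'e[symmetric] he \<pi>e ..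
  ultimately show "p \<in> split_pair ` splits K" by blast
 qed
qed

context approp_seq
begin

definition FK where "FK K v = (\<Sum>m<K. of_real (c (m + 1)) / fact m * v ^ m :: complex)"
definition UK where "UK K v = 1 / v + 1 + (1 + v) * FK K v"
definition GK where "GK K x y = (\<Sum>(m, n)\<in>SK K. of_real (d (m + 1) (n + 1)) / (fact m * fact n) * x ^ m * y ^ n :: complex)"

text \<open>The one-block partition of size s contributes c_s / s! times the derivative s * v^(s-1),
  hence c_s / (s-1)!: the truncated series F.\<close>

lemma psL_single:
 assumes asy: "asymp (parts_upto K) EE (ee c d) A r \<eta>"
 shows "asymp.psL (parts_upto K) (ee c d) r om {a} = TT om a * (1 + vv r om a) * FK K (vv r om a)"
proof -
 let ?v = "vv r om a" and ?g = "asymp.gL r om"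
 have inj: "inj_on (%r. {{..<r :: nat}}) {1..K}" by (auto simp: inj_on_def)
 have hs: "{h \<in> {X} \<rightarrow>\<^sub>E {a}. h ` {X} = {a}} = {\<lambda>b\<in>{X}. a}" for X :: "nat set"
 proof (intro subset_antisym subsetI)
  fix h assume "h \<in> {h \<in> {X} \<rightarrow>\<^sub>E {a}. h ` {X} = {a}}"
  then have h: "h \<in> {X} \<rightarrow>\<^sub>E {a}" by simp
  have "h = (\<lambda>b\<in>{X}. a)" using h by (auto simp: PiE_iff extensional_def fun_eq_iff)
  then show "h \<in> {\<lambda>b\<in>{X}. a}" by simp
 qed auto
 have "asymp.psL (parts_upto K) (ee c d) r om {a} = (\<Sum>\<pi>\<in>{\<pi> \<in> parts_upto K. card \<pi> = 1}. ee c d \<pi> * (\<Sum>h\<in>{h\<in>\<pi> \<rightarrow>\<^sub>E {a}. h ` \<pi> = {a}}. \<Prod>b\<in>\<pi>. ?g (h b) (card b)))"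
  unfolding asymp.psL_def[OF asy] by simp
 also have "\<dots> = (\<Sum>s\<in>{1..K}. ee c d {{..<s}} * ?g a s)"
 proof -
  have "(\<Sum>h\<in>{h \<in> {X} \<rightarrow>\<^sub>E {a}. h ` {X} = {a}}. \<Prod>b\<in>{X}. ?g (h b) (card b)) = ?g a (card X)" for X :: "nat set"
   unfolding hs by simp
  note inner = this
  show ?thesis unfolding one_block_parts sum.reindex[OF inj] comp_def inner card_lessThan ..
 qed
 also have "\<dots> = (\<Sum>m<K. ee c d {{..<Suc m}} * ?g a (Suc m))"
  using sum.atLeast1_atMost_eq[of "%s. ee c d {{..<s}} * ?g a s" K] by simp
 also have "\<dots> = (\<Sum>m<K. TT om a * (1 + ?v) * (of_real (c (m + 1)) / fact m * ?v ^ m))"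
 proof (rule sum.cong[OF refl])
  fix m
  have f: "complex_of_nat (Suc m) / fact (Suc m) = 1 / fact m" unfolding fact_Suc of_nat_mult by (simp del: of_nat_Suc)
  have "ee c d {{..<Suc m}} * ?g a (Suc m) = of_real (c (Suc m)) * (complex_of_nat (Suc m) / fact (Suc m)) * (TT om a * (1 + ?v) * ?v ^ m)"
   unfolding ee_def asymp.gL_def[OF asy] by (simp add: divide_inverse mult_ac del: fact_Suc of_nat_Suc)
  then show "ee c d {{..<Suc m}} * ?g a (Suc m) = TT om a * (1 + ?v) * (of_real (c (m + 1)) / fact m * ?v ^ m)"
   unfolding f by simp
 qed
 finally show ?thesis unfolding FK_def by (simp add: sum_distrib_left)
qed

text \<open>B need not be the block that contains 0; if it is not, symmetry of d exchanges the two
  sizes.\<close>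

lemma ee_split:
 assumes B: "B \<subseteq> {..<r}" "B \<noteq> {}" "B \<noteq> {..<r}"
 shows "ee c d {B, {..<r} - B} = of_real (d (card B) (r - card B)) / fact r"
proof -
 note sp = split_partition[OF B]
 have fB: "finite B" by (rule finite_subset[OF B(1)]) simp
 have cB: "card ({..<r} - B) = r - card B" using B(1) by (simp add: card_Diff_subset[OF fB])
 have b1: "card B \<ge> 1" using B(2) fB by (simp add: Suc_le_eq card_gt_0_iff)
 have "card ({..<r} - B) > 0" using sp(4) by (simp add: card_gt_0_iff)
 then have b2: "r - card B \<ge> 1" using cB by simp
 have U: "card (\<Union>{B, {..<r} - B}) = r" using B(1) by (simp add: Un_absorb1)
 have r: "0 < r" using b2 by simp
 have "card (blk {B, {..<r} - B} 0) = card B \<or> card (blk {B, {..<r} - B} 0) = r - card B"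
 proof (cases "0 \<in> B")
  case True
  then show ?thesis using blk_eq[OF sp(1), of B 0] by simp
 next
  case False
  then show ?thesis using blk_eq[OF sp(1), of "{..<r} - B" 0] r cB by simp
 qed
 moreover have "d (r - card B) (r - (r - card B)) = d (card B) (r - card B)"
 proof -
  have "r - (r - card B) = card B" using b2 by simp
  then show ?thesis using d_sym[OF b1 b2] by simp
 qed
 ultimately show ?thesis unfolding ee_def U sp(3) by auto
qed

lemma prod_pair:
 fixes q :: "nat set => complex"
 shows "B \<noteq> X ==> (\<Prod>b\<in>{B, X}. q b) = q B * q X"
 by simp

text \<open>There are s choose m subsets of size m, and the derivatives bring the factors m and s -
  m. Divided by s! this leaves 1/((m-1)! (s-m-1)!), so the sum is the truncated series G.\<close>

lemma psL_pair:
 assumes asy: "asymp (parts_upto K) EE (ee c d) A r \<eta>"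
 shows "asymp.psL (parts_upto K) (ee c d) r om {0, 1} =
  (TT om 0 * (1 + vv r om 0)) * (TT om 1 * (1 + vv r om 1)) * GK K (vv r om 0) (vv r om 1)"
proof -
 let ?v = "vv r om" and ?g = "asymp.gL r om"
 let ?P = "{\<pi> \<in> parts_upto K. card \<pi> = 2}" and ?S = "%\<pi> :: nat set set. {h \<in> \<pi> \<rightarrow>\<^sub>E {0, 1 :: nat}. h ` \<pi> = {0, 1}}"
 let ?c = "(TT om 0 * (1 + ?v 0)) * (TT om 1 * (1 + ?v 1))"
 have fin: "finite ?P" "\<And>\<pi>. \<pi> \<in> ?P ==> finite \<pi>" using good_parts_upto[of K] unfolding good_parts_def by auto
 have c01: "card {0, 1 :: nat} = 2" by simp
 have "asymp.psL (parts_upto K) (ee c d) r om {0, 1} = (\<Sum>\<pi>\<in>?P. \<Sum>h\<in>?S \<pi>. ee c d \<pi> * (\<Prod>b\<in>\<pi>. ?g (h b) (card b)))"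
  unfolding asymp.psL_def[OF asy] c01 by (simp only: sum_distrib_left)
 also have "\<dots> = (\<Sum>(\<pi>, h)\<in>Sigma ?P ?S. ee c d \<pi> * (\<Prod>b\<in>\<pi>. ?g (h b) (card b)))"
 proof -
  have "finite (?S \<pi>)" if p: "\<pi> \<in> ?P" for \<pi>
  proof (rule finite_subset)
   show "?S \<pi> \<subseteq> \<pi> \<rightarrow>\<^sub>E {0, 1}" by (rule Collect_restrict)
   show "finite (\<pi> \<rightarrow>\<^sub>E {0, 1 :: nat})" by (rule finite_PiE[OF fin(2)[OF p]]) simp
  qed
  then have fS: "\<forall>\<pi>\<in>?P. finite (?S \<pi>)" by (rule ballI)
  show ?thesis
   by (rule sum.Sigma[where A = ?P and B = ?S and g = "%\<pi> h. ee c d \<pi> * (\<Prod>b\<in>\<pi>. ?g (h b) (card b))", OF fin(1) fS])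
 qed
 also have "\<dots> = (\<Sum>p\<in>splits K. case split_pair p of (\<pi>, h) => ee c d \<pi> * (\<Prod>b\<in>\<pi>. ?g (h b) (card b)))"
  by (simp only: split_pair_bij(2)[symmetric] sum.reindex[OF split_pair_bij(1)] comp_def)
 also have "\<dots> = (\<Sum>(s, B)\<in>splits K. of_real (d (card B) (s - card B)) / fact s * (?g 0 (card B) * ?g 1 (s - card B)))"
 proof (rule sum.cong[OF refl], clarify)
  fix s B assume "(s, B) \<in> splits K"
  then have B: "B \<subseteq> {..<s}" "B \<noteq> {}" "B \<noteq> {..<s}" unfolding splits_def by auto
  have fB: "finite B" by (rule finite_subset[OF B(1)]) simp
  have cB: "card ({..<s} - B) = s - card B" using B(1) by (simp add: card_Diff_subset[OF fB])
  have ne: "B \<noteq> {..<s} - B" by (rule split_partition(2)[OF B])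
  let ?h = "\<lambda>b\<in>{B, {..<s} - B}. if b = B then 0 else 1 :: nat"
  have h1: "?h B = 0" by simp
  have h2: "?h ({..<s} - B) = 1" using ne by auto
  have pe: "(\<Prod>b\<in>{B, {..<s} - B}. ?g (?h b) (card b)) = ?g 0 (card B) * ?g 1 (s - card B)"
   unfolding prod_pair[OF ne] h1 h2 cB ..
  show "(case split_pair (s, B) of (\<pi>, h) => ee c d \<pi> * (\<Prod>b\<in>\<pi>. ?g (h b) (card b)))
   = of_real (d (card B) (s - card B)) / fact s * (?g 0 (card B) * ?g 1 (s - card B))"
   unfolding split_pair_def prod.case ee_split[OF B] pe ..
 qed
 also have "\<dots> = (\<Sum>s\<in>{1..K}. \<Sum>B\<in>{B. B \<subseteq> {..<s} \<and> B \<noteq> {} \<and> B \<noteq> {..<s}}. of_real (d (card B) (s - card B)) / fact s * (?g 0 (card B) * ?g 1 (s - card B)))"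
 proof -
  have "finite {B. B \<subseteq> {..<s} \<and> B \<noteq> {} \<and> B \<noteq> {..<s}}" for s :: nat
   by (rule finite_subset[of _ "Pow {..<s}"]) auto
  then show ?thesis unfolding splits_def by (intro sum.Sigma[symmetric]) auto
 qed
 also have "\<dots> = (\<Sum>s\<in>{1..K}. \<Sum>m\<in>{1..<s}. ?c * (of_real (d m (s - m)) / (fact (m - 1) * fact (s - m - 1)) * ?v 0 ^ (m - 1) * ?v 1 ^ (s - m - 1)))"
 proof (rule sum.cong[OF refl])
  fix s :: nat
  let ?Q = "{B. B \<subseteq> {..<s} \<and> B \<noteq> {} \<and> B \<noteq> {..<s}}"
  let ?f = "%m. of_real (d m (s - m)) / fact s * (?g 0 m * ?g 1 (s - m))"
  have fQ: "finite ?Q" by (rule finite_subset[of _ "Pow {..<s}"]) auto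
  have img: "card ` ?Q \<subseteq> {1..<s}"
  proof (rule image_subsetI)
   fix B assume "B \<in> ?Q"
   then have B: "B \<subset> {..<s}" "B \<noteq> {}" by auto
   have "card B < s" using psubset_card_mono[OF _ B(1)] by simp
   moreover have "card B > 0" using B finite_subset[of B "{..<s}"] by (simp add: card_gt_0_iff psubset_imp_subset)
   ultimately show "card B \<in> {1..<s}" by simp
  qed
  have "(\<Sum>B\<in>?Q. ?f (card B)) = (\<Sum>m\<in>{1..<s}. \<Sum>B\<in>{B\<in>?Q. card B = m}. ?f (card B))"
   by (rule sum.group[symmetric]) (use fQ img in auto)
  also have "\<dots> = (\<Sum>m\<in>{1..<s}. ?c * (of_real (d m (s - m)) / (fact (m - 1) * fact (s - m - 1)) * ?v 0 ^ (m - 1) * ?v 1 ^ (s - m - 1)))"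
  proof (rule sum.cong[OF refl])
   fix m assume m: "m \<in> {1..<s}"
   have "{B\<in>?Q. card B = m} = {B. B \<subseteq> {..<s} \<and> card B = m}" using m by auto
   then have "(\<Sum>B\<in>{B\<in>?Q. card B = m}. ?f (card B)) = (\<Sum>B\<in>{B. B \<subseteq> {..<s} \<and> card B = m}. ?f m)"
    by (intro sum.cong) auto
   also have "\<dots> = of_nat (s choose m) * ?f m"
    using n_subsets[of "{..<s}" m] by simp
   finally have 1: "(\<Sum>B\<in>{B\<in>?Q. card B = m}. ?f (card B)) = of_nat (s choose m) * ?f m" .
   have bf: "complex_of_nat (s choose m) = fact s / (fact m * fact (s - m))" using m by (intro binomial_fact) simp
   have bf': "complex_of_nat (s choose m) / fact s = 1 / (fact m * fact (s - m))" unfolding bf by simp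
   have f1: "of_nat m / fact m = 1 / (fact (m - 1) :: complex)" using m by (subst fact_reduce) auto
   have f2: "of_nat (s - m) / fact (s - m) = 1 / (fact (s - m - 1) :: complex)" using m by (subst fact_reduce) auto
   have "of_nat (s choose m) * ?f m = (of_nat (s choose m) / fact s) * (of_real (d m (s - m)) * (?g 0 m * ?g 1 (s - m)))"
    by (simp only: divide_inverse mult_ac)
   also have "\<dots> = (of_nat m / fact m) * (of_nat (s - m) / fact (s - m)) * (of_real (d m (s - m)) * (?c * (?v 0 ^ (m - 1) * ?v 1 ^ (s - m - 1))))"
    unfolding bf' asymp.gL_def[OF asy] by (simp only: divide_inverse inverse_mult_distrib mult_1_left mult_ac)
   also have "\<dots> = ?c * (of_real (d m (s - m)) / (fact (m - 1) * fact (s - m - 1)) * ?v 0 ^ (m - 1) * ?v 1 ^ (s - m - 1))"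
    unfolding f1 f2 by (simp only: divide_inverse inverse_mult_distrib mult_1_left mult_ac)
   finally show "(\<Sum>B\<in>{B\<in>?Q. card B = m}. ?f (card B)) = ?c * (of_real (d m (s - m)) / (fact (m - 1) * fact (s - m - 1)) * ?v 0 ^ (m - 1) * ?v 1 ^ (s - m - 1))"
    unfolding 1 .
  qed
  finally show "(\<Sum>B\<in>?Q. ?f (card B)) = (\<Sum>m\<in>{1..<s}. ?c * (of_real (d m (s - m)) / (fact (m - 1) * fact (s - m - 1)) * ?v 0 ^ (m - 1) * ?v 1 ^ (s - m - 1)))" .
 qed
 also have "\<dots> = (\<Sum>(s, m)\<in>Sigma {1..K} (%s. {1..<s}). ?c * (of_real (d m (s - m)) / (fact (m - 1) * fact (s - m - 1)) * ?v 0 ^ (m - 1) * ?v 1 ^ (s - m - 1)))"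
  by (rule sum.Sigma) auto
 also have "\<dots> = (\<Sum>(m, n)\<in>SK K. ?c * (of_real (d (m + 1) (n + 1)) / (fact m * fact n) * ?v 0 ^ m * ?v 1 ^ n))"
 proof -
  let ?i = "%(m, n). (m + n + 2, m + 1) :: nat \<times> nat"
  have im: "Sigma {1..K} (%s. {1..<s}) = ?i ` SK K"
  proof (intro subset_antisym subsetI)
   fix p assume "p \<in> Sigma {1..K} (%s. {1..<s})"
   then obtain s m where p: "p = (s, m)" "s \<le> K" "1 \<le> m" "m < s" by auto
   have "p = ?i (m - 1, s - m - 1)" using p by simp
   moreover have "(m - 1, s - m - 1) \<in> SK K" using p unfolding SK_def by simp
   ultimately show "p \<in> ?i ` SK K" by (rule image_eqI)
  qed (auto simp: SK_def)
  have inj: "inj_on ?i (SK K)" by (auto simp: inj_on_def)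
  show ?thesis unfolding im by (subst sum.reindex[OF inj], rule sum.cong[OF refl]) clarsimp
 qed
 also have "\<dots> = ?c * GK K (?v 0) (?v 1)"
  unfolding GK_def sum_distrib_left by (simp add: case_prod_unfold)
 finally show ?thesis .
qed

end

context approp_seq
begin

definition Hc where "Hc K k1 k2 x y = x * y * UK K x ^ k1 * UK K y ^ k2 * (1 / (x - y) ^ 2 + GK K x y)"

text \<open>The two auxiliary angles are integrated out by \<open>T_integral\<close>; only the
  contour variables and the integrand of the covariance, with truncated series, remain.\<close>

lemma WW_eq:
 assumes r: "radii {0, 1} \<eta> r"
 shows "WW K r k {0, 1} = integral\<^sup>L (PU {(0, True), (1, True)}) (%om. Hc K (k 0) (k 1) (vv r om 0) (vv r om 1))"
proof -
 have as: "asymp (parts_upto K) EE (ee c d) {0, 1} r \<eta>" by (rule asymp_parts) (use r in simp_all)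
 interpret asy: asymp "parts_upto K" EE "ee c d" "{0, 1}" r \<eta> k by (rule as)
 let ?J = "{(0, True), (1, True)} :: (nat \<times> bool) set"
 let ?P = "%om. vv r om 0 * vv r om 1 * (1 / (vv r om 0 - vv r om 1) ^ 2 + GK K (vv r om 0) (vv r om 1))"
 let ?\<phi> = "%om a. exp (TT om a * UK K (vv r om a)) / TT om a ^ k a"
 let ?f = "%om. ?P om * ?\<phi> om 0 * ?\<phi> om 1"
 let ?u = "%om a. UK K (vv r om a) ^ k a / fact (k a)"
 have I4: "{0, 1} \<times> UNIV = insert (0, False) (insert (1, False) ?J)" by (auto simp: UNIV_bool)
 have LLe: "asy.LL {0, 1} om = ?f om" for om
 proof -
  have nz: "vv r om a \<noteq> 0" "1 + vv r om a \<noteq> 0" if "a \<in> {0, 1}" for a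
  proof -
   show "vv r om a \<noteq> 0" using asy.nv[OF that, of om] asy.rpos[OF that] by (intro notI) simp
   show "1 + vv r om a \<noteq> 0" using asy.one_plus_low[OF that, of om] asy.\<eta> by (intro notI) simp
  qed
  have T0: "TT om a \<noteq> 0" for a using norm_TT[of om a] by (intro notI) simp
  \<comment> \<open>The factor T * (1 + v) that \<open>KK\<close> supplies for each operator cancels
    the one in the denominator of \<open>muL\<close>, and the exponents add up to T * U.\<close>
  have mu: "TT om a * (1 + vv r om a) * asy.muL om a = vv r om a * ?\<phi> om a" if a: "a \<in> {0, 1}" for a
  proof -
   have "TT om a * UK K (vv r om a) = TT om a * (1 + vv r om a) / vv r om a + TT om a * (1 + vv r om a) * FK K (vv r om a)"
    unfolding UK_def using nz(1)[OF a] by (simp add: field_simps)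
   then have e: "exp (TT om a * UK K (vv r om a)) = exp (TT om a * (1 + vv r om a) / vv r om a) * exp (TT om a * (1 + vv r om a) * FK K (vv r om a))"
    by (simp only: exp_add)
   show ?thesis unfolding asy.muL_def psL_single[OF as] e using nz[OF a] T0[of a] by simp
  qed
  have KKe: "asy.KK om {0, 1} = (TT om 0 * (1 + vv r om 0)) * (TT om 1 * (1 + vv r om 1)) *
    (1 / (vv r om 0 - vv r om 1) ^ 2 + GK K (vv r om 0) (vv r om 1))"
  proof -
   have "(\<Prod>a\<in>{0, 1}. TT om a * (1 + vv r om a)) = (TT om 0 * (1 + vv r om 0)) * (TT om 1 * (1 + vv r om 1))" by simp
   moreover have "card {0, 1 :: nat} = 2" "Min {0, 1 :: nat} = 0" "Max {0, 1 :: nat} = 1" by auto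
   ultimately show ?thesis unfolding asy.KK_def psL_pair[OF as] by (simp only: if_True refl divide_inverse distrib_left mult_1_left)
  qed
  have "asy.LL {0, 1} om = (asy.muL om 0 * asy.muL om 1) * asy.KK om {0, 1}" unfolding asy.LL_def by simp
  also have "\<dots> = (TT om 0 * (1 + vv r om 0) * asy.muL om 0) * (TT om 1 * (1 + vv r om 1) * asy.muL om 1) *
    (1 / (vv r om 0 - vv r om 1) ^ 2 + GK K (vv r om 0) (vv r om 1))"
   unfolding KKe by (simp only: mult_ac)
  also have "\<dots> = (vv r om 0 * ?\<phi> om 0) * (vv r om 1 * ?\<phi> om 1) * (1 / (vv r om 0 - vv r om 1) ^ 2 + GK K (vv r om 0) (vv r om 1))"
   using mu[of 0] mu[of 1] by simp
  also have "\<dots> = ?f om" by (simp only: mult_ac)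
  finally show ?thesis .
 qed
 have LLf: "asy.LL {0, 1} = ?f" by (rule ext) (rule LLe)
 have b0: "bmeas (PU (insert (0, False) (insert (1, False) ?J))) ?f"
  using asy.LL_bmeas unfolding I4 LLf by simp
 have vu: "vv r (fun_upd om (a, False) \<theta>) b = vv r om b" for om a \<theta> b by (simp add: vv_def)
 have tu: "TT (fun_upd om (a, False) \<theta>) b = (if b = a then cir 1 \<theta> else TT om b)" for om a \<theta> b by (simp add: TT_def)
 have in0: "integral\<^sup>L U01 (%\<theta>. ?f (fun_upd om (0, False) \<theta>)) = ?P om * ?u om 0 * ?\<phi> om 1" for om
 proof -
  have "(%\<theta>. ?f (fun_upd om (0, False) \<theta>)) = (%\<theta>. (?P om * ?\<phi> om 1) * (exp (cir 1 \<theta> * UK K (vv r om 0)) / cir 1 \<theta> ^ k 0))"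
   unfolding vu tu by (simp add: fun_eq_iff mult_ac)
  note e = this
  show ?thesis unfolding e integral_mult_right_zero T_integral by (simp only: mult_ac)
 qed
 have s1: "integral\<^sup>L (PU (insert (0, False) (insert (1, False) ?J))) ?f = integral\<^sup>L (PU (insert (1, False) ?J)) (%om. ?P om * ?u om 0 * ?\<phi> om 1)"
  using PU_insert[OF _ _ b0] unfolding in0 by simp
 have b1: "bmeas (PU (insert (1, False) ?J)) (%om. ?P om * ?u om 0 * ?\<phi> om 1)"
  using bmeas_inner[OF b0] unfolding in0 .
 have in1: "integral\<^sup>L U01 (%\<theta>. (%om. ?P om * ?u om 0 * ?\<phi> om 1) (fun_upd om (1, False) \<theta>)) = ?P om * ?u om 0 * ?u om 1" for om
 proof -
  have "(%\<theta>. (%om. ?P om * ?u om 0 * ?\<phi> om 1) (fun_upd om (1, False) \<theta>)) = (%\<theta>. (?P om * ?u om 0) * (exp (cir 1 \<theta> * UK K (vv r om 1)) / cir 1 \<theta> ^ k 1))"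
   unfolding vu tu by simp
  note e = this
  show ?thesis unfolding e integral_mult_right_zero T_integral ..
 qed
 have s2: "integral\<^sup>L (PU (insert (1, False) ?J)) (%om. ?P om * ?u om 0 * ?\<phi> om 1) = integral\<^sup>L (PU ?J) (%om. ?P om * ?u om 0 * ?u om 1)"
  using PU_insert[OF _ _ b1] unfolding in1 by simp
 have "WW K r k {0, 1} = (fact (k 0) * fact (k 1)) * integral\<^sup>L (PU ?J) (%om. ?P om * ?u om 0 * ?u om 1)"
  unfolding WW_def LLf I4 s1 s2 by simp
 also have "\<dots> = integral\<^sup>L (PU ?J) (%om. (fact (k 0) * fact (k 1)) * (?P om * ?u om 0 * ?u om 1))" by simp
 also have "(%om. (fact (k 0) * fact (k 1)) * (?P om * ?u om 0 * ?u om 1)) = (%om. Hc K (k 0) (k 1) (vv r om 0) (vv r om 1))"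
 proof
  fix om
  have "fact (k 0) * fact (k 1) * (?P om * ?u om 0 * ?u om 1) = ?P om * (fact (k 0) * ?u om 0) * (fact (k 1) * ?u om 1)"
   by (simp only: mult_ac)
  also have "\<dots> = Hc K (k 0) (k 1) (vv r om 0) (vv r om 1)" unfolding Hc_def by simp
  finally show "fact (k 0) * fact (k 1) * (?P om * ?u om 0 * ?u om 1) = Hc K (k 0) (k 1) (vv r om 0) (vv r om 1)" .
 qed
 finally show ?thesis .
qed

lemma FK_bconv:
 assumes R: "R > 0" "\<And>x :: complex. cmod (x - 1) < R ==> summable (%m. of_real (c (m + 1)) / fact m * (x - 1) ^ m)"
  and a: "(a, True) \<in> I" and ra: "0 < r a" "r a < R / 2"
 shows "bconv (PU I) (%K om. FK K (vv r om a)) (%om. F_lim c (1 + vv r om a))"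
proof -
 let ?b = "%m. complex_of_real (c (m + 1)) / fact m"
 have "summable (%m. ?b m * of_real (R / 2) ^ m)" using R(2)[of "1 + of_real (R / 2)"] R(1) by simp
 from powser_insidea[OF this, of "of_real (r a)"] have s: "summable (%m. cmod (?b m * of_real (r a) ^ m))"
  using ra R(1) by simp
 have nv: "cmod (vv r om a) = r a" for om using norm_vv[where r = r and a = a and om = om, OF ra(1)] .
 have nt: "cmod (?b m * vv r om a ^ m) = cmod (?b m * of_real (r a) ^ m)" for m om
  using ra by (simp add: norm_mult norm_power norm_divide nv)
 have bd: "cmod (FK K (vv r om a)) \<le> (\<Sum>m. cmod (?b m * of_real (r a) ^ m))" for K om
 proof -
  have "cmod (FK K (vv r om a)) \<le> (\<Sum>m<K. cmod (?b m * vv r om a ^ m))" unfolding FK_def by (rule norm_sum)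
  also have "\<dots> \<le> (\<Sum>m. cmod (?b m * of_real (r a) ^ m))" unfolding nt by (rule sum_le_suminf[OF s]) auto
  finally show ?thesis .
 qed
 have lim: "(%K. FK K (vv r om a)) \<longlonglongrightarrow> F_lim c (1 + vv r om a)" for om
 proof -
  have "summable (%m. ?b m * vv r om a ^ m)" by (rule summable_norm_cancel) (unfold nt, rule s)
  from summable_LIMSEQ[OF this] show ?thesis unfolding FK_def F_lim_def by simp
 qed
 have m: "(%om. FK K (vv r om a)) \<in> borel_measurable (PU I)" for K
  unfolding FK_def using bconv_meas(2)[OF bmeas_vv[OF a, of r]] by measurable
 show ?thesis
  by (rule bconvI[OF m _ _ lim]) (auto intro!: borel_measurable_LIMSEQ_metric[OF m] lim always_eventually bd)
qed

text \<open>The double series converges as an unordered sum, hence absolutely. The triangles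
  \<open>SK K\<close> exhaust all index pairs, and the absolute sum at the two radii is a uniform
  bound.\<close>

lemma GK_bconv:
 assumes R: "R > 0" "\<And>x y :: complex. cmod (x - 1) < R \<and> cmod (y - 1) < R ==>
  (%(m, n). of_real (d (m + 1) (n + 1)) / (fact m * fact n) * (x - 1) ^ m * (y - 1) ^ n) summable_on UNIV"
  and a: "(0, True) \<in> I" "(1, True) \<in> I" and ra: "0 < r 0" "r 0 < R" "0 < r 1" "r 1 < R"
 shows "bconv (PU I) (%K om. GK K (vv r om 0) (vv r om 1)) (%om. G_lim d (1 + vv r om 0) (1 + vv r om 1))"
proof -
 let ?t = "%x y. %(m, n). of_real (d (m + 1) (n + 1)) / (fact m * fact n) * x ^ m * y ^ n :: complex"
 have S: "?t x y summable_on UNIV" if "cmod x < R" "cmod y < R" for x y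
  using R(2)[of "1 + x" "1 + y"] that by simp
 have nv: "cmod (vv r om 0) = r 0" "cmod (vv r om 1) = r 1" for om
  using norm_vv[where r = r and a = 0 and om = om, OF ra(1)] norm_vv[where r = r and a = 1 and om = om, OF ra(3)] by auto
 let ?n = "%p. cmod (?t (of_real (r 0)) (of_real (r 1)) p)"
 have "?t (of_real (r 0)) (of_real (r 1)) summable_on UNIV" by (rule S) (use ra in auto)
 then have Sn: "?n summable_on UNIV" by (simp only: summable_on_iff_abs_summable_on_complex)
 have fSK: "finite (SK K)" for K by (rule finite_subset[of _ "{..K} \<times> {..K}"]) (auto simp: SK_def)
 have nt: "cmod (?t (vv r om 0) (vv r om 1) p) = ?n p" for om p
  using ra by (cases p) (simp add: norm_mult norm_power norm_divide nv nv[unfolded One_nat_def])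
 have bd: "cmod (GK K (vv r om 0) (vv r om 1)) \<le> infsum ?n UNIV" for K om
 proof -
  have "cmod (GK K (vv r om 0) (vv r om 1)) \<le> (\<Sum>p\<in>SK K. cmod (?t (vv r om 0) (vv r om 1) p))" unfolding GK_def by (rule norm_sum)
  also have "\<dots> \<le> infsum ?n UNIV" unfolding nt by (rule finite_sum_le_infsum[OF Sn fSK]) auto
  finally show ?thesis .
 qed
 have fl: "filterlim SK (finite_subsets_at_top UNIV) sequentially"
  unfolding filterlim_finite_subsets_at_top
 proof (intro allI impI)
  fix X :: "(nat \<times> nat) set" assume X: "finite X \<and> X \<subseteq> UNIV"
  define b where "b = (\<Sum>p\<in>X. fst p + snd p + 2)"
  have "X \<subseteq> SK K" if "K \<ge> b" for K
  proof
   fix p assume p: "p \<in> X"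
   have "fst p + snd p + 2 \<le> b" unfolding b_def using X p by (intro member_le_sum[where f = "%p. fst p + snd p + 2"]) auto
   then show "p \<in> SK K" using that by (cases p) (simp add: SK_def)
  qed
  then show "eventually (%K. finite (SK K) \<and> X \<subseteq> SK K \<and> SK K \<subseteq> UNIV) sequentially"
   using fSK by (intro eventually_sequentiallyI[of b]) simp
 qed
 have lim: "(%K. GK K (vv r om 0) (vv r om 1)) \<longlonglongrightarrow> G_lim d (1 + vv r om 0) (1 + vv r om 1)" for om
 proof -
  have "?t (vv r om 0) (vv r om 1) summable_on UNIV" by (rule S) (use ra in \<open>simp_all only: nv\<close>)
  from has_sum_infsum[OF this] have "(sum (?t (vv r om 0) (vv r om 1)) \<longlongrightarrow> infsum (?t (vv r om 0) (vv r om 1)) UNIV) (finite_subsets_at_top UNIV)"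
   unfolding has_sum_def .
  from filterlim_compose[OF this fl] show ?thesis unfolding GK_def G_lim_def by simp
 qed
 have m: "(%om. GK K (vv r om 0) (vv r om 1)) \<in> borel_measurable (PU I)" for K
  unfolding GK_def case_prod_unfold using bconv_meas(2)[OF bmeas_vv[OF a(1), of r]] bconv_meas(2)[OF bmeas_vv[OF a(2), of r]] by measurable
 show ?thesis
 proof (rule bconvI[OF m _ _ lim])
  show "(%om. G_lim d (1 + vv r om 0) (1 + vv r om 1)) \<in> borel_measurable (PU I)"
   by (rule borel_measurable_LIMSEQ_metric[OF m]) (rule lim)
  show "eventually (%K. \<forall>om. cmod (GK K (vv r om 0) (vv r om 1)) \<le> infsum ?n UNIV) sequentially"
   by (intro always_eventually allI bd)
 qed
qed

lemma cov_WW: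
 "\<exists>\<epsilon>0>0. \<forall>\<epsilon>. 0 < \<epsilon> \<and> \<epsilon> < \<epsilon>0 \<longrightarrow> (\<exists>\<eta> r. radii {0, 1} \<eta> r \<and>
  (\<forall>k :: nat => nat. (%K. WW K r k {0, 1}) \<longlonglongrightarrow> cov_integral c d \<epsilon> (k 0) (k 1)))"
proof -
 obtain Rc where Rc: "Rc > 0" "\<And>x :: complex. cmod (x - 1) < Rc ==> summable (%m. of_real (c (m + 1)) / fact m * (x - 1) ^ m)"
  using approp unfolding appropriate_with_def by blast
 obtain Rd where Rd: "Rd > 0" "\<And>x y :: complex. cmod (x - 1) < Rd \<and> cmod (y - 1) < Rd ==>
  (%(m, n). of_real (d (m + 1) (n + 1)) / (fact m * fact n) * (x - 1) ^ m * (y - 1) ^ n) summable_on UNIV"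
  using approp unfolding appropriate_with_def by blast
 \<comment> \<open>The larger circle has radius 2 * epsilon, below half the radius of convergence
   for F, as \<open>FK_bconv\<close> asks, and inside the bidisc of convergence for G.\<close>
 define e0 where "e0 = min (1 / 4) (min (Rc / 4) (Rd / 4))"
 have e0: "e0 > 0" "e0 \<le> 1 / 4" "e0 \<le> Rc / 4" "e0 \<le> Rd / 4" using Rc(1) Rd(1) by (auto simp: e0_def)
 show ?thesis
 proof (rule exI[of _ e0], rule conjI[OF e0(1)], intro allI impI)
  fix \<epsilon> :: real assume e: "0 < \<epsilon> \<and> \<epsilon> < e0"
  define r where "r a = (if a = 0 then \<epsilon> else 2 * \<epsilon>)" for a :: nat
  \<comment> \<open>With eta = epsilon / 4 the separation 4 * eta is exactly the distance between
    the circles of radii epsilon and 2 * epsilon.\<close>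
  have r: "radii {0, 1} (\<epsilon> / 4) r" unfolding radii_def r_def using e e0 by auto
  have r01: "r 0 = \<epsilon>" "r 1 = 2 * \<epsilon>" by (simp_all add: r_def)
  have "(%K. WW K r k {0, 1}) \<longlonglongrightarrow> cov_integral c d \<epsilon> (k 0) (k 1)" for k :: "nat => nat"
  proof -
   let ?J = "{(0, True), (1, True)} :: (nat \<times> bool) set"
   let ?H = "%z w. z * w * U_fun c z ^ k 0 * U_fun c w ^ k 1 * Q_lim d z w"
   have bv: "bmeas (PU ?J) (%om. vv r om 0)" "bmeas (PU ?J) (%om. vv r om 1)" by (rule bmeas_vv, simp)+
   have nv: "cmod (vv r om 0) = \<epsilon>" "cmod (vv r om 1) = 2 * \<epsilon>" for om
    using norm_vv[of r 0 om] norm_vv[of r 1 om] e r01 by auto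
   have F: "bconv (PU ?J) (%K om. FK K (vv r om 0)) (%om. F_lim c (1 + vv r om 0))"
    "bconv (PU ?J) (%K om. FK K (vv r om 1)) (%om. F_lim c (1 + vv r om 1))"
    by (rule FK_bconv[OF Rc]; use e e0 r01 in simp)+
   have G: "bconv (PU ?J) (%K om. GK K (vv r om 0) (vv r om 1)) (%om. G_lim d (1 + vv r om 0) (1 + vv r om 1))"
    by (rule GK_bconv[OF Rd]; use e e0 r01 in simp)
   have inv: "bmeas (PU ?J) (%om. 1 / vv r om 0)" "bmeas (PU ?J) (%om. 1 / vv r om 1)"
    by (rule bmeas_divide[where c = \<epsilon>]; use e nv bv in auto)+
   have U: "bconv (PU ?J) (%K om. UK K (vv r om 0)) (%om. U_fun c (vv r om 0))"
    "bconv (PU ?J) (%K om. UK K (vv r om 1)) (%om. U_fun c (vv r om 1))"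
    unfolding UK_def U_fun_def by (intro bconv_add bconv_mult bmeas_const inv bv F)+
   have low: "\<epsilon> ^ 2 \<le> cmod ((vv r om 0 - vv r om 1) ^ 2)" for om
   proof -
    have "\<epsilon> \<le> cmod (vv r om 0 - vv r om 1)" using norm_triangle_ineq2[of "vv r om 1" "vv r om 0"] nv[of om] by (simp add: norm_minus_commute)
    then show ?thesis unfolding norm_power using e by (intro power_mono) auto
   qed
   have sq: "bmeas (PU ?J) (%om. 1 / (vv r om 0 - vv r om 1) ^ 2)"
    by (rule bmeas_divide[where c = "\<epsilon> ^ 2", OF bmeas_const bconv_power[OF bconv_diff[OF bv]] _ low]) (use e in simp)
   have "bconv (PU ?J) (%K om. vv r om 0 * vv r om 1 * UK K (vv r om 0) ^ k 0 * UK K (vv r om 1) ^ k 1 * (1 / (vv r om 0 - vv r om 1) ^ 2 + GK K (vv r om 0) (vv r om 1)))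
    (%om. vv r om 0 * vv r om 1 * U_fun c (vv r om 0) ^ k 0 * U_fun c (vv r om 1) ^ k 1 * (1 / (vv r om 0 - vv r om 1) ^ 2 + G_lim d (1 + vv r om 0) (1 + vv r om 1)))"
    by (intro bconv_mult bconv_power U bv bconv_add[OF sq G])
   then have B: "bconv (PU ?J) (%K om. Hc K (k 0) (k 1) (vv r om 0) (vv r om 1)) (%om. ?H (vv r om 0) (vv r om 1))"
    unfolding Hc_def Q_lim_def by (simp only: add.commute)
   have "(%K. WW K r k {0, 1}) \<longlonglongrightarrow> integral\<^sup>L (PU ?J) (%om. ?H (vv r om 0) (vv r om 1))"
    unfolding WW_eq[OF r] by (rule bconv_integral[OF finite_measure_PU B])
   also have "integral\<^sup>L (PU ?J) (%om. ?H (vv r om 0) (vv r om 1)) = cov_integral c d \<epsilon> (k 0) (k 1)"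
   proof -
    have v: "vv r om 0 = cir \<epsilon> (om (0, True))" "vv r om 1 = cir (2 * \<epsilon>) (om (1, True))" for om
     unfolding vv_def r01 by simp_all
    have ne: "(0 :: nat, True) \<noteq> (1, True)" by simp
    note bm = bconv_imp_bmeas[OF B]
    show ?thesis unfolding cov_integral_cir
     using PU_two[OF ne, of "%s t. ?H (cir \<epsilon> s) (cir (2 * \<epsilon>) t)"] bm unfolding v by blast
   qed
   finally show ?thesis .
  qed
  then show "\<exists>\<eta> r. radii {0, 1} \<eta> r \<and> (\<forall>k :: nat => nat. (%K. WW K r k {0, 1}) \<longlonglongrightarrow> cov_integral c d \<epsilon> (k 0) (k 1))"
   using r by blast
 qed
qed

end

subsection \<open>Convergence of moments\<close>

lemma matchings_pair: "a \<noteq> b ==> matchings {a, b} = {{{a, b}}}"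
proof -
 assume ab: "a \<noteq> b"
 have "Sigma {b} (%b'. matchings ({b} - {b'})) = {(b, {})}" by (auto simp: matchings_empty)
 then show ?thesis using matchings_insert(1)[of a "{b}"] ab by simp
qed

context approp_seq
begin

lemma exp_moments:
 fixes B :: "nat set"
 assumes N: "N \<ge> 1" and B: "finite B"
 shows "integrable (measure_pmf (\<rho> N)) (%l. \<Prod>a\<in>B. p_k N (k a) l)"
  "((%l. pmf (\<rho> N) l * (\<Prod>a\<in>B. p_k N (k a) l)) has_sum measure_pmf.expectation (\<rho> N) (%l. \<Prod>a\<in>B. p_k N (k a) l)) (set_pmf (\<rho> N))"
proof -
 have N0: "N > 0" and s: "set_pmf (\<rho> N) \<subseteq> GT N" and c: "SGF_unif_conv N (\<rho> N)" using N supp conv by auto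
 note pe = pmf_expectation[OF moments_summable[OF N0 s c B, of k]]
 show "integrable (measure_pmf (\<rho> N)) (%l. \<Prod>a\<in>B. p_k N (k a) l)" by (rule pe(1))
 show "((%l. pmf (\<rho> N) l * (\<Prod>a\<in>B. p_k N (k a) l)) has_sum measure_pmf.expectation (\<rho> N) (%l. \<Prod>a\<in>B. p_k N (k a) l)) (set_pmf (\<rho> N))"
  by (rule pe(2))
qed

text \<open>The exact formula allows any small radius for t, so a radius that varies with N is
  legitimate; 1/N is the one with a limit. \<open>big\<close> makes it admissible.\<close>

lemma moment_exact:
 fixes B :: "nat set"
 assumes N: "N \<ge> 1" "K \<le> N" and B: "finite B" "radii B \<eta> r" and k: "(\<Sum>a\<in>B. k a) \<le> K"
  and big: "1 / real N < min (1 / 4) (\<eta> / 3)"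
 shows "complex_of_real (measure_pmf.expectation (\<rho> N) (%l. \<Prod>a\<in>B. p_k N (k a) l))
  = (\<Prod>a\<in>B. fact (k a)) * JJ N (parts_upto K) (EE N) B k (%_. 1 / real N) r"
proof -
 have N0: "N > 0" and s: "set_pmf (\<rho> N) \<subseteq> GT N" and cv: "SGF_unif_conv N (\<rho> N)" using N supp conv by auto
 have eta: "\<eta> > 0" using B(2) by (simp add: radii_def)
 note ef = exact_formula[OF N0 s cv B jet_SGF[OF N] k, where \<rho>t = "%_. 1 / real N" and R = "min (1 / 4) (\<eta> / 3)"]
 have 1: "((%l. complex_of_real (pmf (\<rho> N) l * (\<Prod>a\<in>B. p_k N (k a) l))) has_sum
  ((\<Prod>a\<in>B. fact (k a)) * JJ N (parts_upto K) (EE N) B k (%_. 1 / real N) r)) (set_pmf (\<rho> N))"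
  by (rule ef) (use eta big N0 in auto)
 have 2: "((%l. complex_of_real (pmf (\<rho> N) l * (\<Prod>a\<in>B. p_k N (k a) l))) has_sum
  complex_of_real (measure_pmf.expectation (\<rho> N) (%l. \<Prod>a\<in>B. p_k N (k a) l))) (set_pmf (\<rho> N))"
  by (rule has_sum_of_real[OF exp_moments(2)[OF N(1) B(1)]])
 show ?thesis by (rule has_sum_unique[OF 2 1])
qed

abbreviation "Mean N f \<equiv> measure_pmf.expectation (\<rho> N) f"

lemma p_norm_expand:
 assumes A: "finite A"
 shows "(\<Prod>a\<in>A. p_norm (\<rho> N) N (k a) l) = (\<Sum>B\<in>Pow A. (\<Prod>a\<in>B. p_k N (k a) l) *
  ((\<Prod>a\<in>B. 1 / real N ^ k a) * (\<Prod>a\<in>A - B. - Mean N (p_k N (k a)) / real N ^ k a)))"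
proof -
 have "(\<Prod>a\<in>A. p_norm (\<rho> N) N (k a) l) = (\<Prod>a\<in>A. p_k N (k a) l * (1 / real N ^ k a) + - Mean N (p_k N (k a)) / real N ^ k a)"
  unfolding p_norm_def by (intro prod.cong refl) (simp add: diff_divide_distrib)
 also have "\<dots> = (\<Sum>B\<in>Pow A. (\<Prod>a\<in>B. p_k N (k a) l * (1 / real N ^ k a)) * (\<Prod>a\<in>A - B. - Mean N (p_k N (k a)) / real N ^ k a))"
  by (rule prod_add[OF A])
 finally show ?thesis by (simp only: prod.distrib mult.assoc)
qed

lemma p_norm_prod:
 fixes A :: "nat set"
 assumes N: "N \<ge> 1" and A: "finite A"
 shows "integrable (measure_pmf (\<rho> N)) (%l. \<Prod>a\<in>A. p_norm (\<rho> N) N (k a) l)"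
  "Mean N (%l. \<Prod>a\<in>A. p_norm (\<rho> N) N (k a) l) = (\<Sum>B\<in>Pow A. Mean N (%l. \<Prod>a\<in>B. p_k N (k a) l) *
  ((\<Prod>a\<in>B. 1 / real N ^ k a) * (\<Prod>a\<in>A - B. - Mean N (p_k N (k a)) / real N ^ k a)))"
proof -
 let ?c = "%B. (\<Prod>a\<in>B. 1 / real N ^ k a) * (\<Prod>a\<in>A - B. - Mean N (p_k N (k a)) / real N ^ k a)"
 have it: "integrable (measure_pmf (\<rho> N)) (%l. (\<Prod>a\<in>B. p_k N (k a) l) * ?c B)" if "B \<in> Pow A" for B
  by (rule integrable_mult_left[OF exp_moments(1)[OF N]]) (use that A finite_subset in blast)
 show "integrable (measure_pmf (\<rho> N)) (%l. \<Prod>a\<in>A. p_norm (\<rho> N) N (k a) l)"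
  unfolding p_norm_expand[OF A] by (rule Bochner_Integration.integrable_sum) (rule it)
 have "Mean N (%l. \<Prod>a\<in>A. p_norm (\<rho> N) N (k a) l) = (\<Sum>B\<in>Pow A. Mean N (%l. (\<Prod>a\<in>B. p_k N (k a) l) * ?c B))"
  unfolding p_norm_expand[OF A] by (rule Bochner_Integration.integral_sum) (rule it)
 then show "Mean N (%l. \<Prod>a\<in>A. p_norm (\<rho> N) N (k a) l) = (\<Sum>B\<in>Pow A. Mean N (%l. \<Prod>a\<in>B. p_k N (k a) l) * ?c B)"
  by (simp only: integral_mult_left_zero)
qed

text \<open>Expanding the centred factors gives the alternating sum over subsets of
  \<open>cumulant_limit\<close>. The powers of N are inside \<open>MM\<close>, and the factorials
  distribute over the pairs of a matching because it partitions A.\<close>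

lemma moment_limit:
 assumes A: "finite A" and r: "radii A \<eta> r" and k: "(\<Sum>a\<in>A. k a) \<le> K"
 shows "(%N. complex_of_real (Mean N (%l. \<Prod>a\<in>A. p_norm (\<rho> N) N (k a) l))) \<longlonglongrightarrow> (\<Sum>H\<in>matchings A. \<Prod>T\<in>H. WW K r k T)"
proof -
 interpret asy: asymp "parts_upto K" EE "ee c d" A r \<eta> k by (rule asymp_parts[OF A r])
 let ?f = "\<Prod>a\<in>A. fact (k a) :: complex"
 have eta: "\<eta> > 0" using r by (simp add: radii_def)
 have l1: "eventually (%N. 1 / real N < min (1 / 4) (\<eta> / 3)) sequentially"
  by (rule order_tendstoD(2)[OF lim_1_over_n[where 'a = real]]) (use eta in simp)
 have ev: "eventually (%N. ?f * (\<Sum>B\<in>Pow A. asy.MM N B * (\<Prod>a\<in>A - B. - asy.MM N {a}))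
  = complex_of_real (Mean N (%l. \<Prod>a\<in>A. p_norm (\<rho> N) N (k a) l))) sequentially"
  using l1 eventually_ge_at_top[of 1] eventually_ge_at_top[of K]
 proof eventually_elim
  case (elim N)
  have mB: "complex_of_real (Mean N (%l. \<Prod>a\<in>B. p_k N (k a) l) * (\<Prod>a\<in>B. 1 / real N ^ k a)) = (\<Prod>a\<in>B. fact (k a)) * asy.MM N B"
   if B: "B \<subseteq> A" for B
  proof -
   have fB: "finite B" using B A finite_subset by blast
   have rB: "radii B \<eta> r" using r B unfolding radii_def by blast
   have kB: "(\<Sum>a\<in>B. k a) \<le> K" using sum_mono2[OF A B, of k] k by simp
   have "(\<Prod>a\<in>B. 1 / real N ^ k a) = (1 / real N) ^ (\<Sum>a\<in>B. k a)" by (simp add: power_sum power_one_over)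
   then show ?thesis using moment_exact[OF elim(2,3) fB rB kB elim(1)] by (simp add: asy.MM_def)
  qed
  have m1: "complex_of_real (- Mean N (p_k N (k a)) / real N ^ k a) = fact (k a) * (- asy.MM N {a})" if "a \<in> A" for a
   using mB[of "{a}"] that by simp
  have "complex_of_real (Mean N (%l. \<Prod>a\<in>A. p_norm (\<rho> N) N (k a) l))
   = (\<Sum>B\<in>Pow A. complex_of_real (Mean N (%l. \<Prod>a\<in>B. p_k N (k a) l) * (\<Prod>a\<in>B. 1 / real N ^ k a)) *
     (\<Prod>a\<in>A - B. complex_of_real (- Mean N (p_k N (k a)) / real N ^ k a)))"
   unfolding p_norm_prod(2)[OF elim(2) A] by (simp add: mult.assoc)
  also have "\<dots> = (\<Sum>B\<in>Pow A. ?f * (asy.MM N B * (\<Prod>a\<in>A - B. - asy.MM N {a})))"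
  proof (rule sum.cong[OF refl])
   fix B assume "B \<in> Pow A"
   then have B: "B \<subseteq> A" by simp
   have "(\<Prod>a\<in>A - B. complex_of_real (- Mean N (p_k N (k a)) / real N ^ k a)) = (\<Prod>a\<in>A - B. fact (k a) * (- asy.MM N {a}))"
    by (rule prod.cong[OF refl m1]) simp
   also have "\<dots> = (\<Prod>a\<in>A - B. fact (k a)) * (\<Prod>a\<in>A - B. - asy.MM N {a})" by (rule prod.distrib)
   finally have e: "(\<Prod>a\<in>A - B. complex_of_real (- Mean N (p_k N (k a)) / real N ^ k a)) = (\<Prod>a\<in>A - B. fact (k a)) * (\<Prod>a\<in>A - B. - asy.MM N {a})" .
   have "?f = (\<Prod>a\<in>A - B. fact (k a)) * (\<Prod>a\<in>B. fact (k a))" using A B by (rule prod.subset_diff[rotated])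
   then show "complex_of_real (Mean N (%l. \<Prod>a\<in>B. p_k N (k a) l) * (\<Prod>a\<in>B. 1 / real N ^ k a)) *
     (\<Prod>a\<in>A - B. complex_of_real (- Mean N (p_k N (k a)) / real N ^ k a)) = ?f * (asy.MM N B * (\<Prod>a\<in>A - B. - asy.MM N {a}))"
    unfolding mB[OF B] e by (simp only: mult_ac)
  qed
  finally show ?case by (simp only: sum_distrib_left)
 qed
 have "(%N. ?f * (\<Sum>B\<in>Pow A. asy.MM N B * (\<Prod>a\<in>A - B. - asy.MM N {a})))
  \<longlonglongrightarrow> ?f * (\<Sum>H\<in>matchings A. \<Prod>T\<in>H. integral\<^sup>L (PU (T \<times> UNIV)) (asy.LL T))"
  by (intro tendsto_mult tendsto_const asy.cumulant_limit)
 also have "?f * (\<Sum>H\<in>matchings A. \<Prod>T\<in>H. integral\<^sup>L (PU (T \<times> UNIV)) (asy.LL T)) = (\<Sum>H\<in>matchings A. \<Prod>T\<in>H. WW K r k T)"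
  unfolding sum_distrib_left
 proof (rule sum.cong[OF refl])
  fix H assume "H \<in> matchings A"
  then have H: "\<Union>H = A" "\<And>T. T \<in> H ==> finite T" "\<And>S T. S \<in> H ==> T \<in> H ==> S \<noteq> T ==> S \<inter> T = {}"
   using A unfolding matchings_def by (auto intro: finite_subset)
  have "prod (%a. fact (k a) :: complex) (\<Union>H) = (\<Prod>T\<in>H. \<Prod>a\<in>T. fact (k a))"
   using prod.Union_disjoint[of H "%a. fact (k a) :: complex"] H(2,3) by (simp add: comp_def)
  then show "?f * (\<Prod>T\<in>H. integral\<^sup>L (PU (T \<times> UNIV)) (asy.LL T)) = (\<Prod>T\<in>H. WW K r k T)"
   unfolding WW_def prod.distrib H(1) by simp
 qed
 finally show ?thesis using ev by (rule Lim_transform_eventually)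
qed

definition m2 where "m2 N i j = Mean N (%l. p_norm (\<rho> N) N i l * p_norm (\<rho> N) N j l)"

text \<open>Taking the limit of the actual covariances as the definition makes this matrix real,
  symmetric and positive semidefinite independently of any contour; its identification with the
  integral is a separate step.\<close>

definition CC where "CC i j = lim (%N. m2 N i j)"

text \<open>A pair has a single matching, so its weight is the limit of real covariances. Hence it
  is real and depends neither on the radii nor on the truncation, as long as K reaches the total
  degree.\<close>

lemma WW_pair:
 assumes ab: "a \<noteq> b" and r: "radii {a, b} \<eta> r" and k: "k a + k b \<le> K"
 shows "(%N. m2 N (k a) (k b)) \<longlonglongrightarrow> CC (k a) (k b)" "WW K r k {a, b} = of_real (CC (k a) (k b))"
proof -
 have "(%N. complex_of_real (m2 N (k a) (k b))) \<longlonglongrightarrow> WW K r k {a, b}"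
  using moment_limit[of "{a, b}" \<eta> r k K] ab r k by (simp add: matchings_pair m2_def)
 note l = this
 from tendsto_Re[OF l] have "(%N. m2 N (k a) (k b)) \<longlonglongrightarrow> Re (WW K r k {a, b})" by simp
 then show 1: "(%N. m2 N (k a) (k b)) \<longlonglongrightarrow> CC (k a) (k b)" unfolding CC_def by (simp add: limI)
 show "WW K r k {a, b} = of_real (CC (k a) (k b))"
  by (rule LIMSEQ_unique[OF l tendsto_of_real[OF 1]])
qed

lemma m2_limit: "(%N. m2 N i j) \<longlonglongrightarrow> CC i j"
proof -
 obtain \<eta> r where "radii {0 :: nat, 1} \<eta> r" using radii_exists[of "{0, 1}"] by auto
 from WW_pair(1)[OF _ this, of "%x. if x = 0 then i else j" "i + j"] show ?thesis by simp
qed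

lemma p_norm_pair_integrable:
 assumes "N \<ge> 1"
 shows "integrable (measure_pmf (\<rho> N)) (%l. p_norm (\<rho> N) N i l * p_norm (\<rho> N) N j l)"
 using p_norm_prod(1)[OF assms, of "{0, 1}" "%x. if x = 0 then i else j"] by simp

text \<open>For finite N the form is the expectation of the square of a linear combination.\<close>

lemma psd_CC: "psd CC"
 unfolding psd_def
proof (intro conjI allI impI)
 show "CC k l = CC l k" for k l unfolding CC_def m2_def by (simp add: mult.commute)
 fix F :: "nat set" and a :: "nat => real" assume F: "finite F"
 have "(%N. \<Sum>k\<in>F. \<Sum>l\<in>F. a k * a l * m2 N k l) \<longlonglongrightarrow> (\<Sum>k\<in>F. \<Sum>l\<in>F. a k * a l * CC k l)"
  by (intro tendsto_sum tendsto_mult tendsto_const m2_limit)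
 moreover have "0 \<le> (\<Sum>k\<in>F. \<Sum>l\<in>F. a k * a l * m2 N k l)" if N: "N \<ge> 1" for N
 proof -
  have "(\<Sum>k\<in>F. \<Sum>l\<in>F. a k * a l * m2 N k l) = Mean N (%x. \<Sum>k\<in>F. \<Sum>l\<in>F. a k * a l * (p_norm (\<rho> N) N k x * p_norm (\<rho> N) N l x))"
   unfolding m2_def
   by (subst Bochner_Integration.integral_sum)
    (auto intro!: Bochner_Integration.integrable_sum integrable_mult_right p_norm_pair_integrable N sum.cong
     simp: Bochner_Integration.integral_sum p_norm_pair_integrable[OF N])
  also have "(%x. \<Sum>k\<in>F. \<Sum>l\<in>F. a k * a l * (p_norm (\<rho> N) N k x * p_norm (\<rho> N) N l x)) = (%x. (\<Sum>k\<in>F. a k * p_norm (\<rho> N) N k x) ^ 2)"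
   by (simp add: power2_eq_square sum_product mult_ac)
  also have "Mean N \<dots> \<ge> 0" by (rule Bochner_Integration.integral_nonneg) simp
  finally show ?thesis .
 qed
 ultimately show "0 \<le> (\<Sum>k\<in>F. \<Sum>l\<in>F. a k * a l * CC k l)"
  by (intro LIMSEQ_le_const[where a = 0]) auto
qed

lemma p_cov_m2:
 assumes N: "N \<ge> 1"
 shows "p_cov (\<rho> N) N i j / real N ^ (i + j) = m2 N i j"
proof -
 let ?p = "p_k N i" and ?q = "p_k N j"
 have ip: "integrable (measure_pmf (\<rho> N)) ?p" "integrable (measure_pmf (\<rho> N)) ?q"
  using exp_moments(1)[OF N, of "{0}" "%_. i"] exp_moments(1)[OF N, of "{0}" "%_. j"] by simp_all
 have ipq: "integrable (measure_pmf (\<rho> N)) (%l. ?p l * ?q l)"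
  using exp_moments(1)[OF N, of "{0, 1}" "%x. if x = 0 then i else j"] by simp
 have "m2 N i j = Mean N (%l. (?p l * ?q l - ?p l * Mean N ?q - (Mean N ?p * ?q l - Mean N ?p * Mean N ?q)) / real N ^ (i + j))"
  unfolding m2_def p_norm_def by (intro arg_cong[where f = "Mean N"] ext) (simp add: power_add algebra_simps diff_divide_distrib add_divide_distrib)
 also have "\<dots> = (Mean N (%l. ?p l * ?q l) - Mean N ?p * Mean N ?q - (Mean N ?p * Mean N ?q - Mean N ?p * Mean N ?q)) / real N ^ (i + j)"
  using ip ipq by (simp add: measure_pmf.prob_space)
 finally show ?thesis by (simp add: p_cov_def)
qed

lemma main_result:
 assumes cov: "\<exists>\<epsilon>0>0. \<forall>\<epsilon>. 0 < \<epsilon> \<and> \<epsilon> < \<epsilon>0 \<longrightarrow> (\<exists>\<eta> r. radii {0, 1} \<eta> r \<and>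
  (\<forall>k :: nat => nat. (%K. WW K r k {0, 1}) \<longlonglongrightarrow> cov_integral c d \<epsilon> (k 0) (k 1)))"
 shows "\<exists>(M :: (nat => real) measure) Z C \<epsilon>0. \<epsilon>0 > 0 \<and> gaussian_family M Z C \<and>
  (\<forall>k1 k2. k1 \<ge> 1 \<and> k2 \<ge> 1 \<longrightarrow>
    (%N. p_cov (\<rho> N) N k1 k2 / real N ^ (k1 + k2)) \<longlonglongrightarrow> C k1 k2 \<and>
    (\<forall>\<epsilon>. 0 < \<epsilon> \<and> \<epsilon> < \<epsilon>0 \<longrightarrow> complex_of_real (C k1 k2) = cov_integral c d \<epsilon> k1 k2)) \<and>
  (\<forall>ks. (\<forall>k\<in>set ks. k \<ge> 1) \<longrightarrow>
    (\<forall>N\<ge>1. integrable (measure_pmf (\<rho> N)) (%l. \<Prod>k\<leftarrow>ks. p_norm (\<rho> N) N k l)) \<and>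
    (%N. measure_pmf.expectation (\<rho> N) (%l. \<Prod>k\<leftarrow>ks. p_norm (\<rho> N) N k l))
     \<longlonglongrightarrow> integral\<^sup>L M (%om. \<Prod>k\<leftarrow>ks. Z k om))"
proof -
 obtain \<epsilon>0 where \<epsilon>0: "\<epsilon>0 > 0" and cov': "\<And>\<epsilon>. 0 < \<epsilon> ==> \<epsilon> < \<epsilon>0 ==> \<exists>\<eta> r. radii {0, 1} \<eta> r \<and>
  (\<forall>k :: nat => nat. (%K. WW K r k {0, 1}) \<longlonglongrightarrow> cov_integral c d \<epsilon> (k 0) (k 1))" using cov by blast
 obtain Z where Z: "gaussian_family SN Z CC" and W: "\<And>A w (k :: nat => nat). finite A ==> (\<forall>a\<in>A. \<forall>b\<in>A. a \<noteq> b \<longrightarrow> w {a, b} = CC (k a) (k b)) ==>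
   integral\<^sup>L SN (%om. \<Prod>a\<in>A. Z (k a) om) = (\<Sum>H\<in>matchings A. \<Prod>T\<in>H. w T)"
  using gaussian_exists[OF psd_CC] by blast
 have c1: "(%N. p_cov (\<rho> N) N k1 k2 / real N ^ (k1 + k2)) \<longlonglongrightarrow> CC k1 k2" for k1 k2
 proof (rule Lim_transform_eventually[OF m2_limit])
  show "eventually (%N. m2 N k1 k2 = p_cov (\<rho> N) N k1 k2 / real N ^ (k1 + k2)) sequentially"
   using eventually_ge_at_top[of 1] by eventually_elim (simp add: p_cov_m2)
 qed
 have c2: "complex_of_real (CC k1 k2) = cov_integral c d \<epsilon> k1 k2" if e: "0 < \<epsilon>" "\<epsilon> < \<epsilon>0" for \<epsilon> k1 k2
 proof -
  obtain \<eta> r where r: "radii {0, 1} \<eta> r" and L: "\<And>k :: nat => nat. (%K. WW K r k {0, 1}) \<longlonglongrightarrow> cov_integral c d \<epsilon> (k 0) (k 1)"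
   using cov'[OF e] by blast
  let ?k = "%x :: nat. if x = 0 then k1 else k2"
  \<comment> \<open>The weights are constant in K from k1 + k2 on, so their limit as K grows, the
    contour integral with the full series, equals this constant.\<close>
  have "WW K r ?k {0, 1} = of_real (CC k1 k2)" if "K \<ge> k1 + k2" for K
   using WW_pair(2)[OF _ r, of ?k K] that by simp
  then have "eventually (%K. WW K r ?k {0, 1} = of_real (CC k1 k2)) sequentially"
   using eventually_ge_at_top[of "k1 + k2"] by (rule eventually_mono[rotated])
  from Lim_transform_eventually[OF L this] have "(%K. complex_of_real (CC k1 k2)) \<longlonglongrightarrow> cov_integral c d \<epsilon> k1 k2" by simp
  then show ?thesis by (simp add: LIMSEQ_const_iff)
 qed
 have pl: "(\<Prod>k\<leftarrow>ks. f k) = (\<Prod>a\<in>{..<length ks}. f (ks ! a))" for ks and f :: "nat => real"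
  unfolding prod.list_conv_set_nth by (simp add: atLeast0LessThan)
 have i1: "integrable (measure_pmf (\<rho> N)) (%l. \<Prod>k\<leftarrow>ks. p_norm (\<rho> N) N k l)" if "N \<ge> 1" for N ks
  unfolding pl by (rule p_norm_prod(1)[OF that]) simp
 have m1: "(%N. Mean N (%l. \<Prod>k\<leftarrow>ks. p_norm (\<rho> N) N k l)) \<longlonglongrightarrow> integral\<^sup>L SN (%om. \<Prod>k\<leftarrow>ks. Z k om)" for ks
 proof -
  let ?A = "{..<length ks}" and ?k = "%a. ks ! a"
  obtain \<eta> r where r: "radii ?A \<eta> r" using radii_exists[of ?A] by auto
  define K where "K = (\<Sum>a\<in>?A. ?k a)"
  \<comment> \<open>Wick's rule asks for real weights attached to sets. Members of a matching are
    pairs, and their weights are real, so the real part loses nothing.\<close>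
  let ?w = "%T. Re (WW K r ?k T)"
  have pr: "WW K r ?k {a, b} = of_real (CC (?k a) (?k b))" if ab: "a \<in> ?A" "b \<in> ?A" "a \<noteq> b" for a b
  proof (rule WW_pair(2)[OF ab(3)])
   show "radii {a, b} \<eta> r" using r ab unfolding radii_def by blast
   have "(\<Sum>x\<in>{a, b}. ?k x) \<le> K" unfolding K_def using ab by (intro sum_mono2) auto
   then show "?k a + ?k b \<le> K" using ab(3) by simp
  qed
  have real: "WW K r ?k T = of_real (?w T)" if "H \<in> matchings ?A" "T \<in> H" for H T
  proof -
   have T: "card T = 2" "T \<subseteq> ?A" using that unfolding matchings_def by auto
   then obtain a b where "T = {a, b}" "a \<noteq> b" by (auto simp: card_2_iff)
   then show ?thesis using pr[of a b] T(2) by simp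
  qed
  have "(\<Sum>H\<in>matchings ?A. \<Prod>T\<in>H. WW K r ?k T) = (\<Sum>H\<in>matchings ?A. \<Prod>T\<in>H. of_real (?w T))"
   by (intro sum.cong prod.cong refl) (rule real)
  also have "\<dots> = of_real (\<Sum>H\<in>matchings ?A. \<Prod>T\<in>H. ?w T)" by simp
  also have "(\<Sum>H\<in>matchings ?A. \<Prod>T\<in>H. ?w T) = integral\<^sup>L SN (%om. \<Prod>a\<in>?A. Z (?k a) om)"
   by (rule W[symmetric]) (use pr in auto)
  finally have e: "(\<Sum>H\<in>matchings ?A. \<Prod>T\<in>H. WW K r ?k T) = of_real (integral\<^sup>L SN (%om. \<Prod>a\<in>?A. Z (?k a) om))" .
  have "(%N. complex_of_real (Mean N (%l. \<Prod>a\<in>?A. p_norm (\<rho> N) N (?k a) l))) \<longlonglongrightarrow> of_real (integral\<^sup>L SN (%om. \<Prod>a\<in>?A. Z (?k a) om))"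
   using moment_limit[OF finite_lessThan r, of ?k K] unfolding e by (simp add: K_def)
  from tendsto_Re[OF this] show ?thesis unfolding pl by simp
 qed
 show ?thesis
  by (rule exI[of _ SN], rule exI[of _ Z], rule exI[of _ CC], rule exI[of _ \<epsilon>0]) (use \<epsilon>0 Z c1 c2 i1 m1 in auto)
qed

end

theorem mainTheorem1:
  fixes \<rho> :: "nat \<Rightarrow> int list pmf" and c :: "nat \<Rightarrow> real" and d :: "nat \<Rightarrow> nat \<Rightarrow> real"
  assumes supp: "\<forall>N\<ge>1. set_pmf (\<rho> N) \<subseteq> GT N"
    and conv: "\<forall>N\<ge>1. SGF_unif_conv N (\<rho> N)"
    and approp: "appropriate_with (\<lambda>N. SGF N (\<rho> N)) c d"
  shows "\<exists>(M :: (nat \<Rightarrow> real) measure) Z C \<epsilon>0. \<epsilon>0 > 0 \<and> gaussian_family M Z C \<and>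
     (\<forall>k1 k2. k1 \<ge> 1 \<and> k2 \<ge> 1 \<longrightarrow>
        (\<lambda>N. p_cov (\<rho> N) N k1 k2 / real N ^ (k1 + k2)) \<longlonglongrightarrow> C k1 k2 \<and>
        (\<forall>\<epsilon>. 0 < \<epsilon> \<and> \<epsilon> < \<epsilon>0 \<longrightarrow> complex_of_real (C k1 k2) = cov_integral c d \<epsilon> k1 k2)) \<and>
     (\<forall>ks. (\<forall>k\<in>set ks. k \<ge> 1) \<longrightarrow>
        (\<forall>N\<ge>1. integrable (measure_pmf (\<rho> N)) (\<lambda>l. \<Prod>k\<leftarrow>ks. p_norm (\<rho> N) N k l)) \<and>
        (\<lambda>N. measure_pmf.expectation (\<rho> N) (\<lambda>l. \<Prod>k\<leftarrow>ks. p_norm (\<rho> N) N k l))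
          \<longlonglongrightarrow> integral\<^sup>L M (\<lambda>\<omega>. \<Prod>k\<leftarrow>ks. Z k \<omega>))"
proof -
  interpret approp_seq \<rho> c d by (rule approp_seq.intro) (fact supp, fact conv, fact approp)
  show ?thesis by (rule main_result[OF cov_WW])
qed

end
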